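(* Let $N$ be a connected Stein surface with $H^2(N,\mathbb{Z})=0$ equipped with a complete holomorphic vector field $X$ with finitely many singularities in $N$ and having a non-nilpotent dicritical singularity (for example, this is the case if $X$ has a singularity where its first jet is of the form $X_\lambda$ for some $\lambda\in\mathbb{Q}_+$). Then $N$ is biholomorphic to $\mathbb{C}^2$ and $X$ is globally analytically linearizable in $N$.
   Context: A Stein surface is a Stein manifold of complex dimension two; a holomorphic vector field is complete if its flow is defined for all complex times. $X_\lambda = x\frac{\partial}{\partial x}+\lambda y\frac{\partial}{\partial y}$; $\mathbb{Q}_+$ is the set of positive rationals. A singularity $p$ of $X$ is dicritical if for some neighborhood $V$ of $p$ there are infinitely many orbits of $X|_V$ accumulating only at $p$. A singularity is non-nilpotent if the linear part of $X$ there is not nilpotent. Globally analytically linearizable means that there is a biholomorphism $N\to\mathbb{C}^2$ conjugating $X$ to a linear vector field.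
   Formalization: In the parenthetical example, λ is a positive rational such that neither λ nor 1/λ is an integer n ≥ 2; there the remark fails, e.g. x∂/∂x+(ny+xⁿ)∂/∂y on C² is complete with first jet X_n at its only singularity, which is not dicritical. *)

theory Defs
  imports "HOL-Analysis.Analysis" "HOL-Homology.Homology"
begin

section \<open>Holomorphic maps in two complex variables\<close>

definition holomorphic_fun2 :: "(complex^2) set \<Rightarrow> (complex^2 \<Rightarrow> complex) \<Rightarrow> bool" where
  "holomorphic_fun2 S f \<longleftrightarrow> open S \<and>
     (\<forall>z\<in>S. \<exists>D. (f has_derivative D) (at z) \<and> (\<forall>a v. D (a *s v) = a * D v))"

definition holomorphic_map2 :: "(complex^2) set \<Rightarrow> (complex^2 \<Rightarrow> complex^2) \<Rightarrow> bool" where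
  "holomorphic_map2 S f \<longleftrightarrow> (\<forall>i. holomorphic_fun2 S (\<lambda>z. f z $ i))"


section \<open>Complex surfaces\<close>

text \<open>A chart is a pair of its domain \<open>U\<close> and its coordinate map, whose values outside \<open>U\<close> are
  irrelevant. A complex structure is a maximal atlas.\<close>

type_synonym 'a chart = "'a set \<times> ('a \<Rightarrow> complex^2)"

definition topological_chart :: "'a topology \<Rightarrow> 'a chart \<Rightarrow> bool" where
  "topological_chart N = (\<lambda>(U, \<phi>). openin N U \<and> open (\<phi> ` U) \<and>
     homeomorphic_map (subtopology N U) (top_of_set (\<phi> ` U)) \<phi>)"

definition in_chart :: "'a chart \<Rightarrow> ('a \<Rightarrow> 'b) \<Rightarrow> complex^2 \<Rightarrow> 'b" where
  "in_chart = (\<lambda>(U, \<phi>) f. f \<circ> inv_into U \<phi>)"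

definition compatible_charts :: "'a chart \<Rightarrow> 'a chart \<Rightarrow> bool" where
  "compatible_charts = (\<lambda>(U, \<phi>) (V, \<psi>).
     holomorphic_map2 (\<phi> ` (U \<inter> V)) (in_chart (U, \<phi>) \<psi>) \<and>
     holomorphic_map2 (\<psi> ` (U \<inter> V)) (in_chart (V, \<psi>) \<phi>))"

definition complex_surface :: "'a topology \<Rightarrow> 'a chart set \<Rightarrow> bool" where
  "complex_surface N \<A> \<longleftrightarrow> Hausdorff_space N \<and> second_countable N \<and>
     (\<forall>\<kappa>\<in>\<A>. topological_chart N \<kappa>) \<and>
     (\<Union>(fst ` \<A>) = topspace N) \<and>
     (\<forall>\<kappa>\<in>\<A>. \<forall>\<mu>\<in>\<A>. compatible_charts \<kappa> \<mu>) \<and>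
     (\<forall>\<kappa>. topological_chart N \<kappa> \<and> (\<forall>\<mu>\<in>\<A>. compatible_charts \<kappa> \<mu>) \<longrightarrow> \<kappa> \<in> \<A>)"

definition holomorphic_functions :: "'a chart set \<Rightarrow> ('a \<Rightarrow> complex) set" where
  "holomorphic_functions \<A> =
     {f. \<forall>\<kappa>\<in>\<A>. holomorphic_fun2 (snd \<kappa> ` fst \<kappa>) (in_chart \<kappa> f)}"


section \<open>Stein surfaces\<close>

text \<open>Stating the hull condition through upper bounds makes it \<open>\<bar>f p\<bar> \<le> sup\<^sub>K \<bar>f\<bar>\<close> for nonempty compact
  \<open>K\<close>, and makes the hull of the empty set empty.\<close>

definition holomorphic_hull ::
  "'a topology \<Rightarrow> 'a chart set \<Rightarrow> 'a set \<Rightarrow> 'a set" where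
  "holomorphic_hull N \<A> K = {p \<in> topspace N. \<forall>f\<in>holomorphic_functions \<A>.
     \<forall>B. (\<forall>q\<in>K. cmod (f q) \<le> B) \<longrightarrow> cmod (f p) \<le> B}"

definition stein_surface :: "'a topology \<Rightarrow> 'a chart set \<Rightarrow> bool" where
  "stein_surface N \<A> \<longleftrightarrow> complex_surface N \<A> \<and>
     (\<forall>K. compactin N K \<longrightarrow> compactin N (holomorphic_hull N \<A> K)) \<and>
     (\<forall>p\<in>topspace N. \<forall>q\<in>topspace N. p \<noteq> q \<longrightarrow> (\<exists>f\<in>holomorphic_functions \<A>. f p \<noteq> f q)) \<and>
     (\<forall>p\<in>topspace N. \<exists>F U. (\<forall>i. (\<lambda>q. F q $ i) \<in> holomorphic_functions \<A>) \<and>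
        p \<in> U \<and> (U, F) \<in> \<A>)"


section \<open>Integral singular cohomology\<close>

text \<open>The dual of the library's singular chain complex: cochains are homomorphisms from the chain
  group to the integers, taken extensional so that each has a unique representative.\<close>

definition cochain_group :: "nat \<Rightarrow> 'a topology \<Rightarrow> ('a chain \<Rightarrow> int) monoid" where
  "cochain_group p X =
     \<lparr>carrier = hom (chain_group p X) integer_group \<inter> extensional (carrier (chain_group p X)),
      monoid.mult = (\<lambda>f g. \<lambda>c\<in>carrier (chain_group p X). f c + g c),
      one = (\<lambda>c\<in>carrier (chain_group p X). 0)\<rparr>"

definition coboundary :: "nat \<Rightarrow> 'a topology \<Rightarrow> ('a chain \<Rightarrow> int) \<Rightarrow> 'a chain \<Rightarrow> int" where
  "coboundary p X f = (\<lambda>c\<in>carrier (chain_group (Suc p) X). f (chain_boundary (Suc p) c))"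

definition cocycle_set :: "nat \<Rightarrow> 'a topology \<Rightarrow> ('a chain \<Rightarrow> int) set" where
  "cocycle_set p X = kernel (cochain_group p X) (cochain_group (Suc p) X) (coboundary p X)"

definition coboundary_set :: "nat \<Rightarrow> 'a topology \<Rightarrow> ('a chain \<Rightarrow> int) set" where
  "coboundary_set p X =
     (case p of 0 \<Rightarrow> {one (cochain_group 0 X)}
      | Suc q \<Rightarrow> coboundary q X ` carrier (cochain_group q X))"

definition cohomology_group :: "nat \<Rightarrow> 'a topology \<Rightarrow> ('a chain \<Rightarrow> int) set monoid" where
  "cohomology_group p X =
     subgroup_generated (cochain_group p X) (cocycle_set p X) Mod coboundary_set p X"


section \<open>Holomorphic vector fields\<close>

text \<open>A vector field is given by its coordinate vectors: \<open>X \<kappa> p\<close> is the value at \<open>p\<close> in the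
  coordinates of the chart \<open>\<kappa>\<close>, and values in different charts are related by the derivative of the
  coordinate change.\<close>

type_synonym 'a vfield = "'a chart \<Rightarrow> 'a \<Rightarrow> complex^2"

definition holomorphic_vector_field :: "'a chart set \<Rightarrow> 'a vfield \<Rightarrow> bool" where
  "holomorphic_vector_field \<A> X \<longleftrightarrow>
     (\<forall>\<kappa>\<in>\<A>. holomorphic_map2 (snd \<kappa> ` fst \<kappa>) (in_chart \<kappa> (X \<kappa>))) \<and>
     (\<forall>\<kappa>\<in>\<A>. \<forall>\<mu>\<in>\<A>. \<forall>p\<in>fst \<kappa> \<inter> fst \<mu>.
        X \<mu> p = frechet_derivative (in_chart \<kappa> (snd \<mu>)) (at (snd \<kappa> p)) (X \<kappa> p))"

definition integral_curve ::
  "'a topology \<Rightarrow> 'a chart set \<Rightarrow> 'a vfield \<Rightarrow> complex set \<Rightarrow> (complex \<Rightarrow> 'a) \<Rightarrow> bool" where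
  "integral_curve N \<A> X T c \<longleftrightarrow> open T \<and> continuous_map (top_of_set T) N c \<and>
     (\<forall>t\<in>T. \<forall>\<kappa>\<in>\<A>. c t \<in> fst \<kappa> \<longrightarrow>
        ((snd \<kappa> \<circ> c) has_derivative (\<lambda>h. h *s X \<kappa> (c t))) (at t))"

definition complete_vector_field :: "'a topology \<Rightarrow> 'a chart set \<Rightarrow> 'a vfield \<Rightarrow> bool" where
  "complete_vector_field N \<A> X \<longleftrightarrow>
     (\<forall>p\<in>topspace N. \<exists>c. integral_curve N \<A> X UNIV c \<and> c 0 = p)"

definition singularities :: "'a topology \<Rightarrow> 'a chart set \<Rightarrow> 'a vfield \<Rightarrow> 'a set" where
  "singularities N \<A> X = {p \<in> topspace N. \<forall>\<kappa>\<in>\<A>. p \<in> fst \<kappa> \<longrightarrow> X \<kappa> p = 0}"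

definition linear_part :: "'a vfield \<Rightarrow> 'a chart \<Rightarrow> 'a \<Rightarrow> complex^2 \<Rightarrow> complex^2" where
  "linear_part X \<kappa> p = frechet_derivative (in_chart \<kappa> (X \<kappa>)) (at (snd \<kappa> p))"

text \<open>At a singularity the linear parts in different charts are conjugate, so the following does
  not depend on the chart.\<close>

definition non_nilpotent_at :: "'a chart set \<Rightarrow> 'a vfield \<Rightarrow> 'a \<Rightarrow> bool" where
  "non_nilpotent_at \<A> X p \<longleftrightarrow>
     (\<forall>\<kappa>\<in>\<A>. p \<in> fst \<kappa> \<longrightarrow> \<not> (\<exists>k. linear_part X \<kappa> p ^^ k = (\<lambda>v. 0)))"

text \<open>The first jet being \<open>x \<partial>/\<partial>x + \<rho> y \<partial>/\<partial>y\<close> in some centred coordinates. For positive rational \<open>\<rho>\<close> this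
  forces a dicritical singularity unless \<open>\<rho>\<close> or \<open>1/\<rho>\<close> is an integer \<open>n \<ge> 2\<close>: the resonant field
  \<open>x \<partial>/\<partial>x + (n y + x\<^sup>n) \<partial>/\<partial>y\<close> is complete on \<open>\<complex>\<^sup>2\<close> and singular only at the origin, but every orbit
  off the line \<open>x = 0\<close> accumulates on that line.\<close>

definition first_jet_X_lambda_at :: "'a chart set \<Rightarrow> 'a vfield \<Rightarrow> complex \<Rightarrow> 'a \<Rightarrow> bool" where
  "first_jet_X_lambda_at \<A> X \<rho> p \<longleftrightarrow>
     (\<exists>\<kappa>\<in>\<A>. p \<in> fst \<kappa> \<and> snd \<kappa> p = 0 \<and> X \<kappa> p = 0 \<and>
        linear_part X \<kappa> p = (\<lambda>v. vector [v $ 1, \<rho> * v $ 2]))"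

text \<open>The orbit through \<open>q\<close> of the restriction of \<open>X\<close> to \<open>V\<close>. It is the leaf through \<open>q\<close> of \<open>X\<close>
  on \<open>V\<close>, in general only a connected piece of the intersection of \<open>V\<close> with the orbit in \<open>N\<close>.\<close>

definition orbit_in ::
  "'a topology \<Rightarrow> 'a chart set \<Rightarrow> 'a vfield \<Rightarrow> 'a set \<Rightarrow> 'a \<Rightarrow> 'a set" where
  "orbit_in N \<A> X V q = {c t | c T t.
     connected T \<and> 0 \<in> T \<and> t \<in> T \<and> integral_curve N \<A> X T c \<and> c ` T \<subseteq> V \<and> c 0 = q}"

text \<open>Accumulation is taken inside \<open>V\<close>: orbits may leave \<open>V\<close> through its boundary.\<close>

definition dicritical_at :: "'a topology \<Rightarrow> 'a chart set \<Rightarrow> 'a vfield \<Rightarrow> 'a \<Rightarrow> bool" where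
  "dicritical_at N \<A> X p \<longleftrightarrow>
     (\<exists>V. openin N V \<and> p \<in> V \<and>
        infinite {L \<in> orbit_in N \<A> X V ` V. (N closure_of L) \<inter> V - L = {p}})"


section \<open>Biholomorphisms onto \<open>\<complex>\<^sup>2\<close> and linearization\<close>

definition biholomorphism_C2 :: "'a topology \<Rightarrow> 'a chart set \<Rightarrow> ('a \<Rightarrow> complex^2) \<Rightarrow> bool" where
  "biholomorphism_C2 N \<A> F \<longleftrightarrow> bij_betw F (topspace N) UNIV \<and>
     (\<forall>\<kappa>\<in>\<A>. holomorphic_map2 (snd \<kappa> ` fst \<kappa>) (in_chart \<kappa> F) \<and>
             holomorphic_map2 (F ` fst \<kappa>) (snd \<kappa> \<circ> inv_into (topspace N) F))"

definition globally_linearizable :: "'a topology \<Rightarrow> 'a chart set \<Rightarrow> 'a vfield \<Rightarrow> bool" where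
  "globally_linearizable N \<A> X \<longleftrightarrow>
     (\<exists>F M. biholomorphism_C2 N \<A> F \<and>
        (\<forall>\<kappa>\<in>\<A>. \<forall>p\<in>fst \<kappa>.
           frechet_derivative (in_chart \<kappa> F) (at (snd \<kappa> p)) (X \<kappa> p) = M *v F p))"

end

theory Submission
  imports Defs "HOL-Complex_Analysis.Complex_Analysis"
begin

text \<open>A leaf accumulating only at \<open>p\<close> is embedded, so its part outside a ball around \<open>p\<close> is covered by
  bounded times. If its stabilizer in \<open>\<complex>\<close> had rank 0 or 2, the orbit would be relatively compact, and
  Liouville's theorem would make it a point because holomorphic functions separate points. Hence the leaf
  lies on a periodic orbit one of whose ends is a punctured disc closing up at \<open>p\<close>, and the leading term of the disc
  is an eigenvector of the linear part. Among infinitely many leaves two share an eigenvalue; comparing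
  them gives a second eigenvector whose eigenvalue is a rational multiple \<open>\<nu> \<ge> 1\<close> of the first one. The
  periodic orbit rules out the resonant term, so some time \<open>T\<close> of the flow is the identity near \<open>p\<close>.
  Averaging global coordinates over this period gives globally defined eigenfunctions, which are local
  coordinates at \<open>p\<close> and conjugate the flow to a linear one on the basin of \<open>p\<close>. The basin is closed:
  along an orbit in its closure, bounds on \<open>f \<circ> \<phi>\<^sub>t\<close> from the maximum principle and holomorphic convexity
  force convergence to \<open>p\<close>. Since \<open>N\<close> is connected, the basin is everything.

  If the first jet is \<open>X\<^sub>\<rho>\<close> without resonance, the same construction linearizes \<open>X\<close>, and the orbits
  \<open>y\<^sup>b = s\<^sup>b x\<^sup>a\<close> of the linear model, with \<open>\<rho> = a / b\<close> in lowest terms, accumulate only at the origin.\<close>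

no_notation fps_nth (infixl "$" 75)

text \<open>With \<open>\<nu> \<ge> 1\<close> the times with \<open>Re (m * t) < 0\<close> contract
  both eigendirections, so the complex flow itself contains a contraction that commutes with the
  time-\<open>T\<close> map. The time-\<open>T\<close> map is tangent to the identity, and the
  lowest-order term of its difference from the identity has to be resonant. The only candidate is
  \<open>x ^ \<nu>\<close> in the second component, for an integer \<open>\<nu> \<ge> 2\<close>. The
  periodic disc consists of points fixed by time \<open>T\<close> and is tangent to the first axis,
  where this monomial does not vanish; hence the term is absent. For a prescribed first jet no disc
  is given, and the exclusion of resonant ratios takes its place. The global obstacle is that basin
  orbits starting near a boundary point of the basin might escape before they converge. Complex time
  removes it: contracting times correspond to the unit disc in
  \<open>w = exp (2 * pi * \<i> * t / T)\<close>, whose boundary circle is a single period.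
  Everything along contracting times is thus controlled by one period, that is by a compact set, and
  its hull is compact on a Stein surface.\<close>

definition cdiff :: "(complex^2 \<Rightarrow> complex) \<Rightarrow> complex^2 \<Rightarrow> bool" where
  "cdiff f z \<longleftrightarrow> (\<exists>D. (f has_derivative D) (at z) \<and> (\<forall>a v. D (a *s v) = a * D v))"

text \<open>Taking the one-variable \<open>deriv\<close> of a slice makes \<open>pd\<close> total
  and meaningful before \<open>cdiff\<close> is known, so that one-variable Cauchy estimates and
  limit theorems apply to functions that are only separately holomorphic.\<close>

definition pd :: "2 \<Rightarrow> (complex^2 \<Rightarrow> complex) \<Rightarrow> complex^2 \<Rightarrow> complex" where
  "pd i f z = deriv (\<lambda>s. f (z + s *s axis i 1)) 0"

lemma holomorphic_fun2_iff: "holomorphic_fun2 S f \<longleftrightarrow> open S \<and> (\<forall>z\<in>S. cdiff f z)"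
  by (simp add: holomorphic_fun2_def cdiff_def)

section \<open>Scaling and coordinates on \<open>complex^2\<close>\<close>

lemma norm_vector_scalar_mult: "norm (s *s v) = cmod s * norm (v :: complex^2)"
  by (simp add: norm_vec_def L2_set_def norm_mult power_mult_distrib sum_distrib_left[symmetric]
      real_sqrt_mult)

lemma bounded_linear_smult_left: "bounded_linear (\<lambda>s::complex. s *s (v :: complex^2))"
  by (rule bounded_linear_intro[where K="norm v"])
     (auto simp: vec_eq_iff norm_vector_scalar_mult algebra_simps)

lemma continuous_on_vector_scalar_mult [continuous_intros]:
  "continuous_on A f \<Longrightarrow> continuous_on A g \<Longrightarrow> continuous_on A (\<lambda>x. f x *s (g x :: complex^2))"
  unfolding vector_scalar_mult_def
  by (intro continuous_on_vec_lambda continuous_intros)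

lemma tendsto_vector_scalar_mult [tendsto_intros]:
  "(f \<longlongrightarrow> a) F \<Longrightarrow> (g \<longlongrightarrow> b) F \<Longrightarrow> ((\<lambda>x. f x *s (g x :: complex^2)) \<longlongrightarrow> a *s b) F"
  unfolding vector_scalar_mult_def
  by (intro tendsto_vec_lambda tendsto_intros)

definition vec2 :: "complex \<Rightarrow> complex \<Rightarrow> complex^2" where
  "vec2 x y = (\<chi> i. if i = 1 then x else y)"

lemma vec2_nth [simp]: "vec2 x y $ 1 = x" "vec2 x y $ 2 = y"
  by (simp_all add: vec2_def)

lemma vec2_eq_iff: "v = w \<longleftrightarrow> v $ 1 = w $ 1 \<and> v $ 2 = w $ 2" for v w :: "complex^2"
  by (simp add: vec_eq_iff forall_2)

lemma vec2_collapse [simp]: "vec2 (v $ 1) (v $ 2) = v"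
  by (simp add: vec2_eq_iff)

lemma norm_axis_1: "norm (axis i (1::complex) :: complex^2) = 1"
  using exhaust_2[of i] by (auto simp: norm_vec_def L2_set_def sum_2 axis_def)

lemma axis_nth_2 [simp]: "axis 1 x $ (1::2) = x" "axis 2 x $ (1::2) = 0" "axis 1 x $ (2::2) = 0" "axis 2 x $ (2::2) = x"
  by (simp_all add: axis_def)

lemma continuous_on_vec2 [continuous_intros]:
  "continuous_on A f \<Longrightarrow> continuous_on A g \<Longrightarrow> continuous_on A (\<lambda>x. vec2 (f x) (g x))"
proof -
  assume *: "continuous_on A f" "continuous_on A g"
  have "continuous_on A (\<lambda>x. if i = 1 then f x else g x)" for i :: 2
    using * by (cases "i = 1") simp_all
  thus ?thesis unfolding vec2_def by (intro continuous_on_vec_lambda)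
qed

section \<open>Calculus of complex differentiable functions of two variables\<close>

lemma vec2_decomp: "v = v $ 1 *s axis 1 1 + v $ 2 *s axis 2 (1::complex)" for v :: "complex^2"
  by (simp add: vec2_eq_iff)

text \<open>Complex homogeneity determines the derivative \<open>D\<close> from its values on the
  two axis vectors, and each of these is the derivative of a slice.\<close>

lemma cdiff_has_derivative:
  assumes "cdiff f z"
  shows "(f has_derivative (\<lambda>v. pd 1 f z * v $ 1 + pd 2 f z * v $ 2)) (at z)"
proof -
  obtain D where D: "(f has_derivative D) (at z)" "\<And>a v. D (a *s v) = a * D v"
    using assms by (auto simp: cdiff_def)
  interpret D: bounded_linear D using D(1) by (rule has_derivative_bounded_linear)
  have pd: "pd i f z = D (axis i 1)" for i
  proof -
    have g: "((\<lambda>s. z + s *s axis i 1) has_derivative (\<lambda>s. s *s axis i 1)) (at 0)"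
      by (auto intro!: derivative_eq_intros bounded_linear.has_derivative[OF bounded_linear_smult_left])
    have "((\<lambda>s. f (z + s *s axis i 1)) has_derivative (\<lambda>s. D (s *s axis i 1))) (at 0)"
      by (rule has_derivative_compose[OF g]) (use D(1) in simp)
    hence "((\<lambda>s. f (z + s *s axis i 1)) has_field_derivative D (axis i 1)) (at 0)"
      unfolding has_field_derivative_def by (rule has_derivative_eq_rhs) (simp add: fun_eq_iff D)
    thus ?thesis by (simp add: pd_def DERIV_imp_deriv)
  qed
  have "D = (\<lambda>v. pd 1 f z * v $ 1 + pd 2 f z * v $ 2)"
  proof
    fix v
    have "D v = D (v $ 1 *s axis 1 1 + v $ 2 *s axis 2 1)" using vec2_decomp[of v] by simp
    thus "D v = pd 1 f z * v $ 1 + pd 2 f z * v $ 2" by (simp add: D.add D pd mult.commute)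
  qed
  with D(1) show ?thesis by simp
qed

lemma cdiffI:
  assumes "(f has_derivative (\<lambda>v. a * v $ 1 + b * v $ 2)) (at z)"
  shows "cdiff f z"
  unfolding cdiff_def using assms by (intro exI conjI, assumption) (simp add: algebra_simps)

lemma cdiff_unique:
  assumes "(f has_derivative (\<lambda>v. a * v $ 1 + b * v $ 2)) (at z)"
  shows "pd 1 f z = a" "pd 2 f z = b"
proof -
  have "(\<lambda>v::complex^2. a * v $ 1 + b * v $ 2) = (\<lambda>v. pd 1 f z * v $ 1 + pd 2 f z * v $ 2)"
    by (rule has_derivative_unique[OF assms cdiff_has_derivative[OF cdiffI[OF assms]]])
  from fun_cong[OF this, of "axis 1 1"] fun_cong[OF this, of "axis 2 1"]
  show "pd 1 f z = a" "pd 2 f z = b" by (auto simp: axis_def)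
qed

lemma cdiff_isCont: "cdiff f z \<Longrightarrow> isCont f z"
  using cdiff_has_derivative has_derivative_continuous by blast

lemma cdiff_cong:
  assumes "eventually (\<lambda>w. f w = g w) (nhds z)" shows "cdiff f z \<longleftrightarrow> cdiff g z"
proof -
  have "(g' has_derivative D) (at z)" if "(f' has_derivative D) (at z)" "eventually (\<lambda>w. f' w = g' w) (nhds z)" for f' g' :: "complex^2 \<Rightarrow> complex" and D
    by (rule has_derivative_transform_eventually[OF that(1)])
       (use that(2) eventually_nhds_x_imp_x[OF that(2)] in \<open>auto simp: eventually_at_filter elim: eventually_mono\<close>)
  moreover have "eventually (\<lambda>w. g w = f w) (nhds z)" using assms by (simp add: eq_commute)
  ultimately show ?thesis using assms unfolding cdiff_def by metis
qed

lemma pd_cong: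
  assumes "eventually (\<lambda>w. f w = g w) (nhds z)" shows "pd i f z = pd i g z"
proof -
  have "((\<lambda>s::complex. z + s *s axis i 1) \<longlongrightarrow> z + 0 *s axis i 1) (nhds 0)"
    by (intro tendsto_intros) (simp add: filterlim_ident)
  hence "eventually (\<lambda>s. f (z + s *s axis i 1) = g (z + s *s axis i 1)) (nhds 0)"
    using assms by (auto simp: filterlim_iff)
  thus ?thesis unfolding pd_def by (rule deriv_cong_ev) simp
qed

lemma cdiff_const [simp]: "cdiff (\<lambda>z. c) z"
  by (rule cdiffI[where a=0 and b=0]) simp

lemma cdiff_nth [simp]: "cdiff (\<lambda>z. z $ i) z"
  unfolding cdiff_def by (rule exI[where x="\<lambda>z. z $ i"]) (auto intro: bounded_linear_imp_has_derivative bounded_linear_vec_nth)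

lemma cdiff_add: "cdiff f z \<Longrightarrow> cdiff g z \<Longrightarrow> cdiff (\<lambda>z. f z + g z) z"
  unfolding cdiff_def by (elim exE conjE) (rule exI, rule conjI, erule (1) has_derivative_add, simp add: algebra_simps)

lemma cdiff_minus: "cdiff f z \<Longrightarrow> cdiff (\<lambda>z. - f z) z"
  unfolding cdiff_def by (elim exE conjE) (rule exI, rule conjI, erule has_derivative_minus, simp add: algebra_simps)

lemma cdiff_diff: "cdiff f z \<Longrightarrow> cdiff g z \<Longrightarrow> cdiff (\<lambda>z. f z - g z) z"
  using cdiff_add[OF _ cdiff_minus, of f z g] by simp

lemma cdiff_mult: "cdiff f z \<Longrightarrow> cdiff g z \<Longrightarrow> cdiff (\<lambda>z. f z * g z) z"
  unfolding cdiff_def by (elim exE conjE) (rule exI, rule conjI, erule (1) has_derivative_mult, simp add: algebra_simps)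

lemma cdiff_map_has_derivative:
  assumes "\<And>i. cdiff (\<lambda>z. F z $ i) z"
  shows "(F has_derivative (\<lambda>v. \<chi> i. pd 1 (\<lambda>z. F z $ i) z * v $ 1 + pd 2 (\<lambda>z. F z $ i) z * v $ 2)) (at z)"
proof -
  have "((\<lambda>z. F z $ i) has_derivative (\<lambda>v. (\<chi> i. pd 1 (\<lambda>z. F z $ i) z * v $ 1 + pd 2 (\<lambda>z. F z $ i) z * v $ 2) $ i)) (at z)" for i
    using cdiff_has_derivative[OF assms[of i]] by simp
  note nth = this
  have "((\<lambda>z. F z \<bullet> b) has_derivative (\<lambda>v. (\<chi> i. pd 1 (\<lambda>z. F z $ i) z * v $ 1 + pd 2 (\<lambda>z. F z $ i) z * v $ 2) \<bullet> b)) (at z)"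
    if b: "b \<in> Basis" for b
  proof -
    obtain i c where "b = axis i c" using b by (auto simp: Basis_vec_def)
    thus ?thesis using has_derivative_inner_left[OF nth[of i], of c] by (simp add: inner_axis)
  qed
  thus ?thesis by (subst has_derivative_componentwise_within) auto
qed

lemma cdiff_compose:
  assumes "cdiff f (F z)" "\<And>i. cdiff (\<lambda>z. F z $ i) z"
  shows "cdiff (\<lambda>z. f (F z)) z"
proof -
  obtain D where D: "(f has_derivative D) (at (F z))" "\<And>a v. D (a *s v) = a * D v"
    using assms by (auto simp: cdiff_def)
  let ?E = "\<lambda>v. \<chi> i. pd 1 (\<lambda>z. F z $ i) z * v $ 1 + pd 2 (\<lambda>z. F z $ i) z * v $ 2"
  have "((\<lambda>z. f (F z)) has_derivative (\<lambda>v. D (?E v))) (at z)"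
    by (rule has_derivative_compose[OF cdiff_map_has_derivative[OF assms(2)] D(1)])
  moreover have "D (?E (a *s v)) = a * D (?E v)" for a and v :: "complex^2"
  proof -
    have "?E (a *s v) = a *s ?E v" by (simp add: vec_eq_iff algebra_simps)
    thus ?thesis by (simp only: D(2))
  qed
  ultimately show ?thesis unfolding cdiff_def by (intro exI[of _ "\<lambda>v. D (?E v)"] conjI allI)
qed

lemma cdiff_slice:
  assumes "cdiff f (z + s *s v)"
  shows "((\<lambda>s. f (z + s *s v)) has_field_derivative
           (pd 1 f (z + s *s v) * v $ 1 + pd 2 f (z + s *s v) * v $ 2)) (at s)"
proof -
  have g: "((\<lambda>s. z + s *s v) has_derivative (\<lambda>s. s *s v)) (at s)"
    by (auto intro!: derivative_eq_intros bounded_linear.has_derivative[OF bounded_linear_smult_left])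
  from has_derivative_compose[OF g cdiff_has_derivative[OF assms]]
  show ?thesis unfolding has_field_derivative_def by (rule has_derivative_eq_rhs) (simp add: fun_eq_iff algebra_simps)
qed

lemma pd_slice:
  assumes "cdiff f (z + s *s axis i 1)"
  shows "((\<lambda>s. f (z + s *s axis i 1)) has_field_derivative pd i f (z + s *s axis i 1)) (at s)"
  using cdiff_slice[OF assms] exhaust_2[of i] by (auto simp: axis_def)

lemma cdiff_curve:
  assumes "cdiff f (u t)" "(u has_derivative (\<lambda>h. h *s v)) (at t)"
  shows "((\<lambda>t. f (u t)) has_field_derivative (pd 1 f (u t) * v $ 1 + pd 2 f (u t) * v $ 2)) (at t)"
  unfolding has_field_derivative_def
  by (rule has_derivative_eq_rhs[OF has_derivative_compose[OF assms(2) cdiff_has_derivative[OF assms(1)]]])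
     (simp add: fun_eq_iff algebra_simps)

text \<open>By the Cauchy estimate, partial derivatives of a continuous separately holomorphic function
  inherit joint continuity.\<close>

lemma pd_continuous:
  assumes S: "open S" "continuous_on S f"
    and sep: "\<And>z. z \<in> S \<Longrightarrow> (\<lambda>s. f (z + s *s axis i 1)) field_differentiable (at 0)"
  shows "continuous_on S (pd i f)"
proof -
  \<comment> \<open>Slices through points of one line differ by a translation of the parameter, so
    differentiability at parameter 0 for all base points gives it at every parameter whose point
    lies in \<open>S\<close>.\<close>
  have sl: "(\<lambda>s. f (z + s *s axis i 1)) field_differentiable (at s)" if "z + s *s axis i 1 \<in> S" for z s
  proof -
    have "((\<lambda>r. f ((z + s *s axis i 1) + r *s axis i 1)) has_field_derivative pd i f (z + s *s axis i 1)) (at (s - s))"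
      using sep[OF that] by (simp add: pd_def field_differentiable_derivI)
    from DERIV_chain2[where f="\<lambda>r. f ((z + s *s axis i 1) + r *s axis i 1)" and g="\<lambda>r. r - s" and Db=1, OF this]
    have "((\<lambda>r. f ((z + s *s axis i 1) + (r - s) *s axis i 1)) has_field_derivative pd i f (z + s *s axis i 1)) (at s)"
      using DERIV_diff[OF DERIV_ident DERIV_const, of s s UNIV] by simp
    moreover have "(z + s *s axis i 1) + (r - s) *s axis i 1 = z + r *s axis i 1" for r
      by (simp add: vec_eq_iff algebra_simps)
    ultimately show ?thesis by (auto simp: field_differentiable_def)
  qed
  have "\<exists>d>0. \<forall>w. dist w z < d \<longrightarrow> w \<in> S \<longrightarrow> dist (pd i f w) (pd i f z) < e" if z: "z \<in> S" and e: "e > 0" for z e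
  proof -
    obtain r0 where r0: "r0 > 0" "cball z r0 \<subseteq> S" using S z open_contains_cball by blast
    \<comment> \<open>Half of \<open>r0\<close>, so that the slice of radius \<open>r\<close>
      through a point at distance less than \<open>r\<close> from \<open>z\<close> stays in
      \<open>cball z r0\<close>.\<close>
    define r where "r = r0 / 2"
    have r: "r > 0" using r0 by (simp add: r_def)
    have uc: "uniformly_continuous_on (cball z r0) f"
      using S(2) r0 by (intro compact_uniformly_continuous) (auto intro: continuous_on_subset)
    \<comment> \<open>Cauchy's estimate for the difference of two slices divides by the radius
      \<open>r\<close>; the tolerance \<open>e * r / 2\<close> therefore bounds the difference of
      the partial derivatives by \<open>e / 2\<close>.\<close>
    obtain d0 where d0: "d0 > 0" "\<And>x y. x \<in> cball z r0 \<Longrightarrow> y \<in> cball z r0 \<Longrightarrow> dist x y < d0 \<Longrightarrow> dist (f x) (f y) < e * r / 2"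
      using uc e r unfolding uniformly_continuous_on_def by (metis half_gt_zero mult_pos_pos)
    show ?thesis
    proof (intro exI[of _ "min d0 r"] conjI allI impI)
      show "min d0 r > 0" using d0 r by simp
      fix w assume w: "dist w z < min d0 r" "w \<in> S"
      have in1: "w + s *s axis i 1 \<in> cball z r0" if "norm s \<le> r" for s
      proof -
        have "dist (w + s *s axis i 1) z \<le> dist w z + norm (s *s axis i 1 :: complex^2)"
          by (metis add_diff_cancel_left' dist_commute dist_norm dist_triangle add.commute)
        thus ?thesis using w that by (simp add: r_def norm_vector_scalar_mult norm_axis_1 dist_commute)
      qed
      have in2: "z + s *s axis i 1 \<in> cball z r0" if "norm s \<le> r" for s
        using that r by (simp add: r_def norm_vector_scalar_mult norm_axis_1 dist_norm)
      define g where "g s = f (w + s *s axis i 1) - f (z + s *s axis i 1)" for s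
      have gd: "g field_differentiable (at s)" if "norm s \<le> r" for s
        unfolding g_def using in1[OF that] in2[OF that] r0(2) by (intro field_differentiable_diff sl) auto
      have "norm ((deriv ^^ 1) g 0) \<le> fact 1 * (e * r / 2) / r ^ 1"
      proof (rule Cauchy_inequality)
        show "g holomorphic_on ball 0 r" using gd by (auto simp: holomorphic_on_def intro: field_differentiable_at_within)
        show "continuous_on (cball 0 r) g"
          using gd by (intro continuous_at_imp_continuous_on) (auto intro: field_differentiable_imp_continuous_at)
        show "0 < r" by fact
        fix s :: complex assume s: "cmod (0 - s) = r"
        have "dist (f (w + s *s axis i 1)) (f (z + s *s axis i 1)) < e * r / 2"
          by (rule d0(2)) (use in1[of s] in2[of s] s w in \<open>auto simp: dist_norm\<close>)
        thus "cmod (g s) \<le> e * r / 2" by (simp add: g_def dist_norm)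
      qed
      moreover have "deriv g 0 = pd i f w - pd i f z"
        unfolding g_def pd_def using sep[OF w(2)] sep[OF z] by (rule deriv_diff)
      ultimately have "dist (pd i f w) (pd i f z) \<le> e / 2" using r by (simp add: dist_norm)
      thus "dist (pd i f w) (pd i f z) < e" using e by simp
    qed
  qed
  thus ?thesis unfolding continuous_on_iff by blast
qed

text \<open>Osgood's lemma. A partial derivative at the point in one direction, together with a
  partial derivative in the other direction that is continuous in both variables, gives total
  differentiability. The continuity comes from \<open>pd_continuous\<close>, and the resulting
  derivative is complex linear by its shape.\<close>

lemma osgood:
  assumes S: "open S" "continuous_on S f"
    and sep: "\<And>z i. z \<in> S \<Longrightarrow> (\<lambda>s. f (z + s *s axis i 1)) field_differentiable (at 0)"
  shows "holomorphic_fun2 S f"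
  unfolding holomorphic_fun2_iff
proof (intro conjI ballI S(1))
  fix z assume z: "z \<in> S"
  \<comment> \<open>The criterion for total differentiability from partial derivatives is stated for
    product spaces, hence the passage to pairs and to a product neighbourhood whose second factor is
    a ball, which is convex.\<close>
  define mk where "mk p = vec2 (fst p) (snd p)" for p
  have mk_cont: "continuous_on A mk" for A
    unfolding mk_def by (intro continuous_intros)
  have "open (mk -` S)" using mk_cont[of UNIV] S(1) by (simp add: open_vimage)
  moreover have "(z $ 1, z $ 2) \<in> mk -` S" using z by (simp add: mk_def)
  ultimately obtain A B where "open A" "open B" "(z $ 1, z $ 2) \<in> A \<times> B" "A \<times> B \<subseteq> mk -` S"
    by (rule open_prod_elim)
  hence AB: "open A" "open B" "z $ 1 \<in> A" "z $ 2 \<in> B" "A \<times> B \<subseteq> mk -` S" by auto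
  obtain r where r: "r > 0" "ball (z $ 2) r \<subseteq> B" using AB open_contains_ball by blast
  let ?Y = "ball (z $ 2) r"
  have inS: "mk (x, y) \<in> S" if "x \<in> A" "y \<in> ?Y" for x y using AB r that by blast
  have mkx: "mk (x, z $ 2) = z + (x - z $ 1) *s axis 1 1" for x
    by (simp add: mk_def vec2_eq_iff)
  have mky: "mk (x, y) + (y' - y) *s axis 2 1 = mk (x, y')" for x y y'
    by (simp add: mk_def vec2_eq_iff)
  have zmk: "mk (z $ 1, z $ 2) = z" by (simp add: mk_def)
  have shift: "((\<lambda>x. g (x - a)) has_field_derivative d) (at a)" if "(g has_field_derivative d) (at 0)" for g :: "complex \<Rightarrow> complex" and a d
    using DERIV_chain2[of g d "\<lambda>x. x - a" a 1 UNIV] DERIV_diff[OF DERIV_ident DERIV_const, of a a UNIV] that by simp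
  have dx: "((\<lambda>x. f (mk (x, z $ 2))) has_field_derivative pd 1 f z) (at (z $ 1))"
  proof -
    have "((\<lambda>s. f (z + s *s axis 1 1)) has_field_derivative pd 1 f z) (at 0)"
      using sep[OF z, of 1] by (simp add: pd_def field_differentiable_derivI)
    from shift[OF this, of "z $ 1"] show ?thesis by (simp add: mkx)
  qed
  have dy: "((\<lambda>y. f (mk (x, y))) has_field_derivative pd 2 f (mk (x, y0))) (at y0)" if "x \<in> A" "y0 \<in> ?Y" for x y0
  proof -
    have "((\<lambda>s. f (mk (x, y0) + s *s axis 2 1)) has_field_derivative pd 2 f (mk (x, y0))) (at 0)"
      using sep[OF inS[OF that], of 2] by (simp add: pd_def field_differentiable_derivI)
    from shift[OF this, of y0] show ?thesis by (simp only: mky)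
  qed
  have c2: "continuous_on S (pd 2 f)" by (rule pd_continuous[OF S sep])
  let ?fy = "\<lambda>x y. blinfun_mult_right (pd 2 f (mk (x, y)))"
  have memb: "(z $ 1, z $ 2) \<in> A \<times> ?Y" using AB r by simp
  have op: "open (A \<times> ?Y)" using AB by (intro open_Times) auto
  have "((\<lambda>(x, y). f (mk (x, y))) has_derivative (\<lambda>(tx, ty). (pd 1 f z * tx) + ?fy (z $ 1) (z $ 2) ty)) (at (z $ 1, z $ 2) within A \<times> ?Y)"
  proof (rule has_derivative_partialsI)
    show "((\<lambda>x. f (mk (x, z $ 2))) has_derivative (*) (pd 1 f z)) (at (z $ 1) within A)"
      using dx unfolding has_field_derivative_def by (rule has_derivative_at_withinI)
    show "((\<lambda>y. f (mk (x, y))) has_derivative blinfun_apply (?fy x y)) (at y within ?Y)" if "x \<in> A" "y \<in> ?Y" for x y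
      using dy[OF that] unfolding has_field_derivative_def by (auto intro: has_derivative_at_withinI)
    have "continuous_on (A \<times> ?Y) (\<lambda>p. pd 2 f (mk p))"
      by (rule continuous_on_compose2[OF c2 mk_cont]) (use inS in auto)
    hence "continuous_on (A \<times> ?Y) (\<lambda>p. blinfun_mult_right (pd 2 f (mk p)))"
      by (rule bounded_linear.continuous_on[OF bounded_linear_blinfun_mult_right])
    thus "continuous (at (z $ 1, z $ 2) within A \<times> ?Y) (\<lambda>(x, y). ?fy x y)"
      unfolding case_prod_beta' using memb by (simp only: continuous_on_eq_continuous_within prod.collapse)
    show "z $ 2 \<in> ?Y" using r by simp
    show "convex ?Y" by simp
  qed
  hence D: "((\<lambda>p. f (mk p)) has_derivative (\<lambda>p. pd 1 f z * fst p + pd 2 f z * snd p)) (at (z $ 1, z $ 2))"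
    unfolding at_within_open[OF memb op] case_prod_beta' prod.collapse zmk blinfun_mult_right.rep_eq .
  have pr: "((\<lambda>v::complex^2. (v $ 1, v $ 2)) has_derivative (\<lambda>v. (v $ 1, v $ 2))) (at z)"
    by (intro has_derivative_Pair bounded_linear_imp_has_derivative bounded_linear_vec_nth)
  have "((\<lambda>v. f (mk (v $ 1, v $ 2))) has_derivative (\<lambda>v. pd 1 f z * v $ 1 + pd 2 f z * v $ 2)) (at z)"
    using has_derivative_compose[OF pr D] by simp
  moreover have "(\<lambda>v. f (mk (v $ 1, v $ 2))) = f" by (simp add: mk_def)
  ultimately show "cdiff f z" by (metis cdiffI)
qed

section \<open>Uniform limits, higher partial derivatives and strict differentiability\<close>

lemma holomorphic_fun2_imp_continuous_on: "holomorphic_fun2 S f \<Longrightarrow> continuous_on S f"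
  by (auto simp: holomorphic_fun2_iff intro!: continuous_at_imp_continuous_on cdiff_isCont)

lemma holomorphic_fun2_subset: "holomorphic_fun2 S f \<Longrightarrow> open T \<Longrightarrow> T \<subseteq> S \<Longrightarrow> holomorphic_fun2 T f"
  by (auto simp: holomorphic_fun2_iff)

lemma holomorphic_fun2_slice:
  assumes "holomorphic_fun2 S f" "\<And>s. s \<in> A \<Longrightarrow> z + s *s v \<in> S"
  shows "(\<lambda>s. f (z + s *s v)) holomorphic_on A"
proof -
  have "cdiff f (z + s *s v)" if "s \<in> A" for s using assms that by (auto simp: holomorphic_fun2_iff)
  from cdiff_slice[OF this] show ?thesis
    unfolding holomorphic_on_def field_differentiable_def
    by (metis has_field_derivative_at_within)
qed

lemma smult_in_ball:
  assumes "cmod s < d" "norm (v :: complex^2) \<le> 1" shows "z + s *s v \<in> ball z d"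
proof -
  have "cmod s * norm v \<le> cmod s * 1" using assms(2) by (intro mult_left_mono) auto
  thus ?thesis using assms(1) by (simp add: dist_norm norm_vector_scalar_mult)
qed

text \<open>Weierstrass's theorem is reduced to one variable: uniform limits of slices are
  holomorphic, and Osgood's lemma combines them with the continuity of the limit.\<close>

lemma holomorphic_fun2_uniform_limit:
  assumes S: "open S" and h: "\<And>n. holomorphic_fun2 S (f n)"
    and lim: "\<And>z. z \<in> S \<Longrightarrow> \<exists>d>0. ball z d \<subseteq> S \<and> uniform_limit (ball z d) f g sequentially"
  shows "holomorphic_fun2 S g"
proof (rule osgood[OF S])
  show "continuous_on S g"
  proof (rule continuous_at_imp_continuous_on, rule ballI)
    fix z assume "z \<in> S"
    then obtain d where d: "d > 0" "ball z d \<subseteq> S" "uniform_limit (ball z d) f g sequentially" using lim by blast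
    have "continuous_on (ball z d) g"
      by (rule uniform_limit_theorem[OF always_eventually d(3)])
         (use h d(2) holomorphic_fun2_imp_continuous_on continuous_on_subset in \<open>blast, simp\<close>)
    thus "isCont g z" using d(1) by (simp add: continuous_on_eq_continuous_at)
  qed
  fix z i assume "z \<in> S"
  then obtain d where d: "d > 0" "ball z d \<subseteq> S" "uniform_limit (ball z d) f g sequentially" using lim by blast
  have inb: "z + s *s axis i 1 \<in> ball z d" if "s \<in> ball 0 d" for s
    using that by (intro smult_in_ball) (auto simp: norm_axis_1)
  have "(\<lambda>s. g (z + s *s axis i 1)) holomorphic_on ball 0 d"
  proof (rule holomorphic_uniform_sequence[where f="\<lambda>n s. f n (z + s *s axis i 1)"])
    show "(\<lambda>s. f n (z + s *s axis i 1)) holomorphic_on ball 0 d" for n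
      by (rule holomorphic_fun2_slice[OF h]) (use inb d in blast)
    fix x :: complex assume "x \<in> ball 0 d"
    then obtain e where e: "e > 0" "cball x e \<subseteq> ball 0 d" by (meson open_ball open_contains_cball)
    have "uniform_limit (cball x e) (\<lambda>n s. f n (z + s *s axis i 1)) (\<lambda>s. g (z + s *s axis i 1)) sequentially"
      by (rule uniform_limit_compose'[OF d(3)]) (use e inb in blast)
    thus "\<exists>d'>0. cball x d' \<subseteq> ball 0 d \<and> uniform_limit (cball x d') (\<lambda>n s. f n (z + s *s axis i 1)) (\<lambda>s. g (z + s *s axis i 1)) sequentially"
      using e by blast
  qed simp
  thus "(\<lambda>s. g (z + s *s axis i 1)) field_differentiable (at 0)"
    using d(1) by (auto intro: holomorphic_on_imp_differentiable_at)
qed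

lemma holomorphic_fun2_pd_continuous: "holomorphic_fun2 S f \<Longrightarrow> continuous_on S (pd i f)"
  by (rule pd_continuous)
     (auto simp: holomorphic_fun2_iff field_differentiable_def intro: holomorphic_fun2_imp_continuous_on
       dest: pd_slice[where s=0, simplified])

text \<open>The difference quotients in direction \<open>i\<close> converge uniformly, so their derivatives in
  direction \<open>j\<close> converge as well; this yields holomorphy and the symmetry of mixed partials at once.\<close>

lemma pd_quotient_limit:
  assumes f: "holomorphic_fun2 S f" and z: "z \<in> S"
  shows "\<exists>g'. ((\<lambda>s. pd i f (z + s *s axis j 1)) has_field_derivative g') (at 0) \<and>
     ((\<lambda>h. (pd j f (z + h *s axis i 1) - pd j f z) / h) \<longlongrightarrow> g') (at 0)"
proof -
  have S: "open S" and cd: "\<And>z. z \<in> S \<Longrightarrow> cdiff f z" using f by (auto simp: holomorphic_fun2_iff)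
  obtain r0 where r0: "r0 > 0" "cball z r0 \<subseteq> S" using S z open_contains_cball by blast
  define r where "r = r0 / 2"
  have r: "r > 0" using r0 by (simp add: r_def)
  let ?p = "\<lambda>s h. z + s *s axis j 1 + h *s axis i 1"
  have inb: "?p s h \<in> cball z r0" if "norm s \<le> r" "norm h \<le> r" for s h
  proof -
    have "dist (?p s h) z \<le> norm (s *s axis j 1 :: complex^2) + norm (h *s axis i 1 :: complex^2)"
      unfolding dist_norm by (metis add_diff_cancel_left' add.assoc norm_triangle_ineq)
    thus ?thesis using that by (simp add: dist_commute norm_vector_scalar_mult norm_axis_1 r_def)
  qed
  have inS: "?p s h \<in> S" if "norm s \<le> r" "norm h \<le> r" for s h using inb[OF that] r0 by blast
  have inS0: "z + s *s axis j 1 \<in> S" if "norm s \<le> r" for s using inS[of s 0] that r by simp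
  define F where "F h s = (f (?p s h) - f (z + s *s axis j 1)) / h" for h s
  have uc: "uniformly_continuous_on (cball z r0) (pd i f)"
    using holomorphic_fun2_pd_continuous[OF f] r0
    by (intro compact_uniformly_continuous) (auto intro: continuous_on_subset)
  \<comment> \<open>On each slice the mean value estimate is applied to \<open>f\<close> minus the
    linear function of slope \<open>?c\<close>; uniform continuity of \<open>pd i f\<close> makes
    the derivative of this difference at most \<open>e / 2\<close>, uniformly in
    \<open>s\<close>.\<close>
  have ul: "uniform_limit (cball 0 r) F (\<lambda>s. pd i f (z + s *s axis j 1)) (at 0)"
  proof (rule uniform_limitI)
    fix e :: real assume e: "e > 0"
    obtain d where d: "d > 0" "\<And>x y. x \<in> cball z r0 \<Longrightarrow> y \<in> cball z r0 \<Longrightarrow> dist x y < d \<Longrightarrow> dist (pd i f x) (pd i f y) < e / 2"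
      using uc e unfolding uniformly_continuous_on_def by (metis half_gt_zero)
    have "dist (F h s) (pd i f (z + s *s axis j 1)) < e" if h: "h \<noteq> 0" "dist h 0 < min d r" and s: "s \<in> cball 0 r" for h s
    proof -
      let ?c = "pd i f (z + s *s axis j 1)"
      have s': "norm s \<le> r" using s by simp
      have "norm ((\<lambda>t. f (?p s t) - t * ?c) h - (\<lambda>t. f (?p s t) - t * ?c) 0) \<le> e / 2 * norm (h - 0)"
      proof (rule field_differentiable_bound[where S="cball 0 (norm h)" and f'="\<lambda>t. pd i f (?p s t) - ?c"])
        fix t :: complex assume t: "t \<in> cball 0 (cmod h)"
        hence t': "norm t \<le> r" using h by auto
        have "((\<lambda>t. f (?p s t)) has_field_derivative pd i f (?p s t)) (at t)"
          by (rule pd_slice[OF cd[OF inS[OF s' t']]])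
        from DERIV_diff[OF this DERIV_cmult_right[OF DERIV_ident, of ?c]]
        show "((\<lambda>t. f (?p s t) - t * ?c) has_field_derivative pd i f (?p s t) - ?c) (at t within cball 0 (cmod h))"
          by (simp add: has_field_derivative_at_within)
        have "dist (pd i f (?p s t)) ?c < e / 2"
          by (rule d(2)) (use inb[OF s' t'] inb[OF s', of 0] r t h in \<open>auto simp: dist_norm norm_vector_scalar_mult norm_axis_1\<close>)
        thus "cmod (pd i f (?p s t) - ?c) \<le> e / 2" by (simp add: dist_norm)
      qed auto
      hence "norm (f (?p s h) - f (z + s *s axis j 1) - h * ?c) \<le> e / 2 * norm h" by (simp add: algebra_simps)
      moreover have "F h s - ?c = (f (?p s h) - f (z + s *s axis j 1) - h * ?c) / h" using h by (simp add: F_def field_simps)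
      ultimately have "norm (F h s - ?c) * norm h \<le> e / 2 * norm h" using h by (simp add: norm_divide)
      hence "norm (F h s - ?c) \<le> e / 2" by (rule mult_right_le_imp_le) (use h in simp)
      thus ?thesis using e by (simp add: dist_norm)
    qed
    thus "\<forall>\<^sub>F h in at 0. \<forall>s\<in>cball 0 r. dist (F h s) (pd i f (z + s *s axis j 1)) < e"
      unfolding eventually_at using d r by (intro exI[of _ "min d r"]) auto
  qed
  let ?F' = "\<lambda>h s. (pd j f (?p s h) - pd j f (z + s *s axis j 1)) / h"
  have sw: "?p s h = (z + h *s axis i 1) + s *s axis j 1" for s h by (simp add: algebra_simps)
  have FD: "(F h has_field_derivative ?F' h s) (at s)" if "h \<noteq> 0" "norm h \<le> r" "norm s \<le> r" for h s
  proof -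
    have 1: "((\<lambda>s. f (?p s h)) has_field_derivative pd j f (?p s h)) (at s)"
      unfolding sw by (rule pd_slice) (use cd[OF inS[OF that(3,2)]] in \<open>simp add: sw\<close>)
    have 2: "((\<lambda>s. f (z + s *s axis j 1)) has_field_derivative pd j f (z + s *s axis j 1)) (at s)"
      by (rule pd_slice) (use cd[OF inS0[OF that(3)]] in simp)
    show ?thesis unfolding F_def using DERIV_cdivide[OF DERIV_diff[OF 1 2]] .
  qed
  have ev: "\<forall>\<^sub>F h in at 0. h \<noteq> 0 \<and> norm h \<le> r"
    unfolding eventually_at using r by (intro exI[of _ r]) auto
  \<comment> \<open>Derivatives of uniformly convergent holomorphic functions converge to the
    derivative of the limit. Here \<open>F h\<close> tends to \<open>pd i f\<close>, while the
    derivatives \<open>?F' h\<close> are difference quotients of \<open>pd j f\<close>.\<close>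
  obtain g' where g': "\<And>w. w \<in> ball 0 r \<Longrightarrow> ((\<lambda>s. pd i f (z + s *s axis j 1)) has_field_derivative g' w) (at w) \<and> ((\<lambda>h. ?F' h w) \<longlongrightarrow> g' w) (at 0)"
  proof (rule has_complex_derivative_uniform_limit[OF _ ul])
    show "\<forall>\<^sub>F h in at 0. continuous_on (cball 0 r) (F h) \<and> (\<forall>w\<in>ball 0 r. (F h has_field_derivative ?F' h w) (at w))"
      using ev
    proof eventually_elim
      case (elim h)
      have "continuous_on (cball 0 r) (F h)"
        by (intro continuous_at_imp_continuous_on ballI DERIV_isCont[OF FD]) (use elim in auto)
      thus ?case using FD elim by auto
    qed
  qed (use r in auto)
  show ?thesis using g'[of 0] r by (intro exI[of _ "g' 0"]) simp
qed

lemma holomorphic_fun2_pd: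
  assumes f: "holomorphic_fun2 S f"
  shows "holomorphic_fun2 S (pd i f)"
proof (rule osgood)
  show "open S" using f by (simp add: holomorphic_fun2_iff)
  show "continuous_on S (pd i f)" by (rule holomorphic_fun2_pd_continuous[OF f])
  show "(\<lambda>s. pd i f (z + s *s axis j 1)) field_differentiable at 0" if "z \<in> S" for z j
    using pd_quotient_limit[OF f that, of i j] by (auto simp: field_differentiable_def)
qed

lemma pd_commute:
  assumes f: "holomorphic_fun2 S f" and z: "z \<in> S"
  shows "pd j (pd i f) z = pd i (pd j f) z"
proof -
  obtain g' where g': "((\<lambda>s. pd i f (z + s *s axis j 1)) has_field_derivative g') (at 0)"
     "((\<lambda>h. (pd j f (z + h *s axis i 1) - pd j f z) / h) \<longlongrightarrow> g') (at 0)"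
    using pd_quotient_limit[OF f z] by blast
  have "cdiff (pd j f) z" using holomorphic_fun2_pd[OF f] z by (simp add: holomorphic_fun2_iff)
  from pd_slice[of _ z 0 i, simplified, OF this]
  have "((\<lambda>h. (pd j f (z + h *s axis i 1) - pd j f z) / h) \<longlongrightarrow> pd i (pd j f) z) (at 0)"
    by (simp add: has_field_derivative_iff)
  with g'(2) have "g' = pd i (pd j f) z" by (rule tendsto_unique[rotated]) simp
  moreover have "pd j (pd i f) z = g'" using g'(1) by (simp add: pd_def[of j] DERIV_imp_deriv)
  ultimately show ?thesis by simp
qed

text \<open>Continuity of the partial derivatives makes one linear map approximate the increments
  between any two points near \<open>z\<close>, not only those starting at \<open>z\<close>. The
  two-point form is needed where two moving points are compared: in the commutation of germs, in
  local inversion and for the difference of two orbits.\<close>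

lemma strict_derivative:
  assumes f: "holomorphic_fun2 S f" and z: "z \<in> S" and e: "e > 0"
  shows "\<exists>d>0. ball z d \<subseteq> S \<and> (\<forall>x\<in>ball z d. \<forall>y\<in>ball z d.
     norm (f x - f y - (pd 1 f z * (x - y) $ 1 + pd 2 f z * (x - y) $ 2)) \<le> e * norm (x - y))"
proof -
  have S: "open S" using f by (simp add: holomorphic_fun2_iff)
  have "isCont (pd i f) z" for i
    using holomorphic_fun2_pd_continuous[OF f] S z by (simp add: continuous_on_eq_continuous_at)
  hence "\<forall>\<^sub>F x in nhds z. dist (pd i f x) (pd i f z) < e / 2" for i
    using e by (intro tendstoD) (simp add: isCont_def tendsto_at_iff_tendsto_nhds, simp)
  moreover have "\<forall>\<^sub>F x in nhds z. x \<in> S" using S z by (simp add: eventually_nhds_in_open)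
  ultimately have "\<forall>\<^sub>F x in nhds z. x \<in> S \<and> dist (pd 1 f x) (pd 1 f z) < e / 2 \<and> dist (pd 2 f x) (pd 2 f z) < e / 2"
    by (simp add: eventually_conj_iff)
  then obtain d where d: "d > 0" "\<And>x. x \<in> ball z d \<Longrightarrow> x \<in> S \<and> dist (pd 1 f x) (pd 1 f z) < e / 2 \<and> dist (pd 2 f x) (pd 2 f z) < e / 2"
    by (auto simp: eventually_nhds_metric dist_commute)
  let ?f' = "\<lambda>x (v :: complex^2). pd 1 f x * v $ 1 + pd 2 f x * v $ 2"
  have "norm (f x - f y - ?f' z (x - y)) \<le> norm (x - y) * e" if "x \<in> ball z d" "y \<in> ball z d" for x y
  proof (rule differentiable_bound_linearization[where S="ball z d"])
    show "y + t *\<^sub>R (x - y) \<in> ball z d" if "t \<in> {0..1}" for t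
      using convexD_alt[OF convex_ball \<open>y \<in> ball z d\<close> \<open>x \<in> ball z d\<close>, of t] that by (simp add: algebra_simps)
    show "(f has_derivative ?f' x) (at x within ball z d)" if "x \<in> ball z d" for x
      by (rule has_derivative_at_withinI, rule cdiff_has_derivative) (use d(2)[OF that] f in \<open>simp add: holomorphic_fun2_iff\<close>)
    show "onorm (?f' x - ?f' z) \<le> e" if "x \<in> ball z d" for x
    proof -
      have "norm ((?f' x - ?f' z) v) \<le> e * norm v" for v :: "complex^2"
      proof -
      have "norm ((?f' x - ?f' z) v) = norm ((pd 1 f x - pd 1 f z) * v $ 1 + (pd 2 f x - pd 2 f z) * v $ 2)"
        by (simp add: algebra_simps)
      also have "\<dots> \<le> norm (pd 1 f x - pd 1 f z) * norm (v $ 1) + norm (pd 2 f x - pd 2 f z) * norm (v $ 2)"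
        by (metis norm_mult norm_triangle_ineq)
      also have "\<dots> \<le> e / 2 * norm v + e / 2 * norm v"
        using d(2)[OF that] e by (intro add_mono mult_mono) (auto simp: dist_norm component_le_norm_cart Finite_Cartesian_Product.norm_nth_le)
      finally show ?thesis by simp
      qed
      thus ?thesis by (rule onorm_le)
    qed
    show "z \<in> ball z d" using d by simp
  qed
  thus ?thesis using d by (intro exI[of _ d]) (auto simp: mult.commute)
qed

section \<open>Parameter integrals, periodic functions and Taylor remainders\<close>

lemma param_integral_derivative:
  assumes g: "holomorphic_fun2 S g" and U: "open U" "convex U" "s0 \<in> U"
    and inS: "\<And>s \<tau>. s \<in> U \<Longrightarrow> \<tau> \<in> {0..1} \<Longrightarrow> vec2 (of_real \<tau> * T) s \<in> S"
    and c: "continuous_on {0..1} c"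
  shows "((\<lambda>s. integral {0..1} (\<lambda>\<tau>. c \<tau> * g (vec2 (of_real \<tau> * T) s))) has_field_derivative
           integral {0..1} (\<lambda>\<tau>. c \<tau> * pd 2 g (vec2 (of_real \<tau> * T) s0))) (at s0)"
proof -
  have "((\<lambda>s. integral (cbox 0 1) (\<lambda>\<tau>::real. c \<tau> * g (vec2 (of_real \<tau> * T) s))) has_field_derivative
           integral (cbox 0 1) (\<lambda>\<tau>. c \<tau> * pd 2 g (vec2 (of_real \<tau> * T) s0))) (at s0 within U)"
  proof (rule leibniz_rule_field_derivative)
    fix s and \<tau> :: real assume s: "s \<in> U" "\<tau> \<in> cbox 0 1"
    have eq: "vec2 (of_real \<tau> * T) 0 + s' *s axis 2 1 = vec2 (of_real \<tau> * T) s'" for s' by (simp add: vec2_eq_iff)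
    have "cdiff g (vec2 (of_real \<tau> * T) s)" using g inS[of s \<tau>] s by (auto simp: holomorphic_fun2_iff)
    hence "((\<lambda>s. g (vec2 (of_real \<tau> * T) s)) has_field_derivative pd 2 g (vec2 (of_real \<tau> * T) s)) (at s)"
      using pd_slice[of g "vec2 (of_real \<tau> * T) 0" s 2] by (simp only: eq)
    from DERIV_cmult[OF this]
    show "((\<lambda>s. c \<tau> * g (vec2 (of_real \<tau> * T) s)) has_field_derivative c \<tau> * pd 2 g (vec2 (of_real \<tau> * T) s)) (at s within U)"
      by (rule has_field_derivative_at_within)
  next
    fix s assume s: "s \<in> U"
    have "continuous_on {0..1} (\<lambda>\<tau>::real. g (vec2 (of_real \<tau> * T) s))"
      by (rule continuous_on_compose2[OF holomorphic_fun2_imp_continuous_on[OF g]])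
         (use inS s in \<open>auto intro!: continuous_intros\<close>)
    thus "(\<lambda>\<tau>::real. c \<tau> * g (vec2 (of_real \<tau> * T) s)) integrable_on cbox 0 1"
      using c by (intro integrable_continuous continuous_intros) auto
  next
    have 1: "continuous_on (U \<times> {0..1}) (\<lambda>p::complex \<times> real. pd 2 g (vec2 (of_real (snd p) * T) (fst p)))"
      by (rule continuous_on_compose2[OF holomorphic_fun2_pd_continuous[OF g]])
         (use inS in \<open>auto intro!: continuous_intros\<close>)
    have 2: "continuous_on (U \<times> {0..1}) (\<lambda>p::complex \<times> real. c (snd p))"
      by (rule continuous_on_compose2[OF c]) (auto intro!: continuous_intros)
    show "continuous_on (U \<times> cbox 0 1) (\<lambda>(s, \<tau>::real). c \<tau> * pd 2 g (vec2 (of_real \<tau> * T) s))"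
      using continuous_on_mult[OF 2 1] by (simp add: case_prod_beta')
  qed (use U in auto)
  thus ?thesis by (simp only: at_within_open[OF U(3,1)] cbox_interval)
qed

text \<open>The map \<open>exp (2 * pi * \<i> * t / T)\<close> carries the half-plane onto the
  punctured disc of radius \<open>exp (- 2 * pi * R)\<close>, and two times have the same image iff
  they differ by an integer multiple of \<open>T\<close>. A periodic function therefore descends to
  the punctured disc, and the bound \<open>C\<close> makes the puncture removable.\<close>

lemma periodic_factor:
  fixes T :: complex
  assumes T: "T \<noteq> 0" and hol: "g holomorphic_on {t. Im (t / T) > R}"
    and per: "\<And>t. Im (t / T) > R \<Longrightarrow> g (t + T) = g t"
    and bd: "\<And>t. Im (t / T) > R \<Longrightarrow> norm (g t) \<le> C"
  shows "\<exists>h. h holomorphic_on ball 0 (exp (- 2 * pi * R)) \<and>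
          (\<forall>t. Im (t / T) > R \<longrightarrow> h (exp (2 * pi * \<i> * t / T)) = g t)"
proof -
  let ?r = "exp (- 2 * pi * R)"
  let ?e = "\<lambda>t. exp (2 * pi * \<i> * t / T)"
  define H where "H = {t. Im (t / T) > R}"
  have "open H" unfolding H_def using T by (intro open_Collect_less continuous_intros) auto
  have addT: "Im ((t + of_int n * T) / T) = Im (t / T)" for t n using T by (simp add: add_divide_distrib)
  have perN: "g (t + of_nat n * T) = g t" if "t \<in> H" for t and n :: nat
  proof (induction n)
    case (Suc n)
    have "g (t + of_nat (Suc n) * T) = g ((t + of_nat n * T) + T)" by (simp add: algebra_simps)
    also have "\<dots> = g (t + of_nat n * T)"
      using that addT[of t "int n"] by (intro per) (simp add: H_def)
    finally show ?case using Suc by simp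
  qed simp
  have perZ: "g (t + of_int n * T) = g t" if "t \<in> H" for t n
  proof (cases "n \<ge> 0")
    case True thus ?thesis using perN[OF that, of "nat n"] by simp
  next
    case False
    have "t + of_int n * T \<in> H" using that addT by (simp add: H_def)
    from perN[OF this, of "nat (- n)"] show ?thesis using False by (simp add: algebra_simps)
  qed
  have norm_e: "norm (?e t) = exp (- 2 * pi * Im (t / T))" for t
  proof -
    have "2 * pi * \<i> * t / T = 2 * pi * \<i> * (t / T)" by simp
    moreover have "Re (2 * pi * \<i> * q) = - 2 * pi * Im q" for q by simp
    ultimately show ?thesis by (simp only: norm_exp_eq_Re)
  qed
  have H_iff: "t \<in> H \<longleftrightarrow> norm (?e t) < ?r" for t
    unfolding norm_e by (simp add: H_def)
  define h where "h w = g (T * Ln w / (2 * pi * \<i>))" for w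
  have h: "h (?e t) = g t" if "t \<in> H" for t
  proof -
    obtain n :: int where n: "Ln (?e t) = 2 * pi * \<i> * t / T + of_int n * (2 * pi * \<i>)"
      using exp_eq[of "Ln (?e t)" "2 * pi * \<i> * t / T"] by (auto simp: algebra_simps)
    have "T * Ln (?e t) / (2 * pi * \<i>) = t + of_int n * T" unfolding n using T by (simp add: field_simps)
    thus ?thesis using perZ[OF that] by (simp add: h_def)
  qed
  have holh: "h holomorphic_on (ball 0 ?r - {0})"
  proof (rule holomorphic_onI)
    fix w0 assume w0: "w0 \<in> ball 0 ?r - {0 :: complex}"
    \<comment> \<open>A local inverse of the exponential: \<open>Ln (w / w0)\<close> is holomorphic
      near \<open>w0\<close> even if \<open>w0\<close> lies on the branch cut of
      \<open>Ln\<close>.\<close>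
    define \<tau> where "\<tau> w = T * (Ln (w / w0) + Ln w0) / (2 * pi * \<i>)" for w
    have e\<tau>: "?e (\<tau> w) = w" if "w \<noteq> 0" for w
    proof -
      have "2 * pi * \<i> * \<tau> w / T = Ln (w / w0) + Ln w0" using T by (simp add: \<tau>_def)
      thus ?thesis using that w0 by (simp add: exp_add)
    qed
    have "((\<lambda>w. Ln (w / w0)) has_field_derivative 1 / w0) (at w0)"
      using w0 by (auto intro!: derivative_eq_intros)
    from DERIV_cdivide[OF DERIV_cmult[OF DERIV_add[OF this DERIV_const]]]
    have "\<tau> field_differentiable at w0" unfolding \<tau>_def field_differentiable_def by blast
    moreover have "\<tau> w0 \<in> H" using w0 unfolding H_iff by (subst e\<tau>) auto
    hence "g field_differentiable at (\<tau> w0)"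
      using hol \<open>open H\<close> unfolding H_def[symmetric] by (rule holomorphic_on_imp_differentiable_at[rotated 2])
    ultimately have "(g \<circ> \<tau>) field_differentiable at w0" by (rule field_differentiable_compose)
    moreover have "(g \<circ> \<tau>) w = h w" if "w \<in> ball 0 ?r - {0}" for w
    proof -
      have "\<tau> w \<in> H" using that unfolding H_iff by (subst e\<tau>) auto
      from h[OF this] show ?thesis using e\<tau>[of w] that by simp
    qed
    ultimately have "h field_differentiable at w0"
      unfolding field_differentiable_def
      by (elim exE) (rule exI, erule has_field_derivative_transform_within_open[where S="ball 0 ?r - {0}"], use w0 in auto)
    thus "h field_differentiable at w0 within ball 0 ?r - {0}" by (rule field_differentiable_at_within)
  qed
  have "\<exists>B. \<forall>\<^sub>F w in at 0. norm (h w) \<le> B"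
  proof (rule exI[of _ C], unfold eventually_at, rule exI[of _ ?r], intro conjI ballI impI)
    fix w :: complex assume w: "w \<noteq> 0 \<and> dist w 0 < ?r"
    define t where "t = T * Ln w / (2 * pi * \<i>)"
    have et: "?e t = w" using w T by (simp add: t_def)
    hence "t \<in> H" using w unfolding H_iff by simp
    thus "norm (h w) \<le> C" using h[of t] bd[of t] et by (simp add: H_def)
  qed simp
  then obtain h' where h': "h' holomorphic_on ball 0 ?r" "\<forall>w\<in>ball 0 ?r - {0}. h' w = h w"
    using holomorphic_on_extend_bounded[OF holh] by auto
  show ?thesis
  proof (intro exI conjI allI impI)
    show "h' holomorphic_on ball 0 ?r" by fact
    fix t assume "Im (t / T) > R"
    hence t: "t \<in> H" by (simp add: H_def)
    thus "h' (?e t) = g t" using h[OF t] h'(2) unfolding H_iff by simp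
  qed
qed

text \<open>Cauchy's estimates dominate the tail by a geometric series of ratio
  \<open>norm s / r\<close>; since this is at most 1/2, summation costs the factor 2.\<close>

lemma taylor_leading:
  assumes f: "f holomorphic_on ball 0 R" and r: "0 < r" "r < R"
    and M: "\<And>s. norm s = r \<Longrightarrow> norm (f s) \<le> M"
    and z: "\<And>n. n < m \<Longrightarrow> (deriv ^^ n) f 0 = 0" and s: "norm s \<le> r / 2"
  shows "norm (f s - (deriv ^^ m) f 0 / fact m * s ^ m) \<le> 2 * M * (norm s / r) ^ Suc m"
proof -
  define a where "a n = (deriv ^^ n) f 0 / fact n * s ^ n" for n
  define q where "q = norm s / r"
  have q: "0 \<le> q" "q \<le> 1 / 2" using r s by (auto simp: q_def field_simps)
  have M0: "0 \<le> M" using order_trans[OF norm_ge_zero M[of "of_real r"]] r by simp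
  have sums: "a sums f s"
    using holomorphic_power_series[OF f, of s] r s unfolding a_def by simp
  have "norm (a n) \<le> M * q ^ n" for n
  proof -
    have "norm ((deriv ^^ n) f 0) \<le> fact n * M / r ^ n"
      by (rule Cauchy_inequality) (use r M in \<open>auto intro!: holomorphic_on_subset[OF f] holomorphic_on_imp_continuous_on\<close>)
    hence "norm ((deriv ^^ n) f 0 / fact n) \<le> M / r ^ n"
      by (simp add: norm_divide field_simps)
    hence "norm ((deriv ^^ n) f 0 / fact n) * norm s ^ n \<le> M / r ^ n * norm s ^ n"
      by (rule mult_right_mono) simp
    thus ?thesis unfolding a_def norm_mult norm_power by (simp add: q_def power_divide)
  qed
  note an = this
  have gs: "(\<lambda>n. M * q ^ (n + Suc m)) sums (M * q ^ Suc m * (1 / (1 - q)))"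
    using sums_mult[OF geometric_sums[of q], of "M * q ^ Suc m"] q by (simp add: power_add algebra_simps)
  have "(\<lambda>n. a (n + Suc m)) sums (f s - (\<Sum>n<Suc m. a n))" by (rule sums_split_initial_segment[OF sums])
  moreover have "(\<Sum>n<Suc m. a n) = a m" by (simp add: a_def z)
  ultimately have "(\<lambda>n. a (n + Suc m)) sums (f s - a m)" by simp
  hence "norm (f s - a m) \<le> M * q ^ Suc m * (1 / (1 - q))"
    using norm_suminf_le[OF an sums_summable[OF gs], unfolded sums_unique[OF gs, symmetric]] by (simp only: sums_unique[symmetric])
  also have "\<dots> \<le> M * q ^ Suc m * 2"
    using q M0 by (intro mult_left_mono) (auto simp: field_simps)
  finally show ?thesis by (simp add: a_def q_def mult_ac)
qed

section \<open>Germs tangent to the identity that commute with a contraction\<close>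

lemma norm_le_components: "norm (v :: complex^2) \<le> norm (v $ 1) + norm (v $ 2)"
  by (simp add: norm_vec_def L2_set_def sum_2 sqrt_sum_squares_le_sum)

text \<open>Let \<open>P\<close> be the lowest homogeneous part, of degree \<open>m \<ge> 2\<close>,
  of \<open>G\<close> minus the identity. Commutation gives
  \<open>P (\<Lambda> v) = \<Lambda> (P v)\<close> for the diagonal linear part \<Lambda> of
  \<open>C\<close>, so a monomial of bidegree \<open>(i, j)\<close> survives in the first component
  only if \<open>i + \<nu> j = 1\<close> and in the second only if
  \<open>i + \<nu> j = \<nu>\<close>. With \<open>i + j \<ge> 2\<close> and
  \<open>\<nu> \<ge> 1\<close> the only solution is \<open>i = \<nu>\<close>, \<open>j = 0\<close>
  in the second component. It is excluded if \<nu> is not an integer at least 2, and otherwise by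
  the curve \<open>h\<close> of fixed points, which evaluates \<open>P\<close> in direction
  \<open>(1, 0)\<close>. No two-variable power series occur: \<open>P\<close> is built from Taylor
  coefficients along complex lines.\<close>

lemma commuting_germ_identity:
  fixes G C :: "complex^2 \<Rightarrow> complex^2" and \<nu> :: real
  assumes holG: "\<And>i. holomorphic_fun2 S (\<lambda>z. G z $ i)" and holC: "\<And>i. holomorphic_fun2 S (\<lambda>z. C z $ i)"
    and S0: "0 \<in> S" and G0: "G 0 = 0" and C0: "C 0 = 0"
    and DG: "\<And>i j. pd j (\<lambda>z. G z $ i) 0 = (if i = j then 1 else 0)"
    and DC1: "pd 1 (\<lambda>z. C z $ 1) 0 = exp (- 1)" "pd 2 (\<lambda>z. C z $ 1) 0 = 0"
    and DC2: "pd 1 (\<lambda>z. C z $ 2) 0 = 0" "pd 2 (\<lambda>z. C z $ 2) 0 = exp (- of_real \<nu>)"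
    and \<nu>: "\<nu> \<ge> 1"
    and comm: "\<And>z. z \<in> S \<Longrightarrow> G z \<in> S \<Longrightarrow> C z \<in> S \<Longrightarrow> G (C z) = C (G z)"
    and res: "(\<forall>m::nat. m \<ge> 2 \<longrightarrow> \<nu> \<noteq> m) \<or>
       (\<exists>k h. k > 0 \<and> (\<forall>\<^sub>F w in at (0::complex). G (h w) = h w) \<and>
          ((\<lambda>w. h w $ 1 / w ^ k) \<longlongrightarrow> 1) (at 0) \<and> ((\<lambda>w. h w $ 2 / w ^ k) \<longlongrightarrow> 0) (at 0))"
  shows "\<exists>d>0. ball 0 d \<subseteq> S \<and> (\<forall>z\<in>ball 0 d. G z = z)"
proof -
  have S: "open S" using holG by (simp add: holomorphic_fun2_iff)
  obtain R where R: "R > 0" "ball 0 R \<subseteq> S" using S S0 open_contains_ball by blast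
  define r where "r = R / 2"
  have r: "r > 0" "r < R" using R by (auto simp: r_def)
  define g where "g i z = G z $ i - z $ i" for i z
  have holg: "holomorphic_fun2 S (g i)" for i
    using holG[of i] unfolding g_def holomorphic_fun2_iff by (auto intro!: cdiff_diff)
  have "\<exists>M. \<forall>i. \<forall>z\<in>cball 0 r. norm (g i z) \<le> M"
  proof -
    have "bounded (g i ` cball 0 r)" for i
      using R r by (intro compact_imp_bounded compact_continuous_image continuous_on_subset[OF holomorphic_fun2_imp_continuous_on[OF holg]]) auto
    then obtain B where B: "\<And>i z. z \<in> cball 0 r \<Longrightarrow> norm (g i z) \<le> B i" unfolding bounded_iff by (metis image_eqI)
    hence "\<forall>i. \<forall>z\<in>cball 0 r. norm (g i z) \<le> max (B 1) (B 2)" by (metis (full_types) exhaust_2 max.coboundedI1 max.coboundedI2)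
    thus ?thesis by blast
  qed
  then obtain M where M: "\<And>i z. z \<in> cball 0 r \<Longrightarrow> norm (g i z) \<le> M" by blast
  have sv: "s *s v \<in> ball 0 d" if "norm s < d" "norm v \<le> 1" for s d and v :: "complex^2"
    using smult_in_ball[OF that, of 0] by simp
  have svc: "s *s v \<in> cball 0 r" if "norm s = r" "norm v \<le> 1" for s and v :: "complex^2"
    using mult_left_mono[OF that(2), of "norm s"] that(1) r by (simp add: norm_vector_scalar_mult)
  have hol1: "(\<lambda>s. g i (s *s v)) holomorphic_on ball 0 R" if "norm v \<le> 1" for i v
    using holomorphic_fun2_slice[OF holg, of "ball 0 R" 0 v i] sv[OF _ that] R by (auto simp: subset_iff)
  \<comment> \<open>The homogeneous part of degree \<open>n\<close>, read off as a Taylor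
    coefficient on the complex line through \<open>v\<close>; directions are kept in the unit ball
    so that one radius serves all of them.\<close>
  define c where "c n i v = (deriv ^^ n) (\<lambda>s. g i (s *s v)) 0 / fact n" for n i v
  show ?thesis
  proof (cases "\<exists>n i v. norm v \<le> 1 \<and> c n i v \<noteq> 0")
    case False
    have "g i z = 0" if z: "z \<in> ball 0 R" for i z
    proof (cases "z = 0")
      case True thus ?thesis by (simp add: g_def G0)
    next
      case nz: False
      define v where "v = of_real (1 / norm z) *s z"
      have v: "norm v \<le> 1" "of_real (norm z) *s v = z" using nz by (auto simp: v_def norm_vector_scalar_mult norm_divide)
      have "(\<lambda>s. g i (s *s v)) (of_real (norm z)) = 0"
        by (rule holomorphic_fun_eq_0_on_ball[OF hol1[OF v(1)]]) (use z False v c_def in auto)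
      thus ?thesis by (simp add: v(2))
    qed
    hence "\<forall>z\<in>ball 0 R. G z = z" by (auto simp: g_def vec_eq_iff)
    thus ?thesis using R by blast
  next
    case True
    \<comment> \<open>Least order at which some component has a nonzero coefficient in some
      direction; \<open>G 0 = 0\<close> and the derivative of \<open>G\<close> exclude the orders 0
      and 1.\<close>
    define m where "m = (LEAST n. \<exists>i v. norm v \<le> 1 \<and> c n i v \<noteq> 0)"
    have m: "\<exists>i v. norm v \<le> 1 \<and> c m i v \<noteq> 0" unfolding m_def by (rule LeastI_ex) (use True in blast)
    have mless: "c n i v = 0" if "n < m" "norm v \<le> 1" for n i v
      using not_less_Least[of n "\<lambda>n. \<exists>i v. norm v \<le> 1 \<and> c n i v \<noteq> 0"] that unfolding m_def by blast
    have c0: "c 0 i v = 0" for i v by (simp add: c_def g_def G0)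
    have c1: "c 1 i v = 0" for i v
    proof -
      have cd: "cdiff (\<lambda>z. G z $ i) 0" using holG S0 by (simp add: holomorphic_fun2_iff)
      have "((\<lambda>s. G (s *s v) $ i - (s *s v) $ i) has_field_derivative (pd 1 (\<lambda>z. G z $ i) 0 * v $ 1 + pd 2 (\<lambda>z. G z $ i) 0 * v $ 2) - v $ i) (at 0)"
        using cdiff_slice[of "\<lambda>z. G z $ i" 0 0 v] cd by (intro DERIV_diff) (auto intro!: derivative_eq_intros)
      hence "((\<lambda>s. g i (s *s v)) has_field_derivative 0) (at 0)"
        using exhaust_2[of i] by (auto simp: g_def DG)
      thus ?thesis by (simp add: c_def DERIV_imp_deriv)
    qed
    have m2: "m \<ge> 2"
    proof (rule ccontr)
      assume "\<not> m \<ge> 2"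
      hence "m = 0 \<or> m = 1" by auto
      thus False using m c0 c1 by auto
    qed
    define P where "P = c m"
    define K where "K = 2 * M / r ^ Suc m"
    have est: "norm (g i (s *s v) - P i v * s ^ m) \<le> K * norm s ^ Suc m" if "norm v \<le> 1" "norm s \<le> r / 2" for i s v
    proof -
      have "norm (g i (s *s v) - (deriv ^^ m) (\<lambda>s. g i (s *s v)) 0 / fact m * s ^ m) \<le> 2 * M * (norm s / r) ^ Suc m"
        by (rule taylor_leading[OF hol1[OF that(1)] r _ _ that(2)])
           (use mless[OF _ that(1), unfolded c_def] M svc[OF _ that(1)] in auto)
      thus ?thesis by (simp add: P_def c_def K_def power_divide)
    qed
    \<comment> \<open>The direction may vary with \<open>s\<close>, because the germ has to be
      evaluated at \<open>C (s *s v)\<close>, which is \<open>s\<close> times a direction that only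
      converges to \<open>\<Lambda> v\<close>.\<close>
    have lim: "((\<lambda>s. g i (s *s u s) / s ^ m - P i (u s)) \<longlongrightarrow> 0) (at 0)" if u: "\<forall>\<^sub>F s in at 0. norm (u s) \<le> 1" for i u
    proof (rule Lim_null_comparison[where g="\<lambda>s. K * norm s"])
      have "\<forall>\<^sub>F s in at (0::complex). s \<noteq> 0 \<and> norm s \<le> r / 2"
        unfolding eventually_at using r by (intro exI[of _ "r / 2"]) auto
      with u show "\<forall>\<^sub>F s in at 0. norm (g i (s *s u s) / s ^ m - P i (u s)) \<le> K * norm s"
      proof eventually_elim
        case (elim s)
        have "norm (g i (s *s u s) / s ^ m - P i (u s)) * norm (s ^ m) = norm (g i (s *s u s) - P i (u s) * s ^ m)"
          using elim by (simp add: norm_mult[symmetric] algebra_simps)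
        also have "\<dots> \<le> K * norm s * norm (s ^ m)" using est[of "u s" s i] elim by (simp add: norm_power mult_ac)
        finally show ?case by (rule mult_right_le_imp_le) (use elim in simp)
      qed
      show "((\<lambda>s. K * norm s) \<longlongrightarrow> 0) (at (0::complex))" by (auto intro!: tendsto_eq_intros)
    qed
    have limc: "((\<lambda>s. g i (s *s v) / s ^ m) \<longlongrightarrow> P i v) (at 0)" if "norm v \<le> 1" for i v
      using lim[of "\<lambda>_. v" i] that by (simp add: LIM_zero_iff)
    \<comment> \<open>Homogeneity of degree \<open>m\<close> results from rescaling the parameter of
      the line from \<open>s\<close> to \<open>a * s\<close> in the limit
      \<open>limc\<close>.\<close>
    have hom: "P i (a *s v) = a ^ m * P i v" if "norm v \<le> 1" "norm a \<le> 1" for i a v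
    proof (cases "a = 0")
      case True
      have "g i (s *s 0) = 0" for s by (simp add: g_def G0)
      hence "((\<lambda>s::complex. 0) \<longlongrightarrow> P i 0) (at 0)" using limc[of 0 i] by simp
      hence "P i 0 = 0" using LIM_unique[OF _ tendsto_const] by blast
      thus ?thesis using True m2 by (simp add: power_0_left)
    next
      case False
      have av: "norm (a *s v) \<le> 1" using mult_mono[OF that(2,1)] by (simp add: norm_vector_scalar_mult)
      have fl: "filterlim (\<lambda>s. a * s) (at 0) (at 0)"
        using False by (auto simp: filterlim_at eventually_at_filter intro!: tendsto_eq_intros)
      have "((\<lambda>s. a ^ m * (g i ((a * s) *s v) / (a * s) ^ m)) \<longlongrightarrow> a ^ m * P i v) (at 0)"
        by (intro tendsto_intros filterlim_compose[OF limc[OF that(1)] fl])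
      moreover have "a ^ m * (g i ((a * s) *s v) / (a * s) ^ m) = g i (s *s (a *s v)) / s ^ m" for s
      proof -
        have "(a * s) *s v = s *s (a *s v)" by (simp add: vec_eq_iff)
        hence "g i ((a * s) *s v) = g i (s *s (a *s v))" by (rule arg_cong)
        thus ?thesis using False by (simp only: power_mult_distrib) simp
      qed
      ultimately have "((\<lambda>s. g i (s *s (a *s v)) / s ^ m) \<longlongrightarrow> a ^ m * P i v) (at 0)" by simp
      from LIM_unique[OF limc[OF av] this] show ?thesis .
    qed
    \<comment> \<open>By the remainder estimate \<open>est\<close>, \<open>P\<close> is the uniform
      limit of the rescaled germs \<open>g i (\<delta> n *s v) / \<delta> n ^ m\<close>.\<close>
    have holP: "holomorphic_fun2 (ball 0 1) (P i)" for i
    proof -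
      define \<delta> :: "nat \<Rightarrow> complex" where "\<delta> n = of_real (r / (4 * real (Suc n)))" for n :: nat
      have \<delta>: "\<delta> n \<noteq> 0" "norm (\<delta> n) \<le> r / 2" "norm (\<delta> n) < R" for n
      proof -
        have "r / (4 * real (Suc n)) \<le> r / 2" using r by (intro divide_left_mono) auto
        moreover have "norm (\<delta> n) = r / (4 * real (Suc n))" using r unfolding \<delta>_def norm_of_real by simp
        ultimately show "norm (\<delta> n) \<le> r / 2" "norm (\<delta> n) < R" using r by linarith+
        show "\<delta> n \<noteq> 0" using r unfolding \<delta>_def of_real_eq_0_iff by simp
      qed
      have \<delta>0: "\<delta> \<longlonglongrightarrow> 0" unfolding \<delta>_def
        using tendsto_of_real[OF tendsto_mult_right_zero[OF LIMSEQ_inverse_real_of_nat, of "r / 4"], where 'a=complex] by (simp add: field_simps)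
      show ?thesis
      proof (rule holomorphic_fun2_uniform_limit)
        show "holomorphic_fun2 (ball 0 1) (\<lambda>v. g i (\<delta> n *s v) / \<delta> n ^ m)" for n
          unfolding holomorphic_fun2_iff
        proof (intro conjI ballI)
          fix v :: "complex^2" assume "v \<in> ball 0 1"
          hence "\<delta> n *s v \<in> S" using sv[OF \<delta>(3)] R by auto
          hence "cdiff (g i) (\<delta> n *s v)" using holg by (simp add: holomorphic_fun2_iff)
          moreover have "cdiff (\<lambda>z. (\<delta> n *s z) $ j) v" for j using cdiff_mult[OF cdiff_const cdiff_nth] by simp
          ultimately have "cdiff (\<lambda>v. g i (\<delta> n *s v)) v" by (rule cdiff_compose)
          from cdiff_mult[OF this cdiff_const] show "cdiff (\<lambda>v. g i (\<delta> n *s v) / \<delta> n ^ m) v" by (simp add: divide_inverse)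
        qed simp
        fix z :: "complex^2" assume "z \<in> ball 0 1"
        then obtain d where d: "d > 0" "ball z d \<subseteq> ball 0 1" by (meson open_ball open_contains_ball)
        have "uniform_limit (ball z d) (\<lambda>n v. g i (\<delta> n *s v) / \<delta> n ^ m) (P i) sequentially"
        proof (rule uniform_limitI)
          fix e :: real assume e: "e > 0"
          have "(\<lambda>n. K * norm (\<delta> n)) \<longlonglongrightarrow> 0" using tendsto_mult_right_zero[OF tendsto_norm_zero[OF \<delta>0]] .
          hence "\<forall>\<^sub>F n in sequentially. K * norm (\<delta> n) < e" using e by (rule order_tendstoD)
          thus "\<forall>\<^sub>F n in sequentially. \<forall>v\<in>ball z d. dist (g i (\<delta> n *s v) / \<delta> n ^ m) (P i v) < e"
          proof eventually_elim
            case (elim n)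
            show ?case
            proof
              fix v assume "v \<in> ball z d"
              hence "norm v \<le> 1" using d by auto
              have "norm (g i (\<delta> n *s v) / \<delta> n ^ m - P i v) * norm (\<delta> n ^ m) = norm (g i (\<delta> n *s v) - P i v * \<delta> n ^ m)"
                using \<delta>(1)[of n] by (simp add: norm_mult[symmetric] algebra_simps)
              also have "\<dots> \<le> K * norm (\<delta> n) * norm (\<delta> n ^ m)" using est[OF \<open>norm v \<le> 1\<close> \<delta>(2)[of n], of i] by (simp add: norm_power mult_ac)
              finally have "norm (g i (\<delta> n *s v) / \<delta> n ^ m - P i v) \<le> K * norm (\<delta> n)" by (rule mult_right_le_imp_le) (use \<delta>(1) in simp)
              thus "dist (g i (\<delta> n *s v) / \<delta> n ^ m) (P i v) < e" using elim by (simp add: dist_norm)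
            qed
          qed
        qed
        thus "\<exists>d>0. ball z d \<subseteq> ball 0 1 \<and> uniform_limit (ball z d) (\<lambda>n v. g i (\<delta> n *s v) / \<delta> n ^ m) (P i) sequentially"
          using d by blast
      qed simp
    qed
    have isC: "isCont (P i) v" if "norm v < 1" for i v
      using holomorphic_fun2_imp_continuous_on[OF holP] that by (simp add: continuous_on_eq_continuous_at)
    define B where "B = M / r ^ m"
    have PB: "norm (P i v) \<le> B" if "norm v \<le> 1" for i v
    proof -
      have "norm ((deriv ^^ m) (\<lambda>s. g i (s *s v)) 0) \<le> fact m * M / r ^ m"
        by (rule Cauchy_inequality) (use r M svc[OF _ that] in \<open>auto intro!: holomorphic_on_subset[OF hol1[OF that]] holomorphic_on_imp_continuous_on\<close>)
      thus ?thesis by (simp add: P_def c_def B_def norm_divide field_simps)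
    qed
    define a :: "2 \<Rightarrow> complex" where "a i = (if i = 1 then exp (- 1) else exp (- of_real \<nu>))" for i
    define \<Lambda> :: "complex^2 \<Rightarrow> complex^2" where "\<Lambda> v = vec2 (exp (- 1) * v $ 1) (exp (- of_real \<nu>) * v $ 2)" for v
    have \<Lambda>: "\<Lambda> v $ i = a i * v $ i" for i v using exhaust_2[of i] by (auto simp: \<Lambda>_def a_def)
    have DC: "pd 1 (\<lambda>z. C z $ i) 0 * v $ 1 + pd 2 (\<lambda>z. C z $ i) 0 * v $ 2 = a i * v $ i" for i v
      using exhaust_2[of i] DC1 DC2 by (auto simp: a_def)
    have n\<Lambda>: "norm (\<Lambda> v) \<le> exp (- 1) * norm v" for v
    proof -
      have *: "norm (a i) \<le> exp (- 1)" for i using \<nu> by (auto simp: a_def norm_exp_eq_Re)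
      have "norm (\<Lambda> v) \<le> norm (of_real (exp (- 1)) *s v)"
        by (rule norm_le_componentwise_cart) (auto simp: \<Lambda> norm_mult intro!: mult_right_mono order_trans[OF *])
      thus ?thesis by (simp add: norm_vector_scalar_mult)
    qed
    \<comment> \<open>Comparison of the terms of order \<open>m\<close> in
      \<open>G (C z) = C (G z)\<close>: on the left \<open>P\<close> is evaluated in the limit
      direction \<open>\<Lambda> v\<close> of \<open>C (s *s v) / s\<close>, on the right the
      increment \<open>G z - z\<close> passes through the linear part of \<open>C\<close>.\<close>
    have equi: "P i (\<Lambda> v) = a i * P i v" if v: "norm v < 1" for i v
    proof -
      have v1: "norm v \<le> 1" using v by simp
      have "((\<lambda>s. s *s v) \<longlongrightarrow> 0 *s v) (at 0)"
        by (intro tendsto_vector_scalar_mult tendsto_ident_at tendsto_const)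
      hence sv0: "((\<lambda>s. s *s v) \<longlongrightarrow> 0) (at 0)" by simp
      define u where "u s = (1 / s) *s C (s *s v)" for s
      have uC: "s *s u s = C (s *s v)" if "s \<noteq> 0" for s using that by (simp add: u_def vec_eq_iff)
      have "((\<lambda>s. u s $ i) \<longlongrightarrow> \<Lambda> v $ i) (at 0)" for i
      proof -
        have "cdiff (\<lambda>z. C z $ i) (0 + 0 *s v)" using holC S0 by (simp add: holomorphic_fun2_iff)
        from cdiff_slice[OF this] have "((\<lambda>s. C (s *s v) $ i) has_field_derivative \<Lambda> v $ i) (at 0)" by (simp add: DC \<Lambda>)
        thus ?thesis by (simp add: has_field_derivative_iff C0 u_def)
      qed
      hence ulim: "(u \<longlongrightarrow> \<Lambda> v) (at 0)" by (rule vec_tendstoI)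
      have \<Lambda>v: "norm (\<Lambda> v) < 1"
      proof -
        have "exp (- 1) * norm v \<le> 1 * norm v" by (intro mult_right_mono) auto
        hence "exp (- 1) * norm v < 1" using v by linarith
        thus ?thesis using n\<Lambda>[of v] by linarith
      qed
      have uev: "\<forall>\<^sub>F s in at 0. norm (u s) \<le> 1"
        using order_tendstoD(2)[OF tendsto_norm[OF ulim] \<Lambda>v] by (auto elim: eventually_mono)
      have L2: "((\<lambda>s. g i (s *s u s) / s ^ m) \<longlongrightarrow> P i (\<Lambda> v)) (at 0)"
        using tendsto_add[OF lim[OF uev, of i] isCont_tendsto_compose[OF isC[OF \<Lambda>v] ulim, of i]] by simp
      \<comment> \<open>The error of replacing \<open>C\<close> by its linear part on the increment
        \<open>G z - z\<close>. The increment is of order \<open>s ^ m\<close>, so strict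
        differentiability makes the error negligible against \<open>s ^ m\<close>.\<close>
      define e where "e s = C (G (s *s v)) $ i - C (s *s v) $ i - a i * g i (s *s v)" for s
      have Glim: "((\<lambda>s. G (s *s v)) \<longlongrightarrow> 0) (at 0)"
      proof (rule vec_tendstoI)
        fix j have "isCont (\<lambda>z. G z $ j) 0" using holG S0 by (auto simp: holomorphic_fun2_iff intro: cdiff_isCont)
        from isCont_tendsto_compose[OF this sv0] show "((\<lambda>s. G (s *s v) $ j) \<longlongrightarrow> 0 $ j) (at 0)" by (simp add: G0)
      qed
      have Clim: "((\<lambda>s. C (s *s v)) \<longlongrightarrow> 0) (at 0)"
      proof (rule vec_tendstoI)
        fix j have "isCont (\<lambda>z. C z $ j) 0" using holC S0 by (auto simp: holomorphic_fun2_iff intro: cdiff_isCont)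
        from isCont_tendsto_compose[OF this sv0] show "((\<lambda>s. C (s *s v) $ j) \<longlongrightarrow> 0 $ j) (at 0)" by (simp add: C0)
      qed
      have inev: "\<forall>\<^sub>F s in at 0. f s \<in> W" if "(f \<longlongrightarrow> 0) (at 0)" "open W" "0 \<in> W" for f :: "complex \<Rightarrow> complex^2" and W
        using topological_tendstoD[OF that] .
      have L3: "((\<lambda>s. e s / s ^ m) \<longlongrightarrow> 0) (at 0)"
      proof (rule tendstoI)
        fix \<epsilon> :: real assume \<epsilon>: "\<epsilon> > 0"
        \<comment> \<open>\<open>B'\<close> bounds the sum of the norms of both components of
          \<open>(G z - z) / s ^ m\<close> for small \<open>s\<close>; the choice of \<eta> then
          yields an error of at most \<open>\<epsilon> / 2\<close>.\<close>
        define B' where "B' = 2 * (\<bar>B\<bar> + 1)"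
        define \<eta> where "\<eta> = \<epsilon> / (2 * B')"
        have B': "B' > 0" by (simp add: B'_def)
        have \<eta>: "\<eta> > 0" using \<epsilon> B' by (simp add: \<eta>_def)
        obtain d where d: "d > 0" "\<And>x y. x \<in> ball 0 d \<Longrightarrow> y \<in> ball 0 d \<Longrightarrow>
            norm (C x $ i - C y $ i - a i * (x - y) $ i) \<le> \<eta> * norm (x - y)"
          using strict_derivative[OF holC S0 \<eta>, of i] unfolding DC by blast
        have gb: "\<forall>\<^sub>F s in at 0. norm (g j (s *s v) / s ^ m) < \<bar>B\<bar> + 1" for j
          by (rule order_tendstoD(2)[OF tendsto_norm[OF limc[OF v1, of j]]]) (use PB[OF v1, of j] in linarith)
        have nz: "\<forall>\<^sub>F s in at (0::complex). s \<noteq> 0" by (simp add: eventually_at_filter)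
        have "\<forall>\<^sub>F s in at 0. G (s *s v) \<in> ball 0 d \<and> s *s v \<in> ball 0 d"
          using inev[OF Glim, of "ball 0 d"] inev[OF sv0, of "ball 0 d"] d(1) by (simp add: eventually_conj_iff)
        thus "\<forall>\<^sub>F s in at 0. dist (e s / s ^ m) 0 < \<epsilon>" using gb[of 1] gb[of 2] nz
        proof eventually_elim
          case (elim s)
          have "norm (e s) \<le> \<eta> * norm (G (s *s v) - s *s v)"
            using d(2)[of "G (s *s v)" "s *s v"] elim by (simp add: e_def g_def)
          also have "\<dots> \<le> \<eta> * (norm (g 1 (s *s v)) + norm (g 2 (s *s v)))"
            using \<eta> norm_le_components[of "G (s *s v) - s *s v"] by (intro mult_left_mono) (auto simp: g_def)
          finally have "norm (e s) / norm (s ^ m) \<le> \<eta> * (norm (g 1 (s *s v)) + norm (g 2 (s *s v))) / norm (s ^ m)"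
            by (rule divide_right_mono) simp
          also have "\<dots> = \<eta> * (norm (g 1 (s *s v) / s ^ m) + norm (g 2 (s *s v) / s ^ m))" by (simp add: norm_divide add_divide_distrib distrib_left)
          also have "\<dots> \<le> \<eta> * B'" using elim \<eta> by (intro mult_left_mono) (auto simp: B'_def)
          also have "\<dots> < \<epsilon>" using \<epsilon> B' by (simp add: \<eta>_def)
          finally show ?case by (simp add: norm_divide)
        qed
      qed
      have "\<forall>\<^sub>F s in at 0. s *s v \<in> S \<and> G (s *s v) \<in> S \<and> C (s *s v) \<in> S \<and> s \<noteq> 0"
        using inev[OF sv0 S S0] inev[OF Glim S S0] inev[OF Clim S S0]
        by (simp add: eventually_conj_iff eventually_at_filter)
      hence "\<forall>\<^sub>F s in at 0. e s / s ^ m = g i (s *s u s) / s ^ m - a i * (g i (s *s v) / s ^ m)"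
      proof eventually_elim
        case (elim s)
        thus ?case using comm[of "s *s v"] uC[of s] by (simp add: g_def e_def diff_divide_distrib right_diff_distrib)
      qed
      with L3 have "((\<lambda>s. g i (s *s u s) / s ^ m - a i * (g i (s *s v) / s ^ m)) \<longlongrightarrow> 0) (at 0)"
        by (rule Lim_transform_eventually)
      moreover have "((\<lambda>s. g i (s *s u s) / s ^ m - a i * (g i (s *s v) / s ^ m)) \<longlongrightarrow> P i (\<Lambda> v) - a i * P i v) (at 0)"
        by (intro tendsto_intros L2 limc[OF v1])
      ultimately have "0 = P i (\<Lambda> v) - a i * P i v" by (rule LIM_unique)
      thus ?thesis by simp
    qed
    \<comment> \<open>Writing \<Lambda> as \<open>exp (- 1)\<close> times the diagonal matrix with
      entries 1 and \<beta> lets homogeneity take the scalar out and leaves a map that acts on the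
      second coordinate alone.\<close>
    define \<beta> where "\<beta> = exp (- (\<nu> - 1))"
    have \<beta>: "0 < \<beta>" "\<beta> \<le> 1" using \<nu> by (auto simp: \<beta>_def)
    have nb: "norm (vec2 x (of_real \<beta> * y)) \<le> norm (vec2 x y)" for x y
      using \<beta> by (intro norm_le_componentwise_cart) (auto simp: vec2_def norm_mult intro!: mult_left_le_one_le)
    have \<Lambda>\<beta>: "\<Lambda> (vec2 x y) = of_real (exp (- 1)) *s vec2 x (of_real \<beta> * y)" for x y
      by (simp add: \<Lambda>_def \<beta>_def vec2_eq_iff exp_of_real[symmetric] exp_diff exp_minus field_simps)
    have E: "of_real (exp (- 1)) ^ m * P i (vec2 x (of_real \<beta> * y)) = a i * P i (vec2 x y)" if "norm (vec2 x y) < 1" for i x y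
      using equi[OF that, of i] hom[of "vec2 x (of_real \<beta> * y)" "of_real (exp (- 1))" i] nb[of x y] that unfolding \<Lambda>\<beta> by simp
    \<comment> \<open>Each application of \<open>E\<close> replaces the second coordinate
      \<open>y\<close> by \<open>\<beta> * y\<close> and gains the factor
      \<open>exp (- (m - 1)) < 1\<close>, while \<open>P\<close> stays bounded by
      \<open>B\<close>.\<close>
    have P1: "P 1 v = 0" if v: "norm v < 1" for v
    proof -
      have step: "norm (P 1 (vec2 x y)) = exp (- (real m - 1)) * norm (P 1 (vec2 x (of_real \<beta> * y)))" if "norm (vec2 x y) < 1" for x y
      proof -
        have "exp (- 1) ^ m * norm (P 1 (vec2 x (of_real \<beta> * y))) = exp (- 1) * norm (P 1 (vec2 x y))"
          using arg_cong[OF E[OF that, of 1], of norm] by (simp add: a_def norm_mult norm_power norm_exp_eq_Re)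
        moreover have "exp (- 1) ^ m = (exp (- real m) :: real)" by (simp add: exp_of_nat_mult[symmetric])
        ultimately show ?thesis by (simp add: exp_diff exp_minus field_simps)
      qed
      have "norm (P 1 (vec2 x y)) \<le> exp (- (real m - 1)) ^ n * B" if "norm (vec2 x y) < 1" for n x y
        using that
      proof (induction n arbitrary: y)
        case 0 thus ?case using PB[of "vec2 x y" 1] by simp
      next
        case (Suc n)
        have "norm (P 1 (vec2 x (of_real \<beta> * y))) \<le> exp (- (real m - 1)) ^ n * B"
          using Suc.prems nb[of x y] by (intro Suc.IH) linarith
        thus ?case using step[OF Suc.prems] by simp
      qed
      hence *: "norm (P 1 v) \<le> exp (- (real m - 1)) ^ n * B" for n using v by (metis vec2_collapse)
      have "(\<lambda>n. exp (- (real m - 1)) ^ n * B) \<longlonglongrightarrow> 0 * B"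
        using m2 by (intro tendsto_mult LIMSEQ_realpow_zero tendsto_const) auto
      hence "norm (P 1 v) \<le> 0" using * by (intro LIMSEQ_le_const) auto
      thus ?thesis by simp
    qed
    \<comment> \<open>For the second component \<open>E\<close> reads
      \<open>P 2 (x, \<beta> y) = \<gamma> P 2 (x, y)\<close>, so the coefficient of
      \<open>y ^ j\<close> can be nonzero only if \<open>\<beta> ^ j = \<gamma>\<close>. For
      \<open>j \<ge> 1\<close> this would mean \<open>j (\<nu> - 1) = \<nu> - m\<close>, which is
      impossible for \<open>m \<ge> 2\<close>; for \<open>j = 0\<close> it means
      \<open>\<nu> = m\<close>.\<close>
    define \<gamma> where "\<gamma> = exp (real m - \<nu>)"
    have E2: "P 2 (vec2 x (of_real \<beta> * y)) = of_real \<gamma> * P 2 (vec2 x y)" if "norm (vec2 x y) < 1" for x y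
    proof -
      have "complex_of_real (exp (- 1)) ^ m = of_real (exp (- real m))"
        unfolding of_real_power[symmetric] by (simp add: exp_of_nat_mult[symmetric])
      hence "of_real (exp (- real m)) * P 2 (vec2 x (of_real \<beta> * y)) = of_real (exp (- \<nu>)) * P 2 (vec2 x y)"
        using E[OF that, of 2] by (simp add: a_def exp_of_real[symmetric])
      hence "of_real (exp (real m)) * (of_real (exp (- real m)) * P 2 (vec2 x (of_real \<beta> * y))) = of_real (exp (real m)) * (of_real (exp (- \<nu>)) * P 2 (vec2 x y))" by simp
      moreover have "of_real (exp (real m)) * (of_real (exp (- real m)) * z) = z" "of_real (exp (real m)) * (of_real (exp (- \<nu>)) * z) = of_real \<gamma> * z" for z :: complex
        by (simp_all add: \<gamma>_def exp_diff exp_minus field_simps)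
      ultimately show ?thesis by simp
    qed
    have const: "P 2 (vec2 x y) = P 2 (vec2 x 0) \<and> (\<nu> \<noteq> real m \<longrightarrow> P 2 (vec2 x y) = 0)" if x: "norm x < 1/2" and y: "norm y < 1/2" for x y
    proof (cases "\<nu> = 1")
      case True
      have "norm (vec2 x y) < 1" "norm (vec2 x 0) < 1" using norm_le_components[of "vec2 x y"] norm_le_components[of "vec2 x 0"] x y by auto
      hence "P 2 (vec2 x y) = of_real \<gamma> * P 2 (vec2 x y)" "P 2 (vec2 x 0) = of_real \<gamma> * P 2 (vec2 x 0)" using E2 True by (auto simp: \<beta>_def)
      moreover have "complex_of_real \<gamma> \<noteq> 1" using True m2 by (simp add: \<gamma>_def)
      ultimately show ?thesis by (metis mult_cancel_right1)
    next
      case False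
      hence \<nu>1: "\<nu> > 1" using \<nu> by simp
      define p where "p y = P 2 (vec2 x y)" for y
      have vb: "norm (vec2 x y) < 1" if "norm y < 1/2" for y using norm_le_components[of "vec2 x y"] x that by simp
      have eq: "vec2 x y = vec2 x 0 + y *s axis 2 1" for y by (simp add: vec2_eq_iff)
      have holp: "p holomorphic_on ball 0 (1/2)"
        unfolding p_def using vb by (subst eq) (intro holomorphic_fun2_slice[OF holP], simp flip: eq)
      have hb: "norm (of_real \<beta> * w) < 1/2" if "norm w < 1/2" for w :: complex
      proof -
        have "\<beta> * norm w \<le> 1 * norm w" using \<beta> by (intro mult_right_mono) auto
        thus ?thesis using that \<beta> by (simp add: norm_mult)
      qed
      have holpb: "(\<lambda>y. p (of_real \<beta> * y)) holomorphic_on ball 0 (1/2)"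
        by (rule holomorphic_on_compose_gen[OF _ holp, unfolded o_def]) (use hb in \<open>auto intro!: holomorphic_intros\<close>)
      have coef: "(deriv ^^ j) p 0 = 0 \<or> \<beta> ^ j = \<gamma>" for j
      proof -
        have "(deriv ^^ j) (\<lambda>y. p (of_real \<beta> * y)) 0 = of_real \<beta> ^ j * (deriv ^^ j) p (of_real \<beta> * 0)"
        proof (rule higher_deriv_compose_linear[OF holp])
          show "of_real \<beta> * w \<in> ball 0 (1/2)" if "w \<in> ball 0 (1/2)" for w :: complex
            using hb[of w] that by simp
        qed auto
        moreover have "(deriv ^^ j) (\<lambda>y. p (of_real \<beta> * y)) 0 = (deriv ^^ j) (\<lambda>y. of_real \<gamma> * p y) 0"
          by (rule higher_deriv_transform_within_open[OF holpb holomorphic_on_mult[OF holomorphic_on_const holp] open_ball])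
             (use E2[OF vb] in \<open>auto simp: p_def\<close>)
        moreover have "(deriv ^^ j) (\<lambda>y. of_real \<gamma> * p y) 0 = of_real \<gamma> * (deriv ^^ j) p 0"
          using higher_deriv_cmult[OF holp, of 0 j] by simp
        ultimately have "(of_real (\<beta> ^ j) - of_real \<gamma>) * (deriv ^^ j) p 0 = (0::complex)" by (simp add: algebra_simps)
        thus ?thesis using of_real_eq_iff[of "\<beta> ^ j" \<gamma>, where 'a=complex] by (auto simp del: of_real_power)
      qed
      have "(deriv ^^ j) p 0 = 0" if "j > 0" for j
      proof -
        have "\<beta> ^ j = exp (- (real j * (\<nu> - 1)))" by (simp add: \<beta>_def exp_of_nat_mult[symmetric] algebra_simps)
        moreover have "1 * (\<nu> - 1) \<le> real j * (\<nu> - 1)" using that \<nu> by (intro mult_right_mono) auto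
        hence "- (real j * (\<nu> - 1)) < real m - \<nu>" using m2 by simp
        ultimately have "\<beta> ^ j \<noteq> \<gamma>" by (simp add: \<gamma>_def)
        thus ?thesis using coef[of j] by blast
      qed
      hence "p y - p 0 = 0"
      proof -
        assume d: "\<And>j. j > 0 \<Longrightarrow> (deriv ^^ j) p 0 = 0"
        have "(\<lambda>n. (deriv ^^ n) p 0 / fact n * (y - 0) ^ n) sums p y"
          by (rule holomorphic_power_series[OF holp]) (use y in simp)
        moreover have "(\<lambda>n. (deriv ^^ n) p 0 / fact n * (y - 0) ^ n) = (\<lambda>n. if n = 0 then p 0 else 0)"
          using d by (auto simp: fun_eq_iff)
        moreover have "(\<lambda>n::nat. if n = 0 then p 0 else 0) sums p 0" using sums_single[of 0 "\<lambda>_. p 0"] by simp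
        ultimately show ?thesis using sums_unique2 by fastforce
      qed
      moreover have "p 0 = 0" if "\<nu> \<noteq> real m" using coef[of 0] that by (auto simp: \<gamma>_def)
      ultimately show ?thesis by (auto simp: p_def)
    qed
    have P2: "P 2 v = 0" if v: "norm v < 1/4" for v
    proof -
      have v12: "norm (v $ 1) < 1/4" "norm (v $ 2) < 1/4" by (rule order_le_less_trans[OF Finite_Cartesian_Product.norm_nth_le v])+
      show ?thesis
      proof (cases "\<nu> = real m")
        case False
        have "P 2 (vec2 (v $ 1) (v $ 2)) = 0" using const[of "v $ 1" "v $ 2"] v12 False by linarith
        thus ?thesis by simp
      next
        case True
        obtain k h where kh: "k > 0" "\<forall>\<^sub>F w in at (0::complex). G (h w) = h w"
          "((\<lambda>w. h w $ 1 / w ^ k) \<longlongrightarrow> 1) (at 0)" "((\<lambda>w. h w $ 2 / w ^ k) \<longlongrightarrow> 0) (at 0)"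
          using res
        proof (elim disjE exE conjE)
          assume nr: "\<forall>m::nat. m \<ge> 2 \<longrightarrow> \<nu> \<noteq> m"
          show thesis using spec[OF nr, of m] True m2 by simp
        qed (rule that)
        \<comment> \<open>The factor 1/4 keeps \<open>e1\<close> and the directions
          \<open>u w\<close> close to it inside the unit ball. With \<open>s = 4 * w ^ k\<close> the
          point \<open>s *s u w\<close> is the fixed point \<open>h w\<close>, so the remainder
          estimate bounds \<open>P 2 (u w)\<close> by a multiple of \<open>norm s\<close>.\<close>
        define e1 where "e1 = vec2 (1/4) 0"
        define u where "u w = (1 / (4 * w ^ k)) *s h w" for w
        have ul: "(u \<longlongrightarrow> e1) (at 0)"
        proof (rule vec_tendstoI)
          fix i
          have "((\<lambda>w. (1/4) * (h w $ 1 / w ^ k)) \<longlongrightarrow> 1/4 * 1) (at 0)" "((\<lambda>w. (1/4) * (h w $ 2 / w ^ k)) \<longlongrightarrow> 1/4 * 0) (at 0)"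
            by (intro tendsto_intros kh(3,4))+
          thus "((\<lambda>w. u w $ i) \<longlongrightarrow> e1 $ i) (at 0)" using exhaust_2[of i] by (auto simp: u_def e1_def)
        qed
        have ne1: "norm e1 < 1" using norm_le_components[of e1] by (simp add: e1_def)
        have uev: "\<forall>\<^sub>F w in at 0. norm (u w) \<le> 1"
          using order_tendstoD(2)[OF tendsto_norm[OF ul] ne1] by (rule eventually_mono) simp
        have uP: "((\<lambda>w. P 2 (u w)) \<longlongrightarrow> P 2 e1) (at 0)" by (rule isCont_tendsto_compose[OF isC[OF ne1] ul])
        have w0: "((\<lambda>w. K * norm (4 * w ^ k)) \<longlongrightarrow> 0) (at (0::complex))" "((\<lambda>w::complex. norm (4 * w ^ k)) \<longlongrightarrow> 0) (at 0)"
          using kh(1) by (auto intro!: tendsto_eq_intros)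
        have "((\<lambda>w. P 2 (u w)) \<longlongrightarrow> 0) (at 0)"
        proof (rule Lim_null_comparison[OF _ w0(1)])
          have "\<forall>\<^sub>F w in at (0::complex). norm (4 * w ^ k) < r / 2" using order_tendstoD(2)[OF w0(2), of "r/2"] r by simp
          moreover have "\<forall>\<^sub>F w in at (0::complex). w \<noteq> 0" by (simp add: eventually_at_filter)
          ultimately show "\<forall>\<^sub>F w in at 0. norm (P 2 (u w)) \<le> K * norm (4 * w ^ k)" using uev kh(2)
          proof eventually_elim
            case (elim w)
            define s where "s = 4 * w ^ k"
            have s: "s \<noteq> 0" "norm s \<le> r / 2" using elim by (auto simp: s_def)
            have "s *s u w = h w" using s elim by (simp add: u_def s_def vec_eq_iff)
            hence "g 2 (s *s u w) = 0" using elim by (simp add: g_def)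
            hence "norm (P 2 (u w)) * norm (s ^ m) \<le> K * norm s * norm (s ^ m)"
              using est[of "u w" s 2] elim s by (simp add: norm_mult norm_power mult_ac)
            hence "norm (P 2 (u w)) \<le> K * norm s" by (rule mult_right_le_imp_le) (use s in simp)
            thus ?case by (simp add: s_def)
          qed
        qed
        hence e10: "P 2 e1 = 0" using LIM_unique[OF uP] by blast
        have "vec2 (v $ 1) 0 = (4 * v $ 1) *s e1" by (simp add: e1_def vec2_eq_iff)
        hence "P 2 (vec2 (v $ 1) 0) = 0" using hom[of e1 "4 * v $ 1" 2] ne1 v12 e10 by (simp add: norm_mult)
        thus ?thesis using const[of "v $ 1" "v $ 2"] v12 by simp
      qed
    qed
    obtain i v where iv: "norm v \<le> 1" "P i v \<noteq> 0" using m by (auto simp: P_def)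
    have n8: "norm ((1/8) *s v) < 1/4" using iv(1) by (simp add: norm_vector_scalar_mult)
    have "P i ((1/8) *s v) = 0" using P1[of "(1/8) *s v"] P2[OF n8] n8 exhaust_2[of i] by auto
    moreover have "P i ((1/8) *s v) = (1/8) ^ m * P i v" by (rule hom) (use iv in auto)
    ultimately have False using iv(2) by simp
    thus ?thesis ..
  qed
qed

section \<open>Charts\<close>

definition param :: "'a chart \<Rightarrow> complex^2 \<Rightarrow> 'a" where
  "param \<kappa> = inv_into (fst \<kappa>) (snd \<kappa>)"

definition img :: "'a chart \<Rightarrow> (complex^2) set" where
  "img \<kappa> = snd \<kappa> ` fst \<kappa>"

lemma in_chart_eq: "in_chart \<kappa> f = (\<lambda>z. f (param \<kappa> z))"
  by (cases \<kappa>) (simp add: in_chart_def param_def comp_def)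

locale surface =
  fixes N :: "'a topology" and \<A> :: "'a chart set"
  assumes surf: "complex_surface N \<A>"
begin

lemma hausdorff: "Hausdorff_space N" using surf by (simp add: complex_surface_def)

lemma tchart: "\<kappa> \<in> \<A> \<Longrightarrow> topological_chart N \<kappa>"
  using surf by (simp add: complex_surface_def)

lemma chart_homeo: "\<kappa> \<in> \<A> \<Longrightarrow> homeomorphic_map (subtopology N (fst \<kappa>)) (top_of_set (img \<kappa>)) (snd \<kappa>)"
  using tchart[of \<kappa>] by (cases \<kappa>) (simp add: topological_chart_def img_def)

lemma chart_open: "\<kappa> \<in> \<A> \<Longrightarrow> openin N (fst \<kappa>)" and img_open: "\<kappa> \<in> \<A> \<Longrightarrow> open (img \<kappa>)"
  using tchart[of \<kappa>] by (cases \<kappa>; simp add: topological_chart_def img_def)+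

lemma chart_sub: "\<kappa> \<in> \<A> \<Longrightarrow> fst \<kappa> \<subseteq> topspace N"
  using chart_open openin_subset by blast

lemma chart_inj: "\<kappa> \<in> \<A> \<Longrightarrow> inj_on (snd \<kappa>) (fst \<kappa>)"
  using chart_homeo[of \<kappa>] chart_sub[of \<kappa>]
  by (simp add: homeomorphic_eq_everything_map Int_absorb1)

lemma param_in: "z \<in> img \<kappa> \<Longrightarrow> param \<kappa> z \<in> fst \<kappa>"
  unfolding param_def img_def by (rule inv_into_into)

lemma chart_param: "z \<in> img \<kappa> \<Longrightarrow> snd \<kappa> (param \<kappa> z) = z"
  unfolding param_def img_def by (rule f_inv_into_f)

lemma param_chart: "\<kappa> \<in> \<A> \<Longrightarrow> q \<in> fst \<kappa> \<Longrightarrow> param \<kappa> (snd \<kappa> q) = q"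
  unfolding param_def by (rule inv_into_f_f[OF chart_inj])

lemma chart_in: "q \<in> fst \<kappa> \<Longrightarrow> snd \<kappa> q \<in> img \<kappa>"
  by (simp add: img_def)

lemma chart_at: "q \<in> topspace N \<Longrightarrow> \<exists>\<kappa>\<in>\<A>. q \<in> fst \<kappa>"
proof -
  have "\<Union> (fst ` \<A>) = topspace N" using surf by (simp only: complex_surface_def)
  thus "q \<in> topspace N \<Longrightarrow> ?thesis" by blast
qed

lemma chart_preimage_open:
  assumes "\<kappa> \<in> \<A>" "open W" shows "openin N {q \<in> fst \<kappa>. snd \<kappa> q \<in> W}"
proof -
  have "continuous_map (subtopology N (fst \<kappa>)) (top_of_set (img \<kappa>)) (snd \<kappa>)"
    using chart_homeo[OF assms(1)] by (simp add: homeomorphic_imp_continuous_map)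
  from openin_continuous_map_preimage[OF this openin_open_Int[OF assms(2)]]
  have "openin (subtopology N (fst \<kappa>)) {q \<in> topspace (subtopology N (fst \<kappa>)). snd \<kappa> q \<in> img \<kappa> \<inter> W}" .
  moreover have "{q \<in> topspace (subtopology N (fst \<kappa>)). snd \<kappa> q \<in> img \<kappa> \<inter> W} = {q \<in> fst \<kappa>. snd \<kappa> q \<in> W}"
    using chart_sub[OF assms(1)] by (auto simp: img_def)
  ultimately show ?thesis
    using openin_trans_full[OF _ chart_open[OF assms(1)]] by simp
qed

lemma param_continuous:
  assumes "\<kappa> \<in> \<A>" shows "continuous_map (top_of_set (img \<kappa>)) N (param \<kappa>)"
proof -
  obtain g where g: "homeomorphic_maps (subtopology N (fst \<kappa>)) (top_of_set (img \<kappa>)) (snd \<kappa>) g"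
    using chart_homeo[OF assms] by (auto simp: homeomorphic_map_maps)
  hence "continuous_map (top_of_set (img \<kappa>)) (subtopology N (fst \<kappa>)) g" by (simp add: homeomorphic_maps_def)
  hence cg: "continuous_map (top_of_set (img \<kappa>)) N g" and gin: "\<And>z. z \<in> img \<kappa> \<Longrightarrow> g z \<in> fst \<kappa>"
    by (auto simp: continuous_map_in_subtopology)
  show ?thesis
  proof (rule continuous_map_eq[OF cg])
    fix z assume "z \<in> topspace (top_of_set (img \<kappa>))"
    hence z: "z \<in> img \<kappa>" by simp
    have "snd \<kappa> (g z) = z" using g z by (simp add: homeomorphic_maps_def)
    thus "g z = param \<kappa> z" using param_chart[OF assms gin[OF z]] by simp
  qed
qed

lemma param_preimage_open:
  assumes "\<kappa> \<in> \<A>" "openin N W" shows "open {z \<in> img \<kappa>. param \<kappa> z \<in> W}"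
proof -
  have "openin (top_of_set (img \<kappa>)) {z \<in> topspace (top_of_set (img \<kappa>)). param \<kappa> z \<in> W}"
    using param_continuous[OF assms(1)] assms(2) by (rule openin_continuous_map_preimage)
  thus ?thesis using img_open[OF assms(1)] by (simp add: openin_open_eq)
qed

lemma param_compact:
  assumes "\<kappa> \<in> \<A>" "compact C" "C \<subseteq> img \<kappa>" shows "compactin N (param \<kappa> ` C)"
  by (rule image_compactin[OF _ param_continuous[OF assms(1)]])
     (use assms in \<open>simp add: compactin_subtopology\<close>)

lemma chart_trans:
  assumes "\<kappa> \<in> \<A>" "\<mu> \<in> \<A>" "q \<in> fst \<kappa>" "q \<in> fst \<mu>"
  shows "cdiff (\<lambda>z. snd \<mu> (param \<kappa> z) $ i) (snd \<kappa> q)"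
proof -
  have "compatible_charts \<kappa> \<mu>" using surf assms by (simp add: complex_surface_def)
  hence "holomorphic_map2 (snd \<kappa> ` (fst \<kappa> \<inter> fst \<mu>)) (in_chart \<kappa> (snd \<mu>))"
    by (cases \<kappa>; cases \<mu>) (simp add: compatible_charts_def)
  thus ?thesis using assms by (auto simp: holomorphic_map2_def holomorphic_fun2_iff in_chart_eq)
qed

text \<open>One chart is enough: compatibility transfers the condition to every other chart
  (\<open>mdiff_chart\<close>), so pointwise arguments may choose the chart.\<close>

definition mdiff :: "('a \<Rightarrow> complex) \<Rightarrow> 'a \<Rightarrow> bool" where
  "mdiff f q \<longleftrightarrow> (\<exists>\<kappa>\<in>\<A>. q \<in> fst \<kappa> \<and> cdiff (\<lambda>z. f (param \<kappa> z)) (snd \<kappa> q))"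

lemma eventually_in_chart:
  assumes "\<kappa> \<in> \<A>" "q \<in> fst \<kappa>" "openin N W" "q \<in> W"
  shows "\<forall>\<^sub>F z in nhds (snd \<kappa> q). z \<in> img \<kappa> \<and> param \<kappa> z \<in> W"
  using eventually_nhds_in_open[OF param_preimage_open[OF assms(1,3)], of "snd \<kappa> q"] assms
  by (simp add: chart_in param_chart)

lemma mdiff_chart:
  assumes "mdiff f q" "\<kappa> \<in> \<A>" "q \<in> fst \<kappa>"
  shows "cdiff (\<lambda>z. f (param \<kappa> z)) (snd \<kappa> q)"
proof -
  obtain \<mu> where \<mu>: "\<mu> \<in> \<A>" "q \<in> fst \<mu>" "cdiff (\<lambda>z. f (param \<mu> z)) (snd \<mu> q)"
    using assms(1) by (auto simp: mdiff_def)
  have "cdiff (\<lambda>z. f (param \<mu> z)) (snd \<mu> (param \<kappa> (snd \<kappa> q)))"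
    using \<mu>(3) assms param_chart by simp
  from cdiff_compose[OF this chart_trans[OF assms(2) \<mu>(1) assms(3) \<mu>(2)]]
  have "cdiff (\<lambda>z. f (param \<mu> (snd \<mu> (param \<kappa> z)))) (snd \<kappa> q)" .
  moreover have "\<forall>\<^sub>F z in nhds (snd \<kappa> q). f (param \<mu> (snd \<mu> (param \<kappa> z))) = f (param \<kappa> z)"
    using eventually_in_chart[OF assms(2,3) chart_open[OF \<mu>(1)] \<mu>(2)]
    by eventually_elim (simp add: param_chart \<mu>(1))
  ultimately show ?thesis by (simp only: cdiff_cong[where f="\<lambda>z. f (param \<mu> (snd \<mu> (param \<kappa> z)))"])
qed

lemma holomorphic_functions_iff: "f \<in> holomorphic_functions \<A> \<longleftrightarrow> (\<forall>q\<in>topspace N. mdiff f q)"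
proof
  assume f: "f \<in> holomorphic_functions \<A>"
  show "\<forall>q\<in>topspace N. mdiff f q"
  proof
    fix q assume "q \<in> topspace N"
    then obtain \<kappa> where "\<kappa> \<in> \<A>" "q \<in> fst \<kappa>" using chart_at by blast
    thus "mdiff f q" using f
      by (auto simp: mdiff_def holomorphic_functions_def holomorphic_fun2_iff in_chart_eq)
  qed
next
  assume f: "\<forall>q\<in>topspace N. mdiff f q"
  show "f \<in> holomorphic_functions \<A>"
    unfolding holomorphic_functions_def holomorphic_fun2_iff in_chart_eq mem_Collect_eq
  proof (intro ballI conjI)
    fix \<kappa> assume \<kappa>: "\<kappa> \<in> \<A>"
    show "open (snd \<kappa> ` fst \<kappa>)" using img_open[OF \<kappa>] by (simp add: img_def)
    fix z assume "z \<in> snd \<kappa> ` fst \<kappa>"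
    then obtain q where "q \<in> fst \<kappa>" "z = snd \<kappa> q" by blast
    thus "cdiff (\<lambda>z. f (param \<kappa> z)) z" using mdiff_chart[of f q \<kappa>] f \<kappa> chart_sub by blast
  qed
qed

lemma holomorphic_in_chart:
  assumes "f \<in> holomorphic_functions \<A>" "\<kappa> \<in> \<A>"
  shows "holomorphic_fun2 (img \<kappa>) (\<lambda>z. f (param \<kappa> z))"
  using assms by (simp add: holomorphic_functions_def in_chart_eq img_def)

lemma holomorphic_continuous_map:
  assumes "f \<in> holomorphic_functions \<A>" shows "continuous_map N euclidean f"
  unfolding continuous_map_atin
proof
  fix q assume q: "q \<in> topspace N"
  obtain \<kappa> where \<kappa>: "\<kappa> \<in> \<A>" "q \<in> fst \<kappa>" using chart_at[OF q] by blast
  show "limitin euclidean f (f q) (atin N q)"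
    unfolding limitin_atin
  proof (intro conjI allI impI)
    fix V assume V: "openin euclidean V \<and> f q \<in> V"
    have "{z \<in> img \<kappa>. f (param \<kappa> z) \<in> V} = img \<kappa> \<inter> (\<lambda>z. f (param \<kappa> z)) -` V" by auto
    moreover have "open V" using V by (simp only: open_openin)
    ultimately have "open {z \<in> img \<kappa>. f (param \<kappa> z) \<in> V}"
      using continuous_open_preimage[OF holomorphic_fun2_imp_continuous_on[OF holomorphic_in_chart[OF assms \<kappa>(1)]] img_open[OF \<kappa>(1)]]
      by metis
    from chart_preimage_open[OF \<kappa>(1) this]
    show "\<exists>U. openin N U \<and> q \<in> U \<and> f ` (U - {q}) \<subseteq> V"
      using \<kappa> V by (intro exI[of _ "{q \<in> fst \<kappa>. snd \<kappa> q \<in> {z \<in> img \<kappa>. f (param \<kappa> z) \<in> V}}"] conjI)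
         (auto simp: chart_in param_chart)
  qed simp
qed

end

section \<open>The flow of a complete vector field\<close>

definition lie :: "(complex^2 \<Rightarrow> complex^2) \<Rightarrow> (complex^2 \<Rightarrow> complex) \<Rightarrow> complex^2 \<Rightarrow> complex" where
  "lie Y f z = pd 1 f z * Y z $ 1 + pd 2 f z * Y z $ 2"

lemma holomorphic_fun2_lie:
  assumes "holomorphic_fun2 S f" "\<And>i. holomorphic_fun2 S (\<lambda>z. Y z $ i)"
  shows "holomorphic_fun2 S (lie Y f)"
  using holomorphic_fun2_pd[OF assms(1), of 1] holomorphic_fun2_pd[OF assms(1), of 2] assms(2)
  unfolding lie_def holomorphic_fun2_iff by (auto intro!: cdiff_add cdiff_mult)

lemma holomorphic_fun2_lie_iter:
  assumes "holomorphic_fun2 S f" "\<And>i. holomorphic_fun2 S (\<lambda>z. Y z $ i)"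
  shows "holomorphic_fun2 S ((lie Y ^^ n) f)"
  by (induction n) (auto intro: assms holomorphic_fun2_lie)

lemma has_derivative_lie:
  assumes "cdiff f (u t)" "(u has_derivative (\<lambda>h. h *s Y (u t))) (at t)"
  shows "((\<lambda>t. f (u t)) has_field_derivative lie Y f (u t)) (at t)"
  unfolding lie_def by (rule cdiff_curve[OF assms])

text \<open>The Taylor coefficients of a solution are iterated Lie derivatives at its initial value; this gives
  both uniqueness of solutions and their holomorphic dependence on the initial value.\<close>

lemma higher_deriv_lie:
  assumes f: "holomorphic_fun2 S f" and Y: "\<And>i. holomorphic_fun2 S (\<lambda>z. Y z $ i)"
    and U: "open U" and u: "\<And>t. t \<in> U \<Longrightarrow> u t \<in> S" "\<And>t. t \<in> U \<Longrightarrow> (u has_derivative (\<lambda>h. h *s Y (u t))) (at t)"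
    and t: "t \<in> U"
  shows "(deriv ^^ n) (\<lambda>t. f (u t)) t = (lie Y ^^ n) f (u t)"
  using t
proof (induction n arbitrary: t)
  case (Suc n)
  have "deriv ((deriv ^^ n) (\<lambda>t. f (u t))) t = deriv (\<lambda>t. (lie Y ^^ n) f (u t)) t"
    by (rule deriv_cong_ev) (use eventually_nhds_in_open[OF U Suc.prems] Suc.IH in \<open>auto elim: eventually_mono\<close>)
  also have "\<dots> = lie Y ((lie Y ^^ n) f) (u t)"
    by (rule DERIV_imp_deriv, rule has_derivative_lie)
       (use u Suc.prems holomorphic_fun2_lie_iter[OF f Y, of n] in \<open>auto simp: holomorphic_fun2_iff\<close>)
  finally show ?case by simp
qed simp

lemma solution_holomorphic:
  assumes f: "holomorphic_fun2 S f"
    and u: "\<And>t. t \<in> U \<Longrightarrow> u t \<in> S" "\<And>t. t \<in> U \<Longrightarrow> (u has_derivative (\<lambda>h. h *s Y (u t))) (at t)"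
  shows "(\<lambda>t. f (u t)) holomorphic_on U"
proof -
  have "((\<lambda>t. f (u t)) has_field_derivative lie Y f (u t)) (at t)" if "t \<in> U" for t
    using f u that by (intro has_derivative_lie) (auto simp: holomorphic_fun2_iff)
  thus ?thesis unfolding holomorphic_on_def field_differentiable_def by (metis has_field_derivative_at_within)
qed

locale complete_field = surface +
  fixes X :: "'a vfield"
  assumes hvf: "holomorphic_vector_field \<A> X" and comp: "complete_vector_field N \<A> X"
begin

definition Y :: "'a chart \<Rightarrow> complex^2 \<Rightarrow> complex^2" where
  "Y \<kappa> z = X \<kappa> (param \<kappa> z)"

lemma Y_hol: "\<kappa> \<in> \<A> \<Longrightarrow> holomorphic_fun2 (img \<kappa>) (\<lambda>z. Y \<kappa> z $ i)"
  using hvf by (simp add: holomorphic_vector_field_def holomorphic_map2_def in_chart_eq Y_def img_def)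

section \<open>Integral curves and their uniqueness\<close>

abbreviation icurve :: "complex set \<Rightarrow> (complex \<Rightarrow> 'a) \<Rightarrow> bool" where
  "icurve T c \<equiv> integral_curve N \<A> X T c"

lemma icurve_open: "icurve T c \<Longrightarrow> open T" by (simp add: integral_curve_def)

lemma icurve_topspace: "icurve T c \<Longrightarrow> t \<in> T \<Longrightarrow> c t \<in> topspace N"
  by (auto simp: integral_curve_def continuous_map_def)

lemma icurve_preimage_open:
  assumes "icurve T c" "openin N W" shows "open {t \<in> T. c t \<in> W}"
proof -
  have "openin (top_of_set T) {t \<in> topspace (top_of_set T). c t \<in> W}"
    using assms by (intro openin_continuous_map_preimage) (auto simp: integral_curve_def)
  thus ?thesis using icurve_open[OF assms(1)] by (simp add: openin_open_eq)
qed

lemma icurve_deriv: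
  assumes "icurve T c" "t \<in> T" "\<kappa> \<in> \<A>" "c t \<in> fst \<kappa>"
  shows "((\<lambda>t. snd \<kappa> (c t)) has_derivative (\<lambda>h. h *s Y \<kappa> (snd \<kappa> (c t)))) (at t)"
  using assms by (simp add: integral_curve_def comp_def Y_def param_chart)

lemma icurve_subset: "icurve T c \<Longrightarrow> open T' \<Longrightarrow> T' \<subseteq> T \<Longrightarrow> icurve T' c"
  unfolding integral_curve_def by (auto intro: continuous_map_from_subtopology_mono)

lemma icurve_shift:
  assumes "icurve T c" shows "icurve ((\<lambda>t. t - a) ` T) (\<lambda>t. c (t + a))"
proof -
  have im: "t \<in> (\<lambda>t. t - a) ` T \<longleftrightarrow> t + a \<in> T" for t by force
  have op: "open ((\<lambda>t. t - a) ` T)" using icurve_open[OF assms] open_translation[of T "- a"] by simp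
  have "continuous_map (top_of_set ((\<lambda>t. t - a) ` T)) (top_of_set T) (\<lambda>t. t + a)"
    by (auto simp: continuous_map_in_subtopology intro!: continuous_intros)
  from continuous_map_compose[OF this, of N c] assms
  have cont: "continuous_map (top_of_set ((\<lambda>t. t - a) ` T)) N (\<lambda>t. c (t + a))" by (simp add: integral_curve_def comp_def)
  have "((\<lambda>t. snd \<kappa> (c (t + a))) has_derivative (\<lambda>h. h *s X \<kappa> (c (t + a)))) (at t)"
    if "t + a \<in> T" "\<kappa> \<in> \<A>" "c (t + a) \<in> fst \<kappa>" for t \<kappa>
  proof -
    have "((\<lambda>t. snd \<kappa> (c t)) has_derivative (\<lambda>h. h *s X \<kappa> (c (t + a)))) (at (t + a))"
      using assms that by (simp add: integral_curve_def comp_def)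
    moreover have "((\<lambda>t. t + a) has_derivative (\<lambda>h. h)) (at t)" by (auto intro!: derivative_eq_intros)
    ultimately show ?thesis by (rule has_derivative_compose[rotated])
  qed
  thus ?thesis using op cont im unfolding integral_curve_def by (auto simp: comp_def)
qed

text \<open>In a chart both curves are holomorphic in time, and by \<open>higher_deriv_lie\<close>
  their Taylor coefficients at \<open>a\<close> are the same functions of the common value.\<close>

lemma icurve_unique_local:
  assumes c1: "icurve T1 c1" and c2: "icurve T2 c2" and a: "a \<in> T1" "a \<in> T2" and eq: "c1 a = c2 a"
  shows "\<forall>\<^sub>F t in nhds a. c1 t = c2 t"
proof -
  obtain \<kappa> where \<kappa>: "\<kappa> \<in> \<A>" "c1 a \<in> fst \<kappa>" using chart_at icurve_topspace[OF c1 a(1)] by blast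
  define U where "U = {t \<in> T1. c1 t \<in> fst \<kappa>} \<inter> {t \<in> T2. c2 t \<in> fst \<kappa>}"
  have "open U" unfolding U_def
    by (intro open_Int icurve_preimage_open[OF c1] icurve_preimage_open[OF c2] chart_open \<kappa>)
  moreover have "a \<in> U" using a \<kappa> eq by (simp add: U_def)
  ultimately obtain d where d: "d > 0" "ball a d \<subseteq> U" using open_contains_ball by blast
  have u1: "snd \<kappa> (c1 t) \<in> img \<kappa>" "((\<lambda>t. snd \<kappa> (c1 t)) has_derivative (\<lambda>h. h *s Y \<kappa> (snd \<kappa> (c1 t)))) (at t)" if "t \<in> ball a d" for t
    using icurve_deriv[OF c1 _ \<kappa>(1), of t] that d by (auto simp: U_def intro: chart_in)
  have u2: "snd \<kappa> (c2 t) \<in> img \<kappa>" "((\<lambda>t. snd \<kappa> (c2 t)) has_derivative (\<lambda>h. h *s Y \<kappa> (snd \<kappa> (c2 t)))) (at t)" if "t \<in> ball a d" for t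
    using icurve_deriv[OF c2 _ \<kappa>(1), of t] that d by (auto simp: U_def intro: chart_in)
  have ho: "holomorphic_fun2 (img \<kappa>) (\<lambda>z. z $ i)" for i using img_open[OF \<kappa>(1)] by (simp add: holomorphic_fun2_iff)
  have "c1 t = c2 t" if t: "t \<in> ball a d" for t
  proof -
    have "snd \<kappa> (c1 t) $ i = snd \<kappa> (c2 t) $ i" for i
    proof (rule holomorphic_fun_eq_on_ball[OF _ _ t])
      show "(\<lambda>t. snd \<kappa> (c1 t) $ i) holomorphic_on ball a d"
        by (rule solution_holomorphic[OF ho, where Y="Y \<kappa>"]) (use u1 in auto)
      show "(\<lambda>t. snd \<kappa> (c2 t) $ i) holomorphic_on ball a d"
        by (rule solution_holomorphic[OF ho, where Y="Y \<kappa>"]) (use u2 in auto)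
      fix n
      have "(deriv ^^ n) (\<lambda>t. snd \<kappa> (c1 t) $ i) a = (lie (Y \<kappa>) ^^ n) (\<lambda>z. z $ i) (snd \<kappa> (c1 a))"
        by (rule higher_deriv_lie[OF ho Y_hol[OF \<kappa>(1)] open_ball[of a d]]) (use u1 d in auto)
      moreover have "(deriv ^^ n) (\<lambda>t. snd \<kappa> (c2 t) $ i) a = (lie (Y \<kappa>) ^^ n) (\<lambda>z. z $ i) (snd \<kappa> (c2 a))"
        by (rule higher_deriv_lie[OF ho Y_hol[OF \<kappa>(1)] open_ball[of a d]]) (use u2 d in auto)
      ultimately show "(deriv ^^ n) (\<lambda>t. snd \<kappa> (c1 t) $ i) a = (deriv ^^ n) (\<lambda>t. snd \<kappa> (c2 t) $ i) a" by (simp add: eq)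
    qed
    hence "snd \<kappa> (c1 t) = snd \<kappa> (c2 t)" by (simp add: vec_eq_iff)
    moreover have "t \<in> U" using t d by blast
    ultimately show ?thesis by (intro inj_onD[OF chart_inj[OF \<kappa>(1)]]) (auto simp: U_def)
  qed
  thus ?thesis using d by (auto simp: eventually_nhds_metric dist_commute)
qed

text \<open>The coincidence set is open by local uniqueness and closed because \<open>N\<close> is
  Hausdorff.\<close>

lemma icurve_unique:
  assumes c1: "icurve T c1" and c2: "icurve T c2" and T: "connected T" and a: "a \<in> T" "c1 a = c2 a" and t: "t \<in> T"
  shows "c1 t = c2 t"
proof -
  define E where "E = {t \<in> T. c1 t = c2 t}"
  have "openin (top_of_set T) E"
  proof -
    have "\<exists>e>0. ball s e \<subseteq> E" if "s \<in> E" for s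
    proof -
      have "\<forall>\<^sub>F t in nhds s. t \<in> T \<and> c1 t = c2 t"
        using icurve_unique_local[OF c1 c2, of s] that eventually_nhds_in_open[OF icurve_open[OF c1], of s]
        by (auto simp: E_def eventually_conj_iff)
      thus ?thesis by (auto simp: eventually_nhds_metric E_def subset_iff dist_commute)
    qed
    hence "open E" by (simp add: open_contains_ball)
    thus ?thesis by (auto simp: openin_open E_def)
  qed
  moreover have "closedin (top_of_set T) E"
  proof -
    have "closedin (top_of_set T) {t \<in> topspace (top_of_set T). c1 t = c2 t}"
      by (rule closedin_continuous_maps_eq[OF hausdorff]) (use c1 c2 in \<open>auto simp: integral_curve_def\<close>)
    thus ?thesis by (simp add: E_def)
  qed
  moreover have "E \<noteq> {}" using a by (auto simp: E_def)
  ultimately have "E = T" using T by (auto simp: connected_clopen)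
  thus ?thesis using t by (auto simp: E_def)
qed

text \<open>The choice is immaterial by uniqueness of integral curves; existence for all complex
  times is completeness.\<close>

definition flow :: "complex \<Rightarrow> 'a \<Rightarrow> 'a" where
  "flow t q = (SOME c. icurve UNIV c \<and> c 0 = q) t"

lemma flow_icurve: "q \<in> topspace N \<Longrightarrow> icurve UNIV (\<lambda>t. flow t q)"
  and flow_0: "q \<in> topspace N \<Longrightarrow> flow 0 q = q"
proof -
  assume "q \<in> topspace N"
  hence "\<exists>c. icurve UNIV c \<and> c 0 = q" using comp by (simp add: complete_vector_field_def)
  from someI_ex[OF this] show "icurve UNIV (\<lambda>t. flow t q)" "flow 0 q = q" by (simp_all add: flow_def)
qed

lemma flow_topspace: "q \<in> topspace N \<Longrightarrow> flow t q \<in> topspace N"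
  using icurve_topspace[OF flow_icurve] by blast

lemma icurve_eq_flow:
  assumes "icurve T c" "connected T" "0 \<in> T" "t \<in> T" shows "c t = flow t (c 0)"
proof -
  have q: "c 0 \<in> topspace N" using icurve_topspace assms by blast
  show ?thesis
    by (rule icurve_unique[OF assms(1) _ assms(2,3) _ assms(4)])
       (use flow_0[OF q] icurve_subset[OF flow_icurve[OF q] icurve_open[OF assms(1)]] in auto)
qed

lemma flow_add: "q \<in> topspace N \<Longrightarrow> flow s (flow t q) = flow (s + t) q"
  using icurve_eq_flow[OF icurve_shift[OF flow_icurve, of q t], of s] by (simp add: surj_def[symmetric] surj_diff_right connected_UNIV)

lemma flow_minus: "q \<in> topspace N \<Longrightarrow> flow (- t) (flow t q) = q" "q \<in> topspace N \<Longrightarrow> flow t (flow (- t) q) = q"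
  by (simp_all add: flow_add flow_0)

lemma flow_preimage_open: "q \<in> topspace N \<Longrightarrow> openin N W \<Longrightarrow> open {t. flow t q \<in> W}"
  using icurve_preimage_open[OF flow_icurve, of q W] by simp

lemma flow_deriv:
  assumes "q \<in> topspace N" "\<kappa> \<in> \<A>" "flow t q \<in> fst \<kappa>"
  shows "((\<lambda>t. snd \<kappa> (flow t q)) has_derivative (\<lambda>h. h *s Y \<kappa> (snd \<kappa> (flow t q)))) (at t)"
  by (rule icurve_deriv[OF flow_icurve]) (use assms in auto)

lemma flow_deriv_fun:
  assumes q: "q \<in> topspace N" and \<kappa>: "\<kappa> \<in> \<A>" "flow t q \<in> fst \<kappa>" and f: "mdiff f (flow t q)"
  shows "((\<lambda>t. f (flow t q)) has_field_derivative lie (Y \<kappa>) (\<lambda>z. f (param \<kappa> z)) (snd \<kappa> (flow t q))) (at t)"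
proof -
  have d: "((\<lambda>t. f (param \<kappa> (snd \<kappa> (flow t q)))) has_field_derivative lie (Y \<kappa>) (\<lambda>z. f (param \<kappa> z)) (snd \<kappa> (flow t q))) (at t)"
    by (rule has_derivative_lie[where f="\<lambda>z. f (param \<kappa> z)" and u="\<lambda>t. snd \<kappa> (flow t q)"])
       (use mdiff_chart[OF f \<kappa>] flow_deriv[OF q \<kappa>] in auto)
  show ?thesis
    by (rule has_field_derivative_transform_within_open[OF d flow_preimage_open[OF q chart_open[OF \<kappa>(1)]]])
       (use \<kappa> in \<open>auto simp: param_chart\<close>)
qed

text \<open>Defined by the flow rather than in coordinates, so that it is a function on
  \<open>N\<close> that refers to no chart; \<open>Lie_chart\<close> recovers the coordinate
  formula.\<close>

definition Lie :: "('a \<Rightarrow> complex) \<Rightarrow> 'a \<Rightarrow> complex" where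
  "Lie f q = deriv (\<lambda>t. f (flow t q)) 0"

lemma Lie_chart:
  assumes "f \<in> holomorphic_functions \<A>" "\<kappa> \<in> \<A>" "q \<in> fst \<kappa>"
  shows "Lie f q = lie (Y \<kappa>) (\<lambda>z. f (param \<kappa> z)) (snd \<kappa> q)"
proof -
  have q: "q \<in> topspace N" using assms chart_sub by blast
  have "mdiff f q" using assms q by (simp add: holomorphic_functions_iff)
  thus ?thesis using flow_deriv_fun[OF q assms(2), of 0 f] assms(3) unfolding Lie_def
    by (simp add: flow_0[OF q] DERIV_imp_deriv)
qed

lemma flow_fun_deriv:
  assumes f: "f \<in> holomorphic_functions \<A>" and q: "q \<in> topspace N"
  shows "((\<lambda>t. f (flow t q)) has_field_derivative Lie f (flow t q)) (at t)"
proof -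
  obtain \<kappa> where \<kappa>: "\<kappa> \<in> \<A>" "flow t q \<in> fst \<kappa>" using chart_at flow_topspace[OF q] by blast
  have "mdiff f (flow t q)" using f flow_topspace[OF q] by (simp add: holomorphic_functions_iff)
  thus ?thesis using flow_deriv_fun[OF q \<kappa>] Lie_chart[OF f \<kappa>] by simp
qed

lemma flow_fun_holomorphic:
  assumes "f \<in> holomorphic_functions \<A>" "q \<in> topspace N"
  shows "(\<lambda>t. f (flow t q)) holomorphic_on A"
  unfolding holomorphic_on_def field_differentiable_def
  using flow_fun_deriv[OF assms] has_field_derivative_at_within by blast

text \<open>A first-exit argument: for short times the flow does not leave a coordinate ball.\<close>

lemma flow_stays:
  assumes \<kappa>: "\<kappa> \<in> \<A>" and \<rho>: "\<rho> > 0" "cball z0 (2 * \<rho>) \<subseteq> img \<kappa>"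
  shows "\<exists>r>0. \<forall>z\<in>ball z0 \<rho>. \<forall>t\<in>ball 0 r. flow t (param \<kappa> z) \<in> fst \<kappa> \<and> snd \<kappa> (flow t (param \<kappa> z)) \<in> ball z0 (2 * \<rho>)"
proof -
  have "\<exists>M. \<forall>i. \<forall>z\<in>cball z0 (2 * \<rho>). norm (Y \<kappa> z $ i) \<le> M"
  proof -
    have "bounded ((\<lambda>z. Y \<kappa> z $ i) ` cball z0 (2 * \<rho>))" for i
      using \<rho> by (intro compact_imp_bounded compact_continuous_image continuous_on_subset[OF holomorphic_fun2_imp_continuous_on[OF Y_hol[OF \<kappa>]]]) auto
    then obtain B where B: "\<And>i z. z \<in> cball z0 (2 * \<rho>) \<Longrightarrow> norm (Y \<kappa> z $ i) \<le> B i" unfolding bounded_iff by (metis image_eqI)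
    hence "norm (Y \<kappa> z $ i) \<le> max (B 1) (B 2)" if "z \<in> cball z0 (2 * \<rho>)" for i z
      using B[OF that, of i] exhaust_2[of i] by (auto simp: le_max_iff_disj)
    thus ?thesis by blast
  qed
  then obtain M0 where M0: "\<And>i z. z \<in> cball z0 (2 * \<rho>) \<Longrightarrow> norm (Y \<kappa> z $ i) \<le> M0" by blast
  define M where "M = 2 * \<bar>M0\<bar> + 1"
  have M: "norm (Y \<kappa> z) \<le> M" if "z \<in> cball z0 (2 * \<rho>)" for z
    using norm_le_components[of "Y \<kappa> z"] M0[OF that, of 1] M0[OF that, of 2] by (simp add: M_def)
  have Mpos: "M > 0" by (simp add: M_def)
  \<comment> \<open>At speed at most \<open>M\<close> the displacement within time \<open>r\<close>
    is at most \<open>\<rho> / 2\<close>, so an orbit starting in \<open>ball z0 \<rho>\<close> does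
    not get beyond radius \<open>3 / 2 * \<rho>\<close>, short of the exit radius
    \<open>2 * \<rho>\<close>.\<close>
  define r where "r = \<rho> / (2 * M)"
  define W where "W = {q \<in> fst \<kappa>. snd \<kappa> q \<in> ball z0 (2 * \<rho>)}"
  have W: "openin N W" unfolding W_def by (rule chart_preimage_open[OF \<kappa> open_ball])
  define K where "K = param \<kappa> ` cball z0 (3 / 2 * \<rho>)"
  have sub: "cball z0 (3 / 2 * \<rho>) \<subseteq> img \<kappa>" using \<rho> by (auto intro: order_trans)
  have "closedin N K"
    unfolding K_def by (intro compactin_imp_closedin hausdorff param_compact[OF \<kappa> _ sub]) simp
  have KW: "K \<subseteq> W" unfolding K_def W_def using sub \<rho> by (auto simp: param_in chart_param subset_iff)
  have main: "flow t (param \<kappa> z) \<in> W" if z: "z \<in> ball z0 \<rho>" and t: "norm t < r" for z t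
  proof (rule ccontr)
    assume not: "flow t (param \<kappa> z) \<notin> W"
    have zi: "z \<in> img \<kappa>" using z \<rho> by auto
    define q where "q = param \<kappa> z"
    have q: "q \<in> fst \<kappa>" "q \<in> topspace N" "snd \<kappa> q = z" using param_in[OF zi] chart_sub[OF \<kappa>] chart_param[OF zi] unfolding q_def by blast+
    define A where "A = {s \<in> {0..1::real}. flow (of_real s * t) q \<notin> W}"
    have "A = {0..1} - (\<lambda>s::real. of_real s * t) -` {t. flow t q \<in> W}" by (auto simp: A_def)
    moreover have "open ((\<lambda>s::real. of_real s * t) -` {t. flow t q \<in> W})"
      by (intro open_vimage flow_preimage_open[OF q(2) W] continuous_intros)
    ultimately have "compact A" by (simp add: compact_diff)
    moreover have "A \<noteq> {}" using not by (auto simp: A_def q_def intro!: exI[of _ 1])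
    ultimately obtain s1 where s1: "s1 \<in> A" "\<And>s. s \<in> A \<Longrightarrow> s1 \<le> s" using compact_attains_inf[of A] by blast
    have "s1 \<noteq> 0"
    proof
      assume "s1 = 0"
      thus False using s1(1) z q \<rho> by (auto simp: A_def W_def flow_0)
    qed
    hence s1pos: "s1 > 0" "s1 \<le> 1" using s1(1) by (auto simp: A_def)
    have inW: "flow (of_real s * t) q \<in> W" if "0 \<le> s" "s < s1" for s
      using s1(2)[of s] that s1pos by (force simp: A_def)
    have inK: "flow (of_real s * t) q \<in> K" if s: "0 \<le> s" "s < s1" for s
    proof -
      let ?c = "\<lambda>\<tau>. snd \<kappa> (flow \<tau> q)"
      have seg: "flow \<tau> q \<in> W" if "\<tau> \<in> closed_segment 0 (of_real s * t)" for \<tau>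
      proof -
        have "\<exists>u. 0 \<le> u \<and> u \<le> 1 \<and> \<tau> = (1 - u) *\<^sub>R 0 + u *\<^sub>R (of_real s * t)"
          using that unfolding in_segment(1) .
        then obtain u where u: "0 \<le> u" "u \<le> 1" and eq: "\<tau> = (1 - u) *\<^sub>R 0 + u *\<^sub>R (of_real s * t)"
          by (elim exE conjE)
        have \<tau>: "\<tau> = of_real (u * s) * t" unfolding eq by (simp add: scaleR_conv_of_real)
        have "u * s < s1" using s mult_right_mono[of u 1 s] u by simp
        thus ?thesis using inW[of "u * s"] s u \<tau> by simp
      qed
      have "norm (?c (of_real s * t) - ?c 0) \<le> M * norm (of_real s * t - 0)"
      proof (rule differentiable_bound[where S="closed_segment 0 (of_real s * t)" and f'="\<lambda>\<tau> h. h *s Y \<kappa> (?c \<tau>)"])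
        fix \<tau> assume "\<tau> \<in> closed_segment 0 (of_real s * t)"
        hence w: "flow \<tau> q \<in> W" by (rule seg)
        show "(?c has_derivative (\<lambda>h. h *s Y \<kappa> (?c \<tau>))) (at \<tau> within closed_segment 0 (of_real s * t))"
          by (rule has_derivative_at_withinI, rule flow_deriv[OF q(2) \<kappa>]) (use w in \<open>simp add: W_def\<close>)
        have "norm (Y \<kappa> (?c \<tau>)) \<le> M" by (rule M) (use w in \<open>auto simp: W_def\<close>)
        thus "onorm (\<lambda>h. h *s Y \<kappa> (?c \<tau>)) \<le> M"
          by (intro onorm_le) (simp add: norm_vector_scalar_mult mult.commute[of M] mult_left_mono)
      qed auto
      also have "\<dots> \<le> M * r" using Mpos t s s1pos mult_mono[of s 1 "norm t" r] by (intro mult_left_mono) (auto simp: norm_mult)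
      also have "\<dots> = \<rho> / 2" using Mpos by (simp add: r_def)
      finally have "dist (?c (of_real s * t)) z \<le> \<rho> / 2" using q by (simp add: flow_0 dist_norm)
      hence "dist z0 (?c (of_real s * t)) \<le> 3 / 2 * \<rho>" using z dist_triangle[of z0 "?c (of_real s * t)" z] by (simp add: dist_commute)
      moreover have "param \<kappa> (?c (of_real s * t)) = flow (of_real s * t) q" using inW[OF s] by (intro param_chart \<kappa>) (simp add: W_def)
      ultimately show ?thesis unfolding K_def by (intro image_eqI[of _ _ "?c (of_real s * t)"]) auto
    qed
    \<comment> \<open>All times before the first exit \<open>s1\<close> put the orbit into the
      closed set \<open>K\<close>, so the exit point belongs to \<open>K\<close> as well; but
      \<open>K\<close> lies inside \<open>W\<close>.\<close>
    have "flow (of_real s1 * t) q \<in> K"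
    proof (rule ccontr)
      assume notK: "flow (of_real s1 * t) q \<notin> K"
      have "open ((\<lambda>s::real. of_real s * t) -` {t. flow t q \<in> topspace N - K})"
        by (intro open_vimage flow_preimage_open[OF q(2)] continuous_intros openin_diff openin_topspace \<open>closedin N K\<close>)
      moreover have "s1 \<in> (\<lambda>s::real. of_real s * t) -` {t. flow t q \<in> topspace N - K}" using notK flow_topspace[OF q(2)] by simp
      ultimately obtain e where e: "e > 0" "ball s1 e \<subseteq> (\<lambda>s::real. of_real s * t) -` {t. flow t q \<in> topspace N - K}"
        using open_contains_ball by blast
      define s where "s = max 0 (s1 - e / 2)"
      have "0 \<le> s" "s < s1" "s \<in> ball s1 e" using e s1pos by (auto simp: s_def dist_real_def)
      thus False using inK[of s] e(2) by auto
    qed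
    thus False using KW s1(1) by (auto simp: A_def)
  qed
  have "r > 0" using \<rho> Mpos by (simp add: r_def)
  thus ?thesis using main by (intro exI[of _ r]) (auto simp: W_def)
qed

end

section \<open>Holomorphic dependence of the flow on time and initial value\<close>

context complete_field
begin

text \<open>The Taylor series in \<open>t\<close> has the iterated Lie derivatives
  \<open>L i n\<close> as coefficients, which are holomorphic in the initial value.
  \<open>flow_stays\<close> bounds the solutions uniformly, so Cauchy's estimates yield uniform
  convergence; the sum inherits continuity in both variables and holomorphy in
  \<open>z\<close>.\<close>

lemma flow_box:
  assumes q0: "q0 \<in> topspace N"
  shows "\<exists>\<kappa>\<in>\<A>. \<exists>\<rho>>0. \<exists>r>0. q0 \<in> fst \<kappa> \<and> ball (snd \<kappa> q0) \<rho> \<subseteq> img \<kappa> \<and>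
    (\<forall>z\<in>ball (snd \<kappa> q0) \<rho>. \<forall>t\<in>ball 0 r. flow t (param \<kappa> z) \<in> fst \<kappa>) \<and>
    (\<forall>i. \<forall>t\<in>ball 0 r. holomorphic_fun2 (ball (snd \<kappa> q0) \<rho>) (\<lambda>z. snd \<kappa> (flow t (param \<kappa> z)) $ i)) \<and>
    continuous_on (ball 0 r \<times> ball (snd \<kappa> q0) \<rho>) (\<lambda>p. snd \<kappa> (flow (fst p) (param \<kappa> (snd p))))"
proof -
  obtain \<kappa> where \<kappa>: "\<kappa> \<in> \<A>" "q0 \<in> fst \<kappa>" using chart_at[OF q0] by blast
  define z0 where "z0 = snd \<kappa> q0"
  obtain e where e: "e > 0" "cball z0 e \<subseteq> img \<kappa>"
    using img_open[OF \<kappa>(1)] chart_in[OF \<kappa>(2)] unfolding z0_def by (meson open_contains_cball)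
  define \<rho> where "\<rho> = e / 2"
  have \<rho>: "\<rho> > 0" "cball z0 (2 * \<rho>) \<subseteq> img \<kappa>" using e by (auto simp: \<rho>_def)
  obtain R where R: "R > 0" and st: "\<And>z t. z \<in> ball z0 \<rho> \<Longrightarrow> t \<in> ball 0 R \<Longrightarrow> flow t (param \<kappa> z) \<in> fst \<kappa> \<and> snd \<kappa> (flow t (param \<kappa> z)) \<in> ball z0 (2 * \<rho>)"
    using flow_stays[OF \<kappa>(1) \<rho>] by blast
  have sub: "ball z0 \<rho> \<subseteq> img \<kappa>" using \<rho> by (auto intro: subset_trans[OF _ \<rho>(2)])
  have pz: "param \<kappa> z \<in> topspace N" if "z \<in> ball z0 \<rho>" for z using that sub param_in chart_sub[OF \<kappa>(1)] by blast
  define \<Phi> where "\<Phi> i t z = snd \<kappa> (flow t (param \<kappa> z)) $ i" for i t z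
  define L where "L i n = (lie (Y \<kappa>) ^^ n) (\<lambda>z. z $ i)" for i n
  have ho: "holomorphic_fun2 (img \<kappa>) (\<lambda>z. z $ i)" for i using img_open[OF \<kappa>(1)] by (simp add: holomorphic_fun2_iff)
  have holL: "holomorphic_fun2 (img \<kappa>) (L i n)" for i n
    unfolding L_def by (rule holomorphic_fun2_lie_iter[OF ho Y_hol[OF \<kappa>(1)]])
  have sol: "snd \<kappa> (flow t (param \<kappa> z)) \<in> img \<kappa>"
    "((\<lambda>t. snd \<kappa> (flow t (param \<kappa> z))) has_derivative (\<lambda>h. h *s Y \<kappa> (snd \<kappa> (flow t (param \<kappa> z))))) (at t)"
    if "z \<in> ball z0 \<rho>" "t \<in> ball 0 R" for t z
    using st[OF that] flow_deriv[OF pz[OF that(1)] \<kappa>(1)] by (auto intro: chart_in)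
  have hol\<Phi>: "(\<lambda>t. \<Phi> i t z) holomorphic_on ball 0 R" if "z \<in> ball z0 \<rho>" for i z
    unfolding \<Phi>_def by (rule solution_holomorphic[OF ho, where Y="Y \<kappa>"]) (use sol[OF that] in auto)
  have der: "(deriv ^^ n) (\<lambda>t. \<Phi> i t z) 0 = L i n z" if z: "z \<in> ball z0 \<rho>" for i n z
  proof -
    have "(deriv ^^ n) (\<lambda>t. \<Phi> i t z) 0 = L i n (snd \<kappa> (flow 0 (param \<kappa> z)))"
      unfolding \<Phi>_def L_def
      by (rule higher_deriv_lie[OF ho Y_hol[OF \<kappa>(1)] open_ball[of 0 R]]) (use sol[OF z] R in auto)
    moreover have "z \<in> img \<kappa>" using sub z by blast
    ultimately show ?thesis using flow_0[OF pz[OF z]] by (simp add: chart_param)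
  qed
  \<comment> \<open>Estimating at radius \<open>3 / 4 * R\<close> and summing up to radius
    \<open>R / 2\<close> gives the ratio 2/3 of the dominating geometric series.\<close>
  define r where "r = R / 2"
  define r1 where "r1 = 3 / 4 * R"
  define B where "B = norm z0 + 2 * \<rho>"
  have \<Phi>B: "norm (\<Phi> i t z) \<le> B" if "z \<in> ball z0 \<rho>" "t \<in> ball 0 R" for i t z
  proof -
    have "norm (\<Phi> i t z) \<le> norm (snd \<kappa> (flow t (param \<kappa> z)))" unfolding \<Phi>_def by (rule Finite_Cartesian_Product.norm_nth_le)
    also have "\<dots> \<le> norm z0 + dist z0 (snd \<kappa> (flow t (param \<kappa> z)))" by (metis dist_commute dist_norm norm_triangle_sub)
    also have "\<dots> \<le> B" using st[OF that] by (simp add: B_def)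
    finally show ?thesis .
  qed
  have coef: "norm (L i n z / fact n * t ^ n) \<le> B * (2 / 3) ^ n" if z: "z \<in> ball z0 \<rho>" and t: "t \<in> ball 0 r" for i n z t
  proof -
    have "norm ((deriv ^^ n) (\<lambda>t. \<Phi> i t z) 0) \<le> fact n * B / r1 ^ n"
    proof (rule Cauchy_inequality)
      show "(\<lambda>t. \<Phi> i t z) holomorphic_on ball 0 r1"
        by (rule holomorphic_on_subset[OF hol\<Phi>[OF z]]) (use R in \<open>auto simp: r1_def\<close>)
      show "continuous_on (cball 0 r1) (\<lambda>t. \<Phi> i t z)"
        by (rule holomorphic_on_imp_continuous_on, rule holomorphic_on_subset[OF hol\<Phi>[OF z]]) (use R in \<open>auto simp: r1_def\<close>)
      show "0 < r1" using R by (simp add: r1_def)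
      show "cmod (\<Phi> i t z) \<le> B" if "cmod (0 - t) = r1" for t
        by (rule \<Phi>B[OF z]) (use that R in \<open>auto simp: r1_def\<close>)
    qed
    hence "norm (L i n z) / fact n \<le> B / r1 ^ n" using der[OF z, of n i] by (simp add: field_simps)
    moreover have "norm t ^ n \<le> r ^ n" using t by (intro power_mono) auto
    moreover have "B \<ge> 0" using \<rho> by (simp add: B_def)
    ultimately have "norm (L i n z) / fact n * norm t ^ n \<le> B / r1 ^ n * r ^ n"
      using R by (intro mult_mono) (auto simp: r1_def)
    also have "B / r1 ^ n * r ^ n = B * (r / r1) ^ n" by (simp add: power_divide)
    also have "r / r1 = 2 / 3" using R by (simp add: r_def r1_def field_simps)
    finally show ?thesis by (simp add: norm_mult norm_divide norm_power)
  qed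
  have sums: "(\<lambda>n. L i n z / fact n * t ^ n) sums \<Phi> i t z" if z: "z \<in> ball z0 \<rho>" and t: "t \<in> ball 0 r" for i z t
  proof -
    have "t \<in> ball 0 R" using t R by (simp add: r_def)
    from holomorphic_power_series[OF hol\<Phi>[OF z] this, of i] show ?thesis using der[OF z] by simp
  qed
  have ul: "uniform_limit (ball 0 r \<times> ball z0 \<rho>) (\<lambda>m p. \<Sum>n<m. L i n (snd p) / fact n * fst p ^ n)
       (\<lambda>p. suminf (\<lambda>n. L i n (snd p) / fact n * fst p ^ n)) sequentially" for i
    by (rule Weierstrass_m_test[where M="\<lambda>n. B * (2 / 3) ^ n"]) (use coef in \<open>auto intro!: summable_mult summable_geometric\<close>)
  have ul\<Phi>: "uniform_limit (ball 0 r \<times> ball z0 \<rho>) (\<lambda>m p. \<Sum>n<m. L i n (snd p) / fact n * fst p ^ n)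
       (\<lambda>p. \<Phi> i (fst p) (snd p)) sequentially" for i
    by (rule uniform_limit_cong'[THEN iffD1, OF _ _ ul]) (use sums in \<open>auto simp: sums_iff\<close>)
  have contL: "continuous_on (ball 0 r \<times> ball z0 \<rho>) (\<lambda>p. L i n (snd p))" for i n
    by (rule continuous_on_compose2[OF holomorphic_fun2_imp_continuous_on[OF holL]]) (use sub in \<open>auto intro!: continuous_intros\<close>)
  have cont: "continuous_on (ball 0 r \<times> ball z0 \<rho>) (\<lambda>p. \<Phi> i (fst p) (snd p))" for i
    by (rule uniform_limit_theorem[OF always_eventually ul\<Phi>]) (auto intro!: continuous_intros contL)
  have contv: "continuous_on (ball 0 r \<times> ball z0 \<rho>) (\<lambda>p. \<chi> i. \<Phi> i (fst p) (snd p))"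
    by (intro continuous_on_vec_lambda cont)
  have hol: "holomorphic_fun2 (ball z0 \<rho>) (\<Phi> i t)" if t: "t \<in> ball 0 r" for i t
  proof (rule holomorphic_fun2_uniform_limit[where f="\<lambda>m z. \<Sum>n<m. L i n z / fact n * t ^ n"])
    show "holomorphic_fun2 (ball z0 \<rho>) (\<lambda>z. \<Sum>n<m. L i n z / fact n * t ^ n)" for m
      unfolding holomorphic_fun2_iff
    proof (intro conjI ballI)
      fix z assume "z \<in> ball z0 \<rho>"
      hence c: "cdiff (L i n) z" for n using holL sub by (auto simp: holomorphic_fun2_iff)
      show "cdiff (\<lambda>z. \<Sum>n<m. L i n z / fact n * t ^ n) z"
      proof (induction m)
        case (Suc m)
        have "cdiff (\<lambda>z. L i m z * (t ^ m / fact m)) z" by (rule cdiff_mult[OF c cdiff_const])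
        from cdiff_add[OF Suc this] show ?case by simp
      qed simp
    qed simp
    fix z assume "z \<in> ball z0 \<rho>"
    then obtain d where d: "d > 0" "ball z d \<subseteq> ball z0 \<rho>" by (meson open_ball open_contains_ball)
    have "uniform_limit (ball z d) (\<lambda>m z. \<Sum>n<m. L i n z / fact n * t ^ n) (\<Phi> i t) sequentially"
    proof -
      have "Pair t \<in> ball z d \<rightarrow> ball 0 r \<times> ball z0 \<rho>" using d t by auto
      from uniform_limit_compose'[OF ul\<Phi>[of i] this] show ?thesis by simp
    qed
    thus "\<exists>d>0. ball z d \<subseteq> ball z0 \<rho> \<and> uniform_limit (ball z d) (\<lambda>m z. \<Sum>n<m. L i n z / fact n * t ^ n) (\<Phi> i t) sequentially"
      using d by blast
  qed simp
  have rpos: "r > 0" using R by (simp add: r_def)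
  have eq: "(\<lambda>p. \<chi> i. \<Phi> i (fst p) (snd p)) = (\<lambda>p. snd \<kappa> (flow (fst p) (param \<kappa> (snd p))))"
    by (simp add: \<Phi>_def fun_eq_iff vec_eq_iff)
  have stay: "flow t (param \<kappa> z) \<in> fst \<kappa>" if "z \<in> ball z0 \<rho>" "t \<in> ball 0 r" for z t
    using st[OF that(1), of t] that(2) R by (simp add: r_def)
  have hol': "holomorphic_fun2 (ball z0 \<rho>) (\<lambda>z. snd \<kappa> (flow t (param \<kappa> z)) $ i)" if "t \<in> ball 0 r" for t i
    using hol[OF that, of i] unfolding \<Phi>_def .
  show ?thesis
    by (rule bexI[OF _ \<kappa>(1)], rule exI[of _ \<rho>], rule conjI[OF \<rho>(1)], rule exI[of _ r], rule conjI[OF rpos],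
        unfold z0_def[symmetric], use \<kappa>(2) sub stay hol' contv[unfolded eq] in blast)
qed

lemma mdiff_cong:
  assumes "mdiff f q" "\<And>q. q \<in> topspace N \<Longrightarrow> f q = g q" shows "mdiff g q"
proof -
  obtain \<kappa> where \<kappa>: "\<kappa> \<in> \<A>" "q \<in> fst \<kappa>" "cdiff (\<lambda>z. f (param \<kappa> z)) (snd \<kappa> q)" using assms(1) by (auto simp: mdiff_def)
  have "\<forall>\<^sub>F z in nhds (snd \<kappa> q). f (param \<kappa> z) = g (param \<kappa> z)"
    using eventually_in_chart[OF \<kappa>(1,2) openin_topspace subsetD[OF chart_sub[OF \<kappa>(1)] \<kappa>(2)]]
    by (rule eventually_mono) (simp add: assms(2))
  from cdiff_cong[OF this] show ?thesis using \<kappa> by (auto simp: mdiff_def)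
qed

text \<open>Both clauses, joint continuity at \<open>(t, q)\<close> and pullback of holomorphic
  germs, avoid fixing charts along the orbit, so that they compose (\<open>regular_add\<close>) and
  can be propagated to long times.\<close>

definition regular_at :: "complex \<Rightarrow> 'a \<Rightarrow> bool" where
  "regular_at t q \<longleftrightarrow>
     (\<forall>W. openin N W \<and> flow t q \<in> W \<longrightarrow> (\<exists>d>0. \<exists>U. openin N U \<and> q \<in> U \<and> (\<forall>s\<in>ball t d. \<forall>q'\<in>U. flow s q' \<in> W))) \<and>
     (\<forall>f. mdiff f (flow t q) \<longrightarrow> mdiff (\<lambda>q. f (flow t q)) q)"

lemma regular_mdiff: "regular_at t q \<Longrightarrow> mdiff f (flow t q) \<Longrightarrow> mdiff (\<lambda>q. f (flow t q)) q"
  by (simp add: regular_at_def)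

lemma regular_local:
  assumes q0: "q0 \<in> topspace N"
  shows "\<exists>U. \<exists>r>0. openin N U \<and> q0 \<in> U \<and> (\<forall>q\<in>U. \<forall>t\<in>ball 0 r. regular_at t q)"
proof -
  from flow_box[OF q0] obtain \<kappa> \<rho> r where \<kappa>: "\<kappa> \<in> \<A>" and \<rho>: "\<rho> > 0" and r: "r > 0" and q0\<kappa>: "q0 \<in> fst \<kappa>"
    and sub: "ball (snd \<kappa> q0) \<rho> \<subseteq> img \<kappa>"
    and st': "\<forall>z\<in>ball (snd \<kappa> q0) \<rho>. \<forall>t\<in>ball 0 r. flow t (param \<kappa> z) \<in> fst \<kappa>"
    and hol': "\<forall>i. \<forall>t\<in>ball 0 r. holomorphic_fun2 (ball (snd \<kappa> q0) \<rho>) (\<lambda>z. snd \<kappa> (flow t (param \<kappa> z)) $ i)"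
    and cont: "continuous_on (ball 0 r \<times> ball (snd \<kappa> q0) \<rho>) (\<lambda>p. snd \<kappa> (flow (fst p) (param \<kappa> (snd p))))"
    by (elim bexE exE conjE) (rule that)
  note st = st'[rule_format] and hol = hol'[rule_format]
  define D where "D = ball (snd \<kappa> q0) \<rho>"
  define U where "U = {q \<in> fst \<kappa>. snd \<kappa> q \<in> D}"
  have U: "openin N U" "q0 \<in> U" using chart_preimage_open[OF \<kappa> open_ball] q0\<kappa> \<rho> by (auto simp: U_def D_def)
  have "regular_at t q" if q: "q \<in> U" and t: "t \<in> ball 0 r" for q t
    unfolding regular_at_def
  proof (intro conjI allI impI)
    fix W assume W: "openin N W \<and> flow t q \<in> W"
    define O' where "O' = {w \<in> img \<kappa>. param \<kappa> w \<in> W}"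
    have "open O'" unfolding O'_def using W by (intro param_preimage_open \<kappa>) auto
    have qz: "param \<kappa> (snd \<kappa> q) = q" "snd \<kappa> q \<in> D" using q param_chart[OF \<kappa>] by (auto simp: U_def)
    have fl: "flow t q \<in> fst \<kappa>" using st[of "snd \<kappa> q" t] qz t by (simp add: D_def)
    have "open ((ball 0 r \<times> D) \<inter> (\<lambda>p. snd \<kappa> (flow (fst p) (param \<kappa> (snd p)))) -` O')"
      unfolding D_def by (rule continuous_open_preimage[OF cont]) (auto intro: open_Times \<open>open O'\<close>)
    moreover have "(t, snd \<kappa> q) \<in> (ball 0 r \<times> D) \<inter> (\<lambda>p. snd \<kappa> (flow (fst p) (param \<kappa> (snd p)))) -` O'"
      using t qz fl W by (simp add: O'_def chart_in param_chart[OF \<kappa>])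
    ultimately obtain A B where AB: "open A" "open B" "(t, snd \<kappa> q) \<in> A \<times> B"
       "A \<times> B \<subseteq> (ball 0 r \<times> D) \<inter> (\<lambda>p. snd \<kappa> (flow (fst p) (param \<kappa> (snd p)))) -` O'" by (rule open_prod_elim)
    obtain d where d: "d > 0" "ball t d \<subseteq> A" using AB open_contains_ball by blast
    have "flow s q' \<in> W" if "s \<in> ball t d" "q' \<in> {q \<in> fst \<kappa>. snd \<kappa> q \<in> B}" for s q'
    proof -
      have "(s, snd \<kappa> q') \<in> A \<times> B" using that d by auto
      hence *: "s \<in> ball 0 r" "snd \<kappa> q' \<in> D" "snd \<kappa> (flow s (param \<kappa> (snd \<kappa> q'))) \<in> O'" using AB(4) by auto
      have "param \<kappa> (snd \<kappa> q') = q'" using that param_chart[OF \<kappa>] by simp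
      hence "flow s q' \<in> fst \<kappa>" "snd \<kappa> (flow s q') \<in> O'" using * st[of "snd \<kappa> q'" s] by (auto simp: D_def)
      thus ?thesis by (simp add: O'_def param_chart[OF \<kappa>])
    qed
    thus "\<exists>d>0. \<exists>U. openin N U \<and> q \<in> U \<and> (\<forall>s\<in>ball t d. \<forall>q'\<in>U. flow s q' \<in> W)"
      using d(1) chart_preimage_open[OF \<kappa> AB(2)] AB(3) q
      by (intro exI[of _ d] conjI exI[of _ "{q \<in> fst \<kappa>. snd \<kappa> q \<in> B}"]) (auto simp: U_def)
  next
    fix f assume f: "mdiff f (flow t q)"
    have qz: "param \<kappa> (snd \<kappa> q) = q" "snd \<kappa> q \<in> D" "q \<in> fst \<kappa>" using q param_chart[OF \<kappa>] by (auto simp: U_def)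
    have fl: "flow t q \<in> fst \<kappa>" using st[of "snd \<kappa> q" t] qz t by (simp add: D_def)
    have "cdiff (\<lambda>w. f (param \<kappa> w)) (snd \<kappa> (flow t (param \<kappa> (snd \<kappa> q))))"
      using mdiff_chart[OF f \<kappa> fl] qz by simp
    moreover have "cdiff (\<lambda>z. snd \<kappa> (flow t (param \<kappa> z)) $ i) (snd \<kappa> q)" for i
      using hol[OF t, of i] qz by (simp add: holomorphic_fun2_iff D_def)
    ultimately have "cdiff (\<lambda>z. f (param \<kappa> (snd \<kappa> (flow t (param \<kappa> z))))) (snd \<kappa> q)" by (rule cdiff_compose)
    moreover have "\<forall>\<^sub>F z in nhds (snd \<kappa> q). f (param \<kappa> (snd \<kappa> (flow t (param \<kappa> z)))) = f (flow t (param \<kappa> z))"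
      using eventually_nhds_in_open[OF open_ball, of "snd \<kappa> q" "snd \<kappa> q0" \<rho>] qz(2) unfolding D_def
      by (auto elim!: eventually_mono simp: param_chart[OF \<kappa>] st[OF _ t])
    ultimately have "cdiff (\<lambda>z. f (flow t (param \<kappa> z))) (snd \<kappa> q)"
      by (simp only: cdiff_cong[where f="\<lambda>z. f (param \<kappa> (snd \<kappa> (flow t (param \<kappa> z))))"])
    thus "mdiff (\<lambda>q. f (flow t q)) q" using \<kappa> qz by (auto simp: mdiff_def)
  qed
  thus ?thesis using U r by blast
qed

lemma regular_add:
  assumes q: "q \<in> topspace N" and t: "regular_at t q" and s: "regular_at s (flow t q)"
  shows "regular_at (s + t) q"
  unfolding regular_at_def
proof (intro conjI allI impI)
  fix W assume W: "openin N W \<and> flow (s + t) q \<in> W"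
  then obtain d U where d: "d > 0" "openin N U" "flow t q \<in> U" "\<And>s' q'. s' \<in> ball s d \<Longrightarrow> q' \<in> U \<Longrightarrow> flow s' q' \<in> W"
    using s flow_add[OF q, of s t] unfolding regular_at_def by metis
  then obtain d' U' where d': "d' > 0" "openin N U'" "q \<in> U'" "\<And>s' q'. s' \<in> ball t d' \<Longrightarrow> q' \<in> U' \<Longrightarrow> flow s' q' \<in> U"
    using t unfolding regular_at_def by metis
  have "flow \<tau> q' \<in> W" if "\<tau> \<in> ball (s + t) d" "q' \<in> U'" for \<tau> q'
  proof -
    have q': "q' \<in> topspace N" using that(2) d'(2) openin_subset by blast
    have "\<tau> - t \<in> ball s d" using that(1) by (simp add: dist_norm algebra_simps)
    hence "flow (\<tau> - t) (flow t q') \<in> W" using d(4) d'(4)[of t q'] that(2) d'(1) by simp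
    thus ?thesis by (simp add: flow_add[OF q'])
  qed
  thus "\<exists>d>0. \<exists>U. openin N U \<and> q \<in> U \<and> (\<forall>s'\<in>ball (s + t) d. \<forall>q'\<in>U. flow s' q' \<in> W)" using d(1) d' by blast
next
  fix f assume "mdiff f (flow (s + t) q)"
  hence "mdiff f (flow s (flow t q))" by (simp add: flow_add[OF q])
  from regular_mdiff[OF t regular_mdiff[OF s this]]
  have "mdiff (\<lambda>q. f (flow s (flow t q))) q" .
  thus "mdiff (\<lambda>q. f (flow (s + t) q)) q" by (rule mdiff_cong) (simp add: flow_add)
qed

text \<open>Regularity at long times follows from regularity at short times, since the set of regular times
  is open and closed.\<close>

lemma regular:
  assumes q: "q \<in> topspace N" shows "regular_at t q"
proof -
  define A where "A = {t. regular_at t q}"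
  \<comment> \<open>The two times differ by a short time, and short times are regular at every point
    near \<open>flow t1 q\<close>, backwards as well as forwards; hence regularity at one of them
    passes to the other.\<close>
  have key: "\<exists>d>0. \<forall>t\<in>ball t1 d. regular_at t q \<longleftrightarrow> regular_at t1 q" for t1
  proof -
    obtain U r where U: "r > 0" "openin N U" "flow t1 q \<in> U" "\<And>q t. q \<in> U \<Longrightarrow> t \<in> ball 0 r \<Longrightarrow> regular_at t q"
      using regular_local[OF flow_topspace[OF q, of t1]] by blast
    have "open {t. flow t q \<in> U}" using flow_preimage_open[OF q U(2)] .
    then obtain d where d: "d > 0" "ball t1 d \<subseteq> {t. flow t q \<in> U}" using U(3) open_contains_ball by blast
    have "regular_at t q \<longleftrightarrow> regular_at t1 q" if t: "t \<in> ball t1 (min d r)" for t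
    proof
      assume "regular_at t q"
      moreover have "regular_at (t1 - t) (flow t q)" using U(4) d(2) t by (auto simp: dist_norm)
      ultimately have "regular_at ((t1 - t) + t) q" by (rule regular_add[OF q])
      thus "regular_at t1 q" by simp
    next
      assume "regular_at t1 q"
      moreover have "regular_at (t - t1) (flow t1 q)" using U(3,4) t by (auto simp: dist_norm norm_minus_commute)
      ultimately have "regular_at ((t - t1) + t1) q" by (rule regular_add[OF q])
      thus "regular_at t q" by simp
    qed
    note eqv = this
    show ?thesis
    proof (intro exI[of _ "min d r"] conjI ballI)
      show "min d r > 0" using d(1) U(1) by simp
      fix t assume "t \<in> ball t1 (min d r)"
      thus "regular_at t q \<longleftrightarrow> regular_at t1 q" by (rule eqv)
    qed
  qed
  have "open A" unfolding open_contains_ball A_def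
  proof
    fix t assume "t \<in> {t. regular_at t q}"
    hence "regular_at t q" by simp
    moreover obtain d where "d > 0" "\<forall>t'\<in>ball t d. regular_at t' q \<longleftrightarrow> regular_at t q" using key[of t] by (elim exE conjE)
    ultimately show "\<exists>e>0. ball t e \<subseteq> {t. regular_at t q}" by blast
  qed
  moreover have "open (- A)" unfolding open_contains_ball A_def
  proof
    fix t assume "t \<in> - {t. regular_at t q}"
    hence "\<not> regular_at t q" by simp
    moreover obtain d where "d > 0" "\<forall>t'\<in>ball t d. regular_at t' q \<longleftrightarrow> regular_at t q" using key[of t] by (elim exE conjE)
    ultimately show "\<exists>e>0. ball t e \<subseteq> - {t. regular_at t q}" by blast
  qed
  moreover have "0 \<in> A" using regular_local[OF q] unfolding A_def by force
  ultimately have "A = UNIV" using clopen[of A] by (auto simp: closed_def)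
  thus ?thesis by (auto simp: A_def)
qed

lemma flow_continuous: "continuous_map (prod_topology euclidean N) N (\<lambda>p. flow (fst p) (snd p))"
  unfolding continuous_map_def
proof (intro conjI allI impI)
  show "(\<lambda>p. flow (fst p) (snd p)) \<in> topspace (prod_topology euclidean N) \<rightarrow> topspace N" by (auto simp: flow_topspace)
  fix W assume W: "openin N W"
  show "openin (prod_topology euclidean N) {p \<in> topspace (prod_topology euclidean N). flow (fst p) (snd p) \<in> W}"
    unfolding openin_prod_topology_alt
  proof (intro allI impI)
    fix t q assume "(t, q) \<in> {p \<in> topspace (prod_topology euclidean N). flow (fst p) (snd p) \<in> W}"
    hence q: "q \<in> topspace N" "flow t q \<in> W" by auto
    then obtain d U where dU: "d > 0" "openin N U" "q \<in> U" "\<forall>s\<in>ball t d. \<forall>q'\<in>U. flow s q' \<in> W"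
      using regular[OF q(1), of t] W unfolding regular_at_def by metis
    have "U \<subseteq> topspace N" using dU(2) openin_subset by blast
    thus "\<exists>U V. openin euclidean U \<and> openin N V \<and> t \<in> U \<and> q \<in> V \<and>
        U \<times> V \<subseteq> {p \<in> topspace (prod_topology euclidean N). flow (fst p) (snd p) \<in> W}"
      using dU by (intro exI[of _ "ball t d"] exI[of _ U]) (auto simp flip: open_openin)
  qed
qed

lemma flow_map_continuous: "continuous_map N N (flow t)"
proof -
  have "continuous_map N (prod_topology euclidean N) (\<lambda>q. (t, q))" by (intro continuous_map_pairedI) auto
  from continuous_map_compose[OF this flow_continuous] show ?thesis by (simp add: comp_def)
qed

lemma flow_compose_holomorphic: "f \<in> holomorphic_functions \<A> \<Longrightarrow> (\<lambda>q. f (flow t q)) \<in> holomorphic_functions \<A>"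
  unfolding holomorphic_functions_iff using regular flow_topspace by (auto simp: regular_at_def)

text \<open>Time and a complex line of initial values are combined into one function of two complex
  variables, to which symmetry of mixed partial derivatives and differentiation under the integral
  apply. Osgood's lemma asks only for joint continuity and for each variable separately.\<close>

lemma flow_joint_holomorphic:
  assumes f: "f \<in> holomorphic_functions \<A>" and \<kappa>: "\<kappa> \<in> \<A>" and U: "open U" "\<And>s. s \<in> U \<Longrightarrow> z + s *s v \<in> img \<kappa>"
  shows "holomorphic_fun2 {w. w $ 2 \<in> U} (\<lambda>w. f (flow (w $ 1) (param \<kappa> (z + w $ 2 *s v))))"
proof (rule osgood)
  let ?S = "{w :: complex^2. w $ 2 \<in> U}"
  have "?S = (\<lambda>w. w $ 2) -` U" by auto
  thus "open ?S" using U(1) by (auto intro!: open_vimage continuous_intros)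
  have 1: "continuous_map (top_of_set ?S) N (\<lambda>w. param \<kappa> (z + w $ 2 *s v))"
  proof -
    have "continuous_map (top_of_set ?S) (top_of_set (img \<kappa>)) (\<lambda>w. z + w $ 2 *s v)"
      using U(2) by (auto simp: continuous_map_in_subtopology intro!: continuous_intros)
    from continuous_map_compose[OF this param_continuous[OF \<kappa>]] show ?thesis by (simp add: comp_def)
  qed
  have "continuous_map (top_of_set ?S) (prod_topology euclidean N) (\<lambda>w. (w $ 1, param \<kappa> (z + w $ 2 *s v)))"
    by (intro continuous_map_pairedI 1) (auto intro!: continuous_intros)
  from continuous_map_compose[OF this continuous_map_compose[OF flow_continuous holomorphic_continuous_map[OF f]]]
  show "continuous_on ?S (\<lambda>w. f (flow (w $ 1) (param \<kappa> (z + w $ 2 *s v))))" by (simp add: comp_def)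
  fix w :: "complex^2" and i assume w: "w \<in> ?S"
  hence wi: "z + w $ 2 *s v \<in> img \<kappa>" using U(2) by simp
  have q: "param \<kappa> (z + w $ 2 *s v) \<in> topspace N" using param_in[OF wi] chart_sub[OF \<kappa>] by blast
  show "(\<lambda>s. f (flow ((w + s *s axis i 1) $ 1) (param \<kappa> (z + (w + s *s axis i 1) $ 2 *s v)))) field_differentiable at 0"
  proof (cases "i = 1")
    case True
    have d: "((\<lambda>t. f (flow t (param \<kappa> (z + w $ 2 *s v)))) has_field_derivative Lie f (flow (w $ 1) (param \<kappa> (z + w $ 2 *s v)))) (at (w $ 1 + 0))"
      using flow_fun_deriv[OF f q, of "w $ 1"] by simp
    have "((\<lambda>s. w $ 1 + s) has_field_derivative 1) (at 0)" by (auto intro!: derivative_eq_intros)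
    from DERIV_chain2[OF d this] show ?thesis using True by (auto simp: field_differentiable_def)
  next
    case False
    hence i: "i = 2" using exhaust_2 by blast
    have eq: "z + (w + s *s axis i 1) $ 2 *s v = (z + w $ 2 *s v) + s *s v" for s using i by (simp add: vec_eq_iff algebra_simps)
    have "cdiff (\<lambda>z. f (flow (w $ 1) (param \<kappa> z))) ((z + w $ 2 *s v) + 0 *s v)"
      using holomorphic_in_chart[OF flow_compose_holomorphic[OF f] \<kappa>] wi by (simp add: holomorphic_fun2_iff)
    from cdiff_slice[OF this] show ?thesis unfolding eq using i by (auto simp: field_differentiable_def)
  qed
qed

end

section \<open>Local inversion of a holomorphic map\<close>

definition polydisc :: "real \<Rightarrow> (complex^2) set" where
  "polydisc r = {w. norm (w $ 1) < r \<and> norm (w $ 2) < r}"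

lemma open_polydisc: "open (polydisc r)"
proof -
  have "polydisc r = (\<lambda>w. norm (w $ 1)) -` {..<r} \<inter> (\<lambda>w. norm (w $ 2)) -` {..<r}"
    by (auto simp: polydisc_def)
  thus ?thesis by (auto intro!: open_Int open_vimage continuous_intros)
qed

lemma polydisc_small:
  assumes "open W" "0 \<in> W" shows "\<exists>r>0. polydisc r \<subseteq> (W :: (complex^2) set)"
proof -
  obtain e where e: "e > 0" "ball 0 e \<subseteq> W" using assms open_contains_ball by blast
  have "w \<in> ball 0 e" if "w \<in> polydisc (e / 2)" for w
    using that norm_le_components[of w] by (simp add: polydisc_def)
  thus ?thesis using e by (intro exI[of _ "e / 2"]) auto
qed

text \<open>On a small ball \<open>F\<close> differs from the identity by a map with Lipschitz
  constant 1/2. Hence it is injective with \<open>norm (x - y) \<le> 2 * norm (F x - F y)\<close>,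
  and its image is open by invariance of domain. The inverse is then continuous and differentiable,
  with complex linear derivative as the inverse of a complex linear map.\<close>

lemma local_biholomorphism:
  fixes F :: "complex^2 \<Rightarrow> complex^2"
  assumes F: "\<And>i. holomorphic_fun2 S (\<lambda>z. F z $ i)" and S: "0 \<in> S" and F0: "F 0 = 0"
    and DF: "\<And>i j. pd j (\<lambda>z. F z $ i) 0 = (if i = j then 1 else 0)" and e: "e > 0"
  shows "\<exists>d r E. 0 < d \<and> d < e \<and> 0 < r \<and> ball 0 d \<subseteq> S \<and>
    (\<forall>w\<in>polydisc r. E w \<in> ball 0 d \<and> F (E w) = w) \<and>
    (\<forall>z\<in>ball 0 d. F z \<in> polydisc r \<longrightarrow> E (F z) = z) \<and>
    (\<forall>i. holomorphic_fun2 (polydisc r) (\<lambda>w. E w $ i))"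
proof -
  have st: "\<exists>d>0. ball 0 d \<subseteq> S \<and> (\<forall>x\<in>ball 0 d. \<forall>y\<in>ball 0 d. norm (F x $ i - F y $ i - (x - y) $ i) \<le> 1/4 * norm (x - y))" for i
    using strict_derivative[OF F S, of "1/4" i] exhaust_2[of i] by (auto simp: DF)
  obtain d1 where d1: "d1 > 0" "ball 0 d1 \<subseteq> S" "\<And>x y. x \<in> ball 0 d1 \<Longrightarrow> y \<in> ball 0 d1 \<Longrightarrow> norm (F x $ 1 - F y $ 1 - (x - y) $ 1) \<le> 1/4 * norm (x - y)"
    using st[of 1] by blast
  obtain d2 where d2: "d2 > 0" "\<And>x y. x \<in> ball 0 d2 \<Longrightarrow> y \<in> ball 0 d2 \<Longrightarrow> norm (F x $ 2 - F y $ 2 - (x - y) $ 2) \<le> 1/4 * norm (x - y)"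
    using st[of 2] by blast
  define d where "d = min (min d1 d2) (e / 2)"
  have d: "d > 0" "d < e" "d \<le> d1" "d \<le> d2" using d1 d2 e by (auto simp: d_def)
  have dS: "ball 0 d \<subseteq> S" using d1(2) d(3) by auto
  have close: "norm (F x - F y - (x - y)) \<le> 1/2 * norm (x - y)" if "x \<in> ball 0 d" "y \<in> ball 0 d" for x y
  proof -
    have "norm (F x - F y - (x - y)) \<le> norm (F x $ 1 - F y $ 1 - (x - y) $ 1) + norm (F x $ 2 - F y $ 2 - (x - y) $ 2)"
      using norm_le_components[of "F x - F y - (x - y)"] by simp
    also have "\<dots> \<le> 1/4 * norm (x - y) + 1/4 * norm (x - y)"
      using that d by (intro add_mono d1(3) d2(2)) auto
    finally show ?thesis by simp
  qed
  have lower: "norm (x - y) \<le> 2 * norm (F x - F y)" if "x \<in> ball 0 d" "y \<in> ball 0 d" for x y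
  proof -
    have "norm (x - y) = norm ((F x - F y) - (F x - F y - (x - y)))" by simp
    also have "\<dots> \<le> norm (F x - F y) + norm (F x - F y - (x - y))" by (rule norm_triangle_ineq4)
    finally show ?thesis using close[OF that] by linarith
  qed
  have inj: "inj_on F (ball 0 d)"
    by (rule inj_onI) (use lower in force)
  have cdF: "cdiff (\<lambda>z. F z $ i) z" if "z \<in> ball 0 d" for z i using F dS that by (auto simp: holomorphic_fun2_iff)
  define F' where "F' z v = (\<chi> i. pd 1 (\<lambda>z. F z $ i) z * v $ 1 + pd 2 (\<lambda>z. F z $ i) z * v $ 2)" for z and v :: "complex^2"
  have DF': "(F has_derivative F' z) (at z)" if "z \<in> ball 0 d" for z
    using cdiff_map_has_derivative[of F z] cdF[OF that] unfolding F'_def by simp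
  have contF: "continuous_on (ball 0 d) F"
    by (intro continuous_at_imp_continuous_on ballI has_derivative_continuous[OF DF'])
  have opF: "open (F ` ball 0 d)"
    by (rule invariance_of_domain[OF contF open_ball inj])
  have "0 \<in> F ` ball 0 d" using F0 d(1) by (intro image_eqI[of _ _ 0]) auto
  then obtain r where r: "r > 0" "polydisc r \<subseteq> F ` ball 0 d" using polydisc_small[OF opF] by blast
  define E where "E = inv_into (ball 0 d) F"
  have E: "E w \<in> ball 0 d" "F (E w) = w" if "w \<in> polydisc r" for w
  proof -
    have "w \<in> F ` ball 0 d" using that r(2) by blast
    thus "E w \<in> ball 0 d" "F (E w) = w" unfolding E_def by (rule inv_into_into, rule f_inv_into_f)
  qed
  have EF: "E (F z) = z" if "z \<in> ball 0 d" for z unfolding E_def by (rule inv_into_f_f[OF inj that])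
  have contE: "isCont E w" if w: "w \<in> polydisc r" for w
  proof -
    have "\<forall>\<^sub>F w' in at w. norm (E w' - E w) \<le> 2 * norm (w' - w)"
      using eventually_at_in_open'[OF open_polydisc w] by eventually_elim (use lower E w in metis)
    moreover have "((\<lambda>w'. 2 * norm (w' - w)) \<longlongrightarrow> 0) (at w)" by (auto intro!: tendsto_eq_intros)
    ultimately have "((\<lambda>w'. E w' - E w) \<longlongrightarrow> 0) (at w)" by (rule Lim_null_comparison)
    thus ?thesis by (simp add: isCont_def LIM_zero_iff)
  qed
  have holE: "cdiff (\<lambda>w. E w $ i) w" if w: "w \<in> polydisc r" for w i
  proof -
    let ?z = "E w"
    have z: "?z \<in> ball 0 d" using E w by blast
    have F'lin: "linear (F' ?z)" using DF'[OF z] by (rule has_derivative_linear)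
    have F'hom: "F' ?z (a *s v) = a *s F' ?z v" for a v by (simp add: F'_def vec_eq_iff algebra_simps)
    \<comment> \<open>The Lipschitz bound passes to the derivative as a limit of difference
      quotients and makes it injective.\<close>
    have F'close: "norm (F' ?z v - v) \<le> 1/2 * norm v" for v
    proof -
      have lim: "((\<lambda>s. (1 / s) *s (F (?z + s *s v) - F ?z) - v) \<longlongrightarrow> F' ?z v - v) (at (0::complex))"
      proof (intro tendsto_diff vec_tendstoI tendsto_const)
        fix k
        have "((\<lambda>s. F (?z + s *s v) $ k) has_field_derivative F' ?z v $ k) (at 0)"
          using cdiff_slice[of "\<lambda>z. F z $ k" ?z 0 v] cdF[OF z, of k] by (simp add: F'_def)
        thus "((\<lambda>s. ((1 / s) *s (F (?z + s *s v) - F ?z)) $ k) \<longlongrightarrow> F' ?z v $ k) (at 0)"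
          by (simp add: has_field_derivative_iff diff_divide_distrib)
      qed
      have "\<forall>\<^sub>F s in at (0::complex). norm ((1 / s) *s (F (?z + s *s v) - F ?z) - v) \<le> 1/2 * norm v"
      proof -
        have "((\<lambda>s::complex. ?z + s *s v) \<longlongrightarrow> ?z + 0 *s v) (at 0)" by (intro tendsto_intros)
        hence "\<forall>\<^sub>F s in at (0::complex). ?z + s *s v \<in> ball 0 d" by (rule topological_tendstoD) (use z in auto)
        moreover have "\<forall>\<^sub>F s in at (0::complex). s \<noteq> 0" by (simp add: eventually_at_filter)
        ultimately show ?thesis
        proof eventually_elim
          case (elim s)
          have "(1 / s) *s (F (?z + s *s v) - F ?z) - v = (1 / s) *s (F (?z + s *s v) - F ?z - s *s v)"
            using elim by (simp add: vec_eq_iff field_simps)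
          hence "norm ((1 / s) *s (F (?z + s *s v) - F ?z) - v) = norm (1 / s) * norm (F (?z + s *s v) - F ?z - s *s v)"
            by (simp only: norm_vector_scalar_mult)
          also have "\<dots> \<le> norm (1 / s) * (1/2 * norm (s *s v))"
            using close[of "?z + s *s v" ?z] elim z by (intro mult_left_mono) auto
          also have "\<dots> = 1/2 * norm v" using elim by (simp add: norm_vector_scalar_mult norm_divide)
          finally show ?case .
        qed
      qed
      from tendsto_upperbound[OF tendsto_norm[OF lim] this] show ?thesis by simp
    qed
    have inj': "inj (F' ?z)"
    proof (rule linear_injective_0[OF F'lin, THEN iffD2], intro allI impI)
      fix v assume "F' ?z v = 0"
      thus "v = 0" using F'close[of v] by simp
    qed
    then obtain g where g: "linear g" "g \<circ> F' ?z = id" "F' ?z \<circ> g = id"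
      using linear_injective_isomorphism[OF F'lin] by (auto simp: fun_eq_iff)
    have ghom: "g (a *s v) = a *s g v" for a v
    proof -
      have "F' ?z (g (a *s v)) = F' ?z (a *s g v)" using g(3) by (simp add: F'hom fun_eq_iff)
      thus ?thesis using inj' by (simp add: inj_eq)
    qed
    have DE: "(E has_derivative g) (at w)"
    proof (rule has_derivative_inverse_basic[where f=F and f'="F' ?z" and T="polydisc r"])
      show "(F has_derivative F' ?z) (at (E w))" by (rule DF'[OF z])
      show "bounded_linear g" using g(1) by (simp add: linear_conv_bounded_linear)
      show "continuous (at w) E" using contE[OF w] .
      show "open (polydisc r)" by (rule open_polydisc)
      show "w \<in> polydisc r" by (rule w)
      show "\<And>x. x \<in> polydisc r \<Longrightarrow> F (E x) = x" by (rule E(2))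
      show "g \<circ> F' ?z = id" by (rule g(2))
    qed
    have "((\<lambda>w. E w $ i) has_derivative (\<lambda>v. g v $ i)) (at w)"
      by (rule bounded_linear.has_derivative[OF bounded_linear_vec_nth DE])
    thus ?thesis unfolding cdiff_def using ghom by (intro exI[of _ "\<lambda>v. g v $ i"]) auto
  qed
  show ?thesis
  proof (intro exI conjI)
    show "\<forall>i. holomorphic_fun2 (polydisc r) (\<lambda>w. E w $ i)" using holE open_polydisc by (simp add: holomorphic_fun2_iff)
    show "\<forall>w\<in>polydisc r. E w \<in> ball 0 d \<and> F (E w) = w" using E by blast
    show "\<forall>z\<in>ball 0 d. F z \<in> polydisc r \<longrightarrow> E (F z) = z" using EF by blast
  qed (use d dS r in auto)
qed

lemma deriv_zero_const:
  assumes "\<And>t. (f has_field_derivative 0) (at (t :: complex))" shows "f a = f b"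
  using has_field_derivative_zero_constant[of UNIV f] assms by auto

section \<open>Diagonal singularities\<close>

text \<open>The coordinates of \<kappa> are required to be holomorphic on all of \<open>N\<close>:
  then \<open>snd \<kappa> (flow t q)\<close> is meaningful and holomorphic even after the orbit has
  left the chart, as averaging over a long period demands. A Stein surface has such charts at every
  point.\<close>

locale diagonal_point = complete_field +
  fixes \<kappa> :: "'a chart" and p :: 'a and \<mu> :: "2 \<Rightarrow> complex"
  assumes \<kappa>: "\<kappa> \<in> \<A>" and p: "p \<in> fst \<kappa>" and z0: "snd \<kappa> p = 0"
    and global: "\<And>i. (\<lambda>q. snd \<kappa> q $ i) \<in> holomorphic_functions \<A>"
    and sing: "p \<in> singularities N \<A> X"
    and diag: "\<And>i j. pd j (\<lambda>z. Y \<kappa> z $ i) 0 = (if i = j then \<mu> i else 0)"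
begin

lemma pN: "p \<in> topspace N" using sing by (simp add: singularities_def)

lemma img0: "0 \<in> img \<kappa>" using chart_in[OF p] z0 by simp

lemma param0: "param \<kappa> 0 = p" using param_chart[OF \<kappa> p] z0 by simp

lemma flow_p: "flow t p = p"
proof -
  have "icurve UNIV (\<lambda>_. p)"
    using pN sing unfolding integral_curve_def singularities_def by (auto simp: comp_def)
  from icurve_eq_flow[OF this, of t] show ?thesis by (simp add: connected_UNIV)
qed

lemma Lie_coordinate:
  assumes "z \<in> img \<kappa>" shows "Lie (\<lambda>q. snd \<kappa> q $ i) (param \<kappa> z) = Y \<kappa> z $ i"
proof -
  have "pd j (\<lambda>z. snd \<kappa> (param \<kappa> z) $ i) z = (if i = j then 1 else 0)" for j
  proof -
    have "\<forall>\<^sub>F w in nhds z. snd \<kappa> (param \<kappa> w) $ i = w $ i"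
      using eventually_nhds_in_open[OF img_open[OF \<kappa>] assms] by eventually_elim (simp add: chart_param)
    from pd_cong[OF this] have "pd j (\<lambda>z. snd \<kappa> (param \<kappa> z) $ i) z = pd j (\<lambda>z. z $ i) z" .
    moreover have "((\<lambda>z. z $ i) has_derivative (\<lambda>v. (if i = 1 then 1 else 0) * v $ 1 + (if i = 2 then 1 else 0) * v $ 2)) (at z)"
      by (rule has_derivative_eq_rhs[OF bounded_linear_imp_has_derivative[OF bounded_linear_vec_nth]])
         (use exhaust_2[of i] in auto)
    from cdiff_unique[OF this] have "pd j (\<lambda>z. z $ i) z = (if i = j then 1 else 0)"
      using exhaust_2[of j] by auto
    ultimately show ?thesis by simp
  qed
  thus ?thesis using Lie_chart[OF global[of i] \<kappa> param_in[OF assms]] exhaust_2[of i]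
    by (auto simp: lie_def chart_param[OF assms])
qed

lemma flow_coordinate_holomorphic:
  "holomorphic_fun2 (img \<kappa>) (\<lambda>z. snd \<kappa> (flow t (param \<kappa> z)) $ i)"
  by (rule holomorphic_in_chart[OF flow_compose_holomorphic[OF global] \<kappa>])

lemma ball_in_img: "\<exists>R>0. ball 0 R \<subseteq> img \<kappa>"
  using img_open[OF \<kappa>] img0 open_contains_ball by blast

text \<open>Differentiating \<open>z\<^sub>i (\<phi>\<^sub>t (s v))\<close> in \<open>s\<close> and \<open>t\<close> shows that the derivative of \<open>\<phi>\<^sub>t\<close> at the fixed point
  solves the linear equation \<open>D' = A D\<close>.\<close>

lemma flow_linear_part:
  "pd j (\<lambda>z. snd \<kappa> (flow t (param \<kappa> z)) $ i) 0 = (if i = j then exp (\<mu> i * t) else 0)"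
proof -
  obtain R where R: "R > 0" "ball 0 R \<subseteq> img \<kappa>" using ball_in_img by blast
  let ?v = "axis j 1 :: complex^2"
  have inR: "0 + s *s ?v \<in> img \<kappa>" if "s \<in> ball 0 R" for s
    using R(2) smult_in_ball[of s R ?v 0] that by (auto simp: norm_axis_1)
  define \<psi> where "\<psi> i w = snd \<kappa> (flow (w $ 1) (param \<kappa> (0 + w $ 2 *s ?v))) $ i" for i and w :: "complex^2"
  let ?S = "{w :: complex^2. w $ 2 \<in> ball 0 R}"
  have hol: "holomorphic_fun2 ?S (\<psi> i)" for i
    unfolding \<psi>_def by (rule flow_joint_holomorphic[OF global \<kappa> open_ball inR])
  define e where "e i t = pd j (\<lambda>z. snd \<kappa> (flow t (param \<kappa> z)) $ i) 0" for i t
  have e\<psi>: "pd 2 (\<psi> i) (vec2 t 0) = e i t" for i t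
    unfolding e_def pd_def \<psi>_def by simp
  have inS: "vec2 t 0 \<in> ?S" for t using R by simp
  have de: "(e i has_field_derivative \<mu> i * e i t) (at t)" for i t
  proof -
    have "cdiff (pd 2 (\<psi> i)) (vec2 t 0)" using holomorphic_fun2_pd[OF hol] inS by (simp add: holomorphic_fun2_iff)
    moreover have "vec2 0 0 + s *s axis 1 1 = vec2 s 0" for s by (simp add: vec2_eq_iff)
    ultimately have "((\<lambda>s. pd 2 (\<psi> i) (vec2 s 0)) has_field_derivative pd 1 (pd 2 (\<psi> i)) (vec2 t 0)) (at t)"
      using pd_slice[of "pd 2 (\<psi> i)" "vec2 0 0" t 1] by simp
    moreover have "pd 1 (pd 2 (\<psi> i)) (vec2 t 0) = pd 2 (pd 1 (\<psi> i)) (vec2 t 0)"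
      by (rule pd_commute[OF hol inS])
    moreover have "pd 2 (pd 1 (\<psi> i)) (vec2 t 0) = \<mu> i * e i t"
    proof -
      have p1: "pd 1 (\<psi> i) w = Lie (\<lambda>q. snd \<kappa> q $ i) (flow (w $ 1) (param \<kappa> (0 + w $ 2 *s ?v)))" if "w \<in> ?S" for w
      proof -
        have q: "param \<kappa> (0 + w $ 2 *s ?v) \<in> topspace N"
          using param_in[OF inR[of "w $ 2"]] that chart_sub[OF \<kappa>] by auto
        have A: "((\<lambda>t. snd \<kappa> (flow t (param \<kappa> (0 + w $ 2 *s ?v))) $ i) has_field_derivative
            Lie (\<lambda>q. snd \<kappa> q $ i) (flow (w $ 1) (param \<kappa> (0 + w $ 2 *s ?v)))) (at (w $ 1 + 0))"
          using flow_fun_deriv[OF global q, of i "w $ 1"] by simp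
        have B: "((\<lambda>s. w $ 1 + s) has_field_derivative 1) (at 0)" by (auto intro!: derivative_eq_intros)
        from DERIV_chain2[OF A B] have "((\<lambda>s. \<psi> i (w + s *s axis 1 1)) has_field_derivative
            Lie (\<lambda>q. snd \<kappa> q $ i) (flow (w $ 1) (param \<kappa> (0 + w $ 2 *s ?v)))) (at 0)"
          unfolding \<psi>_def by simp
        thus ?thesis unfolding pd_def by (simp add: DERIV_imp_deriv)
      qed
      \<comment> \<open>\<open>flow t\<close> fixes \<open>p\<close>, so for fixed \<open>t\<close>,
        however large, the images of points close to \<open>p\<close> still lie in the chart, where
        the Lie derivative of a coordinate is a component of \<open>Y \<kappa>\<close>.\<close>
      have flim: "\<forall>\<^sub>F s in nhds 0. s \<in> ball 0 R \<and> flow t (param \<kappa> (0 + s *s ?v)) \<in> fst \<kappa>"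
      proof -
        have "openin N {q \<in> topspace N. flow t q \<in> fst \<kappa>}"
          by (rule openin_continuous_map_preimage[OF flow_map_continuous chart_open[OF \<kappa>]])
        hence "\<forall>\<^sub>F z in nhds (snd \<kappa> p). z \<in> img \<kappa> \<and> param \<kappa> z \<in> {q \<in> topspace N. flow t q \<in> fst \<kappa>}"
          by (rule eventually_in_chart[OF \<kappa> p]) (simp add: pN flow_p p)
        moreover have "((\<lambda>s. 0 + s *s ?v) \<longlongrightarrow> 0 + 0 *s ?v) (nhds 0)"
          by (intro tendsto_intros) (simp add: filterlim_ident)
        hence "filterlim (\<lambda>s. 0 + s *s ?v) (nhds (snd \<kappa> p)) (nhds 0)" by (simp add: z0)
        ultimately have "\<forall>\<^sub>F s in nhds 0. param \<kappa> (0 + s *s ?v) \<in> {q \<in> topspace N. flow t q \<in> fst \<kappa>}"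
          by (auto simp: filterlim_iff elim: eventually_mono)
        moreover have "\<forall>\<^sub>F s in nhds 0. s \<in> ball 0 R" using R by (intro eventually_nhds_in_open) auto
        ultimately show ?thesis by eventually_elim auto
      qed
      have eq: "\<forall>\<^sub>F s in nhds 0. pd 1 (\<psi> i) (vec2 t 0 + s *s axis 2 1) = Y \<kappa> (snd \<kappa> (flow t (param \<kappa> (0 + s *s ?v)))) $ i"
        using flim
      proof eventually_elim
        case (elim s)
        have "pd 1 (\<psi> i) (vec2 t 0 + s *s axis 2 1) = Lie (\<lambda>q. snd \<kappa> q $ i) (flow t (param \<kappa> (0 + s *s ?v)))"
          using p1[of "vec2 t 0 + s *s axis 2 1"] elim by simp
        also have "\<dots> = Y \<kappa> (snd \<kappa> (flow t (param \<kappa> (0 + s *s ?v)))) $ i"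
          using Lie_coordinate[of "snd \<kappa> (flow t (param \<kappa> (0 + s *s ?v)))" i] elim
          by (simp add: chart_in param_chart[OF \<kappa>])
        finally show ?case .
      qed
      let ?u = "\<lambda>z. snd \<kappa> (flow t (param \<kappa> z))"
      have u0: "?u 0 = 0" by (simp add: param0 flow_p z0)
      have cdu: "cdiff (\<lambda>z. ?u z $ k) 0" for k
        using flow_coordinate_holomorphic[of t k] img0 by (simp add: holomorphic_fun2_iff)
      have cdY: "cdiff (\<lambda>z. Y \<kappa> z $ i) (?u 0)" using Y_hol[OF \<kappa>, of i] img0 by (simp add: holomorphic_fun2_iff u0)
      have dY: "((\<lambda>z. Y \<kappa> z $ i) has_derivative (\<lambda>v. \<mu> i * v $ i)) (at (?u 0))"
        by (rule has_derivative_eq_rhs[OF cdiff_has_derivative[OF cdY]]) (use exhaust_2[of i] in \<open>auto simp: u0 diag\<close>)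
      have du: "(?u has_derivative (\<lambda>v. \<chi> k. pd 1 (\<lambda>z. ?u z $ k) 0 * v $ 1 + pd 2 (\<lambda>z. ?u z $ k) 0 * v $ 2)) (at 0)"
        by (rule cdiff_map_has_derivative[OF cdu])
      have dYu: "((\<lambda>z. Y \<kappa> (?u z) $ i) has_derivative (\<lambda>v. (\<mu> i * pd 1 (\<lambda>z. ?u z $ i) 0) * v $ 1 + (\<mu> i * pd 2 (\<lambda>z. ?u z $ i) 0) * v $ 2)) (at 0)"
        by (rule has_derivative_eq_rhs[OF has_derivative_compose[OF du dY]]) (simp add: fun_eq_iff algebra_simps)
      have "pd 2 (pd 1 (\<psi> i)) (vec2 t 0) = deriv (\<lambda>s. Y \<kappa> (?u (0 + s *s ?v)) $ i) 0"
        unfolding pd_def[of 2 "pd 1 (\<psi> i)"] by (rule deriv_cong_ev[OF eq refl])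
      also have "\<dots> = pd j (\<lambda>z. Y \<kappa> (?u z) $ i) 0" by (simp add: pd_def)
      also have "\<dots> = \<mu> i * pd j (\<lambda>z. ?u z $ i) 0"
        using cdiff_unique[OF dYu] exhaust_2[of j] by auto
      finally show ?thesis by (simp add: e_def)
    qed
    ultimately show ?thesis using e\<psi> by simp
  qed
  have "((\<lambda>t. e i t * exp (- \<mu> i * t)) has_field_derivative 0) (at t)" for t
    by (auto intro!: derivative_eq_intros de simp: algebra_simps)
  hence "e i t * exp (- \<mu> i * t) = e i 0 * exp (- \<mu> i * 0)" by (rule deriv_zero_const)
  moreover have "e i 0 = (if i = j then 1 else 0)"
  proof -
    have "\<forall>\<^sub>F z in nhds 0. snd \<kappa> (flow 0 (param \<kappa> z)) $ i = z $ i"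
      using eventually_nhds_in_open[OF img_open[OF \<kappa>] img0]
    proof eventually_elim
      case (elim z)
      thus ?case using chart_sub[OF \<kappa>] param_in[OF elim] by (auto simp: flow_0 chart_param[OF elim])
    qed
    from pd_cong[OF this] have "e i 0 = pd j (\<lambda>z. z $ i) 0" by (simp add: e_def)
    also have "\<dots> = (if i = j then 1 else 0)"
    proof -
      have "((\<lambda>z::complex^2. z $ i) has_derivative (\<lambda>v. (if i = 1 then 1 else 0) * v $ 1 + (if i = 2 then 1 else 0) * v $ 2)) (at 0)"
        by (rule has_derivative_eq_rhs[OF bounded_linear_imp_has_derivative[OF bounded_linear_vec_nth]])
           (use exhaust_2[of i] in auto)
      from cdiff_unique[OF this] show ?thesis using exhaust_2[of j] by auto
    qed
    finally show ?thesis .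
  qed
  ultimately have "e i t = (if i = j then 1 else 0) * exp (\<mu> i * t)"
    by (simp add: exp_minus field_simps split: if_splits)
  thus ?thesis by (simp add: e_def)
qed

end

section \<open>Periodicity near the singularity and averaged coordinates\<close>

context diagonal_point
begin

lemma chart_flow_open: "openin N {q \<in> topspace N. flow t q \<in> fst \<kappa>}"
  by (rule openin_continuous_map_preimage[OF flow_map_continuous chart_open[OF \<kappa>]])

text \<open>The germ lemma is applied with \<open>G\<close> the time-\<open>T\<close> map, tangent
  to the identity because \<open>exp (\<mu> i * T) = 1\<close>, and \<open>C\<close> the map of time
  \<open>t0 = - 1 / m\<close>, whose linear part has the entries \<open>exp (- 1)\<close> and
  \<open>exp (- \<nu>)\<close>. Maps of one flow commute. Orbits may leave the chart in between;
  only their end points have to lie in it, which is how \<open>S\<close> is defined.\<close>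

lemma flow_periodic_near:
  fixes m T :: complex and \<nu> :: real
  assumes m: "m \<noteq> 0" "\<mu> 1 = m" "\<mu> 2 = m * of_real \<nu>" and \<nu>: "\<nu> \<ge> 1"
    and T: "\<And>i. exp (\<mu> i * T) = 1"
    and res: "(\<forall>n::nat. n \<ge> 2 \<longrightarrow> \<nu> \<noteq> n) \<or>
       (\<exists>k h. k > 0 \<and> (\<forall>\<^sub>F w in at (0::complex). h w \<in> img \<kappa> \<and> flow T (param \<kappa> (h w)) = param \<kappa> (h w)) \<and>
          ((\<lambda>w. h w $ 1 / w ^ k) \<longlongrightarrow> 1) (at 0) \<and> ((\<lambda>w. h w $ 2 / w ^ k) \<longlongrightarrow> 0) (at 0))"
  shows "\<exists>d>0. ball 0 d \<subseteq> img \<kappa> \<and> (\<forall>z\<in>ball 0 d. flow T (param \<kappa> z) = param \<kappa> z)"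
proof -
  define t0 where "t0 = - 1 / m"
  define G where "G z = snd \<kappa> (flow T (param \<kappa> z))" for z
  define C where "C z = snd \<kappa> (flow t0 (param \<kappa> z))" for z
  define V where "V = {q \<in> topspace N. flow T q \<in> fst \<kappa>} \<inter> {q \<in> topspace N. flow t0 q \<in> fst \<kappa>}"
  define S where "S = {z \<in> img \<kappa>. param \<kappa> z \<in> V}"
  have "open S" unfolding S_def V_def by (intro param_preimage_open[OF \<kappa>] openin_Int chart_flow_open)
  have Ssub: "S \<subseteq> img \<kappa>" by (auto simp: S_def)
  have S0: "0 \<in> S" by (simp add: S_def V_def img0 param0 flow_p pN p)
  have "\<exists>d>0. ball 0 d \<subseteq> S \<and> (\<forall>z\<in>ball 0 d. G z = z)"
  proof (rule commuting_germ_identity[where C=C and \<nu>=\<nu>])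
    show "holomorphic_fun2 S (\<lambda>z. G z $ i)" "holomorphic_fun2 S (\<lambda>z. C z $ i)" for i
      unfolding G_def C_def by (rule holomorphic_fun2_subset[OF flow_coordinate_holomorphic \<open>open S\<close> Ssub])+
    show "G 0 = 0" "C 0 = 0" by (simp_all add: G_def C_def param0 flow_p z0)
    show "pd j (\<lambda>z. G z $ i) 0 = (if i = j then 1 else 0)" for i j
      unfolding G_def by (simp add: flow_linear_part T)
    show "pd 1 (\<lambda>z. C z $ 1) 0 = exp (- 1)" "pd 2 (\<lambda>z. C z $ 1) 0 = 0" "pd 1 (\<lambda>z. C z $ 2) 0 = 0" "pd 2 (\<lambda>z. C z $ 2) 0 = exp (- of_real \<nu>)"
      unfolding C_def flow_linear_part using m by (simp_all add: t0_def)
    show "G (C z) = C (G z)" if "z \<in> S" for z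
    proof -
      have q: "param \<kappa> z \<in> topspace N" "flow T (param \<kappa> z) \<in> fst \<kappa>" "flow t0 (param \<kappa> z) \<in> fst \<kappa>"
        using that by (auto simp: S_def V_def)
      show ?thesis using q by (simp add: G_def C_def param_chart[OF \<kappa>] flow_add add.commute)
    qed
    show "(\<forall>n::nat. n \<ge> 2 \<longrightarrow> \<nu> \<noteq> n) \<or> (\<exists>k h. k > 0 \<and> (\<forall>\<^sub>F w in at (0::complex). G (h w) = h w) \<and>
          ((\<lambda>w. h w $ 1 / w ^ k) \<longlongrightarrow> 1) (at 0) \<and> ((\<lambda>w. h w $ 2 / w ^ k) \<longlongrightarrow> 0) (at 0))"
      using res
    proof (elim disjE exE conjE)
      fix k h assume k: "k > (0::nat)" and ev: "\<forall>\<^sub>F w in at (0::complex). h w \<in> img \<kappa> \<and> flow T (param \<kappa> (h w)) = param \<kappa> (h w)"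
        and l: "((\<lambda>w. h w $ 1 / w ^ k) \<longlongrightarrow> 1) (at 0)" "((\<lambda>w. h w $ 2 / w ^ k) \<longlongrightarrow> 0) (at 0)"
      have "\<forall>\<^sub>F w in at (0::complex). G (h w) = h w"
        using ev by (rule eventually_mono) (simp add: G_def chart_param)
      thus ?thesis using k l by blast
    qed blast
  qed (use S0 \<nu> in auto)
  then obtain d where d: "d > 0" "ball 0 d \<subseteq> S" "\<And>z. z \<in> ball 0 d \<Longrightarrow> G z = z" by blast
  have "flow T (param \<kappa> z) = param \<kappa> z" if "z \<in> ball 0 d" for z
  proof -
    have "flow T (param \<kappa> z) \<in> fst \<kappa>" using d(2) that by (auto simp: S_def V_def)
    from param_chart[OF \<kappa> this] show ?thesis using d(3)[OF that] by (simp add: G_def)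
  qed
  thus ?thesis using d Ssub by blast
qed

text \<open>Averaging the coordinates over one period, twisted by the linear flow, yields eigenfunctions.\<close>

definition avg :: "complex \<Rightarrow> 2 \<Rightarrow> 'a \<Rightarrow> complex" where
  "avg T i q = integral {0..1} (\<lambda>\<tau>. exp (- \<mu> i * (of_real \<tau> * T)) * snd \<kappa> (flow (of_real \<tau> * T) q) $ i)"

lemma avg_deriv:
  assumes \<kappa>': "\<kappa>' \<in> \<A>" and U: "R > 0" "\<And>s. s \<in> ball 0 R \<Longrightarrow> z + s *s v \<in> img \<kappa>'"
  shows "((\<lambda>s. avg T i (param \<kappa>' (z + s *s v))) has_field_derivative
      integral {0..1} (\<lambda>\<tau>. exp (- \<mu> i * (of_real \<tau> * T)) *
        pd 2 (\<lambda>w. snd \<kappa> (flow (w $ 1) (param \<kappa>' (z + w $ 2 *s v))) $ i) (vec2 (of_real \<tau> * T) 0))) (at 0)"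
proof -
  let ?g = "\<lambda>w :: complex^2. snd \<kappa> (flow (w $ 1) (param \<kappa>' (z + w $ 2 *s v))) $ i"
  have "((\<lambda>s. integral {0..1} (\<lambda>\<tau>. exp (- \<mu> i * (of_real \<tau> * T)) * ?g (vec2 (of_real \<tau> * T) s))) has_field_derivative
           integral {0..1} (\<lambda>\<tau>. exp (- \<mu> i * (of_real \<tau> * T)) * pd 2 ?g (vec2 (of_real \<tau> * T) 0))) (at 0)"
  proof (rule param_integral_derivative[where U="ball 0 R"])
    show "holomorphic_fun2 {w. w $ 2 \<in> ball 0 R} ?g" by (rule flow_joint_holomorphic[OF global \<kappa>' open_ball U(2)])
    show "continuous_on {0..1} (\<lambda>\<tau>. exp (- \<mu> i * (of_real \<tau> * T)))" by (intro continuous_intros)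
  qed (use U(1) in \<open>auto simp: vec2_nth\<close>)
  thus ?thesis by (simp add: avg_def)
qed

text \<open>The integrand is continuous jointly in time and point, and Leibniz's rule differentiates
  along each complex line; Osgood's lemma turns this into holomorphy.\<close>

lemma avg_holomorphic: "avg T i \<in> holomorphic_functions \<A>"
  unfolding holomorphic_functions_iff
proof
  fix q assume "q \<in> topspace N"
  then obtain \<kappa>' where \<kappa>': "\<kappa>' \<in> \<A>" "q \<in> fst \<kappa>'" using chart_at by blast
  have "holomorphic_fun2 (img \<kappa>') (\<lambda>z. avg T i (param \<kappa>' z))"
  proof (rule osgood)
    show "open (img \<kappa>')" by (rule img_open[OF \<kappa>'(1)])
    let ?P = "img \<kappa>' \<times> cbox 0 (1::real)"
    have 1: "continuous_map (top_of_set ?P) N (\<lambda>p. param \<kappa>' (fst p))"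
    proof -
      have "continuous_map (top_of_set ?P) (top_of_set (img \<kappa>')) fst"
        by (auto simp: continuous_map_in_subtopology intro!: continuous_intros)
      from continuous_map_compose[OF this param_continuous[OF \<kappa>'(1)]] show ?thesis by (simp add: comp_def)
    qed
    have "continuous_map (top_of_set ?P) (prod_topology euclidean N) (\<lambda>p. (of_real (snd p) * T, param \<kappa>' (fst p)))"
      by (intro continuous_map_pairedI 1) (auto intro!: continuous_intros)
    from continuous_map_compose[OF this continuous_map_compose[OF flow_continuous holomorphic_continuous_map[OF global[of i]]]]
    have "continuous_on ?P (\<lambda>p. snd \<kappa> (flow (of_real (snd p) * T) (param \<kappa>' (fst p))) $ i)" by (simp add: comp_def)
    moreover have "continuous_on ?P (\<lambda>p. exp (- \<mu> i * (of_real (snd p) * T)))" by (intro continuous_intros)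
    ultimately have "continuous_on ?P (\<lambda>p. exp (- \<mu> i * (of_real (snd p) * T)) * snd \<kappa> (flow (of_real (snd p) * T) (param \<kappa>' (fst p))) $ i)"
      by (rule continuous_on_mult[rotated])
    hence "continuous_on ?P (\<lambda>(z, \<tau>). exp (- \<mu> i * (of_real \<tau> * T)) * snd \<kappa> (flow (of_real \<tau> * T) (param \<kappa>' z)) $ i)"
      by (simp only: case_prod_beta')
    from integral_continuous_on_param[OF this] show "continuous_on (img \<kappa>') (\<lambda>z. avg T i (param \<kappa>' z))"
      by (simp add: avg_def)
    fix z j assume "z \<in> img \<kappa>'"
    then obtain R where R: "R > 0" "ball z R \<subseteq> img \<kappa>'" using img_open[OF \<kappa>'(1)] open_contains_ball by blast
    have "z + s *s axis j 1 \<in> img \<kappa>'" if "s \<in> ball 0 R" for s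
      using R(2) smult_in_ball[of s R "axis j 1" z] that by (auto simp: norm_axis_1)
    from avg_deriv[OF \<kappa>'(1) R(1) this] show "(\<lambda>s. avg T i (param \<kappa>' (z + s *s axis j 1))) field_differentiable at 0"
      by (auto simp: field_differentiable_def)
  qed
  thus "mdiff (avg T i) q" using \<kappa>' chart_in[OF \<kappa>'(2)] by (auto simp: mdiff_def holomorphic_fun2_iff)
qed

text \<open>The twist cancels the factor \<open>exp (\<mu> i * t)\<close> of the linearized flow, so
  the differentiated integrand is constant and the averaged coordinates are tangent to the original
  ones.\<close>

lemma avg_linear_part: "pd j (\<lambda>z. avg T i (param \<kappa> z)) 0 = (if i = j then 1 else 0)"
proof -
  obtain R where R: "R > 0" "ball 0 R \<subseteq> img \<kappa>" using ball_in_img by blast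
  have inR: "0 + s *s axis j 1 \<in> img \<kappa>" if "s \<in> ball 0 R" for s
    using R(2) smult_in_ball[of s R "axis j 1" 0] that by (auto simp: norm_axis_1)
  have "pd 2 (\<lambda>w. snd \<kappa> (flow (w $ 1) (param \<kappa> (0 + w $ 2 *s axis j 1))) $ i) (vec2 t 0) = (if i = j then exp (\<mu> i * t) else 0)" for t
    using flow_linear_part[of j t i] by (simp add: pd_def)
  hence "(\<lambda>\<tau>. exp (- \<mu> i * (of_real \<tau> * T)) * pd 2 (\<lambda>w. snd \<kappa> (flow (w $ 1) (param \<kappa> (0 + w $ 2 *s axis j 1))) $ i) (vec2 (of_real \<tau> * T) 0)) =
     (\<lambda>\<tau>::real. if i = j then 1 else 0)"
    by (simp add: fun_eq_iff exp_add[symmetric])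
  with avg_deriv[OF \<kappa> R(1) inR, of T i] have "((\<lambda>s. avg T i (param \<kappa> (0 + s *s axis j 1))) has_field_derivative (if i = j then 1 else 0)) (at 0)"
    by simp
  thus ?thesis by (simp add: pd_def DERIV_imp_deriv)
qed

text \<open>The twisted coordinate \<open>k\<close> is an entire \<open>T\<close>-periodic function
  of time, and \<open>avg T i (flow t q)\<close> is, up to a factor, its mean over the segment from
  \<open>t\<close> to \<open>t + T\<close>. With a primitive \<open>K\<close> this mean is
  \<open>(K (T + t) - K t) / T\<close>, whose derivative vanishes by periodicity; so complex shifts
  \<open>t\<close> in any direction are covered.\<close>

lemma avg_equivariant:
  assumes T: "exp (\<mu> i * T) = 1" "T \<noteq> 0" and q: "q \<in> topspace N" "flow T q = q"
  shows "avg T i (flow t q) = exp (\<mu> i * t) * avg T i q"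
proof -
  define k where "k t = exp (- \<mu> i * t) * snd \<kappa> (flow t q) $ i" for t
  have holk: "k holomorphic_on UNIV" unfolding k_def
    by (intro holomorphic_intros flow_fun_holomorphic[OF global q(1)])
  obtain K where K: "\<And>t. (K has_field_derivative k t) (at t)"
    using holomorphic_convex_primitive'[OF convex_UNIV open_UNIV holk] by auto
  have per: "k (T + t) = k t" for t
  proof -
    have "flow (T + t) q = flow t q" using flow_add[OF q(1), of t T] q(2) by (simp add: add.commute)
    moreover have "exp (- \<mu> i * (T + t)) = exp (- \<mu> i * t)" using T(1) by (simp add: distrib_left exp_diff exp_minus inverse_eq_divide)
    ultimately show ?thesis by (simp add: k_def)
  qed
  define P where "P t = (K (T + t) - K t) / T" for t
  have "(P has_field_derivative 0) (at t)" for t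
  proof -
    have "((\<lambda>t. K (T + t)) has_field_derivative k (T + t) * 1) (at t)"
      by (rule DERIV_chain2[OF K]) (auto intro!: derivative_eq_intros)
    from DERIV_cdivide[OF DERIV_diff[OF this K], of T] show ?thesis unfolding P_def by (simp add: per)
  qed
  hence Pc: "P t = P 0" by (rule deriv_zero_const)
  have int: "exp (- \<mu> i * t) * avg T i (flow t q) = P t" for t
  proof -
    have "((\<lambda>\<tau>::real. k (of_real \<tau> * T + t)) has_integral (K (of_real 1 * T + t) / T - K (of_real 0 * T + t) / T)) {0..1}"
    proof (rule fundamental_theorem_of_calculus)
      fix \<tau> :: real
      have "((\<lambda>s. s * T + t) has_field_derivative T) (at (of_real \<tau>))" by (auto intro!: derivative_eq_intros)
      from DERIV_cdivide[OF DERIV_chain2[OF K this], of T]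
      have "((\<lambda>s. K (s * T + t) / T) has_field_derivative k (of_real \<tau> * T + t)) (at (of_real \<tau>))" using T(2) by simp
      from has_vector_derivative_real_field[OF this]
      show "((\<lambda>\<tau>::real. K (of_real \<tau> * T + t) / T) has_vector_derivative k (of_real \<tau> * T + t)) (at \<tau> within {0..1})"
        by (simp add: comp_def)
    qed simp
    hence "integral {0..1} (\<lambda>\<tau>::real. k (of_real \<tau> * T + t)) = P t"
      by (simp add: integral_unique P_def diff_divide_distrib)
    moreover have "k (of_real \<tau> * T + t) = exp (- \<mu> i * t) * (exp (- \<mu> i * (of_real \<tau> * T)) * snd \<kappa> (flow (of_real \<tau> * T) (flow t q)) $ i)" for \<tau>
    proof -
      have "exp (- \<mu> i * (of_real \<tau> * T + t)) = exp (- \<mu> i * t) * exp (- \<mu> i * (of_real \<tau> * T))"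
        unfolding exp_add[symmetric] by (simp add: algebra_simps)
      thus ?thesis unfolding k_def flow_add[OF q(1)] by (simp only: mult.assoc)
    qed
    ultimately show ?thesis by (simp add: avg_def)
  qed
  have "exp (- \<mu> i * t) * avg T i (flow t q) = avg T i q"
    using int[of t] int[of 0] Pc by (simp add: flow_0[OF q(1)])
  hence "exp (\<mu> i * t) * (exp (- \<mu> i * t) * avg T i (flow t q)) = exp (\<mu> i * t) * avg T i q" by simp
  thus ?thesis by (simp add: mult.assoc[symmetric] exp_add[symmetric])
qed

lemma avg_p: "avg T i p = 0"
  by (simp add: avg_def flow_p z0)

end

section \<open>Global linearization\<close>

lemma periodic_int_shift:
  fixes g :: "complex \<Rightarrow> 'b"
  assumes "\<And>t. g (t + T) = g t" shows "g (t + of_int n * T) = g t"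
proof -
  have nat: "g (t + of_nat n * T) = g t" for t and n :: nat
  proof (induction n)
    case (Suc n)
    have "g (t + of_nat (Suc n) * T) = g ((t + of_nat n * T) + T)" by (simp add: algebra_simps)
    thus ?case using Suc assms by simp
  qed simp
  show ?thesis
  proof (cases "n \<ge> 0")
    case True thus ?thesis using nat[of t "nat n"] by simp
  next
    case False
    thus ?thesis using nat[of "t + of_int n * T" "nat (- n)"] by (simp add: algebra_simps)
  qed
qed

text \<open>In the remaining strip, translation by multiples of \<open>T\<close> reaches a compact
  rectangle. The lower edge -1 is chosen so that the image disc under
  \<open>exp (2 * pi * \<i> * t / T)\<close> has radius \<open>exp (2 * pi) > 1\<close> and contains
  the closed unit disc.\<close>

lemma periodic_bounded:
  fixes g :: "complex \<Rightarrow> complex"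
  assumes T: "T \<noteq> 0" and cont: "continuous_on UNIV g" and per: "\<And>t. g (t + T) = g t"
    and bd: "\<And>t. Im (t / T) \<ge> b1 \<Longrightarrow> norm (g t) \<le> B"
  shows "\<exists>C. \<forall>t. Im (t / T) > - 1 \<longrightarrow> norm (g t) \<le> C"
proof -
  define K where "K = (\<lambda>(a, b). T * Complex a b) ` ({0..1} \<times> {-1..b1})"
  have "compact K" unfolding K_def
    by (intro compact_continuous_image compact_Times)
       (auto simp: case_prod_beta' Complex_eq intro!: continuous_intros)
  hence "bounded (g ` K)" by (intro compact_imp_bounded compact_continuous_image continuous_on_subset[OF cont]) auto
  then obtain C where C: "\<And>t. t \<in> K \<Longrightarrow> norm (g t) \<le> C" unfolding bounded_iff by auto
  have "norm (g t) \<le> max B C" if t: "Im (t / T) > - 1" for t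
  proof (cases "Im (t / T) \<ge> b1")
    case True thus ?thesis using bd[of t] by simp
  next
    case False
    define n where "n = \<lfloor>Re (t / T)\<rfloor>"
    define s where "s = t + of_int (- n) * T"
    have sT: "s / T = t / T - of_int n" using T by (simp add: s_def field_simps)
    have "s \<in> K" unfolding K_def
    proof (rule image_eqI[where x="(Re (s / T), Im (s / T))"])
      show "s = (case (Re (s / T), Im (s / T)) of (a, b) \<Rightarrow> T * Complex a b)" using T by (simp add: complex_eq)
      have "Re (s / T) = Re (t / T) - of_int n" unfolding sT by simp
      hence "0 \<le> Re (s / T)" "Re (s / T) \<le> 1" using floor_correct[of "Re (t / T)"] unfolding n_def by linarith+
      moreover have "- 1 \<le> Im (s / T)" "Im (s / T) \<le> b1" unfolding sT using t False by auto
      ultimately show "(Re (s / T), Im (s / T)) \<in> {0..1} \<times> {-1..b1}" by simp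
    qed
    moreover have "g s = g t" unfolding s_def by (rule periodic_int_shift[where g=g and T=T, OF per])
    ultimately show ?thesis using C[of s] by simp
  qed
  thus ?thesis by blast
qed

text \<open>The local data from which the global linearization grows: time \<open>T\<close> is the
  identity near \<open>p\<close>, and \<open>E\<close> inverts the averaged coordinates on a
  polydisc. Since \<open>m * (\<i> * T) = - 2 * pi * c\<close> with \<open>c > 0\<close>, positive
  multiples of \<open>\<i> * T\<close> contract. The closed ball of radius \<open>d\<close> lies in
  the chart in order to bound holomorphic functions near \<open>p\<close>.\<close>

locale linear_patch = diagonal_point +
  fixes m T :: complex and \<nu> :: real and c :: nat and d r :: real and E :: "complex^2 \<Rightarrow> complex^2"
  assumes stein: "stein_surface N \<A>" and conn: "connected_space N"
    and m: "m \<noteq> 0" "\<mu> 1 = m" "\<mu> 2 = m * of_real \<nu>" and \<nu>: "\<nu> \<ge> 1"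
    and c: "c > 0" and T: "T = 2 * pi * \<i> * of_nat c / m" and expT: "\<And>i. exp (\<mu> i * T) = 1"
    and d: "d > 0" "cball 0 d \<subseteq> img \<kappa>" "\<And>z. z \<in> ball 0 d \<Longrightarrow> flow T (param \<kappa> z) = param \<kappa> z"
    and r: "r > 0" and E: "\<And>w. w \<in> polydisc r \<Longrightarrow> E w \<in> ball 0 d"
      "\<And>w i. w \<in> polydisc r \<Longrightarrow> avg T i (param \<kappa> (E w)) = w $ i"
      "\<And>z. z \<in> ball 0 d \<Longrightarrow> (\<chi> i. avg T i (param \<kappa> z)) \<in> polydisc r \<Longrightarrow> E (\<chi> i. avg T i (param \<kappa> z)) = z"
      "\<And>i. holomorphic_fun2 (polydisc r) (\<lambda>w. E w $ i)"
begin

section \<open>Averaged coordinates near the singularity and its basin\<close>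

lemma T0: "T \<noteq> 0" using m c by (simp add: T)

definition F :: "'a \<Rightarrow> complex^2" where "F q = (\<chi> i. avg T i q)"

definition Lam :: "complex \<Rightarrow> complex^2 \<Rightarrow> complex^2" where
  "Lam t w = (\<chi> i. exp (\<mu> i * t) * w $ i)"

definition Z :: "(complex^2) set" where "Z = {z \<in> ball 0 d. F (param \<kappa> z) \<in> polydisc r}"

definition U0 :: "'a set" where "U0 = {q \<in> fst \<kappa>. snd \<kappa> q \<in> Z}"

definition Einv :: "complex^2 \<Rightarrow> 'a" where "Einv w = param \<kappa> (E w)"

text \<open>The basin of \<open>p\<close>. By \<open>U0_forward\<close> an orbit that is in
  \<open>U0\<close> at time \<open>t\<close> is there at all times \<open>t'\<close> with
  \<open>Re (m * t') \<le> Re (m * t)\<close>, and it tends to \<open>p\<close> as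
  \<open>Re (m * t')\<close> decreases to minus infinity; so one visit suffices.\<close>

definition A0 :: "'a set" where "A0 = {q \<in> topspace N. \<exists>t. flow t q \<in> U0}"

lemma F_holomorphic: "(\<lambda>q. F q $ i) \<in> holomorphic_functions \<A>"
  using avg_holomorphic by (simp add: F_def)

lemma Fp: "F p = 0" by (simp add: F_def avg_p vec_eq_iff)

lemma F_flow: "q \<in> topspace N \<Longrightarrow> flow T q = q \<Longrightarrow> F (flow t q) = Lam t (F q)"
  by (simp add: F_def Lam_def vec_eq_iff avg_equivariant[OF expT T0])

lemma Lam_add: "Lam s (Lam t w) = Lam (s + t) w"
  by (simp add: Lam_def vec_eq_iff exp_add distrib_left)

lemma Lam_0: "Lam 0 w = w" by (simp add: Lam_def vec_eq_iff)

lemma d_img: "ball 0 d \<subseteq> img \<kappa>" using d(2) ball_subset_cball by blast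

lemma open_Z: "open Z"
proof -
  have "continuous_on (ball 0 d) (\<lambda>z. \<chi> i. avg T i (param \<kappa> z))"
    by (intro continuous_on_vec_lambda continuous_on_subset[OF holomorphic_fun2_imp_continuous_on[OF holomorphic_in_chart[OF avg_holomorphic \<kappa>]] d_img])
  hence "continuous_on (ball 0 d) (\<lambda>z. F (param \<kappa> z))" by (simp add: F_def)
  from continuous_open_preimage[OF this open_ball open_polydisc]
  have "open (ball 0 d \<inter> (\<lambda>z. F (param \<kappa> z)) -` polydisc r)" .
  moreover have "ball 0 d \<inter> (\<lambda>z. F (param \<kappa> z)) -` polydisc r = Z" by (auto simp: Z_def)
  ultimately show ?thesis by simp
qed

lemma U0_open: "openin N U0" unfolding U0_def by (rule chart_preimage_open[OF \<kappa> open_Z])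

lemma U0_sub: "U0 \<subseteq> topspace N" using U0_open openin_subset by blast

lemma Einv_U0: "w \<in> polydisc r \<Longrightarrow> Einv w \<in> U0" and F_Einv: "w \<in> polydisc r \<Longrightarrow> F (Einv w) = w"
proof -
  assume w: "w \<in> polydisc r"
  show FE: "F (Einv w) = w" using E(2)[OF w] by (simp add: F_def Einv_def vec_eq_iff)
  have "E w \<in> img \<kappa>" using E(1)[OF w] d_img by blast
  thus "Einv w \<in> U0" using E(1)[OF w] FE w by (simp add: U0_def Z_def Einv_def param_in chart_param)
qed

lemma Einv_F: "q \<in> U0 \<Longrightarrow> Einv (F q) = q" and F_U0: "q \<in> U0 \<Longrightarrow> F q \<in> polydisc r"
  and U0_fixed: "q \<in> U0 \<Longrightarrow> flow T q = q"
proof -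
  assume q: "q \<in> U0"
  define z where "z = snd \<kappa> q"
  have qz: "param \<kappa> z = q" using q param_chart[OF \<kappa>] by (simp add: z_def U0_def)
  have z: "z \<in> ball 0 d" "F q \<in> polydisc r" using q qz by (auto simp: U0_def Z_def z_def)
  show "F q \<in> polydisc r" by fact
  show "flow T q = q" using d(3)[OF z(1)] qz by simp
  show "Einv (F q) = q" using E(3)[OF z(1)] z(2) qz by (simp add: F_def Einv_def)
qed

lemma E_continuous: "continuous_on (polydisc r) E"
proof -
  have "continuous_on (polydisc r) (\<lambda>w. \<chi> i. E w $ i)"
    by (intro continuous_on_vec_lambda holomorphic_fun2_imp_continuous_on E(4))
  thus ?thesis by simp
qed

lemma Einv_continuous: "continuous_map (top_of_set (polydisc r)) N Einv"
proof -
  have "continuous_map (top_of_set (polydisc r)) (top_of_set (img \<kappa>)) E"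
    using E_continuous E(1) d_img by (auto simp: continuous_map_in_subtopology)
  from continuous_map_compose[OF this param_continuous[OF \<kappa>]] show ?thesis by (simp add: comp_def Einv_def[abs_def])
qed

text \<open>Since \<open>\<nu> \<ge> 1\<close>, the second coordinate contracts at least as fast as
  the first; the one rate \<open>exp (Re (m * t))\<close> serves both.\<close>

lemma norm_exp_mu: "Re (m * t) \<le> 0 \<Longrightarrow> norm (exp (\<mu> i * t)) \<le> exp (Re (m * t))"
proof -
  assume t: "Re (m * t) \<le> 0"
  have "Re (m * of_real \<nu> * t) = \<nu> * Re (m * t)" by (simp add: algebra_simps)
  moreover have "\<nu> * Re (m * t) \<le> 1 * Re (m * t)" using t \<nu> by (intro mult_right_mono_neg) auto
  ultimately have "Re (\<mu> i * t) \<le> Re (m * t)" using exhaust_2[of i] m by auto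
  thus ?thesis by (simp add: norm_exp_eq_Re)
qed

lemma Lam_nth_le: "Re (m * t) \<le> 0 \<Longrightarrow> norm (Lam t w $ i) \<le> exp (Re (m * t)) * norm (w $ i)"
  using mult_right_mono[OF norm_exp_mu, of t "norm (w $ i)" i] by (simp add: Lam_def norm_mult)

lemma Lam_polydisc:
  assumes w: "w \<in> polydisc r" and t: "Re (m * t) \<le> 0" shows "Lam t w \<in> polydisc r"
proof -
  have "norm (Lam t w $ i) \<le> norm (w $ i)" for i
  proof -
    have "exp (Re (m * t)) * norm (w $ i) \<le> 1 * norm (w $ i)" using t by (intro mult_right_mono) auto
    thus ?thesis using Lam_nth_le[OF t, of w i] by linarith
  qed
  thus ?thesis using w by (auto simp: polydisc_def intro: order_le_less_trans)
qed

lemma Lam_continuous: "continuous_on A (\<lambda>t. Lam t w)"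
  unfolding Lam_def by (intro continuous_on_vec_lambda continuous_intros)

text \<open>On the half-plane \<open>H\<close> of contracting times the orbit is in
  \<open>U0\<close> exactly when it equals the candidate \<open>Einv (Lam t (F q))\<close>. The
  former condition is open, the latter is closed since \<open>N\<close> is Hausdorff, and
  \<open>H\<close> is convex and contains 0.\<close>

lemma U0_forward:
  assumes q: "q \<in> U0" and t: "Re (m * t) \<le> 0"
  shows "flow t q \<in> U0"
proof -
  define H where "H = {t. Re (m * t) \<le> 0}"
  have qN: "q \<in> topspace N" using q U0_sub by blast
  have eq: "flow t q \<in> U0 \<longleftrightarrow> flow t q = Einv (Lam t (F q))" if "t \<in> H" for t
  proof
    assume "flow t q \<in> U0"
    from Einv_F[OF this] show "flow t q = Einv (Lam t (F q))" by (simp add: F_flow[OF qN U0_fixed[OF q]])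
  next
    assume *: "flow t q = Einv (Lam t (F q))"
    have "Lam t (F q) \<in> polydisc r" using Lam_polydisc[OF F_U0[OF q]] that by (simp add: H_def)
    thus "flow t q \<in> U0" unfolding * by (rule Einv_U0)
  qed
  define J where "J = {t \<in> H. flow t q \<in> U0}"
  have "convex H"
  proof (rule convexI)
    fix x y u v assume "x \<in> H" "y \<in> H" "0 \<le> u" "0 \<le> v" "u + v = (1::real)"
    moreover have "Re (m * (u *\<^sub>R x + v *\<^sub>R y)) = u * Re (m * x) + v * Re (m * y)"
      by (simp add: algebra_simps)
    ultimately show "u *\<^sub>R x + v *\<^sub>R y \<in> H"
      unfolding H_def mem_Collect_eq by (simp only:) (intro add_nonpos_nonpos mult_nonneg_nonpos)
  qed
  hence cH: "connected H" by (rule convex_connected)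
  have "openin (top_of_set H) J"
    unfolding openin_open J_def using flow_preimage_open[OF qN U0_open] by blast
  moreover have "closedin (top_of_set H) J"
  proof -
    have 1: "continuous_map (top_of_set H) N (\<lambda>t. flow t q)"
      using icurve_subset flow_icurve[OF qN] unfolding integral_curve_def
      by (auto intro: continuous_map_from_subtopology)
    have "continuous_map (top_of_set H) (top_of_set (polydisc r)) (\<lambda>t. Lam t (F q))"
      using Lam_continuous Lam_polydisc[OF F_U0[OF q]] by (auto simp: continuous_map_in_subtopology H_def)
    from continuous_map_compose[OF this Einv_continuous]
    have 2: "continuous_map (top_of_set H) N (\<lambda>t. Einv (Lam t (F q)))" by (simp add: comp_def)
    have "closedin (top_of_set H) {t \<in> topspace (top_of_set H). flow t q = Einv (Lam t (F q))}"
      by (rule closedin_continuous_maps_eq[OF hausdorff 1 2])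
    moreover have "{t \<in> topspace (top_of_set H). flow t q = Einv (Lam t (F q))} = J" using eq by (auto simp: J_def)
    ultimately show ?thesis by simp
  qed
  moreover have "0 \<in> J" using q by (simp add: J_def H_def flow_0[OF qN])
  ultimately have "J = H" using cH by (auto simp: connected_clopen)
  thus ?thesis using t by (auto simp: J_def H_def)
qed

lemma p_U0: "p \<in> U0"
proof -
  have "F (param \<kappa> 0) \<in> polydisc r" using r by (simp add: param0 Fp polydisc_def)
  thus ?thesis using p d(1) by (simp add: U0_def Z_def z0)
qed

lemma A0_fixed: "q \<in> A0 \<Longrightarrow> flow T q = q"
proof -
  assume "q \<in> A0"
  then obtain t where q: "q \<in> topspace N" "flow t q \<in> U0" by (auto simp: A0_def)
  have "flow T (flow t q) = flow t q" by (rule U0_fixed[OF q(2)])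
  hence "flow (- t) (flow (T + t) q) = flow (- t) (flow t q)" by (simp add: flow_add[OF q(1)])
  thus ?thesis using q(1) by (simp add: flow_add flow_0)
qed

lemma A0_eventually:
  assumes "q \<in> A0" shows "\<exists>R. \<forall>t. Re (m * t) \<le> R \<longrightarrow> flow t q \<in> U0"
proof -
  obtain t0 where q: "q \<in> topspace N" "flow t0 q \<in> U0" using assms by (auto simp: A0_def)
  have "flow t q \<in> U0" if "Re (m * t) \<le> Re (m * t0)" for t
  proof -
    have "flow (t - t0) (flow t0 q) \<in> U0" by (rule U0_forward[OF q(2)]) (use that in \<open>simp add: right_diff_distrib\<close>)
    thus ?thesis by (simp add: flow_add[OF q(1)])
  qed
  thus ?thesis by blast
qed

lemma A0_open: "openin N A0"
proof -
  have "A0 = (\<Union>t. {q \<in> topspace N. flow t q \<in> U0})" by (auto simp: A0_def)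
  thus ?thesis using openin_continuous_map_preimage[OF flow_map_continuous U0_open] by auto
qed

text \<open>Translates the contraction rate \<open>Re (m * t)\<close> into the disc variable:
  strictly contracting times form the half-plane \<open>Im (t / T) > 0\<close>, which
  \<open>exp (2 * pi * \<i> * t / T)\<close> maps into the unit disc.\<close>

lemma Im_T: "Im (t / T) = - Re (m * t) / (2 * pi * c)"
proof -
  have "t / T = - \<i> * (m * t) / of_real (2 * pi * c)" using m c by (simp add: T field_simps)
  hence "Im (t / T) = Im (- \<i> * (m * t) / of_real (2 * pi * c))" by simp
  also have "\<dots> = - Re (m * t) / (2 * pi * c)" unfolding Im_divide_of_real by simp
  finally show ?thesis .
qed

text \<open>At the times \<open>\<i> * T * n\<close> one has
  \<open>m * t = - 2 * pi * c * n\<close>, so the averaged coordinates of the orbit tend to 0, and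
  \<open>E\<close> is continuous there.\<close>

lemma A0_limit:
  assumes q: "q \<in> U0" and f: "f \<in> holomorphic_functions \<A>"
  shows "(\<lambda>n. f (flow (\<i> * T * of_nat n) q)) \<longlonglongrightarrow> f p"
proof -
  have qN: "q \<in> topspace N" using q U0_sub by blast
  define s where "s n = \<i> * T * of_nat n" for n :: nat
  have Res: "Re (m * s n) = - 2 * pi * real c * real n" for n
  proof -
    have "m * s n = of_real (- 2 * pi * real c * real n)" using m by (simp add: s_def T)
    thus ?thesis by (simp only: Re_complex_of_real)
  qed
  have neg: "Re (m * s n) \<le> 0" for n unfolding Res by simp
  have e0: "(\<lambda>n. exp (Re (m * s n))) \<longlonglongrightarrow> 0"
  proof -
    have "exp (Re (m * s n)) = exp (- 2 * pi * real c) ^ n" for n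
    proof -
      have "- 2 * pi * real c * real n = real n * (- 2 * pi * real c)" by simp
      thus ?thesis unfolding Res by (simp only: exp_of_nat_mult)
    qed
    thus ?thesis using c by (simp add: LIMSEQ_realpow_zero)
  qed
  have "(\<lambda>n. Lam (s n) (F q)) \<longlonglongrightarrow> 0"
  proof (rule vec_tendstoI)
    fix i
    have "(\<lambda>n. exp (Re (m * s n)) * norm (F q $ i)) \<longlonglongrightarrow> 0 * norm (F q $ i)" by (intro tendsto_intros e0)
    hence z: "(\<lambda>n. exp (Re (m * s n)) * norm (F q $ i)) \<longlonglongrightarrow> 0" by simp
    have "(\<lambda>n. Lam (s n) (F q) $ i) \<longlonglongrightarrow> 0"
      by (rule Lim_null_comparison[OF _ z]) (use Lam_nth_le[OF neg] in simp)
    thus "(\<lambda>n. Lam (s n) (F q) $ i) \<longlonglongrightarrow> 0 $ i" by simp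
  qed
  moreover have pd0: "0 \<in> polydisc r" using r by (simp add: polydisc_def)
  hence "isCont E 0" using E_continuous open_polydisc by (simp add: continuous_on_eq_continuous_at)
  moreover have E0: "E 0 = 0"
  proof -
    have "(\<chi> i. avg T i (param \<kappa> 0)) = 0" using Fp by (simp add: F_def param0)
    thus ?thesis using E(3)[of 0] d(1) pd0 by simp
  qed
  ultimately have "(\<lambda>n. E (Lam (s n) (F q))) \<longlonglongrightarrow> 0" using isCont_tendsto_compose[of 0 E] by metis
  moreover have "isCont (\<lambda>z. f (param \<kappa> z)) 0"
    using holomorphic_fun2_imp_continuous_on[OF holomorphic_in_chart[OF f \<kappa>]] img_open[OF \<kappa>] img0
    by (simp add: continuous_on_eq_continuous_at)
  ultimately have "(\<lambda>n. f (param \<kappa> (E (Lam (s n) (F q))))) \<longlonglongrightarrow> f (param \<kappa> 0)" by (rule isCont_tendsto_compose[rotated])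
  moreover have "param \<kappa> (E (Lam (s n) (F q))) = flow (s n) q" for n
    using Einv_F[OF U0_forward[OF q neg]] by (simp add: F_flow[OF qN U0_fixed[OF q]] Einv_def)
  ultimately show ?thesis by (simp add: s_def param0)
qed

text \<open>The function \<open>t \<mapsto> f (\<phi>\<^sub>t q)\<close> factors through \<open>w = exp (2 \<pi> i t / T)\<close>; the maximum principle and the
  Schwarz lemma on the unit disc then bound it by its values on one period.\<close>

lemma A0_bound:
  assumes q: "q \<in> A0" and f: "f \<in> holomorphic_functions \<A>"
    and C: "\<And>s. s \<in> {0..1} \<Longrightarrow> norm (f (flow (of_real s * T) q)) \<le> C" and t: "Re (m * t) < 0"
  shows "norm (f (flow t q)) \<le> C" "norm (f (flow t q) - f p) \<le> 2 * (C + 1) * norm (exp (2 * pi * \<i> * t / T))"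
proof -
  have qN: "q \<in> topspace N" using q by (simp add: A0_def)
  define g where "g t = f (flow t q)" for t
  have holg: "g holomorphic_on A" for A unfolding g_def by (rule flow_fun_holomorphic[OF f qN])
  have per: "g (t + T) = g t" for t
    using flow_add[OF qN, of t T] A0_fixed[OF q] by (simp add: g_def)
  obtain R where R: "\<And>t. Re (m * t) \<le> R \<Longrightarrow> flow t q \<in> U0" using A0_eventually[OF q] by blast
  have "\<exists>B. \<forall>x\<in>U0. norm (f x) \<le> B"
  proof -
    have "bounded ((\<lambda>z. f (param \<kappa> z)) ` cball 0 d)"
      using d(2) by (intro compact_imp_bounded compact_continuous_image continuous_on_subset[OF holomorphic_fun2_imp_continuous_on[OF holomorphic_in_chart[OF f \<kappa>]]]) auto
    then obtain B where B: "\<And>z. z \<in> cball 0 d \<Longrightarrow> norm (f (param \<kappa> z)) \<le> B" unfolding bounded_iff by (metis image_eqI)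
    have "norm (f x) \<le> B" if "x \<in> U0" for x
      using B[of "snd \<kappa> x"] that param_chart[OF \<kappa>, of x] by (auto simp: U0_def Z_def)
    thus ?thesis by blast
  qed
  then obtain B where B: "\<And>x. x \<in> U0 \<Longrightarrow> norm (f x) \<le> B" by blast
  have c0: "2 * pi * real c > 0" using c by simp
  have dle: "a / (2 * pi * real c) \<le> b / (2 * pi * real c) \<Longrightarrow> a \<le> b" for a b :: real
    using c0 by (simp add: divide_le_cancel)
  have "norm (g t) \<le> B" if "Im (t / T) \<ge> - R / (2 * pi * c)" for t
  proof -
    have "- R / (2 * pi * c) \<le> - Re (m * t) / (2 * pi * c)" using that by (simp only: Im_T)
    from dle[OF this] have "Re (m * t) \<le> R" by linarith
    thus ?thesis unfolding g_def by (intro B R)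
  qed
  from periodic_bounded[OF T0 holomorphic_on_imp_continuous_on[OF holg] per this]
  obtain C' where C': "\<And>t. Im (t / T) > - 1 \<Longrightarrow> norm (g t) \<le> C'" by blast
  obtain h where h: "h holomorphic_on ball 0 (exp (- 2 * pi * (- 1)))" "\<And>t. Im (t / T) > - 1 \<Longrightarrow> h (exp (2 * pi * \<i> * t / T)) = g t"
    using periodic_factor[OF T0 holg per C'] by blast
  \<comment> \<open>The disc on which \<open>h\<close> is holomorphic has radius
    \<open>exp (2 * pi)\<close>. The unit circle inside it is the image of the times
    \<open>s * T\<close> with \<open>0 \<le> s \<le> 1\<close>, that is of one period of the orbit,
    where \<open>C\<close> is assumed as a bound.\<close>
  have big: "exp (- 2 * pi * (- 1)) > (1::real)" by simp
  have holh: "h holomorphic_on ball 0 1" "continuous_on (cball 0 1) h"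
  proof -
    have "cball 0 1 \<subseteq> ball (0::complex) (exp (- 2 * pi * (- 1)))" using order.strict_trans1[OF _ big] by auto
    hence "h holomorphic_on cball 0 1" by (rule holomorphic_on_subset[OF h(1)])
    thus "h holomorphic_on ball 0 1" "continuous_on (cball 0 1) h"
      using holomorphic_on_subset[of h "cball 0 1" "ball 0 1"] by (auto intro: holomorphic_on_imp_continuous_on)
  qed
  have circ: "norm (h w) \<le> C" if "norm w = 1" for w
  proof -
    define s where "s = Arg2pi w / (2 * pi)"
    have s: "s \<in> {0..1}" using Arg2pi_ge_0[of w] Arg2pi_lt_2pi[of w] by (auto simp: s_def)
    have "2 * pi * \<i> * (of_real s * T) / T = \<i> * of_real (Arg2pi w)" using T0 by (simp add: s_def)
    hence "exp (2 * pi * \<i> * (of_real s * T) / T) = w" using Arg2pi_eq[of w] that by simp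
    moreover have "Im (of_real s * T / T) > - 1" using T0 by simp
    ultimately have "h w = g (of_real s * T)" using h(2)[of "of_real s * T"] by simp
    thus ?thesis using C[OF s] by (simp add: g_def)
  qed
  have disc: "norm (h w) \<le> C" if "norm w \<le> 1" for w
    by (rule maximum_modulus_frontier[of h "cball 0 1"]) (use holh circ that in auto)
  have Cpos: "C \<ge> 0" using order_trans[OF norm_ge_zero circ[of 1]] by simp
  \<comment> \<open>From a time \<open>t1\<close> at which the orbit is in \<open>U0\<close>, moving
    on by \<open>\<i> * T * n\<close> sends the disc variable to 0 and the orbit to
    \<open>p\<close>.\<close>
  have h0: "h 0 = f p"
  proof -
    define t1 where "t1 = of_real (R - 1) / m"
    have t1: "Re (m * t1) \<le> R" using m by (simp add: t1_def)
    define q1 where "q1 = flow t1 q"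
    have q1: "q1 \<in> U0" unfolding q1_def by (rule R[OF t1])
    define tn where "tn n = \<i> * T * of_nat n + t1" for n :: nat
    have 1: "(\<lambda>n. g (tn n)) \<longlonglongrightarrow> f p"
      using A0_limit[OF q1 f] by (simp add: g_def tn_def q1_def flow_add[OF qN])
    have wn: "exp (2 * pi * \<i> * tn n / T) = exp (2 * pi * \<i> * t1 / T) * of_real (exp (- 2 * pi) ^ n)" for n
    proof -
      have "2 * pi * \<i> * tn n / T = 2 * pi * \<i> * t1 / T + of_real (real n * (- 2 * pi))"
        using T0 by (simp add: tn_def field_simps)
      thus ?thesis by (simp only: exp_add exp_of_real exp_of_nat_mult)
    qed
    have w0: "(\<lambda>n. exp (2 * pi * \<i> * tn n / T)) \<longlonglongrightarrow> 0"
    proof -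
      have "(\<lambda>n. exp (- 2 * pi) ^ n) \<longlonglongrightarrow> (0::real)" by (rule LIMSEQ_realpow_zero) auto
      from tendsto_mult_right_zero[OF tendsto_of_real[OF this, unfolded of_real_0]] show ?thesis unfolding wn .
    qed
    have "isCont h 0" using holomorphic_on_imp_continuous_on[OF holh(1)] by (simp add: continuous_on_eq_continuous_at)
    from isCont_tendsto_compose[OF this w0] have 2: "(\<lambda>n. h (exp (2 * pi * \<i> * tn n / T))) \<longlonglongrightarrow> h 0" .
    have Itn: "Im (tn n / T) > - 1" if "n \<ge> nat \<lceil>\<bar>Im (t1 / T)\<bar>\<rceil>" for n
    proof -
      have "tn n / T = \<i> * of_nat n + t1 / T" using T0 by (simp add: tn_def field_simps)
      hence "Im (tn n / T) = real n + Im (t1 / T)" by simp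
      thus ?thesis using that by linarith
    qed
    have "\<forall>\<^sub>F n in sequentially. h (exp (2 * pi * \<i> * tn n / T)) = g (tn n)"
      by (rule eventually_sequentiallyI[of "nat \<lceil>\<bar>Im (t1 / T)\<bar>\<rceil>"]) (rule h(2)[OF Itn])
    from Lim_transform_eventually[OF 2 this] have "(\<lambda>n. g (tn n)) \<longlonglongrightarrow> h 0" .
    from LIMSEQ_unique[OF this 1] show ?thesis .
  qed
  \<comment> \<open>Schwarz's lemma requires values strictly inside the unit disc. The maximum
    principle gives \<open>norm (h w - h 0) \<le> 2 * C\<close>; the denominator
    \<open>2 * (C + 1)\<close> is strictly larger, and nonzero also for
    \<open>C = 0\<close>.\<close>
  define k where "k w = (h w - h 0) / of_real (2 * (C + 1))" for w
  have Schw: "norm (h w - h 0) \<le> 2 * (C + 1) * norm w" if w: "norm w < 1" for w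
  proof -
    have "norm (k w) \<le> norm w"
    proof (rule Schwarz_Lemma(1))
      show "k holomorphic_on ball 0 1" unfolding k_def using Cpos
        by (intro holomorphic_intros holh) (auto simp flip: of_real_add of_real_mult)
      show "k 0 = 0" by (simp add: k_def)
      fix z :: complex assume "norm z < 1"
      hence "norm (h z - h 0) \<le> 2 * C" using norm_triangle_ineq4[of "h z" "h 0"] disc[of z] disc[of 0] by simp
      hence "norm (h z - h 0) < 2 * (C + 1)" by simp
      moreover have "norm (complex_of_real (2 * (C + 1))) = 2 * (C + 1)" using Cpos by (simp only: norm_of_real) simp
      ultimately show "norm (k z) < 1" unfolding k_def norm_divide using Cpos by simp
    qed (use w in auto)
    moreover have "norm (complex_of_real (2 * (C + 1))) = 2 * (C + 1)" using Cpos by (simp only: norm_of_real) simp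
    ultimately have "norm (h w - h 0) / (2 * (C + 1)) \<le> norm w" unfolding k_def norm_divide by (simp only:)
    thus ?thesis using Cpos by (simp add: pos_divide_le_eq mult.commute)
  qed
  have It: "Im (t / T) > 0" unfolding Im_T using t c0 by simp
  let ?w = "exp (2 * pi * \<i> * t / T)"
  have "norm ?w < 1"
  proof -
    have "2 * pi * \<i> * t / T = 2 * pi * \<i> * (t / T)" by simp
    moreover have "Re (2 * pi * \<i> * x) = - 2 * pi * Im x" for x by simp
    ultimately have "norm ?w = exp (- 2 * pi * Im (t / T))" by (simp only: norm_exp_eq_Re)
    thus ?thesis using It by simp
  qed
  moreover have "h ?w = f (flow t q)" using h(2)[of t] It by (simp add: g_def)
  ultimately show "norm (f (flow t q)) \<le> C" "norm (f (flow t q) - f p) \<le> 2 * (C + 1) * norm ?w"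
    using disc[of ?w] Schw[of ?w] h0 by auto
qed

end

section \<open>The basin is closed; global coordinates\<close>

context linear_patch
begin

text \<open>Near a point of the closure of the basin, the orbits of the basin stay for \<open>Re (m t) < 0\<close> in the
  holomorphic hull of a compact set. The same holds for the limit orbit, whose backward limit is then
  \<open>p\<close> because holomorphic functions separate points.\<close>

lemma A0_closed_point:
  assumes q: "q \<in> N closure_of A0" shows "q \<in> A0"
proof -
  have qN: "q \<in> topspace N" using q closure_of_subset_topspace[of N A0] by blast
  obtain \<kappa>' where \<kappa>': "\<kappa>' \<in> \<A>" "q \<in> fst \<kappa>'" using chart_at[OF qN] by blast
  obtain \<rho> where \<rho>: "\<rho> > 0" "cball (snd \<kappa>' q) \<rho> \<subseteq> img \<kappa>'"
    using img_open[OF \<kappa>'(1)] chart_in[OF \<kappa>'(2)] open_contains_cball by blast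
  \<comment> \<open>A relatively compact neighbourhood of \<open>q\<close>: basin points in
    \<open>Uq\<close> approximate \<open>q\<close>, and one period of each of their orbits lies in
    the single compact set \<open>KU\<close>.\<close>
  define Uq where "Uq = {x \<in> fst \<kappa>'. snd \<kappa>' x \<in> ball (snd \<kappa>' q) \<rho>}"
  have Uq: "openin N Uq" "q \<in> Uq" using chart_preimage_open[OF \<kappa>'(1) open_ball] \<kappa>' \<rho> by (auto simp: Uq_def)
  define Kq where "Kq = param \<kappa>' ` cball (snd \<kappa>' q) \<rho>"
  have Kq: "compactin N Kq" unfolding Kq_def by (rule param_compact[OF \<kappa>'(1) _ \<rho>(2)]) simp
  have UK: "Uq \<subseteq> Kq"
  proof
    fix x assume "x \<in> Uq"
    thus "x \<in> Kq" unfolding Kq_def Uq_def by (intro image_eqI[of _ _ "snd \<kappa>' x"]) (auto simp: param_chart[OF \<kappa>'(1)])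
  qed
  define S where "S = (\<lambda>s::real. of_real s * T) ` {0..1}"
  have "compact S" unfolding S_def by (intro compact_continuous_image continuous_intros) auto
  hence SK: "compactin (prod_topology euclidean N) (S \<times> Kq)" using Kq by (simp add: compactin_Times)
  define KU where "KU = (\<lambda>p. flow (fst p) (snd p)) ` (S \<times> Kq)"
  have KU: "compactin N KU" unfolding KU_def by (rule image_compactin[OF SK flow_continuous])
  have KUin: "flow (of_real s * T) x \<in> KU" if "s \<in> {0..1}" "x \<in> Uq" for s x
    using that UK unfolding KU_def S_def by force
  \<comment> \<open>Compact by holomorphic convexity. Every bound for \<open>f\<close> on
    \<open>KU\<close> is by \<open>A0_bound\<close> a bound on the contracting half-orbits of basin
    points in \<open>Uq\<close>, so these half-orbits lie in the hull.\<close>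
  define H where "H = holomorphic_hull N \<A> KU"
  have H: "compactin N H" using stein KU by (simp add: stein_surface_def H_def)
  hence Hc: "closedin N H" by (rule compactin_imp_closedin[OF hausdorff])
  have AH: "flow t x \<in> H" if x: "x \<in> A0" "x \<in> Uq" and t: "Re (m * t) < 0" for x t
    unfolding H_def holomorphic_hull_def mem_Collect_eq
  proof (intro conjI ballI allI impI)
    show "flow t x \<in> topspace N" using x by (simp add: A0_def flow_topspace)
    fix f B assume f: "f \<in> holomorphic_functions \<A>" and B: "\<forall>q\<in>KU. cmod (f q) \<le> B"
    show "cmod (f (flow t x)) \<le> B"
      by (rule A0_bound(1)[OF x(1) f _ t]) (use B KUin x(2) in blast)
  qed
  have dense: "\<exists>x\<in>A0. x \<in> Uq \<and> x \<in> W" if "openin N W" "q \<in> W" for W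
    using q Uq that unfolding in_closure_of by (metis IntE IntI openin_Int)
  have qH: "flow t q \<in> H" if t: "Re (m * t) < 0" for t
  proof (rule ccontr)
    assume "flow t q \<notin> H"
    hence qin: "q \<in> {x \<in> topspace N. flow t x \<in> topspace N - H}" using qN flow_topspace[OF qN] by simp
    have "openin N {x \<in> topspace N. flow t x \<in> topspace N - H}"
      by (rule openin_continuous_map_preimage[OF flow_map_continuous]) (rule openin_diff[OF openin_topspace Hc])
    from dense[OF this qin] obtain x where x: "x \<in> A0" "x \<in> Uq" "flow t x \<notin> H" by auto
    show False using AH[OF x(1,2) t] x(3) by simp
  qed
  \<comment> \<open>The Schwarz estimate is a closed condition on the initial point, with a constant
    common to all basin points in \<open>Uq\<close>; so it passes to \<open>q\<close>.\<close>
  have conv: "\<exists>C. \<forall>t. Re (m * t) < 0 \<longrightarrow> norm (f (flow t q) - f p) \<le> C * norm (exp (2 * pi * \<i> * t / T))"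
    if f: "f \<in> holomorphic_functions \<A>" for f
  proof -
    have "compact (f ` KU)" using image_compactin[OF KU holomorphic_continuous_map[OF f]] by simp
    hence "bounded (f ` KU)" by (rule compact_imp_bounded)
    then obtain C where C: "\<And>x. x \<in> KU \<Longrightarrow> norm (f x) \<le> C" by (auto simp: bounded_iff)
    have "norm (f (flow t q) - f p) \<le> 2 * (C + 1) * norm (exp (2 * pi * \<i> * t / T))" (is "_ \<le> ?b") if t: "Re (m * t) < 0" for t
    proof (rule ccontr)
      assume not: "\<not> norm (f (flow t q) - f p) \<le> ?b"
      have "continuous_map N euclidean (\<lambda>x. f (flow t x))" by (rule holomorphic_continuous_map[OF flow_compose_holomorphic[OF f]])
      moreover have "open {y. norm (y - f p) > ?b}" by (intro open_Collect_less continuous_intros)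
      hence "openin euclidean {y. norm (y - f p) > ?b}" by (simp only: open_openin)
      ultimately have "openin N {x \<in> topspace N. f (flow t x) \<in> {y. norm (y - f p) > ?b}}" by (rule openin_continuous_map_preimage)
      then obtain x where x: "x \<in> A0" "x \<in> Uq" "norm (f (flow t x) - f p) > ?b" using dense[of "{x \<in> topspace N. f (flow t x) \<in> {y. norm (y - f p) > ?b}}"] qN not by auto
      have "norm (f (flow t x) - f p) \<le> ?b" by (rule A0_bound(2)[OF x(1) f _ t]) (use C KUin x(2) in blast)
      thus False using x(3) by simp
    qed
    thus ?thesis by blast
  qed
  have "\<exists>t. flow t q \<in> U0"
  proof (rule ccontr)
    assume none: "\<nexists>t. flow t q \<in> U0"
    define tn where "tn n = \<i> * T * of_nat (Suc n)" for n :: nat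
    have Rtn: "Re (m * tn n) < 0" for n
    proof -
      have "m * tn n = of_real (- 2 * pi * real c * real (Suc n))" using m by (simp add: tn_def T del: of_nat_Suc)
      hence "Re (m * tn n) = - 2 * pi * real c * real (Suc n)" by (simp only: Re_complex_of_real)
      thus ?thesis using c by (simp add: mult_pos_pos)
    qed
    have wn: "norm (exp (2 * pi * \<i> * tn n / T)) = exp (- 2 * pi) ^ Suc n" for n
    proof -
      have "2 * pi * \<i> * tn n / T = of_real (real (Suc n) * (- 2 * pi))" using T0 by (simp add: tn_def field_simps)
      thus ?thesis by (simp only: exp_of_real norm_of_real) (simp only: exp_of_nat_mult abs_exp_cancel power_abs)
    qed
    have w0: "(\<lambda>n. exp (- 2 * pi) ^ Suc n) \<longlonglongrightarrow> (0::real)" by (rule LIMSEQ_Suc, rule LIMSEQ_realpow_zero) auto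
    \<comment> \<open>If the orbit of \<open>q\<close> never met \<open>U0\<close>, the points
      \<open>flow (tn n) q\<close> would all lie in the compact set \<open>H'\<close>, which omits
      \<open>p\<close>. Each point of \<open>H'\<close> is separated from \<open>p\<close> by some
      \<open>f\<close>, and \<open>f (flow (tn n) q)\<close> tends to \<open>f p\<close>; so it has
      a neighbourhood that the sequence leaves for good, and finitely many of these cover
      \<open>H'\<close>.\<close>
    define H' where "H' = H - U0"
    have H': "compactin N H'"
      unfolding H'_def by (rule closed_compactin[OF H _ closedin_diff[OF Hc U0_open]]) blast
    define good where "good V \<longleftrightarrow> openin N V \<and> (\<forall>\<^sub>F n in sequentially. flow (tn n) q \<notin> V)" for V
    have "\<exists>V. good V \<and> x \<in> V" if x: "x \<in> H'" for x
    proof -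
      have xN: "x \<in> topspace N" "x \<noteq> p" using x compactin_subset_topspace[OF H] p_U0 by (auto simp: H'_def)
      then obtain f where f: "f \<in> holomorphic_functions \<A>" "f x \<noteq> f p" using stein pN unfolding stein_surface_def by blast
      obtain C where C: "\<And>t. Re (m * t) < 0 \<Longrightarrow> norm (f (flow t q) - f p) \<le> C * norm (exp (2 * pi * \<i> * t / T))" using conv[OF f(1)] by blast
      define e where "e = norm (f x - f p) / 2"
      have e: "e > 0" using f(2) by (simp add: e_def)
      define V where "V = {y \<in> topspace N. f y \<in> {y. norm (y - f p) > e}}"
      have "open {y. norm (y - f p) > e}" by (intro open_Collect_less continuous_intros)
      hence "openin euclidean {y. norm (y - f p) > e}" by (simp only: open_openin)
      hence "openin N V" unfolding V_def by (rule openin_continuous_map_preimage[OF holomorphic_continuous_map[OF f(1)]])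
      moreover have "x \<in> V" using xN f(2) by (simp add: V_def e_def)
      moreover have "\<forall>\<^sub>F n in sequentially. flow (tn n) q \<notin> V"
      proof -
        have "(\<lambda>n. C * exp (- 2 * pi) ^ Suc n) \<longlonglongrightarrow> 0" using tendsto_mult_right_zero[OF w0] .
        hence "\<forall>\<^sub>F n in sequentially. C * exp (- 2 * pi) ^ Suc n < e" using e by (rule order_tendstoD)
        thus ?thesis
        proof eventually_elim
          case (elim n)
          have "norm (f (flow (tn n) q) - f p) \<le> C * exp (- 2 * pi) ^ Suc n" using C[OF Rtn[of n]] unfolding wn .
          thus ?case using elim by (simp add: V_def)
        qed
      qed
      ultimately show ?thesis unfolding good_def by blast
    qed
    hence "H' \<subseteq> \<Union>{V. good V}" by blast
    moreover have "\<forall>V\<in>{V. good V}. openin N V" by (simp add: good_def)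
    ultimately obtain \<F> where \<F>: "finite \<F>" "\<F> \<subseteq> {V. good V}" "H' \<subseteq> \<Union>\<F>" using H' unfolding compactin_def by meson
    have "\<forall>\<^sub>F n in sequentially. \<forall>V\<in>\<F>. flow (tn n) q \<notin> V"
      using \<F>(1,2) by (auto intro!: eventually_ball_finite simp: good_def)
    then obtain n where "\<forall>V\<in>\<F>. flow (tn n) q \<notin> V" by (auto simp: eventually_sequentially)
    moreover have "flow (tn n) q \<in> H'" using qH[OF Rtn[of n]] none by (simp add: H'_def)
    ultimately show False using \<F>(3) by blast
  qed
  thus ?thesis using qN by (simp add: A0_def)
qed

lemma A0_eq: "A0 = topspace N"
proof -
  have "N closure_of A0 \<subseteq> A0" using A0_closed_point by blast
  moreover have "A0 \<subseteq> topspace N" by (auto simp: A0_def)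
  ultimately have "closedin N A0" using closure_of_subset[of A0 N] closure_of_eq[of N A0] by blast
  moreover have "p \<in> A0" using p_U0 pN flow_0[OF pN] by (auto simp: A0_def intro!: exI[of _ 0])
  ultimately show ?thesis using conn A0_open by (auto simp: connected_space_clopen_in)
qed

lemma all_fixed: "q \<in> topspace N \<Longrightarrow> flow T q = q" using A0_fixed A0_eq by blast

lemma F_equivariant: "q \<in> topspace N \<Longrightarrow> F (flow t q) = Lam t (F q)"
  by (rule F_flow[OF _ all_fixed])

lemma Lam_into:
  obtains t where "Lam t w \<in> polydisc r"
proof -
  define B where "B = norm (w $ 1) + norm (w $ 2) + 1"
  have B: "norm (w $ i) < B" "B > 0" for i
  proof -
    have "norm (w $ i) \<le> norm (w $ 1) + norm (w $ 2)" using exhaust_2[of i] by auto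
    thus "norm (w $ i) < B" unfolding B_def by linarith
    thus "B > 0" by (rule order_le_less_trans[OF norm_ge_zero])
  qed
  define t where "t = of_real (min 0 (ln (r / B))) / m"
  have mt: "Re (m * t) = min 0 (ln (r / B))" using m by (simp add: t_def)
  have "exp (Re (m * t)) \<le> r / B" unfolding mt using r B(2) by (metis divide_pos_pos exp_le_cancel_iff exp_ln min.cobounded2)
  have "norm (Lam t w $ i) < r" for i
  proof -
    have "norm (Lam t w $ i) \<le> exp (Re (m * t)) * norm (w $ i)" by (rule Lam_nth_le) (simp only: mt min.cobounded1)
    also have "\<dots> < exp (Re (m * t)) * B" using B by simp
    also have "\<dots> \<le> r / B * B" using \<open>exp (Re (m * t)) \<le> r / B\<close> B(2) by (intro mult_right_mono) auto
    finally show ?thesis using B(2) by simp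
  qed
  thus ?thesis by (intro that[of t]) (simp add: polydisc_def)
qed

text \<open>Equivariance moves both questions into \<open>U0\<close>, where \<open>Einv\<close>
  inverts \<open>F\<close>: two points are carried into \<open>U0\<close> by one common time, and
  every target point is contracted into the polydisc by some \<open>Lam t\<close>.\<close>

lemma F_bij: "bij_betw F (topspace N) UNIV"
proof -
  have "inj_on F (topspace N)"
  proof (rule inj_onI)
    fix q1 q2 assume q: "q1 \<in> topspace N" "q2 \<in> topspace N" "F q1 = F q2"
    obtain R1 R2 where R: "\<And>t. Re (m * t) \<le> R1 \<Longrightarrow> flow t q1 \<in> U0" "\<And>t. Re (m * t) \<le> R2 \<Longrightarrow> flow t q2 \<in> U0"
      using A0_eventually q A0_eq by metis
    define t where "t = of_real (min R1 R2) / m"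
    have mt: "Re (m * t) = min R1 R2" using m by (simp add: t_def)
    have "F (flow t q1) = F (flow t q2)" using q by (simp add: F_equivariant)
    moreover have "flow t q1 \<in> U0" by (rule R(1)) (simp only: mt min.cobounded1)
    moreover have "flow t q2 \<in> U0" by (rule R(2)) (simp only: mt min.cobounded2)
    ultimately have eq: "flow t q1 = flow t q2" using Einv_F[of "flow t q1"] Einv_F[of "flow t q2"] by metis
    have "q1 = flow (- t) (flow t q1)" by (rule flow_minus(1)[OF q(1), symmetric])
    also have "\<dots> = q2" unfolding eq by (rule flow_minus(1)[OF q(2)])
    finally show "q1 = q2" .
  qed
  moreover have "w \<in> F ` topspace N" for w
  proof -
    obtain t where t: "Lam t w \<in> polydisc r" by (rule Lam_into)
    have e: "Einv (Lam t w) \<in> topspace N" using Einv_U0[OF t] U0_sub by blast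
    have "F (flow (- t) (Einv (Lam t w))) = w" by (simp add: F_equivariant[OF e] F_Einv[OF t] Lam_add Lam_0)
    thus ?thesis using flow_topspace[OF e] by (metis image_eqI)
  qed
  ultimately show ?thesis by (auto simp: bij_betw_def)
qed

text \<open>Exhibits the inverse near any point as a linear map followed by the local inverse and a
  map of the flow, from which its continuity and holomorphy are read off.\<close>

lemma F_inv_eq:
  assumes "Lam t w \<in> polydisc r"
  shows "inv_into (topspace N) F w = flow (- t) (Einv (Lam t w))"
proof -
  have e: "Einv (Lam t w) \<in> topspace N" using Einv_U0[OF assms] U0_sub by blast
  have "F (flow (- t) (Einv (Lam t w))) = w" by (simp add: F_equivariant[OF e] F_Einv[OF assms] Lam_add Lam_0)
  thus ?thesis using inv_into_f_f[OF bij_betw_imp_inj_on[OF F_bij] flow_topspace[OF e, of "- t"]] by simp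
qed

lemma Lam_map_continuous: "continuous_on A (Lam t)"
proof -
  have "continuous_on A (\<lambda>w. \<chi> i. exp (\<mu> i * t) * w $ i)" by (intro continuous_on_vec_lambda continuous_intros)
  thus ?thesis by (simp add: Lam_def[abs_def])
qed

lemma open_Lam_polydisc: "open {w. Lam t w \<in> polydisc r}"
proof -
  have "continuous_on UNIV (Lam t)" by (rule Lam_map_continuous)
  from open_vimage[OF open_polydisc this] show ?thesis by (simp add: vimage_def)
qed

lemma F_biholomorphism: "biholomorphism_C2 N \<A> F"
  unfolding biholomorphism_C2_def
proof (intro conjI ballI)
  show "bij_betw F (topspace N) UNIV" by (rule F_bij)
  fix \<kappa>' assume \<kappa>': "\<kappa>' \<in> \<A>"
  show "holomorphic_map2 (snd \<kappa>' ` fst \<kappa>') (in_chart \<kappa>' F)"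
    using holomorphic_in_chart[OF F_holomorphic \<kappa>'] by (simp add: holomorphic_map2_def in_chart_eq img_def)
  let ?G = "inv_into (topspace N) F"
  have key: "\<exists>W. open W \<and> w0 \<in> W \<and> W \<subseteq> F ` fst \<kappa>' \<and> (\<forall>i. cdiff (\<lambda>w. snd \<kappa>' (?G w) $ i) w0)" if w0: "w0 \<in> F ` fst \<kappa>'" for w0
  proof -
    obtain q0 where q0: "q0 \<in> fst \<kappa>'" "F q0 = w0" using w0 by blast
    have q0N: "q0 \<in> topspace N" using q0 chart_sub[OF \<kappa>'] by blast
    have Gw0: "?G w0 = q0" using inv_into_f_f[OF bij_betw_imp_inj_on[OF F_bij] q0N] q0 by simp
    obtain t where t: "Lam t w0 \<in> polydisc r" by (rule Lam_into)
    define q1 where "q1 = Einv (Lam t w0)"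
    have q1: "q1 \<in> U0" "q1 \<in> topspace N" using Einv_U0[OF t] U0_sub by (auto simp: q1_def)
    have fl: "flow (- t) q1 = q0" using F_inv_eq[OF t] Gw0 by (simp add: q1_def)
    define P where "P = {w. Lam t w \<in> polydisc r}"
    have P: "open P" "w0 \<in> P" using open_Lam_polydisc t by (auto simp: P_def)
    have cG: "continuous_map (top_of_set P) N (\<lambda>w. flow (- t) (Einv (Lam t w)))"
    proof -
      have "continuous_map (top_of_set P) (top_of_set (polydisc r)) (Lam t)"
        using Lam_map_continuous by (auto simp: continuous_map_in_subtopology P_def)
      from continuous_map_compose[OF continuous_map_compose[OF this Einv_continuous] flow_map_continuous]
      show ?thesis by (simp add: comp_def)
    qed
    define W where "W = {w \<in> P. flow (- t) (Einv (Lam t w)) \<in> fst \<kappa>'}"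
    have "openin (top_of_set P) {w \<in> topspace (top_of_set P). flow (- t) (Einv (Lam t w)) \<in> fst \<kappa>'}"
      by (rule openin_continuous_map_preimage[OF cG chart_open[OF \<kappa>']])
    hence "open W" using P(1) by (simp add: W_def openin_open_eq)
    moreover have "w0 \<in> W" using P(2) fl q0 by (simp add: W_def q1_def)
    moreover have "W \<subseteq> F ` fst \<kappa>'"
    proof
      fix w assume w: "w \<in> W"
      hence "?G w \<in> fst \<kappa>'" using F_inv_eq[of t w] by (simp add: W_def P_def)
      moreover have "F (?G w) = w" using f_inv_into_f[of w F "topspace N"] F_bij by (simp add: bij_betw_def)
      ultimately show "w \<in> F ` fst \<kappa>'" by (metis image_eqI)
    qed
    moreover have "cdiff (\<lambda>w. snd \<kappa>' (?G w) $ i) w0" for i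
    proof -
      have "mdiff (\<lambda>q. snd \<kappa>' q $ i) q0"
      proof -
        have "\<forall>\<^sub>F z in nhds (snd \<kappa>' q0). z $ i = snd \<kappa>' (param \<kappa>' z) $ i"
          using eventually_nhds_in_open[OF img_open[OF \<kappa>'] chart_in[OF q0(1)]] by eventually_elim (simp add: chart_param)
        from cdiff_cong[OF this] show ?thesis using \<kappa>' q0(1) by (auto simp: mdiff_def)
      qed
      hence "mdiff (\<lambda>q. snd \<kappa>' q $ i) (flow (- t) q1)" by (simp add: fl)
      hence "mdiff (\<lambda>q. snd \<kappa>' (flow (- t) q) $ i) q1" by (rule regular_mdiff[OF regular[OF q1(2)]])
      hence "cdiff (\<lambda>z. snd \<kappa>' (flow (- t) (param \<kappa> z)) $ i) (snd \<kappa> q1)"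
        by (rule mdiff_chart[OF _ \<kappa>]) (use q1 in \<open>simp add: U0_def\<close>)
      moreover have "snd \<kappa> q1 = E (Lam t w0)" using E(1)[OF t] d_img by (auto simp: q1_def Einv_def intro!: chart_param)
      ultimately have 1: "cdiff (\<lambda>z. snd \<kappa>' (flow (- t) (param \<kappa> z)) $ i) (E (Lam t w0))" by simp
      have 2: "cdiff (\<lambda>w. E w $ j) (Lam t w0)" for j using E(4) t by (simp add: holomorphic_fun2_iff)
      have 3: "cdiff (\<lambda>w. Lam t w $ j) w0" for j using cdiff_mult[OF cdiff_const cdiff_nth] by (simp add: Lam_def)
      have 4: "cdiff (\<lambda>w. E (Lam t w) $ j) w0" for j by (rule cdiff_compose[OF 2 3])
      have "cdiff (\<lambda>w. snd \<kappa>' (flow (- t) (param \<kappa> (E (Lam t w)))) $ i) w0" by (rule cdiff_compose[OF 1 4])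
      moreover have "\<forall>\<^sub>F w in nhds w0. snd \<kappa>' (flow (- t) (param \<kappa> (E (Lam t w)))) $ i = snd \<kappa>' (?G w) $ i"
        using eventually_nhds_in_open[OF P] by eventually_elim (simp add: F_inv_eq P_def Einv_def)
      ultimately show ?thesis
        by (simp only: cdiff_cong[where f="\<lambda>w. snd \<kappa>' (flow (- t) (param \<kappa> (E (Lam t w)))) $ i"])
    qed
    ultimately show ?thesis by blast
  qed
  have "open (F ` fst \<kappa>')" by (subst open_subopen) (use key in blast)
  thus "holomorphic_map2 (F ` fst \<kappa>') (snd \<kappa>' \<circ> ?G)"
    using key by (simp add: holomorphic_map2_def holomorphic_fun2_iff) blast
qed

text \<open>Differentiating \<open>F (flow t q) = Lam t (F q)\<close> at \<open>t = 0\<close> shows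
  that each component of \<open>F\<close> is an eigenfunction of the Lie derivative, which is the
  conjugacy to a diagonal field.\<close>

lemma F_linearizes: "globally_linearizable N \<A> X"
  unfolding globally_linearizable_def
proof (intro exI conjI ballI)
  show "biholomorphism_C2 N \<A> F" by (rule F_biholomorphism)
  fix \<kappa>' q assume \<kappa>': "\<kappa>' \<in> \<A>" and q: "q \<in> fst \<kappa>'"
  have qN: "q \<in> topspace N" using q chart_sub[OF \<kappa>'] by blast
  let ?M = "\<chi> i j. if i = j then \<mu> i else (0::complex)"
  have L: "Lie (\<lambda>q. F q $ i) q = \<mu> i * F q $ i" for i
  proof -
    have "((\<lambda>t. exp (\<mu> i * t) * F q $ i) has_field_derivative \<mu> i * F q $ i) (at 0)" by (auto intro!: derivative_eq_intros)
    thus ?thesis unfolding Lie_def F_equivariant[OF qN] Lam_def by (simp add: DERIV_imp_deriv)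
  qed
  have cd: "cdiff (\<lambda>z. F (param \<kappa>' z) $ i) (snd \<kappa>' q)" for i
    using holomorphic_in_chart[OF F_holomorphic \<kappa>'] chart_in[OF q] by (simp add: holomorphic_fun2_iff)
  have "frechet_derivative (\<lambda>z. F (param \<kappa>' z)) (at (snd \<kappa>' q)) = (\<lambda>v. \<chi> i. pd 1 (\<lambda>z. F (param \<kappa>' z) $ i) (snd \<kappa>' q) * v $ 1 + pd 2 (\<lambda>z. F (param \<kappa>' z) $ i) (snd \<kappa>' q) * v $ 2)"
    by (rule frechet_derivative_at[OF cdiff_map_has_derivative[OF cd], symmetric])
  moreover have "pd 1 (\<lambda>z. F (param \<kappa>' z) $ i) (snd \<kappa>' q) * X \<kappa>' q $ 1 + pd 2 (\<lambda>z. F (param \<kappa>' z) $ i) (snd \<kappa>' q) * X \<kappa>' q $ 2 = \<mu> i * F q $ i" for i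
    using Lie_chart[OF F_holomorphic \<kappa>' q, of i] L[of i] by (simp add: lie_def Y_def param_chart[OF \<kappa>' q])
  moreover have "(?M *v F q) $ i = \<mu> i * F q $ i" for i
    using exhaust_2[of i] by (auto simp: matrix_vector_mult_def sum_2)
  ultimately show "frechet_derivative (in_chart \<kappa>' F) (at (snd \<kappa>' q)) (X \<kappa>' q) = ?M *v F q"
    by (simp add: in_chart_eq vec_eq_iff)
qed

end

section \<open>Orbits accumulating at a singularity\<close>

context complete_field
begin

text \<open>Passes to a leaf that is closed in an open set, to which the Baire category theorem is
  then applied.\<close>

lemma locally_compact: "locally_compact_space N"
  unfolding locally_compact_space_def
proof
  fix q assume "q \<in> topspace N"
  then obtain \<kappa> where \<kappa>: "\<kappa> \<in> \<A>" "q \<in> fst \<kappa>" using chart_at by blast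
  obtain e where e: "e > 0" "cball (snd \<kappa> q) e \<subseteq> img \<kappa>"
    using img_open[OF \<kappa>(1)] chart_in[OF \<kappa>(2)] open_contains_cball by blast
  let ?U = "{x \<in> fst \<kappa>. snd \<kappa> x \<in> ball (snd \<kappa> q) e}" and ?K = "param \<kappa> ` cball (snd \<kappa> q) e"
  have "?U \<subseteq> ?K"
  proof
    fix x assume "x \<in> ?U"
    thus "x \<in> ?K" by (intro image_eqI[of _ _ "snd \<kappa> x"]) (auto simp: param_chart[OF \<kappa>(1)])
  qed
  moreover have "openin N ?U" by (rule chart_preimage_open[OF \<kappa>(1) open_ball])
  moreover have "compactin N ?K" by (rule param_compact[OF \<kappa>(1) _ e(2)]) simp
  moreover have "q \<in> ?U" using \<kappa>(2) e(1) by simp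
  ultimately show "\<exists>U K. openin N U \<and> compactin N K \<and> q \<in> U \<and> U \<subseteq> K" by blast
qed

lemma flow_orbit_continuous: "q \<in> topspace N \<Longrightarrow> continuous_map (top_of_set S) N (\<lambda>t. flow t q)"
  using flow_icurve unfolding integral_curve_def by (auto intro: continuous_map_from_subtopology)

lemma flow_orbit_compact: "q \<in> topspace N \<Longrightarrow> compact S \<Longrightarrow> compactin N ((\<lambda>t. flow t q) ` S)"
  by (rule image_compactin[OF _ flow_orbit_continuous[of q UNIV]]) auto

lemma flow_singular: "p \<in> singularities N \<A> X \<Longrightarrow> flow t p = p"
proof -
  assume sing: "p \<in> singularities N \<A> X"
  have "icurve UNIV (\<lambda>_. p)"
    using sing unfolding integral_curve_def singularities_def by (auto simp: comp_def)
  from icurve_eq_flow[OF this, of t] show ?thesis by (simp add: connected_UNIV)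
qed

definition leaf_times :: "'a set \<Rightarrow> 'a \<Rightarrow> complex set" where
  "leaf_times V q = connected_component_set {t. flow t q \<in> V} 0"

text \<open>By uniqueness every integral curve starting at \<open>q\<close> is a restriction of the
  flow, so the admissible time domains have a largest member, the component of 0, which is open
  because the set of times in \<open>V\<close> is.\<close>

lemma orbit_in_eq:
  assumes V: "openin N V" and q: "q \<in> V"
  shows "orbit_in N \<A> X V q = (\<lambda>t. flow t q) ` leaf_times V q"
proof -
  have qN: "q \<in> topspace N" using V q openin_subset by blast
  have opV: "open {t. flow t q \<in> V}" by (rule flow_preimage_open[OF qN V])
  show ?thesis
  proof
    show "orbit_in N \<A> X V q \<subseteq> (\<lambda>t. flow t q) ` leaf_times V q"
    proof
      fix x assume "x \<in> orbit_in N \<A> X V q"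
      then obtain c T t where c: "x = c t" "connected T" "0 \<in> T" "t \<in> T" "icurve T c" "c ` T \<subseteq> V" "c 0 = q"
        unfolding orbit_in_def by blast
      have eq: "c s = flow s q" if "s \<in> T" for s using icurve_eq_flow[OF c(5,2,3) that] c(7) by simp
      have "T \<subseteq> leaf_times V q" unfolding leaf_times_def
        by (rule connected_component_maximal[OF c(3,2)]) (use eq c(6) in force)
      thus "x \<in> (\<lambda>t. flow t q) ` leaf_times V q" using eq[OF c(4)] c(1,4) by blast
    qed
    show "(\<lambda>t. flow t q) ` leaf_times V q \<subseteq> orbit_in N \<A> X V q"
    proof
      fix x assume "x \<in> (\<lambda>t. flow t q) ` leaf_times V q"
      then obtain t where t: "t \<in> leaf_times V q" "x = flow t q" by blast
      have z: "0 \<in> leaf_times V q" using q qN by (simp add: leaf_times_def flow_0)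
      have o: "open (leaf_times V q)" unfolding leaf_times_def by (rule open_connected_component[OF opV])
      have "icurve (leaf_times V q) (\<lambda>t. flow t q)" by (rule icurve_subset[OF flow_icurve[OF qN] o]) simp
      moreover have "(\<lambda>t. flow t q) ` leaf_times V q \<subseteq> V"
        using connected_component_subset[of "{t. flow t q \<in> V}" 0] by (auto simp: leaf_times_def)
      ultimately show "x \<in> orbit_in N \<A> X V q" unfolding orbit_in_def
        using t z flow_0[OF qN] connected_connected_component[of "{t. flow t q \<in> V}" 0]
        by (intro CollectI exI[of _ "\<lambda>t. flow t q"] exI[of _ "leaf_times V q"] exI[of _ t]) (auto simp: leaf_times_def)
    qed
  qed
qed

text \<open>A closed leaf is embedded: by the Baire category theorem a compact part of it is covered by
  boundedly many times of the flow.\<close>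

lemma closed_leaf_compact:
  assumes V: "openin N V" and q: "q \<in> V" and L: "L = (\<lambda>t. flow t q) ` leaf_times V q"
    and clos: "(N closure_of L) \<inter> V - L = {p}" and K: "compactin N K" "K \<subseteq> L"
  shows "\<exists>R. K \<subseteq> (\<lambda>t. flow t q) ` cball 0 R"
proof -
  have qN: "q \<in> topspace N" using V q openin_subset by blast
  let ?C = "leaf_times V q"
  have opV: "open {t. flow t q \<in> V}" by (rule flow_preimage_open[OF qN V])
  have oC: "open ?C" unfolding leaf_times_def by (rule open_connected_component[OF opV])
  have cC: "connected ?C" unfolding leaf_times_def by (rule connected_connected_component)
  have C0: "0 \<in> ?C" using q qN by (simp add: leaf_times_def flow_0)
  have LN: "L \<subseteq> topspace N" using L flow_topspace[OF qN] by blast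
  have LV: "L \<subseteq> V" using connected_component_subset[of "{t. flow t q \<in> V}" 0] by (auto simp: leaf_times_def L)
  have Cmax: "S \<subseteq> ?C" if "connected S" "S \<subseteq> {t. flow t q \<in> V}" "t \<in> S" "t \<in> ?C" for S t
    using connected_component_maximal[OF that(3,1,2)] that(4) unfolding leaf_times_def
    by (metis connected_component_eq)
  have pN: "p \<in> topspace N" "p \<notin> L" using clos closure_of_subset_topspace[of N L] by blast+
  have clp: "closedin N {p}" using hausdorff pN by (simp add: closedin_Hausdorff_sing_eq)
  define V' where "V' = V - {p}"
  have V': "openin N V'" unfolding V'_def by (rule openin_diff[OF V clp])
  \<comment> \<open>The leaf is closed in the open set \<open>V - {p}\<close>, hence locally compact
    as a subspace; this is what makes Baire applicable to a leaf that a priori is only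
    immersed.\<close>
  have LV': "L = V' \<inter> (N closure_of L)" using clos LV pN(2) closure_of_subset[OF LN] by (auto simp: V'_def)
  have lc: "locally_compact_space (subtopology N L)"
  proof -
    have "locally_compact_space (subtopology N V')"
      using locally_compact_space_open_subset[OF _ locally_compact V'] hausdorff by blast
    moreover have "closedin (subtopology N V') L"
      unfolding closedin_subtopology using LV' by (intro exI[of _ "N closure_of L"]) auto
    ultimately have "locally_compact_space (subtopology (subtopology N V') L)" by (rule locally_compact_space_closed_subset)
    moreover have "V' \<inter> L = L" using LV' by blast
    ultimately show ?thesis by (simp add: subtopology_subtopology)
  qed
  have "regular_space (subtopology N L)"
    by (rule locally_compact_Hausdorff_imp_regular_space[OF lc Hausdorff_space_subtopology[OF hausdorff]])
  define Ln where "Ln n = L \<inter> (\<lambda>t. flow t q) ` cball 0 (real n)" for n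
  have Lncl: "closedin (subtopology N L) (Ln n)" for n
    unfolding closedin_subtopology Ln_def
    using compactin_imp_closedin[OF hausdorff flow_orbit_compact[OF qN compact_cball]] by blast
  have LUn: "\<Union>(range Ln) = L"
  proof -
    have "x \<in> \<Union>(range Ln)" if x: "x \<in> L" for x
    proof -
      obtain t where "x = flow t q" using x by (auto simp: L)
      moreover have "t \<in> cball 0 (real (nat \<lceil>norm t\<rceil>))" by simp
      ultimately show ?thesis using x unfolding Ln_def by blast
    qed
    thus ?thesis by (auto simp: Ln_def)
  qed
  \<comment> \<open>The leaf is the countable union of its closed parts reached in time at most
    \<open>n\<close>. One of them has interior, so near some point of \<open>L\<close> the leaf is
    covered by bounded times.\<close>
  have "\<exists>n. subtopology N L interior_of Ln n \<noteq> {}"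
  proof (rule ccontr)
    assume "\<not> ?thesis"
    hence "subtopology N L interior_of \<Union>(range Ln) = {}"
      using lc \<open>regular_space (subtopology N L)\<close> Lncl by (intro Baire_category_alt) auto
    moreover have "subtopology N L interior_of L = L" using interior_of_topspace[of "subtopology N L"] LN by (simp add: Int_absorb1 topspace_subtopology_subset)
    ultimately have "L = {}" by (simp add: LUn)
    thus False using C0 by (auto simp: L)
  qed
  then obtain n x0 where "x0 \<in> subtopology N L interior_of Ln n" by blast
  then obtain W' where "openin (subtopology N L) W'" "x0 \<in> W'" "W' \<subseteq> Ln n" by (auto simp: interior_of_def)
  then obtain W where W: "openin N W" "x0 \<in> W" "x0 \<in> L" "W \<inter> L \<subseteq> Ln n" by (auto simp: openin_subtopology)
  obtain t0 where t0: "t0 \<in> ?C" "x0 = flow t0 q" using W(3) by (auto simp: L)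
  \<comment> \<open>Transport of this property along the leaf: points of \<open>L\<close> near
    \<open>x1\<close> can follow the path of times from \<open>t1\<close> to \<open>t0\<close>
    without leaving \<open>V\<close>, so they stay on \<open>L\<close> and arrive in
    \<open>W\<close>; shifting back changes the time bound by \<open>norm (t1 - t0)\<close>.\<close>
  have loc: "\<exists>U R. openin N U \<and> x1 \<in> U \<and> U \<inter> L \<subseteq> (\<lambda>t. flow t q) ` cball 0 R" if x1: "x1 \<in> L" for x1
  proof -
    obtain t1 where t1: "t1 \<in> ?C" "x1 = flow t1 q" using x1 by (auto simp: L)
    have x1N: "x1 \<in> topspace N" using x1 LN by blast
    obtain \<gamma> where \<gamma>: "path \<gamma>" "path_image \<gamma> \<subseteq> ?C" "pathstart \<gamma> = t1" "pathfinish \<gamma> = t0"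
      using connected_open_path_connected[OF oC cC] t0(1) t1(1) unfolding path_connected_def by blast
    define P where "P = path_image \<gamma>"
    have P: "compact P" "connected P" "t1 \<in> P" "t0 \<in> P" "P \<subseteq> ?C"
      using \<gamma> by (auto simp: P_def compact_path_image connected_path_image pathstart_in_path_image[of \<gamma>] pathfinish_in_path_image[of \<gamma>])
    define G where "G = {(d, U). open d \<and> openin N U \<and> x1 \<in> U \<and> (\<forall>s\<in>d. \<forall>x\<in>U. flow (s - t1) x \<in> V)}"
    have "\<exists>a\<in>G. s \<in> fst a" if s: "s \<in> P" for s
    proof -
      have "flow (s - t1) x1 \<in> V"
        using s P(5) connected_component_subset[of "{t. flow t q \<in> V}" 0] by (auto simp: t1(2) flow_add[OF qN] leaf_times_def)
      then obtain d U where dU: "d > 0" "openin N U" "x1 \<in> U" "\<forall>s'\<in>ball (s - t1) d. \<forall>x\<in>U. flow s' x \<in> V"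
        using regular[OF x1N, of "s - t1"] V unfolding regular_at_def by metis
      have "(ball s d, U) \<in> G" unfolding G_def using dU by (auto simp: dist_norm)
      thus ?thesis using dU(1) by force
    qed
    hence "P \<subseteq> \<Union>(fst ` G)" by auto
    moreover have "\<And>B. B \<in> fst ` G \<Longrightarrow> open B" by (auto simp: G_def)
    ultimately obtain \<C> where \<C>: "\<C> \<subseteq> fst ` G" "finite \<C>" "P \<subseteq> \<Union>\<C>" using compactE[OF P(1)] by metis
    then obtain G' where G': "G' \<subseteq> G" "finite G'" "\<C> = fst ` G'" using finite_subset_image by metis
    \<comment> \<open>Compactness of the path leaves finitely many neighbourhoods of
      \<open>x1\<close> whose points remain in \<open>V\<close> along it, so their intersection is
      still open.\<close>
    define U where "U = {x \<in> topspace N. flow (t0 - t1) x \<in> W} \<inter> (topspace N \<inter> \<Inter>(snd ` G'))"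
    have oI: "openin N (topspace N \<inter> \<Inter>(snd ` G'))"
      using G' by (intro openin_Int_Inter) (auto simp: G_def)
    have "openin N U" unfolding U_def
      by (rule openin_Int[OF openin_continuous_map_preimage[OF flow_map_continuous W(1)] oI])
    moreover have "x1 \<in> U"
      using G'(1) x1N W(2) t0 t1 by (auto simp: U_def G_def flow_add[OF qN])
    moreover have "U \<inter> L \<subseteq> (\<lambda>t. flow t q) ` cball 0 (real n + norm (t1 - t0))"
    proof
      fix x assume x: "x \<in> U \<inter> L"
      obtain tx where tx: "tx \<in> ?C" "x = flow tx q" using x by (auto simp: L)
      have xN: "x \<in> topspace N" using x LN by blast
      have inV: "flow (s - t1) x \<in> V" if "s \<in> P" for s
      proof -
        have "s \<in> \<Union>(fst ` G')" using that \<C>(3) G'(3) by blast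
        then obtain a where a: "a \<in> G'" "s \<in> fst a" by blast
        have "x \<in> snd a" using x a(1) by (auto simp: U_def)
        thus ?thesis using a G'(1) unfolding G_def by fastforce
      qed
      define Q where "Q = (\<lambda>s. tx + (s - t1)) ` P"
      have "connected Q" unfolding Q_def by (intro connected_continuous_image continuous_intros P)
      moreover have "Q \<subseteq> {t. flow t q \<in> V}" using inV by (auto simp: Q_def tx(2) flow_add[OF qN] add.commute)
      moreover have "tx \<in> Q" using P(3) by (auto simp: Q_def intro!: image_eqI[of _ _ t1])
      ultimately have "Q \<subseteq> ?C" using Cmax tx(1) by blast
      hence "tx + (t0 - t1) \<in> ?C" using P(4) by (auto simp: Q_def)
      hence "flow (t0 - t1) x \<in> L" by (auto simp: L tx(2) flow_add[OF qN] add.commute)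
      moreover have "flow (t0 - t1) x \<in> W" using x by (simp add: U_def)
      ultimately obtain u where u: "norm u \<le> real n" "flow (t0 - t1) x = flow u q" using W(4) by (auto simp: Ln_def)
      have "x = flow (t1 - t0) (flow (t0 - t1) x)" using flow_add[OF xN, of "t1 - t0" "t0 - t1"] flow_0[OF xN] by simp
      also have "\<dots> = flow (t1 - t0 + u) q" unfolding u(2) by (rule flow_add[OF qN])
      finally have "x = flow (t1 - t0 + u) q" .
      moreover have "norm (t1 - t0 + u) \<le> real n + norm (t1 - t0)" using norm_triangle_ineq[of "t1 - t0" u] u(1) by simp
      ultimately show "x \<in> (\<lambda>t. flow t q) ` cball 0 (real n + norm (t1 - t0))" by auto
    qed
    ultimately show ?thesis by blast
  qed
  define \<U> where "\<U> = {U. openin N U \<and> (\<exists>R. U \<inter> L \<subseteq> (\<lambda>t. flow t q) ` cball 0 R)}"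
  have "K \<subseteq> \<Union>\<U>" using loc K(2) unfolding \<U>_def by blast
  moreover have "\<forall>U\<in>\<U>. openin N U" by (simp add: \<U>_def)
  ultimately obtain \<F> where \<F>: "finite \<F>" "\<F> \<subseteq> \<U>" "K \<subseteq> \<Union>\<F>" using K(1) unfolding compactin_def by meson
  have "\<forall>U\<in>\<F>. \<exists>R. U \<inter> L \<subseteq> (\<lambda>t. flow t q) ` cball 0 R" using \<F>(2) by (auto simp: \<U>_def)
  then obtain Rf where Rf: "\<And>U. U \<in> \<F> \<Longrightarrow> U \<inter> L \<subseteq> (\<lambda>t. flow t q) ` cball 0 (Rf U)" by metis
  have "K \<subseteq> (\<lambda>t. flow t q) ` cball 0 (Max (insert 0 (Rf ` \<F>)))"
  proof
    fix x assume "x \<in> K"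
    then obtain U where U: "U \<in> \<F>" "x \<in> U \<inter> L" using \<F>(3) K(2) by blast
    hence "x \<in> (\<lambda>t. flow t q) ` cball 0 (Rf U)" using Rf by blast
    moreover have "Rf U \<le> Max (insert 0 (Rf ` \<F>))" using \<F>(1) U(1) by (intro Max_ge) auto
    ultimately show "x \<in> (\<lambda>t. flow t q) ` cball 0 (Max (insert 0 (Rf ` \<F>)))" by auto
  qed
  thus ?thesis by blast
qed

lemma bounded_orbit_fixed:
  assumes stein: "stein_surface N \<A>" and q: "q \<in> topspace N" and K: "compactin N K" "\<And>t. flow t q \<in> K"
  shows "flow t q = q"
proof (rule ccontr)
  assume "flow t q \<noteq> q"
  then obtain f where f: "f \<in> holomorphic_functions \<A>" "f (flow t q) \<noteq> f q"
    using stein q flow_topspace[OF q] unfolding stein_surface_def by blast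
  have "compact (f ` K)" using image_compactin[OF K(1) holomorphic_continuous_map[OF f(1)]] by simp
  hence "bounded (range (\<lambda>t. f (flow t q)))"
    by (rule bounded_subset[OF compact_imp_bounded]) (use K(2) in auto)
  hence "(\<lambda>t. f (flow t q)) constant_on UNIV"
    by (rule Liouville_theorem[OF flow_fun_holomorphic[OF f(1) q]])
  then obtain y where y: "\<And>t. f (flow t q) = y" unfolding constant_on_def by auto
  show False using f(2) flow_0[OF q] y[of 0] y[of t] by simp
qed

text \<open>A leaf accumulating only at \<open>p\<close> lies on a periodic orbit, one end of which converges to \<open>p\<close>:
  aperiodic and doubly periodic orbits would be relatively compact, hence constant by Liouville.\<close>

lemma leaf_parametrization:
  assumes stein: "stein_surface N \<A>" and \<kappa>: "\<kappa> \<in> \<A>" "p \<in> fst \<kappa>" and sing: "p \<in> singularities N \<A> X"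
    and V: "openin N V" "p \<in> V" and q: "q \<in> V" and L: "L = orbit_in N \<A> X V q"
    and clos: "(N closure_of L) \<inter> V - L = {p}"
  shows "\<exists>\<omega> \<rho> h. \<omega> \<noteq> 0 \<and> \<rho> > 0 \<and> (\<forall>i. (\<lambda>w. h w $ i) holomorphic_on ball 0 \<rho>) \<and> h 0 = snd \<kappa> p \<and> flow \<omega> q = q \<and>
    (\<forall>t. norm (exp (2 * pi * \<i> * t / \<omega>)) < \<rho> \<longrightarrow> flow t q \<in> fst \<kappa> \<and> flow t q \<in> L \<and> snd \<kappa> (flow t q) = h (exp (2 * pi * \<i> * t / \<omega>)))"
proof -
  have qN: "q \<in> topspace N" using V q openin_subset by blast
  let ?C = "leaf_times V q"
  have Leq: "L = (\<lambda>t. flow t q) ` ?C" unfolding L by (rule orbit_in_eq[OF V(1) q])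
  define Vt where "Vt = {t. flow t q \<in> V}"
  have opV: "open Vt" unfolding Vt_def by (rule flow_preimage_open[OF qN V(1)])
  have oC: "open ?C" unfolding leaf_times_def Vt_def[symmetric] by (rule open_connected_component[OF opV])
  have CV: "?C \<subseteq> Vt" unfolding leaf_times_def Vt_def[symmetric] by (rule connected_component_subset)
  have oVC: "open (Vt - ?C)"
  proof (subst open_subopen, intro ballI)
    fix x assume x: "x \<in> Vt - ?C"
    have "connected_component_set Vt x \<inter> ?C = {}"
      using x connected_component_disjoint[of Vt x 0] connected_component_eq_empty[of Vt x]
      unfolding leaf_times_def Vt_def[symmetric] by (metis DiffD1 DiffD2 connected_component_refl_eq connected_component_eq disjoint_iff mem_Collect_eq)
    thus "\<exists>T. open T \<and> x \<in> T \<and> T \<subseteq> Vt - ?C"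
      using open_connected_component[OF opV, of x] connected_component_subset[of Vt x] x
      by (intro exI[of _ "connected_component_set Vt x"]) auto
  qed
  have C0: "0 \<in> ?C" using q qN by (simp add: leaf_times_def flow_0)
  have pL: "p \<in> topspace N" "p \<notin> L" "p \<in> N closure_of L" using clos closure_of_subset_topspace[of N L] by blast+
  have LN: "L \<subseteq> topspace N" using Leq flow_topspace[OF qN] by blast
  \<comment> \<open>A one-point leaf is closed and could not accumulate at a point outside
    itself.\<close>
  have notfix: "\<not> (\<forall>t. flow t q = q)"
  proof
    assume "\<forall>t. flow t q = q"
    hence "L = {q}" using C0 by (auto simp: Leq)
    moreover have "closedin N {q}" using hausdorff qN by (simp add: closedin_Hausdorff_sing_eq)
    ultimately have "N closure_of L = L" by (simp add: closure_of_closedin)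
    thus False using pL by blast
  qed
  define z0 where "z0 = snd \<kappa> p"
  have "open {z \<in> img \<kappa>. param \<kappa> z \<in> V}" by (rule param_preimage_open[OF \<kappa>(1) V(1)])
  moreover have "z0 \<in> {z \<in> img \<kappa>. param \<kappa> z \<in> V}" using \<kappa> V(2) by (simp add: z0_def chart_in param_chart)
  ultimately obtain r0 where r0: "r0 > 0" "cball z0 r0 \<subseteq> {z \<in> img \<kappa>. param \<kappa> z \<in> V}" by (meson open_contains_cball)
  have r0i: "cball z0 r0 \<subseteq> img \<kappa>" using r0(2) by blast
  define B where "B = param \<kappa> ` cball z0 r0"
  define Bo where "Bo e = {x \<in> fst \<kappa>. snd \<kappa> x \<in> ball z0 e}" for e
  define S where "S = param \<kappa> ` sphere z0 r0"
  have Bo: "openin N (Bo e)" for e unfolding Bo_def by (rule chart_preimage_open[OF \<kappa>(1) open_ball])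
  have pBo: "p \<in> Bo e" if "e > 0" for e using that \<kappa>(2) by (simp add: Bo_def z0_def)
  have Bc: "compactin N B" unfolding B_def by (rule param_compact[OF \<kappa>(1) _ r0i]) simp
  have Bcl: "closedin N B" by (rule compactin_imp_closedin[OF hausdorff Bc])
  have "sphere z0 r0 \<subseteq> img \<kappa>" using r0i by auto
  hence Sc: "compactin N S" unfolding S_def by (intro param_compact[OF \<kappa>(1)]) auto
  have BoB: "Bo r0 \<subseteq> B"
  proof
    fix x assume "x \<in> Bo r0"
    thus "x \<in> B" unfolding B_def Bo_def by (intro image_eqI[of _ _ "snd \<kappa> x"]) (auto simp: param_chart[OF \<kappa>(1)])
  qed
  have BV: "B \<subseteq> V" using r0(2) by (auto simp: B_def)
  have Bsplit: "x \<in> Bo r0 \<or> x \<in> S" if xB: "x \<in> B" for x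
  proof -
    obtain z where z: "z \<in> cball z0 r0" "x = param \<kappa> z" using xB unfolding B_def by blast
    have zi: "z \<in> img \<kappa>" using z r0i by blast
    show ?thesis using z param_in[OF zi] chart_param[OF zi] by (cases "dist z0 z < r0") (auto simp: Bo_def S_def)
  qed
  have SV: "S \<subseteq> V" "p \<notin> S"
  proof -
    show "S \<subseteq> V" using r0 by (auto simp: S_def)
    show "p \<notin> S"
    proof
      assume "p \<in> S"
      then obtain z where z: "dist z0 z = r0" "p = param \<kappa> z" by (auto simp: S_def)
      have "z \<in> img \<kappa>" using z r0i by auto
      hence "z = z0" using chart_param[of z \<kappa>] by (simp add: z0_def z(2))
      thus False using z(1) r0(1) by simp
    qed
  qed
  \<comment> \<open>The part of the closure of the leaf on the sphere around \<open>p\<close>. Since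
    the leaf accumulates within \<open>V\<close> only at \<open>p\<close>, this is a compact subset
    of \<open>L\<close>, covered by bounded times.\<close>
  define KL where "KL = (N closure_of L) \<inter> S"
  have KLL: "KL \<subseteq> L" using clos SV by (auto simp: KL_def)
  have "compactin N KL" unfolding KL_def by (rule closed_Int_compactin[OF closedin_closure_of Sc])
  then obtain R where R: "KL \<subseteq> (\<lambda>t. flow t q) ` cball 0 R" using closed_leaf_compact[OF V(1) q Leq clos _ KLL] by blast
  define \<Gamma> where "\<Gamma> = {s. flow s q = q}"
  have \<Gamma>add: "flow (t + s) q = flow t q" if "s \<in> \<Gamma>" for s t using that flow_add[OF qN, of t s] by (simp add: \<Gamma>_def)
  have \<Gamma>diff: "t - u \<in> \<Gamma>" if "flow t q = flow u q" for t u
    using that flow_add[OF qN, of "- u" t] flow_add[OF qN, of "- u" u] flow_0[OF qN] by (simp add: \<Gamma>_def)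
  have \<Gamma>minus: "- s \<in> \<Gamma>" if "s \<in> \<Gamma>" for s using \<Gamma>diff[of 0 s] that flow_0[OF qN] by (simp add: \<Gamma>_def)
  have Sper: "\<exists>u. norm u \<le> R \<and> t - u \<in> \<Gamma>" if "t \<in> ?C" "flow t q \<in> S" for t
  proof -
    have "flow t q \<in> KL" using that closure_of_subset[OF LN] by (auto simp: KL_def Leq)
    then obtain u where "norm u \<le> R" "flow t q = flow u q" using R by auto
    thus ?thesis using \<Gamma>diff by blast
  qed
  define J where "J = {t \<in> ?C. flow t q \<in> Bo r0}"
  \<comment> \<open>A connected set of times cannot pass from the inside of the ball to the outside,
    nor into another component of the times in \<open>V\<close>, without meeting the sphere at a
    time of the leaf; \<open>J\<close> and \<open>J'\<close> are the disjoint open sets that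
    separate these cases.\<close>
  have JE: "E \<subseteq> J" if E: "connected E" "\<And>t. t \<in> E \<Longrightarrow> t \<in> ?C \<Longrightarrow> flow t q \<notin> S" and ne: "E \<inter> J \<noteq> {}" for E
  proof -
    have oJ: "open J"
    proof -
      have "J = ?C \<inter> {t. flow t q \<in> Bo r0}" by (auto simp: J_def)
      thus ?thesis using oC flow_preimage_open[OF qN Bo] by auto
    qed
    define J' where "J' = {t. flow t q \<in> topspace N - B} \<union> (Vt - ?C)"
    have oJ': "open J'" unfolding J'_def
      by (intro open_Un oVC flow_preimage_open[OF qN] openin_diff openin_topspace Bcl)
    have "E \<subseteq> J \<union> J'"
    proof
      fix t assume t: "t \<in> E"
      show "t \<in> J \<union> J'"
      proof (cases "flow t q \<in> B \<and> t \<in> ?C")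
        case True thus ?thesis using Bsplit E(2)[OF t] by (auto simp: J_def)
      next
        case False thus ?thesis using flow_topspace[OF qN] BV by (auto simp: J'_def Vt_def)
      qed
    qed
    moreover have "J \<inter> J' = {}" using BoB by (auto simp: J_def J'_def)
    ultimately have "J' \<inter> E = {}" using connectedD[OF E(1) oJ oJ'] ne by blast
    thus ?thesis using \<open>E \<subseteq> J \<union> J'\<close> by blast
  qed
  \<comment> \<open>\<open>p\<close> lies in the closure of the leaf but not on the orbit, and orbit
    pieces of bounded time are compact; so the leaf comes close to \<open>p\<close> at times far
    from all elements of \<Gamma>.\<close>
  have far: "\<exists>t\<in>?C. flow t q \<in> Bo e \<and> (\<forall>u. norm u \<le> M \<longrightarrow> t - u \<notin> \<Gamma>)" if e: "e > 0" for e M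
  proof -
    define W where "W = Bo e - (\<lambda>t. flow t q) ` cball 0 M"
    have "openin N W" unfolding W_def
      by (intro openin_diff Bo compactin_imp_closedin[OF hausdorff flow_orbit_compact[OF qN compact_cball]])
    moreover have "p \<in> W"
    proof -
      have "flow u q \<noteq> p" for u
      proof
        assume "flow u q = p"
        hence "q = p" using flow_minus(1)[OF qN, of u] flow_singular[OF sing] by simp
        moreover have "q \<in> L" using C0 flow_0[OF qN] unfolding Leq by (metis image_eqI)
        ultimately show False using pL(2) by simp
      qed
      thus ?thesis using pBo[OF e] by (auto simp: W_def)
    qed
    ultimately obtain x where "x \<in> L" "x \<in> W" using pL(3) unfolding in_closure_of by blast
    then obtain t where t: "t \<in> ?C" "flow t q \<in> W" by (auto simp: Leq)
    have "t - u \<notin> \<Gamma>" if "norm u \<le> M" for u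
    proof
      assume "t - u \<in> \<Gamma>"
      from \<Gamma>add[OF this, of u] have "flow t q = flow u q" by simp
      thus False using t(2) that by (auto simp: W_def)
    qed
    thus ?thesis using t by (auto simp: W_def)
  qed
  \<comment> \<open>Without a period the leaf meets the sphere only at times in the disc of radius
    \<open>R\<close>. The complement of this disc is connected, so the orbit stays in the ball
    \<open>B\<close> there and lies in a compact set altogether.\<close>
  have \<Gamma>0: "\<exists>\<omega>. \<omega> \<in> \<Gamma> \<and> \<omega> \<noteq> 0"
  proof (rule ccontr)
    assume none: "\<nexists>\<omega>. \<omega> \<in> \<Gamma> \<and> \<omega> \<noteq> 0"
    define E where "E = - cball (0::complex) R"
    have Ecn: "connected E" unfolding E_def by (rule connected_complement_bounded_convex) auto
    have ES: "flow t q \<notin> S" if tE: "t \<in> E" "t \<in> ?C" for t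
    proof
      assume "flow t q \<in> S"
      then obtain u where "norm u \<le> R" "t - u \<in> \<Gamma>" using Sper[OF tE(2)] by blast
      hence "t = u" using none by auto
      thus False using tE(1) \<open>norm u \<le> R\<close> by (simp add: E_def)
    qed
    obtain t where t: "t \<in> ?C" "flow t q \<in> Bo r0" "\<And>u. norm u \<le> R \<Longrightarrow> t - u \<notin> \<Gamma>" using far[OF r0(1), of R] by blast
    have "t \<in> E \<inter> J"
    proof -
      have "0 \<in> \<Gamma>" using flow_0[OF qN] by (simp add: \<Gamma>_def)
      hence "\<not> norm t \<le> R" using t(3)[of t] by auto
      thus ?thesis using t(1,2) by (simp add: E_def J_def)
    qed
    hence EJne: "E \<inter> J \<noteq> {}" by blast
    have "E \<subseteq> J" by (rule JE[OF Ecn _ EJne]) (rule ES)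
    have "flow t q \<in> (\<lambda>t. flow t q) ` cball 0 R \<union> B" for t
    proof (cases "t \<in> E")
      case True thus ?thesis using \<open>E \<subseteq> J\<close> BoB by (auto simp: J_def)
    next
      case False thus ?thesis by (auto simp: E_def)
    qed
    hence "flow t q = q" for t
      by (intro bounded_orbit_fixed[OF stein qN, where K="(\<lambda>t. flow t q) ` cball 0 R \<union> B"] compactin_Un flow_orbit_compact[OF qN] Bc) auto
    thus False using notfix by blast
  qed
  then obtain \<omega>0 where \<omega>0: "\<omega>0 \<in> \<Gamma>" "\<omega>0 \<noteq> 0" by blast
  have shift: "flow (t + of_int n * \<omega>) q = flow t q" if "\<omega> \<in> \<Gamma>" for t n \<omega>
    by (rule periodic_int_shift[where g="\<lambda>t. flow t q" and T=\<omega>, OF \<Gamma>add[OF that]])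
  \<comment> \<open>Two real-independent periods would make the orbit the image of a compact
    parallelogram of times.\<close>
  have rank1: "Im (s / \<omega>0) = 0" if s: "s \<in> \<Gamma>" for s
  proof (rule ccontr)
    assume ns: "Im (s / \<omega>0) \<noteq> 0"
    define K where "K = (\<lambda>(a, b). of_real a * \<omega>0 + of_real b * s) ` ({0..1::real} \<times> {0..1::real})"
    have "compact K" unfolding K_def
      by (intro compact_continuous_image compact_Times) (auto simp: case_prod_beta' intro!: continuous_intros)
    hence Kc: "compactin N ((\<lambda>t. flow t q) ` K)" by (rule flow_orbit_compact[OF qN])
    have "flow t q \<in> (\<lambda>t. flow t q) ` K" for t
    proof -
      define b where "b = Im (t / \<omega>0) / Im (s / \<omega>0)"
      define a where "a = Re (t / \<omega>0) - b * Re (s / \<omega>0)"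
      have "\<tau> = of_real (Re \<tau> - Im \<tau> / Im \<sigma> * Re \<sigma>) + of_real (Im \<tau> / Im \<sigma>) * \<sigma>" if "Im \<sigma> \<noteq> 0" for \<sigma> \<tau> :: complex
        using that by (simp add: complex_eq_iff)
      from this[OF ns, of "t / \<omega>0"] have "t / \<omega>0 = of_real a + of_real b * (s / \<omega>0)" unfolding a_def b_def .
      hence ab: "t = of_real a * \<omega>0 + of_real b * s" using \<omega>0(2) by (simp add: field_simps)
      define t' where "t' = (t + of_int (- \<lfloor>a\<rfloor>) * \<omega>0) + of_int (- \<lfloor>b\<rfloor>) * s"
      have "t' = of_real (a - of_int \<lfloor>a\<rfloor>) * \<omega>0 + of_real (b - of_int \<lfloor>b\<rfloor>) * s" unfolding t'_def ab by (simp add: algebra_simps)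
      moreover have "(a - of_int \<lfloor>a\<rfloor>, b - of_int \<lfloor>b\<rfloor>) \<in> {0..1} \<times> {0..1}" by (simp, linarith)
      ultimately have "t' \<in> K" unfolding K_def by (intro image_eqI[of _ _ "(a - of_int \<lfloor>a\<rfloor>, b - of_int \<lfloor>b\<rfloor>)"]) auto
      moreover have "flow t' q = flow t q" unfolding t'_def shift[OF s] shift[OF \<omega>0(1)] ..
      ultimately show ?thesis by (metis image_eqI)
    qed
    hence "flow t q = q" for t by (rule bounded_orbit_fixed[OF stein qN Kc])
    thus False using notfix by blast
  qed
  define b where "b t = Im (t / \<omega>0)" for t
  \<comment> \<open>Reducing \<open>t\<close> modulo \<open>\<omega>0\<close> brings the real part
    of \<open>t / \<omega>0\<close> into the unit interval, so a bounded imaginary part would place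
    \<open>t\<close> within bounded distance of a period.\<close>
  have farb: "\<exists>t\<in>?C. flow t q \<in> Bo e \<and> \<bar>b t\<bar> > M" if e: "e > 0" for e M
  proof -
    obtain t where t: "t \<in> ?C" "flow t q \<in> Bo e" "\<And>u. norm u \<le> norm \<omega>0 * (1 + \<bar>M\<bar>) \<Longrightarrow> t - u \<notin> \<Gamma>" using far[OF e] by blast
    have "\<bar>b t\<bar> > M"
    proof (rule ccontr)
      assume "\<not> \<bar>b t\<bar> > M"
      hence bM: "\<bar>b t\<bar> \<le> \<bar>M\<bar>" by linarith
      define n where "n = \<lfloor>Re (t / \<omega>0)\<rfloor>"
      define u where "u = t - of_int n * \<omega>0"
      have u: "u / \<omega>0 = t / \<omega>0 - of_int n" using \<omega>0(2) by (simp add: u_def field_simps)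
      have "norm (u / \<omega>0) \<le> \<bar>Re (u / \<omega>0)\<bar> + \<bar>Im (u / \<omega>0)\<bar>" by (rule cmod_le)
      also have "Re (u / \<omega>0) = Re (t / \<omega>0) - of_int n" unfolding u by simp
      also have "Im (u / \<omega>0) = b t" unfolding u b_def by simp
      also have "\<bar>Re (t / \<omega>0) - of_int n\<bar> \<le> 1" unfolding n_def by linarith
      finally have "norm (u / \<omega>0) \<le> 1 + \<bar>M\<bar>" using bM by linarith
      hence "norm u \<le> norm \<omega>0 * (1 + \<bar>M\<bar>)" using \<omega>0(2) by (simp add: norm_divide divide_simps mult.commute)
      from t(3)[OF this] have "of_int n * \<omega>0 \<notin> \<Gamma>" by (simp add: u_def)
      moreover have "flow (0 + of_int n * \<omega>0) q = flow 0 q" by (rule shift[OF \<omega>0(1)])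
      ultimately show False using flow_0[OF qN] by (simp add: \<Gamma>_def)
    qed
    thus ?thesis using t by blast
  qed
  \<comment> \<open>Times modulo the period form a cylinder with two ends. Approach to
    \<open>p\<close> at every scale takes place arbitrarily far out, hence along at least one end at
    all scales; the sign of the period is then chosen to make it the upper one.\<close>
  have "(\<forall>n::nat. \<exists>t\<in>?C. flow t q \<in> Bo (r0 / (real n + 1)) \<and> b t > n) \<or> (\<forall>n::nat. \<exists>t\<in>?C. flow t q \<in> Bo (r0 / (real n + 1)) \<and> - b t > n)"
  proof (rule ccontr)
    assume "\<not> ?thesis"
    then obtain n1 n2 :: nat where n1: "\<And>t. t \<in> ?C \<Longrightarrow> flow t q \<in> Bo (r0 / (real n1 + 1)) \<Longrightarrow> \<not> b t > n1"
      and n2: "\<And>t. t \<in> ?C \<Longrightarrow> flow t q \<in> Bo (r0 / (real n2 + 1)) \<Longrightarrow> \<not> - b t > n2" by blast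
    define n where "n = max n1 n2"
    have mono: "Bo (r0 / (real n + 1)) \<subseteq> Bo (r0 / (real k + 1))" if "k \<le> n" for k
    proof -
      have "r0 / (real n + 1) \<le> r0 / (real k + 1)" using that r0(1) by (intro divide_left_mono) auto
      thus ?thesis by (auto simp: Bo_def)
    qed
    obtain t where t: "t \<in> ?C" "flow t q \<in> Bo (r0 / (real n + 1))" "\<bar>b t\<bar> > real n" using farb[of "r0 / (real n + 1)" "real n"] r0(1) by auto
    have "\<not> b t > n1" "\<not> - b t > n2" using n1[OF t(1)] n2[OF t(1)] mono[of n1] mono[of n2] t(2) by (auto simp: n_def)
    thus False using t(3) by (auto simp: n_def)
  qed
  then obtain \<omega> where \<omega>: "\<omega> \<in> \<Gamma>" "\<omega> \<noteq> 0" "\<And>s. s \<in> \<Gamma> \<Longrightarrow> Im (s / \<omega>) = 0"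
    and seq: "\<And>n::nat. \<exists>t\<in>?C. flow t q \<in> Bo (r0 / (real n + 1)) \<and> Im (t / \<omega>) > n"
  proof (elim disjE)
    assume *: "\<forall>n::nat. \<exists>t\<in>?C. flow t q \<in> Bo (r0 / (real n + 1)) \<and> b t > n"
    show thesis by (rule that[OF \<omega>0 rank1]) (use * in \<open>auto simp: b_def\<close>)
  next
    assume *: "\<forall>n::nat. \<exists>t\<in>?C. flow t q \<in> Bo (r0 / (real n + 1)) \<and> - b t > n"
    have "Im (t / - \<omega>0) = - b t" for t by (simp add: b_def)
    thus thesis using that[of "- \<omega>0"] \<Gamma>minus[OF \<omega>0(1)] \<omega>0(2) rank1 * by (simp add: b_def)
  qed
  \<comment> \<open>All periods are real multiples of \<omega>, and modulo periods the times of
    sphere crossings have norm at most \<open>R\<close>; so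
    \<open>Im (t / \<omega>) \<le> R'\<close> there. The half-plane beyond is connected and meets
    \<open>J\<close>, hence lies in it.\<close>
  define R' where "R' = \<bar>R\<bar> / norm \<omega>"
  define E where "E = {t. Im (t / \<omega>) > R'}"
  have EJ: "E \<subseteq> J"
  proof (rule JE)
    have "convex E" unfolding E_def
    proof (rule convexI, unfold mem_Collect_eq)
      fix x y u v assume "R' < Im (x / \<omega>)" "R' < Im (y / \<omega>)" "0 \<le> u" "0 \<le> v" "u + v = (1::real)"
      moreover have "Im ((u *\<^sub>R x + v *\<^sub>R y) / \<omega>) = u * Im (x / \<omega>) + v * Im (y / \<omega>)"
        by (simp add: add_divide_distrib scaleR_conv_of_real Im_complex_of_real times_divide_eq_right[symmetric] del: times_divide_eq_right)
      ultimately show "R' < Im ((u *\<^sub>R x + v *\<^sub>R y) / \<omega>)"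
        using convex_bound_lt[of "- Im (x / \<omega>)" "- R'" "- Im (y / \<omega>)" u v] by simp
    qed
    thus "connected E" by (rule convex_connected)
    show "flow t q \<notin> S" if tE: "t \<in> E" "t \<in> ?C" for t
    proof
      assume "flow t q \<in> S"
      then obtain u where u: "norm u \<le> R" "t - u \<in> \<Gamma>" using Sper[OF tE(2)] by blast
      have "Im (t / \<omega>) = Im (u / \<omega>)" using \<omega>(3)[OF u(2)] by (simp add: diff_divide_distrib)
      also have "\<dots> \<le> norm (u / \<omega>)" using abs_Im_le_cmod[of "u / \<omega>"] by linarith
      also have "\<dots> \<le> R'" unfolding R'_def norm_divide using u(1) by (intro divide_right_mono) auto
      finally show False using tE(1) by (simp add: E_def)
    qed
    obtain t where t: "t \<in> ?C" "flow t q \<in> Bo (r0 / (real (nat \<lceil>R'\<rceil>) + 1))" "Im (t / \<omega>) > real (nat \<lceil>R'\<rceil>)" using seq[of "nat \<lceil>R'\<rceil>"] by blast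
    have "r0 / (real (nat \<lceil>R'\<rceil>) + 1) \<le> r0 / 1" using r0(1) by (intro divide_left_mono) auto
    hence "flow t q \<in> Bo r0" using t(2) by (auto simp: Bo_def)
    moreover have "t \<in> E" using t(3) unfolding E_def mem_Collect_eq by linarith
    ultimately show "E \<inter> J \<noteq> {}" using t(1) by (auto simp: J_def)
  qed
  let ?e = "\<lambda>t. exp (2 * pi * \<i> * t / \<omega>)"
  have norm_e: "norm (?e t) = exp (- 2 * pi * Im (t / \<omega>))" for t
  proof -
    have "2 * pi * \<i> * t / \<omega> = 2 * pi * \<i> * (t / \<omega>)" by simp
    moreover have "Re (2 * pi * \<i> * x) = - 2 * pi * Im x" for x by simp
    ultimately show ?thesis by (simp only: norm_exp_eq_Re)
  qed
  define \<rho> where "\<rho> = exp (- 2 * pi * R')"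
  have "\<exists>h. h holomorphic_on ball 0 \<rho> \<and> (\<forall>t. Im (t / \<omega>) > R' \<longrightarrow> h (?e t) = snd \<kappa> (flow t q) $ i)" for i
    unfolding \<rho>_def
  proof (rule periodic_factor[OF \<omega>(2)])
    have fl: "flow t q \<in> fst \<kappa>" "snd \<kappa> (flow t q) \<in> ball z0 r0" if "Im (t / \<omega>) > R'" for t
      using EJ that by (auto simp: E_def J_def Bo_def)
    have hoc: "holomorphic_fun2 (img \<kappa>) (\<lambda>z. z $ i)" using img_open[OF \<kappa>(1)] by (simp add: holomorphic_fun2_iff)
    show "(\<lambda>t. snd \<kappa> (flow t q) $ i) holomorphic_on {t. Im (t / \<omega>) > R'}"
      by (rule solution_holomorphic[OF hoc, where Y="Y \<kappa>"])
         (use fl flow_deriv[OF qN \<kappa>(1)] chart_in[OF fl(1)] in auto)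
    show "snd \<kappa> (flow (t + \<omega>) q) $ i = snd \<kappa> (flow t q) $ i" for t by (simp add: \<Gamma>add[OF \<omega>(1)])
    show "norm (snd \<kappa> (flow t q) $ i) \<le> norm z0 + r0" if "Im (t / \<omega>) > R'" for t
    proof -
      have "norm (snd \<kappa> (flow t q) $ i) \<le> norm (snd \<kappa> (flow t q))" by (rule Finite_Cartesian_Product.norm_nth_le)
      also have "\<dots> \<le> norm z0 + dist z0 (snd \<kappa> (flow t q))" by (metis dist_commute dist_norm norm_triangle_sub)
      finally show ?thesis using fl(2)[OF that] by simp
    qed
  qed
  then obtain hh where hh: "\<And>i. hh i holomorphic_on ball 0 \<rho>" "\<And>i t. Im (t / \<omega>) > R' \<Longrightarrow> hh i (?e t) = snd \<kappa> (flow t q) $ i" by metis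
  define h where "h w = (\<chi> i. hh i w)" for w
  have \<rho>: "\<rho> > 0" by (simp add: \<rho>_def)
  have he: "flow t q \<in> fst \<kappa> \<and> flow t q \<in> L \<and> snd \<kappa> (flow t q) = h (?e t)" if "norm (?e t) < \<rho>" for t
  proof -
    have "Im (t / \<omega>) > R'" using that unfolding norm_e \<rho>_def by simp
    thus ?thesis using hh(2) EJ by (auto simp: h_def vec_eq_iff E_def J_def Bo_def Leq)
  qed
  \<comment> \<open>Boundedness alone extends the parametrization across 0; its value there is
    identified along times at which the leaf approaches \<open>p\<close>.\<close>
  have h0: "h 0 = z0"
  proof -
    obtain tn where tn: "\<And>n. flow (tn n) q \<in> Bo (r0 / (real n + 1))" "\<And>n. Im (tn n / \<omega>) > real n" using seq by metis
    have e0: "(\<lambda>n. ?e (tn n)) \<longlonglongrightarrow> 0"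
    proof (rule Lim_null_comparison)
      show "\<forall>\<^sub>F n in sequentially. norm (?e (tn n)) \<le> exp (- 2 * pi) ^ n"
      proof (intro always_eventually allI)
        fix n
        have "2 * pi * real n \<le> 2 * pi * Im (tn n / \<omega>)" using tn(2)[of n] by (intro mult_left_mono) auto
        hence "norm (?e (tn n)) \<le> exp (real n * (- 2 * pi))" unfolding norm_e by simp
        thus "norm (?e (tn n)) \<le> exp (- 2 * pi) ^ n" by (simp only: exp_of_nat_mult)
      qed
      show "(\<lambda>n. exp (- 2 * pi) ^ n) \<longlonglongrightarrow> (0::real)" by (rule LIMSEQ_realpow_zero) auto
    qed
    have "(\<lambda>n. h (?e (tn n))) \<longlonglongrightarrow> h 0"
    proof (rule vec_tendstoI)
      fix i have "isCont (hh i) 0" using holomorphic_on_imp_continuous_on[OF hh(1)] \<rho> by (simp add: continuous_on_eq_continuous_at)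
      from isCont_tendsto_compose[OF this e0] show "(\<lambda>n. h (?e (tn n)) $ i) \<longlonglongrightarrow> h 0 $ i" by (simp add: h_def)
    qed
    moreover have "(\<lambda>n. h (?e (tn n))) \<longlonglongrightarrow> z0"
    proof (rule LIM_zero_cancel, rule Lim_null_comparison)
      have "\<forall>\<^sub>F n in sequentially. norm (?e (tn n)) < \<rho>" using order_tendstoD(2)[OF tendsto_norm_zero[OF e0] \<rho>] .
      thus "\<forall>\<^sub>F n in sequentially. norm (h (?e (tn n)) - z0) \<le> r0 * inverse (real (Suc n))"
      proof eventually_elim
        case (elim n)
        have "h (?e (tn n)) = snd \<kappa> (flow (tn n) q)" using he[OF elim] by simp
        hence "dist z0 (h (?e (tn n))) < r0 / (real n + 1)" using tn(1)[of n] by (simp add: Bo_def)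
        thus ?case by (simp add: dist_norm norm_minus_commute divide_inverse add.commute)
      qed
      show "(\<lambda>n. r0 * inverse (real (Suc n))) \<longlonglongrightarrow> 0" using tendsto_mult_right_zero[OF LIMSEQ_inverse_real_of_nat] .
    qed
    ultimately show ?thesis by (rule LIMSEQ_unique)
  qed
  show ?thesis
    by (intro exI[of _ \<omega>] exI[of _ \<rho>] exI[of _ h] conjI allI impI)
       (use \<omega> \<rho> hh(1) h0 he in \<open>auto simp: h_def[abs_def] z0_def \<Gamma>_def\<close>)
qed

end

section \<open>Leading exponents\<close>

text \<open>The smaller of the vanishing orders of the two components is taken out; the point
  \<open>w0\<close> guarantees that some component is not identically zero. The radius shrinks
  because the factorization at a zero may hold only on a smaller disc.\<close>

lemma vector_order:
  fixes H :: "complex \<Rightarrow> complex^2"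
  assumes H: "\<And>i. (\<lambda>w. H w $ i) holomorphic_on ball 0 \<rho>" and \<rho>: "\<rho> > 0" and H0: "H 0 = 0"
    and ne: "w0 \<in> ball 0 \<rho>" "H w0 \<noteq> 0"
  shows "\<exists>k r g. k > 0 \<and> 0 < r \<and> r \<le> \<rho> \<and> (\<forall>i. (\<lambda>w. g w $ i) holomorphic_on ball 0 r) \<and> g 0 \<noteq> 0 \<and>
    (\<forall>w\<in>ball 0 r. H w = w ^ k *s g w)"
proof -
  have comp: "\<exists>n r f. n > 0 \<and> 0 < r \<and> r \<le> \<rho> \<and> f holomorphic_on ball 0 r \<and> f 0 \<noteq> 0 \<and> (\<forall>w\<in>ball 0 r. H w $ i = w ^ n * f w)"
    if nz: "\<not> (\<lambda>w. H w $ i) constant_on ball 0 \<rho>" for i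
  proof -
    obtain f r n where "0 < n" "0 < r" "ball 0 r \<subseteq> ball (0::complex) \<rho>" "f holomorphic_on ball 0 r"
      "\<And>w. w \<in> ball 0 r \<Longrightarrow> H w $ i = (w - 0) ^ n * f w" "\<And>w. w \<in> ball 0 r \<Longrightarrow> f w \<noteq> 0"
      by (rule holomorphic_factor_zero_nonconstant[OF H[of i] open_ball connected_ball, where \<xi>=0]) (use nz \<rho> H0 in auto)
    moreover from this have "r \<le> \<rho>" using ball_subset_ball_iff[of "0::complex" r 0 \<rho>] by auto
    ultimately show ?thesis by (intro exI[of _ n] exI[of _ r] exI[of _ f]) auto
  qed
  have zero: "H w $ i = 0" if c: "(\<lambda>w. H w $ i) constant_on ball 0 \<rho>" "w \<in> ball 0 \<rho>" for i w
  proof -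
    obtain a where "\<And>w. w \<in> ball 0 \<rho> \<Longrightarrow> H w $ i = a" using c(1) unfolding constant_on_def by blast
    from this[of w] this[of 0] show ?thesis using c(2) \<rho> H0 by simp
  qed
  \<comment> \<open>Component \<open>i\<close> has the smaller order \<open>n\<close>; the other one
    is then divisible by \<open>w ^ n\<close>, either because it vanishes identically or because its
    order is at least \<open>n\<close>.\<close>
  have P: "\<exists>n r f. n > 0 \<and> 0 < r \<and> r \<le> \<rho> \<and> f holomorphic_on ball 0 r \<and> f 0 \<noteq> 0 \<and>
      (\<forall>w\<in>ball 0 r. H w $ i = w ^ n * f w) \<and> (\<forall>j. j \<noteq> i \<longrightarrow> (\<exists>f'. f' holomorphic_on ball 0 r \<and> (\<forall>w\<in>ball 0 r. H w $ j = w ^ n * f' w)))"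
    if nz: "\<not> (\<lambda>w. H w $ i) constant_on ball 0 \<rho>"
      and least: "\<And>j. j \<noteq> i \<Longrightarrow> (\<lambda>w. H w $ j) constant_on ball 0 \<rho> \<or>
        (\<exists>n' r' f'. r' > 0 \<and> n \<le> n' \<and> f' holomorphic_on ball 0 r' \<and> (\<forall>w\<in>ball 0 r'. H w $ j = w ^ n' * f' w))"
      and nf: "n > 0" "0 < r" "r \<le> \<rho>" "f holomorphic_on ball 0 r" "f 0 \<noteq> 0" "\<forall>w\<in>ball 0 r. H w $ i = w ^ n * f w" for i n r f
  proof -
    define j where "j = (if i = 1 then 2 else 1 :: 2)"
    have ij: "j \<noteq> i" "\<And>j'. j' \<noteq> i \<Longrightarrow> j' = j" unfolding j_def using exhaust_2 by (auto split: if_splits) 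
    have "\<exists>r''. 0 < r'' \<and> r'' \<le> r \<and> (\<exists>f'. f' holomorphic_on ball 0 r'' \<and> (\<forall>w\<in>ball 0 r''. H w $ j = w ^ n * f' w))"
      using least[OF ij(1)]
    proof (elim disjE exE conjE)
      assume "(\<lambda>w. H w $ j) constant_on ball 0 \<rho>"
      from zero[OF this] show ?thesis using nf by (intro exI[of _ r] conjI exI[of _ "\<lambda>_. 0"]) auto
    next
      fix n' r' f' assume *: "r' > 0" "n \<le> n'" "f' holomorphic_on ball 0 r'" "\<forall>w\<in>ball 0 r'. H w $ j = w ^ n' * f' w"
      have "(\<lambda>w. w ^ (n' - n) * f' w) holomorphic_on ball 0 (min r r')"
        by (intro holomorphic_intros holomorphic_on_subset[OF *(3)]) auto
      moreover have "H w $ j = w ^ n * (w ^ (n' - n) * f' w)" if "w \<in> ball 0 (min r r')" for w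
        using * that by (simp add: mult.assoc[symmetric] power_add[symmetric])
      ultimately show ?thesis using nf(2) *(1)
        by (intro exI[of _ "min r r'"] conjI exI[of _ "\<lambda>w. w ^ (n' - n) * f' w"]) auto
    qed
    then obtain r'' f' where r'': "0 < r''" "r'' \<le> r" "f' holomorphic_on ball 0 r''" "\<forall>w\<in>ball 0 r''. H w $ j = w ^ n * f' w" by blast
    have "f holomorphic_on ball 0 r''" by (rule holomorphic_on_subset[OF nf(4)]) (use r''(2) in auto)
    thus ?thesis using nf r'' ij(2) by (intro exI[of _ n] exI[of _ r''] exI[of _ f]) (auto intro!: exI[of _ f'])
  qed
  have "\<exists>i n r f. n > 0 \<and> 0 < r \<and> r \<le> \<rho> \<and> f holomorphic_on ball 0 r \<and> f 0 \<noteq> 0 \<and>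
      (\<forall>w\<in>ball 0 r. H w $ i = w ^ n * f w) \<and> (\<forall>j. j \<noteq> i \<longrightarrow> (\<exists>f'. f' holomorphic_on ball 0 r \<and> (\<forall>w\<in>ball 0 r. H w $ j = w ^ n * f' w)))"
  proof (cases "(\<lambda>w. H w $ 1) constant_on ball 0 \<rho> \<or> (\<lambda>w. H w $ 2) constant_on ball 0 \<rho>")
    case True
    have "\<exists>i. \<not> (\<lambda>w. H w $ i) constant_on ball 0 \<rho>" using zero ne by (metis vec_eq_iff zero_index)
    then obtain i where i: "\<not> (\<lambda>w. H w $ i) constant_on ball 0 \<rho>" by blast
    have oth: "(\<lambda>w. H w $ j) constant_on ball 0 \<rho>" if "j \<noteq> i" for j using True i that exhaust_2[of i] exhaust_2[of j] by auto
    obtain n r f where nf: "n > 0" "0 < r" "r \<le> \<rho>" "f holomorphic_on ball 0 r" "f 0 \<noteq> 0" "\<forall>w\<in>ball 0 r. H w $ i = w ^ n * f w" using comp[OF i] by blast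
    from P[OF i _ nf] oth show ?thesis by blast
  next
    case False
    hence nz: "\<not> (\<lambda>w. H w $ 1) constant_on ball 0 \<rho>" "\<not> (\<lambda>w. H w $ 2) constant_on ball 0 \<rho>" by simp_all
    obtain n1 r1 f1 where 1: "n1 > 0" "0 < r1" "r1 \<le> \<rho>" "f1 holomorphic_on ball 0 r1" "f1 0 \<noteq> 0" "\<forall>w\<in>ball 0 r1. H w $ 1 = w ^ n1 * f1 w"
      using comp[OF nz(1)] by blast
    obtain n2 r2 f2 where 2: "n2 > 0" "0 < r2" "r2 \<le> \<rho>" "f2 holomorphic_on ball 0 r2" "f2 0 \<noteq> 0" "\<forall>w\<in>ball 0 r2. H w $ 2 = w ^ n2 * f2 w"
      using comp[OF nz(2)] by blast
    show ?thesis
    proof (cases "n1 \<le> n2")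
      case True
      have "(\<lambda>w. H w $ j) constant_on ball 0 \<rho> \<or> (\<exists>n' r' f'. r' > 0 \<and> n1 \<le> n' \<and> f' holomorphic_on ball 0 r' \<and> (\<forall>w\<in>ball 0 r'. H w $ j = w ^ n' * f' w))" if "j \<noteq> 1" for j
      proof -
        have "j = 2" using that exhaust_2[of j] by blast
        thus ?thesis using 2 True by blast
      qed
      from P[OF _ this 1] False show ?thesis by blast
    next
      case nle: False
      have "(\<lambda>w. H w $ j) constant_on ball 0 \<rho> \<or> (\<exists>n' r' f'. r' > 0 \<and> n2 \<le> n' \<and> f' holomorphic_on ball 0 r' \<and> (\<forall>w\<in>ball 0 r'. H w $ j = w ^ n' * f' w))" if "j \<noteq> 2" for j
      proof -
        have "j = 1" using that exhaust_2[of j] by blast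
        thus ?thesis using 1 nle by (metis nat_le_linear)
      qed
      from P[OF _ this 2] False show ?thesis by blast
    qed
  qed
  then obtain i n r f where nf: "n > 0" "0 < r" "r \<le> \<rho>" "f holomorphic_on ball 0 r" "f 0 \<noteq> 0" "\<forall>w\<in>ball 0 r. H w $ i = w ^ n * f w"
    and oth: "\<forall>j. j \<noteq> i \<longrightarrow> (\<exists>f'. f' holomorphic_on ball 0 r \<and> (\<forall>w\<in>ball 0 r. H w $ j = w ^ n * f' w))" by blast
  have "\<forall>j. \<exists>f'. f' holomorphic_on ball 0 r \<and> (\<forall>w\<in>ball 0 r. H w $ j = w ^ n * f' w) \<and> (j = i \<longrightarrow> f' = f)"
    using nf oth by metis
  then obtain G where G: "\<And>j. G j holomorphic_on ball 0 r" "\<And>j w. w \<in> ball 0 r \<Longrightarrow> H w $ j = w ^ n * G j w" "G i = f" by metis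
  define g where "g w = (\<chi> j. G j w)" for w
  have "g 0 $ i \<noteq> 0" using G(3) nf(5) by (simp add: g_def)
  hence "g 0 \<noteq> 0" by (metis zero_index)
  moreover have "\<forall>w\<in>ball 0 r. H w = w ^ n *s g w" using G(2) by (simp add: g_def vec_eq_iff)
  moreover have "\<forall>i. (\<lambda>w. g w $ i) holomorphic_on ball 0 r" using G(1) by (simp add: g_def)
  ultimately show ?thesis using nf by blast
qed

text \<open>A disc moved by the flow at rate \<open>l\<close> satisfies \<open>l w h' = Y h\<close>.
  Subtracting two such equations, dividing by \<open>w ^ m\<close> and letting \<open>w\<close> tend
  to 0 leaves the eigenvalue equation for \<open>g 0\<close>; strict differentiability controls
  \<open>Y (h1 w) - Y (h2 w)\<close>. With \<open>h2 = 0\<close> this gives the leading term of a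
  single disc.\<close>

lemma leading_eigenvector:
  assumes Y: "\<And>i. holomorphic_fun2 S (\<lambda>z. Y z $ i)" and S: "0 \<in> S"
    and h1: "\<And>i. (\<lambda>w. h1 w $ i) holomorphic_on ball 0 \<rho>" "h1 0 = 0"
    and h2: "\<And>i. (\<lambda>w. h2 w $ i) holomorphic_on ball 0 \<rho>" "h2 0 = 0" and \<rho>: "\<rho> > 0"
    and ode1: "\<And>w i. w \<in> ball 0 \<rho> \<Longrightarrow> w \<noteq> 0 \<Longrightarrow> l * w * deriv (\<lambda>w. h1 w $ i) w = Y (h1 w) $ i"
    and ode2: "\<And>w i. w \<in> ball 0 \<rho> \<Longrightarrow> w \<noteq> 0 \<Longrightarrow> l * w * deriv (\<lambda>w. h2 w $ i) w = Y (h2 w) $ i"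
    and g: "\<And>i. (\<lambda>w. g w $ i) holomorphic_on ball 0 \<rho>" "\<And>w. w \<in> ball 0 \<rho> \<Longrightarrow> h1 w - h2 w = w ^ m *s g w" and m: "m > 0"
  shows "pd 1 (\<lambda>z. Y z $ i) 0 * g 0 $ 1 + pd 2 (\<lambda>z. Y z $ i) 0 * g 0 $ 2 = l * of_nat m * g 0 $ i"
proof -
  let ?A = "\<lambda>v :: complex^2. pd 1 (\<lambda>z. Y z $ i) 0 * v $ 1 + pd 2 (\<lambda>z. Y z $ i) 0 * v $ 2"
  define D where "D w = l * (of_nat m * g w $ i + w * deriv (\<lambda>w. g w $ i) w) - ?A (g w)" for w
  have gc: "isCont (\<lambda>w. g w $ j) 0" for j
    using holomorphic_on_imp_continuous_on[OF g(1)] \<rho> by (simp add: continuous_on_eq_continuous_at)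
  have dgc: "isCont (deriv (\<lambda>w. g w $ j)) 0" for j
    using holomorphic_on_imp_continuous_on[OF holomorphic_deriv[OF g(1) open_ball]] \<rho> by (simp add: continuous_on_eq_continuous_at)
  have glim: "((\<lambda>w. g w) \<longlongrightarrow> g 0) (at 0)" by (rule vec_tendstoI) (use gc in \<open>simp add: isCont_def\<close>)
  have Dlim: "(D \<longlongrightarrow> D 0) (at 0)"
    unfolding D_def by (intro tendsto_intros glim dgc[unfolded isCont_def])
  have hl: "(h1 \<longlongrightarrow> 0) (at 0)" "(h2 \<longlongrightarrow> 0) (at 0)"
  proof -
    have "isCont (\<lambda>w. h1 w $ j) 0" "isCont (\<lambda>w. h2 w $ j) 0" for j
      using holomorphic_on_imp_continuous_on[OF h1(1)] holomorphic_on_imp_continuous_on[OF h2(1)] \<rho>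
      by (simp_all add: continuous_on_eq_continuous_at)
    thus "(h1 \<longlongrightarrow> 0) (at 0)" "(h2 \<longlongrightarrow> 0) (at 0)" by (auto intro!: vec_tendstoI simp: isCont_def h1(2) h2(2))
  qed
  have bound: "norm (D 0) \<le> e * norm (g 0)" if e: "e > 0" for e
  proof (rule tendsto_le[OF _ tendsto_mult[OF tendsto_const tendsto_norm[OF glim]] tendsto_norm[OF Dlim]])
    obtain d where d: "d > 0" "\<And>x y. x \<in> ball 0 d \<Longrightarrow> y \<in> ball 0 d \<Longrightarrow> norm (Y x $ i - Y y $ i - ?A (x - y)) \<le> e * norm (x - y)"
      using strict_derivative[OF Y S e, of i] by blast
    have "\<forall>\<^sub>F w in at 0. h1 w \<in> ball 0 d" "\<forall>\<^sub>F w in at 0. h2 w \<in> ball 0 d"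
      using order_tendstoD(2)[OF tendsto_norm_zero[OF hl(1)] d(1)] order_tendstoD(2)[OF tendsto_norm_zero[OF hl(2)] d(1)] by simp_all
    moreover have "\<forall>\<^sub>F w in at (0::complex). w \<in> ball 0 \<rho> \<and> w \<noteq> 0"
      unfolding eventually_at using \<rho> by (intro exI[of _ \<rho>]) auto
    ultimately show "\<forall>\<^sub>F w in at 0. norm (D w) \<le> e * norm (g w)"
    proof eventually_elim
      case (elim w)
      hence w: "w \<in> ball 0 \<rho>" "w \<noteq> 0" by auto
      have dd: "(f has_field_derivative deriv f w) (at w)" if "f holomorphic_on ball 0 \<rho>" for f
        using holomorphic_derivI[OF that open_ball w(1)] .
      have "((\<lambda>w. h1 w $ i - h2 w $ i) has_field_derivative deriv (\<lambda>w. h1 w $ i) w - deriv (\<lambda>w. h2 w $ i) w) (at w)"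
        by (intro DERIV_diff dd h1 h2)
      moreover have "((\<lambda>w. w ^ m * g w $ i) has_field_derivative of_nat m * w ^ (m - 1) * g w $ i + w ^ m * deriv (\<lambda>w. g w $ i) w) (at w)"
        using dd[OF g(1)] by (auto intro!: derivative_eq_intros simp: algebra_simps)
      hence "((\<lambda>w. h1 w $ i - h2 w $ i) has_field_derivative of_nat m * w ^ (m - 1) * g w $ i + w ^ m * deriv (\<lambda>w. g w $ i) w) (at w)"
        by (rule has_field_derivative_transform_within_open[OF _ open_ball w(1)]) (use g(2) in \<open>auto simp: vec_eq_iff\<close>)
      ultimately have eq: "deriv (\<lambda>w. h1 w $ i) w - deriv (\<lambda>w. h2 w $ i) w = of_nat m * w ^ (m - 1) * g w $ i + w ^ m * deriv (\<lambda>w. g w $ i) w"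
        by (rule DERIV_unique)
      have wm: "w * w ^ (m - 1) = w ^ m" using m by (metis power_Suc Suc_diff_1)
      have "Y (h1 w) $ i - Y (h2 w) $ i = l * w * (deriv (\<lambda>w. h1 w $ i) w - deriv (\<lambda>w. h2 w $ i) w)"
        using ode1[OF w] ode2[OF w] by (simp add: algebra_simps)
      also have "\<dots> = l * (of_nat m * (w * w ^ (m - 1)) * g w $ i + w * w ^ m * deriv (\<lambda>w. g w $ i) w)"
        unfolding eq by (simp add: algebra_simps)
      also have "\<dots> = w ^ m * (l * (of_nat m * g w $ i + w * deriv (\<lambda>w. g w $ i) w))" unfolding wm by (simp add: algebra_simps)
      finally have Yd: "Y (h1 w) $ i - Y (h2 w) $ i = w ^ m * (l * (of_nat m * g w $ i + w * deriv (\<lambda>w. g w $ i) w))" .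
      have "Y (h1 w) $ i - Y (h2 w) $ i - ?A (h1 w - h2 w) = w ^ m * D w"
        unfolding Yd g(2)[OF w(1)] by (simp add: D_def algebra_simps)
      hence "norm (w ^ m) * norm (D w) \<le> e * norm (w ^ m *s g w)"
        using d(2)[of "h1 w" "h2 w"] elim g(2)[OF w(1)] by (simp add: norm_mult)
      hence "norm (D w) * norm (w ^ m) \<le> e * norm (g w) * norm (w ^ m)" by (simp add: norm_vector_scalar_mult mult_ac)
      thus ?case by (rule mult_right_le_imp_le) (use w in simp)
    qed
  qed simp
  have "norm (D 0) \<le> 0"
  proof (rule field_le_epsilon)
    fix e :: real assume e: "e > 0"
    have "norm (D 0) \<le> e / (norm (g 0) + 1) * norm (g 0)" by (rule bound) (use e in \<open>simp add: add_nonneg_pos\<close>)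
    also have "\<dots> \<le> e / (norm (g 0) + 1) * (norm (g 0) + 1)" using e by (intro mult_left_mono) auto
    also have "\<dots> = e" by (simp add: add_nonneg_eq_0_iff)
    finally show "norm (D 0) \<le> 0 + e" by simp
  qed
  thus ?thesis by (simp add: D_def algebra_simps)
qed

section \<open>Change of coordinates\<close>

text \<open>The linear map whose matrix has the columns \<open>a\<close> and
  \<open>b\<close>.\<close>

definition lin2 :: "complex^2 \<Rightarrow> complex^2 \<Rightarrow> complex^2 \<Rightarrow> complex^2" where
  "lin2 a b v = v $ 1 *s a + v $ 2 *s b"

lemma cdiff_lin2: "(\<And>j. cdiff (\<lambda>z. f z $ j) z) \<Longrightarrow> cdiff (\<lambda>z. lin2 a b (f z - c) $ i) z"
  unfolding lin2_def by (simp, intro cdiff_add cdiff_mult cdiff_diff cdiff_const)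

lemma lin2_linear: "lin2 a b (x - y) = lin2 a b x - lin2 a b y" "lin2 a b (s *s x) = s *s lin2 a b x"
  by (simp_all add: lin2_def vec_eq_iff algebra_simps)

lemma lin2_inverse_ex:
  fixes a b :: "complex^2"
  assumes det: "a $ 1 * b $ 2 - a $ 2 * b $ 1 \<noteq> 0"
  shows "\<exists>c d. (\<forall>v. lin2 a b (lin2 c d v) = v) \<and> (\<forall>v. lin2 c d (lin2 a b v) = v)"
proof -
  define k where "k = inverse (a $ 1 * b $ 2 - a $ 2 * b $ 1)"
  have k: "k * (a $ 1 * b $ 2 - a $ 2 * b $ 1) = 1" using det by (simp add: k_def)
  have *: "(x * (b2 * k) + y * (- b1 * k)) * a1 + (x * (- a2 * k) + y * (a1 * k)) * b1 = x"
    "(x * (b2 * k) + y * (- b1 * k)) * a2 + (x * (- a2 * k) + y * (a1 * k)) * b2 = y"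
    "(x * a1 + y * b1) * (b2 * k) + (x * a2 + y * b2) * (- b1 * k) = x"
    "(x * a1 + y * b1) * (- a2 * k) + (x * a2 + y * b2) * (a1 * k) = y"
    if k: "k * (a1 * b2 - a2 * b1) = 1" for x y a1 a2 b1 b2 k :: complex
  proof -
    have "(x * (b2 * k) + y * (- b1 * k)) * a1 + (x * (- a2 * k) + y * (a1 * k)) * b1 = (k * (a1 * b2 - a2 * b1)) * x"
      "(x * (b2 * k) + y * (- b1 * k)) * a2 + (x * (- a2 * k) + y * (a1 * k)) * b2 = (k * (a1 * b2 - a2 * b1)) * y"
      "(x * a1 + y * b1) * (b2 * k) + (x * a2 + y * b2) * (- b1 * k) = (k * (a1 * b2 - a2 * b1)) * x"
      "(x * a1 + y * b1) * (- a2 * k) + (x * a2 + y * b2) * (a1 * k) = (k * (a1 * b2 - a2 * b1)) * y"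
      by (simp_all add: algebra_simps)
    thus "(x * (b2 * k) + y * (- b1 * k)) * a1 + (x * (- a2 * k) + y * (a1 * k)) * b1 = x"
      "(x * (b2 * k) + y * (- b1 * k)) * a2 + (x * (- a2 * k) + y * (a1 * k)) * b2 = y"
      "(x * a1 + y * b1) * (b2 * k) + (x * a2 + y * b2) * (- b1 * k) = x"
      "(x * a1 + y * b1) * (- a2 * k) + (x * a2 + y * b2) * (a1 * k) = y"
      unfolding k by simp_all
  qed
  \<comment> \<open>Cramer's rule: the columns of the inverse matrix, with \<open>k\<close> the
    inverse of the determinant.\<close>
  let ?c = "vec2 (b $ 2 * k) (- a $ 2 * k)" and ?d = "vec2 (- b $ 1 * k) (a $ 1 * k)"
  have 1: "lin2 a b (lin2 ?c ?d v) = v" for v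
    unfolding lin2_def vec2_eq_iff vector_add_component vector_smult_component vec2_nth
    by (intro conjI *(1,2)[OF k])
  have 2: "lin2 ?c ?d (lin2 a b v) = v" for v
    unfolding lin2_def vec2_eq_iff vector_add_component vector_smult_component vec2_nth
    by (intro conjI *(3,4)[OF k])
  show ?thesis using 1 2 by blast
qed

context surface
begin

text \<open>The atlas is maximal, so it suffices that the new coordinates form a topological chart
  compatible with all others; both follow by composition with an affine isomorphism.\<close>

lemma affine_chart:
  assumes \<kappa>: "\<kappa> \<in> \<A>" and inv: "\<And>v. lin2 a b (lin2 c d v) = v" "\<And>v. lin2 c d (lin2 a b v) = v"
  shows "(fst \<kappa>, \<lambda>q. lin2 a b (snd \<kappa> q - z0)) \<in> \<A>"
proof -
  define T where "T z = lin2 a b (z - z0)" for z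
  define T' where "T' w = lin2 c d w + z0" for w
  have TT': "T (T' w) = w" "T' (T z) = z" for w z by (simp_all add: T_def T'_def inv)
  have contT: "continuous_on A T" "continuous_on A T'" for A
    unfolding T_def T'_def lin2_def by (intro continuous_intros)+
  have opT: "open (T ` W)" if "open W" for W
  proof -
    have "T ` W = T' -` W"
    proof
      show "T ` W \<subseteq> T' -` W" using TT' by auto
      show "T' -` W \<subseteq> T ` W" using TT'(1) by (metis image_eqI subsetI vimageE)
    qed
    thus ?thesis using open_vimage[OF that contT(2)] by simp
  qed
  define \<phi> where "\<phi> q = T (snd \<kappa> q)" for q
  let ?\<kappa> = "(fst \<kappa>, \<phi>)"
  have im: "\<phi> ` W = T ` (snd \<kappa> ` W)" for W by (auto simp: \<phi>_def)
  have homT: "homeomorphic_map (top_of_set (img \<kappa>)) (top_of_set (T ` img \<kappa>)) T"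
    unfolding homeomorphic_map_maps
    by (rule exI[of _ T']) (auto simp: homeomorphic_maps_def continuous_map_in_subtopology TT' contT)
  have "homeomorphic_map (subtopology N (fst \<kappa>)) (top_of_set (T ` img \<kappa>)) (T \<circ> snd \<kappa>)"
    by (rule homeomorphic_map_compose[OF chart_homeo[OF \<kappa>] homT])
  hence hom: "homeomorphic_map (subtopology N (fst \<kappa>)) (top_of_set (\<phi> ` fst \<kappa>)) \<phi>"
    by (simp add: img_def \<phi>_def[abs_def] comp_def image_image)
  have top: "topological_chart N ?\<kappa>"
    unfolding topological_chart_def using chart_open[OF \<kappa>] hom opT[OF img_open[OF \<kappa>]] by (simp add: im img_def)
  have par: "inv_into (fst \<kappa>) \<phi> (\<phi> q) = q" if "q \<in> fst \<kappa>" for q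
  proof (rule inv_into_f_f[OF _ that])
    show "inj_on \<phi> (fst \<kappa>)" unfolding \<phi>_def by (rule inj_onI) (metis TT'(2) inj_onD[OF chart_inj[OF \<kappa>]])
  qed
  have comp: "compatible_charts ?\<kappa> \<mu>" if \<mu>: "\<mu> \<in> \<A>" for \<mu>
  proof -
    have cc: "compatible_charts \<kappa> \<mu>" using surf \<kappa> \<mu> by (simp add: complex_surface_def)
    have op1: "open (snd \<kappa> ` (fst \<kappa> \<inter> fst \<mu>))" and op2: "open (snd \<mu> ` (fst \<kappa> \<inter> fst \<mu>))"
      using cc by (cases \<kappa>; cases \<mu>; simp add: compatible_charts_def holomorphic_map2_def holomorphic_fun2_iff)+
    have c1: "cdiff (\<lambda>w. snd \<mu> (inv_into (fst \<kappa>) \<phi> w) $ i) (\<phi> q)" if q: "q \<in> fst \<kappa>" "q \<in> fst \<mu>" for q i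
    proof -
      have "T' (\<phi> q) = snd \<kappa> q" by (simp add: \<phi>_def TT')
      hence "cdiff (\<lambda>z. snd \<mu> (param \<kappa> z) $ i) (T' (\<phi> q))" using chart_trans[OF \<kappa> \<mu> q] by simp
      moreover have "cdiff (\<lambda>w. T' w $ j) (\<phi> q)" for j
        unfolding T'_def using cdiff_add[OF cdiff_lin2[of "\<lambda>z. z" _ _ _ 0] cdiff_const] by simp
      ultimately have 1: "cdiff (\<lambda>w. snd \<mu> (param \<kappa> (T' w)) $ i) (\<phi> q)" by (rule cdiff_compose)
      have "open (\<phi> ` fst \<kappa>)" using opT[OF img_open[OF \<kappa>]] by (simp add: im img_def)
      hence "\<forall>\<^sub>F w in nhds (\<phi> q). w \<in> \<phi> ` fst \<kappa>"
        by (rule eventually_nhds_in_open) (use q in blast)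
      hence "\<forall>\<^sub>F w in nhds (\<phi> q). snd \<mu> (param \<kappa> (T' w)) $ i = snd \<mu> (inv_into (fst \<kappa>) \<phi> w) $ i"
      proof eventually_elim
        case (elim w)
        then obtain q' where q': "q' \<in> fst \<kappa>" "w = \<phi> q'" by blast
        have "T' w = snd \<kappa> q'" by (simp add: q' \<phi>_def TT')
        thus ?case using par[OF q'(1)] q' param_chart[OF \<kappa> q'(1)] by simp
      qed
      from cdiff_cong[OF this] show ?thesis using 1 by simp
    qed
    have c2: "cdiff (\<lambda>w. \<phi> (inv_into (fst \<mu>) (snd \<mu>) w) $ i) (snd \<mu> q)" if q: "q \<in> fst \<kappa>" "q \<in> fst \<mu>" for q i
      unfolding \<phi>_def T_def using cdiff_lin2[OF chart_trans[OF \<mu> \<kappa> q(2,1)]] by (simp add: param_def)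
    have "holomorphic_map2 (\<phi> ` (fst \<kappa> \<inter> fst \<mu>)) (in_chart ?\<kappa> (snd \<mu>))"
      unfolding holomorphic_map2_def holomorphic_fun2_iff in_chart_def
      using c1 opT[OF op1] by (auto simp: im[of "fst \<kappa> \<inter> fst \<mu>"]) (auto simp: \<phi>_def)
    moreover have "holomorphic_map2 (snd \<mu> ` (fst \<kappa> \<inter> fst \<mu>)) (in_chart \<mu> \<phi>)"
      unfolding holomorphic_map2_def holomorphic_fun2_iff in_chart_eq param_def using c2 op2 by auto
    ultimately show ?thesis by (cases \<mu>) (simp add: compatible_charts_def Int_commute)
  qed
  have "?\<kappa> \<in> \<A>" using surf top comp unfolding complex_surface_def by blast
  thus ?thesis by (simp add: \<phi>_def[abs_def] T_def)
qed

end

section \<open>Jacobians, transition maps and conjugacy of linear parts\<close>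

definition jac :: "(complex^2 \<Rightarrow> complex^2) \<Rightarrow> complex^2 \<Rightarrow> complex^2 \<Rightarrow> complex^2" where
  "jac F z u = (\<chi> i. pd 1 (\<lambda>z. F z $ i) z * u $ 1 + pd 2 (\<lambda>z. F z $ i) z * u $ 2)"

lemma jac_has_derivative: "(\<And>i. cdiff (\<lambda>z. F z $ i) z) \<Longrightarrow> (F has_derivative jac F z) (at z)"
  unfolding jac_def[abs_def] by (rule cdiff_map_has_derivative)

lemma jac_unique: "(\<And>i. cdiff (\<lambda>z. F z $ i) z) \<Longrightarrow> (F has_derivative D) (at z) \<Longrightarrow> jac F z = D"
  by (rule has_derivative_unique[OF jac_has_derivative])

lemma jac_compose:
  assumes F: "\<And>i. cdiff (\<lambda>z. F z $ i) z" and G: "\<And>i. cdiff (\<lambda>w. G w $ i) (F z)"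
  shows "jac (\<lambda>z. G (F z)) z u = jac G (F z) (jac F z u)"
proof -
  have "cdiff (\<lambda>z. G (F z) $ i) z" for i by (rule cdiff_compose[OF G F])
  from jac_unique[OF this has_derivative_compose[OF jac_has_derivative[OF F] jac_has_derivative[OF G]]]
  show ?thesis by (simp add: fun_eq_iff)
qed

lemma jac_cong:
  assumes "\<forall>\<^sub>F w in nhds z. F w = G w" shows "jac F z = jac G z"
proof -
  have "\<forall>\<^sub>F w in nhds z. F w $ i = G w $ i" for i using assms by eventually_elim simp
  from pd_cong[OF this] show ?thesis by (simp add: jac_def[abs_def])
qed

lemma jac_ident: "jac (\<lambda>z. z) z = (\<lambda>u. u)"
  by (rule jac_unique[OF cdiff_nth has_derivative_ident])

lemma jac_scale: "jac F z (s *s u) = s *s jac F z u"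
  by (simp add: jac_def vec_eq_iff algebra_simps)

lemma jac_add: "jac F z (u + v) = jac F z u + jac F z v"
  by (simp add: jac_def vec_eq_iff algebra_simps)

lemma jac_lin2: "jac (\<lambda>z. lin2 a b (z - z0)) z = lin2 a b"
proof (rule jac_unique)
  show "cdiff (\<lambda>z. lin2 a b (z - z0) $ i) z" for i by (rule cdiff_lin2[OF cdiff_nth])
  have "bounded_linear (lin2 a b)"
    unfolding lin2_def[abs_def] 
    by (intro bounded_linear_add bounded_linear_compose[OF bounded_linear_smult_left] bounded_linear_vec_nth)
  moreover have "((\<lambda>z. z - z0) has_derivative (\<lambda>u. u)) (at z)" by (auto intro!: derivative_eq_intros)
  ultimately show "((\<lambda>z. lin2 a b (z - z0)) has_derivative lin2 a b) (at z)" by (rule bounded_linear.has_derivative)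
qed

context surface
begin

definition transition :: "'a chart \<Rightarrow> 'a chart \<Rightarrow> complex^2 \<Rightarrow> complex^2" where
  "transition \<kappa> \<kappa>' z = snd \<kappa>' (param \<kappa> z)"

lemma transition_cdiff:
  "\<kappa> \<in> \<A> \<Longrightarrow> \<kappa>' \<in> \<A> \<Longrightarrow> q \<in> fst \<kappa> \<Longrightarrow> q \<in> fst \<kappa>' \<Longrightarrow> cdiff (\<lambda>z. transition \<kappa> \<kappa>' z $ i) (snd \<kappa> q)"
  unfolding transition_def by (rule chart_trans)

lemma transition_point: "\<kappa> \<in> \<A> \<Longrightarrow> q \<in> fst \<kappa> \<Longrightarrow> transition \<kappa> \<kappa>' (snd \<kappa> q) = snd \<kappa>' q"
  by (simp add: transition_def param_chart)

lemma transition_inverse: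
  assumes \<kappa>: "\<kappa> \<in> \<A>" "q \<in> fst \<kappa>" and \<kappa>': "\<kappa>' \<in> \<A>" "q \<in> fst \<kappa>'"
  shows "jac (transition \<kappa>' \<kappa>) (snd \<kappa>' q) (jac (transition \<kappa> \<kappa>') (snd \<kappa> q) u) = u"
proof -
  have "cdiff (\<lambda>w. transition \<kappa>' \<kappa> w $ i) (transition \<kappa> \<kappa>' (snd \<kappa> q))" for i
    using transition_cdiff[OF \<kappa>'(1) \<kappa>(1) \<kappa>'(2) \<kappa>(2)] by (simp add: transition_point[OF \<kappa>])
  from jac_compose[of "transition \<kappa> \<kappa>'", OF transition_cdiff[OF \<kappa>(1) \<kappa>'(1) \<kappa>(2) \<kappa>'(2)] this, of u]
  have "jac (transition \<kappa>' \<kappa>) (snd \<kappa>' q) (jac (transition \<kappa> \<kappa>') (snd \<kappa> q) u) = jac (\<lambda>z. transition \<kappa>' \<kappa> (transition \<kappa> \<kappa>' z)) (snd \<kappa> q) u"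
    by (simp add: transition_point[OF \<kappa>])
  also have "\<forall>\<^sub>F z in nhds (snd \<kappa> q). transition \<kappa>' \<kappa> (transition \<kappa> \<kappa>' z) = z"
    using eventually_in_chart[OF \<kappa> chart_open[OF \<kappa>'(1)] \<kappa>'(2)]
    by eventually_elim (simp add: transition_def param_chart[OF \<kappa>'(1)] chart_param)
  from jac_cong[OF this] have "jac (\<lambda>z. transition \<kappa>' \<kappa> (transition \<kappa> \<kappa>' z)) (snd \<kappa> q) u = u" by (simp add: jac_ident)
  finally show ?thesis .
qed

lemma holomorphic_lin2:
  assumes f: "\<And>i. (\<lambda>q. f q $ i) \<in> holomorphic_functions \<A>"
  shows "(\<lambda>q. lin2 a b (f q - z0) $ i) \<in> holomorphic_functions \<A>"
  unfolding holomorphic_functions_iff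
proof
  fix q assume "q \<in> topspace N"
  then obtain \<kappa> where \<kappa>: "\<kappa> \<in> \<A>" "q \<in> fst \<kappa>" using chart_at by blast
  have "cdiff (\<lambda>z. f (param \<kappa> z) $ j) (snd \<kappa> q)" for j
    using holomorphic_in_chart[OF f \<kappa>(1)] chart_in[OF \<kappa>(2)] by (simp add: holomorphic_fun2_iff)
  from cdiff_lin2[OF this] show "mdiff (\<lambda>q. lin2 a b (f q - z0) $ i) q" using \<kappa> unfolding mdiff_def by blast
qed

text \<open>The Stein condition supplies a chart with globally holomorphic coordinates; the affine
  change applied here is only the translation that centres it at \<open>p\<close>.\<close>

lemma stein_chart:
  assumes "stein_surface N \<A>" "p \<in> topspace N"
  obtains \<kappa> where "\<kappa> \<in> \<A>" "p \<in> fst \<kappa>" "snd \<kappa> p = 0" "\<forall>i. (\<lambda>q. snd \<kappa> q $ i) \<in> holomorphic_functions \<A>"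
proof -
  obtain F U where F: "\<And>i. (\<lambda>q. F q $ i) \<in> holomorphic_functions \<A>" "p \<in> U" "(U, F) \<in> \<A>"
    using assms unfolding stein_surface_def by blast
  have id: "lin2 (axis 1 1) (axis 2 1) v = v" for v by (simp add: lin2_def vec2_eq_iff)
  have z: "lin2 (axis 1 1) (axis 2 1) (F p - F p) = 0" unfolding id by simp
  from affine_chart[OF F(3), of "axis 1 1" "axis 2 1" "axis 1 1" "axis 2 1" "F p"]
  have "(U, \<lambda>q. lin2 (axis 1 1) (axis 2 1) (F q - F p)) \<in> \<A>" unfolding id by simp
  from that[OF this] show thesis using F(2) z holomorphic_lin2[where f=F, OF F(1)] by simp
qed

end

context complete_field
begin

lemma singular_Y: "p \<in> singularities N \<A> X \<Longrightarrow> \<kappa> \<in> \<A> \<Longrightarrow> p \<in> fst \<kappa> \<Longrightarrow> Y \<kappa> (snd \<kappa> p) = 0"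
  by (simp add: Y_def param_chart singularities_def)

lemma Y_cdiff: "\<kappa> \<in> \<A> \<Longrightarrow> q \<in> fst \<kappa> \<Longrightarrow> cdiff (\<lambda>z. Y \<kappa> z $ i) (snd \<kappa> q)"
  using Y_hol[of \<kappa> i] chart_in[of q \<kappa>] by (simp add: holomorphic_fun2_iff)

lemma linear_part_jac: "\<kappa> \<in> \<A> \<Longrightarrow> p \<in> fst \<kappa> \<Longrightarrow> linear_part X \<kappa> p = jac (Y \<kappa>) (snd \<kappa> p)"
  unfolding linear_part_def in_chart_eq Y_def[symmetric]
  by (rule frechet_derivative_at[OF jac_has_derivative[OF Y_cdiff], symmetric])

lemma Y_transition:
  assumes \<kappa>: "\<kappa> \<in> \<A>" "q \<in> fst \<kappa>" and \<kappa>': "\<kappa>' \<in> \<A>" "q \<in> fst \<kappa>'"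
  shows "Y \<kappa>' (snd \<kappa>' q) = jac (transition \<kappa> \<kappa>') (snd \<kappa> q) (Y \<kappa> (snd \<kappa> q))"
proof -
  have "X \<kappa>' q = frechet_derivative (in_chart \<kappa> (snd \<kappa>')) (at (snd \<kappa> q)) (X \<kappa> q)"
    using hvf \<kappa> \<kappa>' unfolding holomorphic_vector_field_def by blast
  moreover have "frechet_derivative (in_chart \<kappa> (snd \<kappa>')) (at (snd \<kappa> q)) = jac (transition \<kappa> \<kappa>') (snd \<kappa> q)"
    unfolding in_chart_eq transition_def[symmetric]
    by (rule frechet_derivative_at[OF jac_has_derivative[OF transition_cdiff[OF \<kappa>(1) \<kappa>'(1) \<kappa>(2) \<kappa>'(2)]], symmetric])
  ultimately show ?thesis by (simp add: Y_def param_chart \<kappa> \<kappa>')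
qed

text \<open>The transformation law of the vector field is differentiated at \<open>p\<close>. The
  term with second derivatives of the transition map is multiplied by the value of
  \<open>Y \<kappa>\<close> at \<open>p\<close>, which vanishes.\<close>

lemma linear_part_conjugate:
  assumes sing: "p \<in> singularities N \<A> X" and \<kappa>: "\<kappa> \<in> \<A>" "p \<in> fst \<kappa>" and \<kappa>': "\<kappa>' \<in> \<A>" "p \<in> fst \<kappa>'"
  shows "jac (Y \<kappa>') (snd \<kappa>' p) (jac (transition \<kappa> \<kappa>') (snd \<kappa> p) u) = jac (transition \<kappa> \<kappa>') (snd \<kappa> p) (jac (Y \<kappa>) (snd \<kappa> p) u)"
proof -
  let ?z = "snd \<kappa> p" and ?\<tau> = "transition \<kappa> \<kappa>'"
  define W where "W = {z \<in> img \<kappa>. param \<kappa> z \<in> fst \<kappa>'}"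
  have W: "open W" unfolding W_def by (rule param_preimage_open[OF \<kappa>(1) chart_open[OF \<kappa>'(1)]])
  have zW: "?z \<in> W" using \<kappa> \<kappa>' by (simp add: W_def chart_in param_chart)
  have \<tau>h: "holomorphic_fun2 W (\<lambda>z. ?\<tau> z $ i)" for i
    unfolding holomorphic_fun2_iff
  proof (intro conjI ballI W)
    fix z assume "z \<in> W"
    thus "cdiff (\<lambda>z. ?\<tau> z $ i) z"
      using transition_cdiff[OF \<kappa>(1) \<kappa>'(1), of "param \<kappa> z" i] by (simp add: W_def param_in chart_param)
  qed
  have Y0: "Y \<kappa> ?z = 0" by (rule singular_Y[OF sing \<kappa>])
  have \<tau>c: "cdiff (\<lambda>z. ?\<tau> z $ i) ?z" for i using \<tau>h zW by (simp add: holomorphic_fun2_iff)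
  have Yc: "cdiff (\<lambda>w. Y \<kappa>' w $ i) (?\<tau> ?z)" for i using Y_cdiff[OF \<kappa>'] by (simp add: transition_point[OF \<kappa>])
  have Yd: "((\<lambda>z. Y \<kappa> z $ i) has_derivative (\<lambda>v. jac (Y \<kappa>) ?z v $ i)) (at ?z)" for i
    using cdiff_has_derivative[OF Y_cdiff[OF \<kappa>], of i] by (simp add: jac_def)
  have pdd: "(pd j (\<lambda>z. ?\<tau> z $ i) has_derivative (\<lambda>v. pd 1 (pd j (\<lambda>z. ?\<tau> z $ i)) ?z * v $ 1 + pd 2 (pd j (\<lambda>z. ?\<tau> z $ i)) ?z * v $ 2)) (at ?z)" for i j
    by (rule cdiff_has_derivative) (use holomorphic_fun2_pd[OF \<tau>h, of j i] zW in \<open>simp add: holomorphic_fun2_iff\<close>)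
  have R: "((\<lambda>z. jac ?\<tau> z (Y \<kappa> z) $ i) has_derivative (\<lambda>v. jac ?\<tau> ?z (jac (Y \<kappa>) ?z v) $ i)) (at ?z)" for i
  proof -
    have "((\<lambda>z. pd 1 (\<lambda>z. ?\<tau> z $ i) z * Y \<kappa> z $ 1 + pd 2 (\<lambda>z. ?\<tau> z $ i) z * Y \<kappa> z $ 2) has_derivative
      (\<lambda>v. pd 1 (\<lambda>z. ?\<tau> z $ i) ?z * jac (Y \<kappa>) ?z v $ 1 + pd 2 (\<lambda>z. ?\<tau> z $ i) ?z * jac (Y \<kappa>) ?z v $ 2)) (at ?z)"
      by (rule has_derivative_eq_rhs[OF has_derivative_add[OF has_derivative_mult[OF pdd Yd] has_derivative_mult[OF pdd Yd]]])
         (simp add: Y0 fun_eq_iff)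
    thus ?thesis by (simp add: jac_def)
  qed
  have ev: "\<forall>\<^sub>F z in nhds ?z. Y \<kappa>' (?\<tau> z) = jac ?\<tau> z (Y \<kappa> z)"
    using eventually_nhds_in_open[OF W zW]
  proof eventually_elim
    case (elim z)
    thus ?case using Y_transition[OF \<kappa>(1) _ \<kappa>'(1), of "param \<kappa> z"]
      by (simp add: W_def param_in chart_param transition_def)
  qed
  have "jac (\<lambda>z. Y \<kappa>' (?\<tau> z)) ?z u $ i = jac ?\<tau> ?z (jac (Y \<kappa>) ?z u) $ i" for i
  proof -
    have L: "((\<lambda>z. Y \<kappa>' (?\<tau> z) $ i) has_derivative (\<lambda>v. jac (\<lambda>z. Y \<kappa>' (?\<tau> z)) ?z v $ i)) (at ?z)"
      using cdiff_has_derivative[OF cdiff_compose[of "\<lambda>w. Y \<kappa>' w $ i" "?\<tau>", OF Yc \<tau>c]] by (simp add: jac_def)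
    have "((\<lambda>z. Y \<kappa>' (?\<tau> z) $ i) has_derivative (\<lambda>v. jac ?\<tau> ?z (jac (Y \<kappa>) ?z v) $ i)) (at ?z)"
    proof (rule has_derivative_transform_eventually[OF R])
      show "\<forall>\<^sub>F z in at ?z. jac ?\<tau> z (Y \<kappa> z) $ i = Y \<kappa>' (?\<tau> z) $ i"
        using ev unfolding eventually_nhds_conv_at by (auto elim: eventually_mono)
      show "jac ?\<tau> ?z (Y \<kappa> ?z) $ i = Y \<kappa>' (?\<tau> ?z) $ i" using eventually_nhds_x_imp_x[OF ev] by simp
    qed simp
    from has_derivative_unique[OF L this] show ?thesis by (rule fun_cong)
  qed
  hence "jac (\<lambda>z. Y \<kappa>' (?\<tau> z)) ?z u = jac ?\<tau> ?z (jac (Y \<kappa>) ?z u)" by (simp add: vec_eq_iff)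
  thus ?thesis using jac_compose[of "?\<tau>" ?z "Y \<kappa>'" u, OF \<tau>c Yc] by (simp add: transition_point[OF \<kappa>])
qed

text \<open>Used for both assertions of the theorem: linear coordinates turn \<open>v1\<close>,
  \<open>v2\<close> into the axes, local periodicity gives the averaged coordinates, and these
  linearize \<open>X\<close> on \<open>N\<close>. With \<open>\<nu> = a / b\<close> the time
  \<open>2 * pi * \<i> * b / m\<close> is a period of both linear factors. The additional multiple
  \<open>k\<close> makes it a period of the disc \<open>h\<close> as well: an orbit of rate
  \<open>l\<close> and leading exponent \<open>k\<close> has \<open>m = l * k\<close> and period
  \<open>2 * pi * \<i> / l\<close>.\<close>

lemma linearization_from_eigenvectors:
  fixes m :: complex and \<nu> :: real and a b k :: nat
  assumes stein: "stein_surface N \<A>" and conn: "connected_space N" and sing: "p \<in> singularities N \<A> X"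
    and \<kappa>: "\<kappa> \<in> \<A>" "p \<in> fst \<kappa>" "snd \<kappa> p = 0" "\<And>i. (\<lambda>q. snd \<kappa> q $ i) \<in> holomorphic_functions \<A>"
    and v: "jac (Y \<kappa>) 0 v1 = m *s v1" "jac (Y \<kappa>) 0 v2 = (m * of_real \<nu>) *s v2"
    and ind: "\<And>x y. x *s v1 + y *s v2 = 0 \<Longrightarrow> x = 0 \<and> y = 0"
    and m: "m \<noteq> 0" and \<nu>: "\<nu> = real a / real b" "b > 0" "\<nu> \<ge> 1" and k: "k > 0"
    and res: "(\<forall>n::nat. n \<ge> 2 \<longrightarrow> \<nu> \<noteq> n) \<or>
       (\<exists>h. (\<forall>\<^sub>F w in at (0::complex). h w \<in> img \<kappa> \<and> flow (2 * pi * \<i> * of_nat (b * k) / m) (param \<kappa> (h w)) = param \<kappa> (h w)) \<and>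
          (\<forall>i. ((\<lambda>w. h w $ i / w ^ k) \<longlongrightarrow> v1 $ i) (at 0)))"
  shows "\<exists>F. biholomorphism_C2 N \<A> F \<and> globally_linearizable N \<A> X \<and> F p = 0 \<and>
    (\<forall>i. (\<lambda>q. F q $ i) \<in> holomorphic_functions \<A>) \<and>
    (\<forall>q\<in>topspace N. \<forall>t. F (flow t q) = vec2 (exp (m * t) * F q $ 1) (exp (m * of_real \<nu> * t) * F q $ 2))"
proof -
  have det: "v1 $ 1 * v2 $ 2 - v1 $ 2 * v2 $ 1 \<noteq> 0"
  proof
    assume 0: "v1 $ 1 * v2 $ 2 - v1 $ 2 * v2 $ 1 = 0"
    have "v2 $ 1 *s v1 + (- v1 $ 1) *s v2 = 0" "v2 $ 2 *s v1 + (- v1 $ 2) *s v2 = 0"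
      using 0 by (simp_all add: vec2_eq_iff algebra_simps)
    from ind[OF this(1)] ind[OF this(2)] have "1 *s v1 + 0 *s v2 = 0" by (simp add: vec2_eq_iff)
    from ind[OF this] show False by simp
  qed
  obtain c d where cd: "\<And>v. lin2 v1 v2 (lin2 c d v) = v" "\<And>v. lin2 c d (lin2 v1 v2 v) = v"
    using lin2_inverse_ex[OF det] by blast
  let ?S = "lin2 c d"
  have Sv: "?S v1 = axis 1 1" "?S v2 = axis 2 1"
    using cd(2)[of "axis 1 1"] cd(2)[of "axis 2 1"] by (simp_all add: lin2_def)
  define \<kappa>' where "\<kappa>' = (fst \<kappa>, \<lambda>q. ?S (snd \<kappa> q - 0))"
  have \<kappa>'A: "\<kappa>' \<in> \<A>" unfolding \<kappa>'_def by (rule affine_chart[OF \<kappa>(1) cd(2,1)])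
  have f': "fst \<kappa>' = fst \<kappa>" and s': "snd \<kappa>' q = ?S (snd \<kappa> q)" for q by (simp_all add: \<kappa>'_def)
  have \<kappa>'p: "p \<in> fst \<kappa>'" using \<kappa>(2) by (simp add: f')
  have \<kappa>'0: "snd \<kappa>' p = 0" by (simp add: s' \<kappa>(3) lin2_def)
  have par: "?S z \<in> img \<kappa>'" "param \<kappa>' (?S z) = param \<kappa> z" if "z \<in> img \<kappa>" for z
  proof -
    have q: "param \<kappa> z \<in> fst \<kappa>'" using param_in[OF that] by (simp add: f')
    have z: "?S z = snd \<kappa>' (param \<kappa> z)" by (simp add: s' chart_param[OF that])
    show "?S z \<in> img \<kappa>'" unfolding z by (rule chart_in[OF q])
    show "param \<kappa>' (?S z) = param \<kappa> z" unfolding z by (rule param_chart[OF \<kappa>'A q])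
  qed
  have "0 \<in> img \<kappa>" using chart_in[OF \<kappa>(2)] \<kappa>(3) by simp
  from eventually_nhds_in_open[OF img_open[OF \<kappa>(1)] this]
  have "\<forall>\<^sub>F z in nhds 0. transition \<kappa> \<kappa>' z = ?S (z - 0)"
    by eventually_elim (simp add: transition_def s' chart_param)
  from jac_cong[OF this] have jS: "jac (transition \<kappa> \<kappa>') 0 = ?S" by (simp only: jac_lin2)
  have conj: "jac (Y \<kappa>') 0 (?S u) = ?S (jac (Y \<kappa>) 0 u)" for u
    using linear_part_conjugate[OF sing \<kappa>(1,2) \<kappa>'A \<kappa>'p, of u] by (simp add: \<kappa>(3) \<kappa>'0 jS)
  have e: "jac (Y \<kappa>') 0 (axis 1 1) = m *s axis 1 1" "jac (Y \<kappa>') 0 (axis 2 1) = (m * of_real \<nu>) *s axis 2 1"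
    using conj[of v1] conj[of v2] by (simp_all only: Sv v lin2_linear)
  define \<mu> where "\<mu> i = (if i = (1::2) then m else m * of_real \<nu>)" for i
  interpret D: diagonal_point N \<A> X \<kappa>' p \<mu>
  proof
    show "\<kappa>' \<in> \<A>" "p \<in> fst \<kappa>'" "snd \<kappa>' p = 0" "p \<in> singularities N \<A> X" by fact+
    show "(\<lambda>q. snd \<kappa>' q $ i) \<in> holomorphic_functions \<A>" for i
      using holomorphic_lin2[where f="snd \<kappa>", OF \<kappa>(4), of c d 0 i] by (simp add: s')
    show "pd j (\<lambda>z. Y \<kappa>' z $ i) 0 = (if i = j then \<mu> i else 0)" for i j
    proof -
      have "pd 1 (\<lambda>z. Y \<kappa>' z $ i) 0 = (m *s axis 1 1 :: complex^2) $ i" for i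
        using arg_cong[OF e(1), of "\<lambda>v. v $ i"] by (simp add: jac_def)
      moreover have "pd 2 (\<lambda>z. Y \<kappa>' z $ i) 0 = ((m * of_real \<nu>) *s axis 2 1 :: complex^2) $ i" for i
        using arg_cong[OF e(2), of "\<lambda>v. v $ i"] by (simp add: jac_def)
      ultimately show ?thesis using exhaust_2[of i] exhaust_2[of j] by (auto simp: \<mu>_def)
    qed
  qed
  define T where "T = 2 * pi * \<i> * of_nat (b * k) / m"
  have \<mu>12: "\<mu> 1 = m" "\<mu> 2 = m * of_real \<nu>" by (simp_all add: \<mu>_def)
  have expT: "exp (\<mu> i * T) = 1" for i
  proof -
    have e1: "exp (2 * pi * \<i> * of_nat n) = 1" for n :: nat
      using exp_integer_2pi[of "of_nat n"] by (simp add: mult_ac)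
    have "m * T = 2 * pi * \<i> * of_nat (b * k)" "m * of_real \<nu> * T = 2 * pi * \<i> * of_nat (a * k)"
      using m \<nu>(2) by (simp_all add: T_def \<nu>(1) field_simps)
    thus ?thesis using exhaust_2[of i] e1[of "b * k"] e1[of "a * k"] by (auto simp only: \<mu>12)
  qed
  have "\<exists>d>0. ball 0 d \<subseteq> img \<kappa>' \<and> (\<forall>z\<in>ball 0 d. flow T (param \<kappa>' z) = param \<kappa>' z)"
  proof (rule D.flow_periodic_near[OF m \<mu>12 \<nu>(3) expT])
    show "(\<forall>n::nat. n \<ge> 2 \<longrightarrow> \<nu> \<noteq> n) \<or>
       (\<exists>k h. k > 0 \<and> (\<forall>\<^sub>F w in at (0::complex). h w \<in> img \<kappa>' \<and> flow T (param \<kappa>' (h w)) = param \<kappa>' (h w)) \<and>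
          ((\<lambda>w. h w $ 1 / w ^ k) \<longlongrightarrow> 1) (at 0) \<and> ((\<lambda>w. h w $ 2 / w ^ k) \<longlongrightarrow> 0) (at 0))"
      using res
    proof (elim disjE exE conjE)
      fix h assume ev: "\<forall>\<^sub>F w in at (0::complex). h w \<in> img \<kappa> \<and> flow (2 * pi * \<i> * of_nat (b * k) / m) (param \<kappa> (h w)) = param \<kappa> (h w)"
        and lim: "\<forall>i. ((\<lambda>w. h w $ i / w ^ k) \<longlongrightarrow> v1 $ i) (at 0)"
      have ev': "\<forall>\<^sub>F w in at 0. ?S (h w) \<in> img \<kappa>' \<and> flow T (param \<kappa>' (?S (h w))) = param \<kappa>' (?S (h w))"
        using ev by (rule eventually_mono) (simp add: par T_def)
      have "((\<lambda>w. h w $ 1 / w ^ k * c $ i + h w $ 2 / w ^ k * d $ i) \<longlongrightarrow> v1 $ 1 * c $ i + v1 $ 2 * d $ i) (at 0)" for i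
        by (intro tendsto_intros) (use lim in auto)
      moreover have "(\<lambda>w. h w $ 1 / w ^ k * c $ i + h w $ 2 / w ^ k * d $ i) = (\<lambda>w. ?S (h w) $ i / w ^ k)" for i
        by (simp add: lin2_def add_divide_distrib)
      moreover have "v1 $ 1 * c $ i + v1 $ 2 * d $ i = axis 1 1 $ i" for i
        using arg_cong[OF Sv(1), of "\<lambda>v. v $ i"] by (simp add: lin2_def)
      ultimately have lim': "((\<lambda>w. ?S (h w) $ i / w ^ k) \<longlongrightarrow> axis 1 1 $ i) (at 0)" for i by simp
      show ?thesis
      proof (intro disjI2 exI conjI)
        show "k > 0" by fact
        show "\<forall>\<^sub>F w in at 0. ?S (h w) \<in> img \<kappa>' \<and> flow T (param \<kappa>' (?S (h w))) = param \<kappa>' (?S (h w))" by (rule ev')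
        show "((\<lambda>w. ?S (h w) $ 1 / w ^ k) \<longlongrightarrow> 1) (at 0)" "((\<lambda>w. ?S (h w) $ 2 / w ^ k) \<longlongrightarrow> 0) (at 0)"
          using lim'[of 1] lim'[of 2] by simp_all
      qed
    qed (rule disjI1, simp)
  qed
  then obtain d0 where "d0 > 0 \<and> ball 0 d0 \<subseteq> img \<kappa>' \<and> (\<forall>z\<in>ball 0 d0. flow T (param \<kappa>' z) = param \<kappa>' z)" by (rule exE)
  hence d0: "d0 > 0" "ball 0 d0 \<subseteq> img \<kappa>'" "\<And>z. z \<in> ball 0 d0 \<Longrightarrow> flow T (param \<kappa>' z) = param \<kappa>' z" by simp_all
  \<comment> \<open>The averaged coordinates are tangent to the identity at \<open>p\<close>, so
    they can be inverted near it; \<open>d < d0\<close> puts the closed ball of radius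
    \<open>d\<close> into the region where \<open>flow T\<close> is the identity.\<close>
  define G where "G z = (\<chi> i. D.avg T i (param \<kappa>' z))" for z
  have "\<exists>d r E. 0 < d \<and> d < d0 \<and> 0 < r \<and> ball 0 d \<subseteq> img \<kappa>' \<and>
    (\<forall>w\<in>polydisc r. E w \<in> ball 0 d \<and> G (E w) = w) \<and>
    (\<forall>z\<in>ball 0 d. G z \<in> polydisc r \<longrightarrow> E (G z) = z) \<and>
    (\<forall>i. holomorphic_fun2 (polydisc r) (\<lambda>w. E w $ i))"
  proof (rule local_biholomorphism[OF _ D.img0 _ _ d0(1)])
    show "holomorphic_fun2 (img \<kappa>') (\<lambda>z. G z $ i)" for i
      unfolding G_def using holomorphic_in_chart[OF D.avg_holomorphic \<kappa>'A] by simp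
    show "G 0 = 0" by (simp add: G_def D.param0 D.avg_p vec_eq_iff)
    show "pd j (\<lambda>z. G z $ i) 0 = (if i = j then 1 else 0)" for i j
      unfolding G_def using D.avg_linear_part by simp
  qed
  then obtain d r E where E': "0 < d \<and> d < d0 \<and> 0 < r \<and> ball 0 d \<subseteq> img \<kappa>' \<and>
    (\<forall>w\<in>polydisc r. E w \<in> ball 0 d \<and> G (E w) = w) \<and>
    (\<forall>z\<in>ball 0 d. G z \<in> polydisc r \<longrightarrow> E (G z) = z) \<and>
    (\<forall>i. holomorphic_fun2 (polydisc r) (\<lambda>w. E w $ i))" by (elim exE)
  note E = E'[THEN conjunct1] E'[THEN conjunct2, THEN conjunct1] E'[THEN conjunct2, THEN conjunct2, THEN conjunct1]
  have E4: "E w \<in> ball 0 d" "G (E w) = w" if "w \<in> polydisc r" for w using E' that by simp_all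
  have E6: "E (G z) = z" if "z \<in> ball 0 d" "G z \<in> polydisc r" for z using E' that by blast
  have E7: "holomorphic_fun2 (polydisc r) (\<lambda>w. E w $ i)" for i using E' by blast
  interpret P: linear_patch N \<A> X \<kappa>' p \<mu> m T \<nu> "b * k" d r E
  proof (unfold_locales, goal_cases)
    case 1 show ?case by (rule stein)
  next
    case 2 show ?case by (rule conn)
  next
    case 3 show ?case by (rule m)
  next
    case 4 show ?case by (rule \<mu>12)
  next
    case 5 show ?case by (rule \<mu>12)
  next
    case 6 show ?case by (rule \<nu>(3))
  next
    case 7 show ?case using \<nu>(2) k by simp
  next
    case 8 show ?case by (rule T_def)
  next
    case (9 i) show ?case by (rule expT)
  next
    case 10 show ?case by (rule E(1))
  next
    case 11 show ?case using d0(2) E(2) by (auto simp: subset_iff)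
  next
    case (12 z) thus ?case using d0(3)[of z] E(2) by simp
  next
    case 13 show ?case by (rule E(3))
  next
    case (14 w) thus ?case by (rule E4)
  next
    case (15 w i) thus ?case using arg_cong[OF E4(2)[of w], of "\<lambda>v. v $ i"] by (simp add: G_def)
  next
    case (16 z) thus ?case using E6[of z] by (simp add: G_def)
  next
    case (17 i) show ?case by (rule E7)
  qed
  have "P.F (flow t q) = vec2 (exp (m * t) * P.F q $ 1) (exp (m * of_real \<nu> * t) * P.F q $ 2)" if "q \<in> topspace N" for t q
    using P.F_equivariant[OF that, of t] by (simp add: P.Lam_def vec2_eq_iff \<mu>12)
  thus ?thesis using P.F_biholomorphism P.F_linearizes P.Fp P.F_holomorphic by (intro exI[of _ P.F]) simp
qed

end

section \<open>Dicritical singularities\<close>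

text \<open>Eigenvalues are roots of the characteristic polynomial. Finiteness drives the pigeonhole
  argument over infinitely many leaves.\<close>

lemma finite_eigenvalues: "finite {x. \<exists>v. v \<noteq> 0 \<and> jac F z v = x *s v}"
proof (rule finite_subset)
  let ?a = "\<lambda>i j. pd j (\<lambda>z. F z $ i) z"
  let ?P = "[:?a 1 1 * ?a 2 2 - ?a 1 2 * ?a 2 1, - (?a 1 1 + ?a 2 2), 1:]"
  show "finite {x. poly ?P x = 0}" by (rule poly_roots_finite) simp
  show "{x. \<exists>v. v \<noteq> 0 \<and> jac F z v = x *s v} \<subseteq> {x. poly ?P x = 0}"
  proof (safe)
    fix x v assume v: "v \<noteq> 0" "jac F z v = x *s v"
    have e: "(?a 1 1 - x) * v $ 1 + ?a 1 2 * v $ 2 = 0" "?a 2 1 * v $ 1 + (?a 2 2 - x) * v $ 2 = 0"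
      using v(2) by (simp_all add: vec2_eq_iff jac_def algebra_simps)
    have "poly ?P x * v $ 1 = (?a 2 2 - x) * ((?a 1 1 - x) * v $ 1 + ?a 1 2 * v $ 2) - ?a 1 2 * (?a 2 1 * v $ 1 + (?a 2 2 - x) * v $ 2)"
      "poly ?P x * v $ 2 = (?a 1 1 - x) * (?a 2 1 * v $ 1 + (?a 2 2 - x) * v $ 2) - ?a 2 1 * ((?a 1 1 - x) * v $ 1 + ?a 1 2 * v $ 2)"
      by (simp_all add: algebra_simps)
    hence "poly ?P x * v $ 1 = 0" "poly ?P x * v $ 2 = 0" unfolding e by simp_all
    thus "poly ?P x = 0" using v(1) by (auto simp: vec2_eq_iff)
  qed
qed

context complete_field
begin

text \<open>An orbit with one end at the singularity, parametrized by a disc: the flow multiplies the disc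
  parameter by \<open>exp (l t)\<close>; \<open>k\<close> and \<open>g 0\<close> are the leading exponent and coefficient of \<open>h\<close>.\<close>

definition orbit_germ :: "'a chart \<Rightarrow> 'a \<Rightarrow> complex \<Rightarrow> nat \<Rightarrow> real \<Rightarrow> (complex \<Rightarrow> complex^2) \<Rightarrow> (complex \<Rightarrow> complex^2) \<Rightarrow> 'a set \<Rightarrow> bool" where
  "orbit_germ \<kappa> q l k r h g L \<longleftrightarrow> q \<in> topspace N \<and> l \<noteq> 0 \<and> k > 0 \<and> r > 0 \<and> h 0 = 0 \<and> g 0 \<noteq> 0 \<and>
     (\<forall>i. (\<lambda>w. h w $ i) holomorphic_on ball 0 r) \<and> (\<forall>i. (\<lambda>w. g w $ i) holomorphic_on ball 0 r) \<and>
     (\<forall>w\<in>ball 0 r. h w = w ^ k *s g w) \<and> flow (2 * pi * \<i> / l) q = q \<and>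
     (\<forall>t. norm (exp (l * t)) < r \<longrightarrow> flow t q \<in> fst \<kappa> \<and> flow t q \<in> L \<and> snd \<kappa> (flow t q) = h (exp (l * t)))"

lemma orbit_germ_flow:
  assumes "orbit_germ \<kappa> q l k r h g L" "norm (exp (l * t)) < r"
  shows "flow t q \<in> fst \<kappa> \<and> flow t q \<in> L \<and> snd \<kappa> (flow t q) = h (exp (l * t))"
  using assms unfolding orbit_germ_def by blast

lemma orbit_germ_ode:
  assumes \<kappa>: "\<kappa> \<in> \<A>" and og: "orbit_germ \<kappa> q l k r h g L" and w: "w \<in> ball 0 r" "w \<noteq> 0"
  shows "l * w * deriv (\<lambda>w. h w $ i) w = Y \<kappa> (h w) $ i"
proof -
  have q: "q \<in> topspace N" and l: "l \<noteq> 0" and hol: "(\<lambda>w. h w $ i) holomorphic_on ball 0 r"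
    and fl: "\<And>t. norm (exp (l * t)) < r \<Longrightarrow> flow t q \<in> fst \<kappa> \<and> snd \<kappa> (flow t q) = h (exp (l * t))"
    using og by (auto simp: orbit_germ_def)
  \<comment> \<open>Any logarithm of \<open>w\<close> gives a time at which the orbit has the
    coordinates \<open>h w\<close>.\<close>
  define t where "t = ln w / l"
  have t: "exp (l * t) = w" using w(2) l by (simp add: t_def)
  have nt: "norm (exp (l * t)) < r" using w(1) by (simp add: t)
  have "((\<lambda>t. snd \<kappa> (flow t q)) has_derivative (\<lambda>u. u *s Y \<kappa> (h w))) (at t)"
    using flow_deriv[OF q \<kappa>, of t] fl[OF nt] by (simp add: t)
  from cdiff_curve[OF cdiff_nth this, of i]
  have "((\<lambda>t. snd \<kappa> (flow t q) $ i) has_derivative (\<lambda>u. u * Y \<kappa> (h w) $ i)) (at t)"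
    using bounded_linear.has_derivative[OF bounded_linear_vec_nth \<open>((\<lambda>t. snd \<kappa> (flow t q)) has_derivative (\<lambda>u. u *s Y \<kappa> (h w))) (at t)\<close>, of i] by simp
  hence d1: "((\<lambda>t. snd \<kappa> (flow t q) $ i) has_field_derivative Y \<kappa> (h w) $ i) (at t)"
    unfolding has_field_derivative_def by (simp add: mult.commute[of _ "Y \<kappa> (h w) $ i"])
  have e: "((\<lambda>t. exp (l * t)) has_field_derivative l * w) (at t)"
    by (auto intro!: derivative_eq_intros simp: t)
  have "((\<lambda>w. h w $ i) has_field_derivative deriv (\<lambda>w. h w $ i) w) (at (exp (l * t)))"
    unfolding t by (rule holomorphic_derivI[OF hol open_ball w(1)])
  from DERIV_chain2[OF this e]
  have "((\<lambda>t. h (exp (l * t)) $ i) has_field_derivative deriv (\<lambda>w. h w $ i) w * (l * w)) (at t)" .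
  moreover have "open {t. norm (exp (l * t)) < r}" by (intro open_Collect_less continuous_intros)
  ultimately have "((\<lambda>t. snd \<kappa> (flow t q) $ i) has_field_derivative deriv (\<lambda>w. h w $ i) w * (l * w)) (at t)"
    by (rule has_field_derivative_transform_within_open) (use nt fl in auto)
  from DERIV_unique[OF this d1] show ?thesis by (simp add: mult_ac)
qed

lemma orbit_germ_eigenvector:
  assumes \<kappa>: "\<kappa> \<in> \<A>" "p \<in> fst \<kappa>" "snd \<kappa> p = 0" and sing: "p \<in> singularities N \<A> X" and og: "orbit_germ \<kappa> q l k r h g L"
  shows "jac (Y \<kappa>) 0 (g 0) = (l * of_nat k) *s g 0"
proof -
  have Y0: "Y \<kappa> 0 = 0" using singular_Y[OF sing \<kappa>(1,2)] \<kappa>(3) by simp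
  have i0: "0 \<in> img \<kappa>" using chart_in[OF \<kappa>(2)] \<kappa>(3) by simp
  have og': "\<And>i. (\<lambda>w. h w $ i) holomorphic_on ball 0 r" "h 0 = 0" "r > 0" "k > 0" "\<And>i. (\<lambda>w. g w $ i) holomorphic_on ball 0 r"
    "\<And>w. w \<in> ball 0 r \<Longrightarrow> h w - 0 = w ^ k *s g w"
    using og by (auto simp: orbit_germ_def)
  have "pd 1 (\<lambda>z. Y \<kappa> z $ i) 0 * g 0 $ 1 + pd 2 (\<lambda>z. Y \<kappa> z $ i) 0 * g 0 $ 2 = l * of_nat k * g 0 $ i" for i
    by (rule leading_eigenvector[where ?h1.0=h and \<rho>=r and ?h2.0="\<lambda>_. 0", OF Y_hol[OF \<kappa>(1)] i0 og'(1,2) _ _ og'(3) orbit_germ_ode[OF \<kappa>(1) og] _ og'(5,6,4)])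
       (simp_all add: Y0)
  thus ?thesis by (simp add: vec_eq_iff jac_def)
qed

lemma orbit_germ_exists:
  assumes stein: "stein_surface N \<A>" and \<kappa>: "\<kappa> \<in> \<A>" "p \<in> fst \<kappa>" "snd \<kappa> p = 0" and sing: "p \<in> singularities N \<A> X"
    and V: "openin N V" "p \<in> V" and q: "q \<in> V" and L: "L = orbit_in N \<A> X V q"
    and clos: "(N closure_of L) \<inter> V - L = {p}"
  shows "\<exists>l k r h g. orbit_germ \<kappa> q l k r h g L"
proof -
  obtain \<omega> \<rho> h where \<omega>: "\<omega> \<noteq> 0" "\<rho> > 0" "\<And>i. (\<lambda>w. h w $ i) holomorphic_on ball 0 \<rho>" "h 0 = 0" "flow \<omega> q = q"
    and fl: "\<And>t. norm (exp (2 * pi * \<i> * t / \<omega>)) < \<rho> \<Longrightarrow> flow t q \<in> fst \<kappa> \<and> flow t q \<in> L \<and> snd \<kappa> (flow t q) = h (exp (2 * pi * \<i> * t / \<omega>))"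
    using leaf_parametrization[OF stein \<kappa>(1,2) sing V q L clos] \<kappa>(3) by metis
  define l where "l = 2 * pi * \<i> / \<omega>"
  have l: "l \<noteq> 0" "2 * pi * \<i> / l = \<omega>" using \<omega>(1) by (simp_all add: l_def)
  have fl': "flow t q \<in> fst \<kappa>" "flow t q \<in> L" "snd \<kappa> (flow t q) = h (exp (l * t))" if "norm (exp (l * t)) < \<rho>" for t
    using fl[of t] that by (simp_all add: l_def)
  define w0 where "w0 = complex_of_real (\<rho> / 2)"
  define t0 where "t0 = ln w0 / l"
  have w0: "w0 \<in> ball 0 \<rho>" "w0 \<noteq> 0" using \<omega>(2) by (simp_all add: w0_def)
  have t0: "exp (l * t0) = w0" using w0(2) l(1) by (simp add: t0_def)
  have n0: "norm (exp (l * t0)) < \<rho>" using w0(1) by (simp add: t0)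
  \<comment> \<open>A zero of \<open>h\<close> off the centre would put \<open>p\<close> on the
    leaf.\<close>
  have "h w0 \<noteq> 0"
  proof
    assume "h w0 = 0"
    hence "snd \<kappa> (flow t0 q) = snd \<kappa> p" using fl'(3)[OF n0] \<kappa>(3) by (simp add: t0)
    hence "flow t0 q = p" using inj_onD[OF chart_inj[OF \<kappa>(1)]] fl'(1)[OF n0] \<kappa>(2) by blast
    thus False using fl'(2)[OF n0] clos by blast
  qed
  from vector_order[OF \<omega>(3,2,4) w0(1) this]
  obtain k r g where g': "k > 0 \<and> 0 < r \<and> r \<le> \<rho> \<and> (\<forall>i. (\<lambda>w. g w $ i) holomorphic_on ball 0 r) \<and> g 0 \<noteq> 0 \<and>
      (\<forall>w\<in>ball 0 r. h w = w ^ k *s g w)" by (elim exE)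
  hence g: "k > 0" "0 < r" "r \<le> \<rho>" "\<And>i. (\<lambda>w. g w $ i) holomorphic_on ball 0 r" "g 0 \<noteq> 0" "\<And>w. w \<in> ball 0 r \<Longrightarrow> h w = w ^ k *s g w"
    by simp_all
  have hr: "(\<lambda>w. h w $ i) holomorphic_on ball 0 r" for i by (rule holomorphic_on_subset[OF \<omega>(3)]) (use g(3) in auto)
  have "q \<in> topspace N" using V(1) q openin_subset by blast
  hence "orbit_germ \<kappa> q l k r h g L" unfolding orbit_germ_def
    using l g hr \<omega>(4,5) fl' by auto
  thus ?thesis by blast
qed

lemma orbit_in_subset:
  assumes V: "openin N V" and q: "q \<in> V" and x: "x \<in> orbit_in N \<A> X V q"
  shows "x \<in> V" "q \<in> orbit_in N \<A> X V x" "orbit_in N \<A> X V q \<subseteq> orbit_in N \<A> X V x"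
proof -
  have qN: "q \<in> topspace N" using V q openin_subset by blast
  let ?C = "leaf_times V q"
  obtain t0 where t0: "t0 \<in> ?C" "x = flow t0 q" using x orbit_in_eq[OF V q] by auto
  have CV: "flow t q \<in> V" if "t \<in> ?C" for t
    using that connected_component_subset[of "{t. flow t q \<in> V}" 0] by (auto simp: leaf_times_def)
  show xV: "x \<in> V" using CV t0 by simp
  have C0: "0 \<in> ?C" using q qN by (simp add: leaf_times_def flow_0)
  have "(\<lambda>t. t - t0) ` ?C \<subseteq> leaf_times V x"
  proof (unfold leaf_times_def, rule connected_component_maximal)
    show "0 \<in> (\<lambda>t. t - t0) ` connected_component_set {t. flow t q \<in> V} 0"
      using t0(1) by (auto simp: leaf_times_def intro!: image_eqI[of _ _ t0])
    show "connected ((\<lambda>t. t - t0) ` connected_component_set {t. flow t q \<in> V} 0)"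
      by (intro connected_continuous_image continuous_intros connected_connected_component)
    show "(\<lambda>t. t - t0) ` connected_component_set {t. flow t q \<in> V} 0 \<subseteq> {t. flow t x \<in> V}"
      using CV by (auto simp: leaf_times_def t0(2) flow_add[OF qN])
  qed
  hence *: "flow t q \<in> orbit_in N \<A> X V x" if "t \<in> ?C" for t
    unfolding orbit_in_eq[OF V xV] using that by (intro image_eqI[of _ _ "t - t0"]) (auto simp: t0(2) flow_add[OF qN])
  show "orbit_in N \<A> X V q \<subseteq> orbit_in N \<A> X V x" unfolding orbit_in_eq[OF V q] using * by blast
  show "q \<in> orbit_in N \<A> X V x" using *[OF C0] flow_0[OF qN] by simp
qed

text \<open>The leaves of \<open>X\<close> on \<open>V\<close> partition \<open>V\<close>, so
  distinct leaves have no common point.\<close>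

lemma orbit_in_member:
  assumes V: "openin N V" and q: "q \<in> V" and x: "x \<in> orbit_in N \<A> X V q"
  shows "orbit_in N \<A> X V x = orbit_in N \<A> X V q"
  using orbit_in_subset[OF assms] orbit_in_subset(3)[OF V] by blast

text \<open>Two orbits with the same eigenvalue can be parametrized by discs moved by the flow at the same
  rate. If their leading terms are parallel, the difference of the parametrizations has an eigenvector
  for a strictly larger multiple of the eigenvalue as its leading term.\<close>

lemma dicritical_imp_eigenvectors:
  assumes stein: "stein_surface N \<A>" and \<kappa>: "\<kappa> \<in> \<A>" "p \<in> fst \<kappa>" "snd \<kappa> p = 0" and sing: "p \<in> singularities N \<A> X"
    and dic: "dicritical_at N \<A> X p"
  obtains q l k r h g L v2 \<nu> a b where "orbit_germ \<kappa> q l k r h g L"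
    "jac (Y \<kappa>) 0 v2 = (l * of_nat k * of_real \<nu>) *s v2" "\<nu> = real a / real b" "b > 0" "\<nu> \<ge> 1"
    "\<forall>x y. x *s g 0 + y *s v2 = 0 \<longrightarrow> x = 0 \<and> y = 0"
proof -
  obtain V where V: "openin N V" "p \<in> V" and inf: "infinite {L \<in> orbit_in N \<A> X V ` V. (N closure_of L) \<inter> V - L = {p}}"
    using dic by (auto simp: dicritical_at_def)
  let ?LL = "{L \<in> orbit_in N \<A> X V ` V. (N closure_of L) \<inter> V - L = {p}}"
  define P where "P L x \<longleftrightarrow> (\<exists>q l k r h g. q \<in> V \<and> L = orbit_in N \<A> X V q \<and> orbit_germ \<kappa> q l k r h g L \<and> x = l * of_nat k)" for L x
  define ev where "ev L = (SOME x. P L x)" for L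
  have "\<exists>x. P L x" if L: "L \<in> ?LL" for L
  proof -
    obtain q where q: "q \<in> V" "L = orbit_in N \<A> X V q" "(N closure_of L) \<inter> V - L = {p}" using L by auto
    show ?thesis using orbit_germ_exists[OF stein \<kappa> sing V q] q unfolding P_def by blast
  qed
  hence ev: "P L (ev L)" if "L \<in> ?LL" for L unfolding ev_def by (rule someI_ex) (rule that)
  \<comment> \<open>Each leaf contributes the eigenvalue of its leading vector; infinitely many
    leaves and finitely many eigenvalues force two leaves to share one.\<close>
  have "ev ` ?LL \<subseteq> {x. \<exists>v. v \<noteq> 0 \<and> jac (Y \<kappa>) 0 v = x *s v}"
  proof
    fix x assume "x \<in> ev ` ?LL"
    then obtain L where L: "L \<in> ?LL" "x = ev L" by blast
    obtain q l k r h g where "orbit_germ \<kappa> q l k r h g L" "x = l * of_nat k" using ev[OF L(1)] L(2) by (auto simp: P_def)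
    thus "x \<in> {x. \<exists>v. v \<noteq> 0 \<and> jac (Y \<kappa>) 0 v = x *s v}"
      using orbit_germ_eigenvector[OF \<kappa> sing, of q l k r h g L] by (auto simp: orbit_germ_def)
  qed
  hence "finite (ev ` ?LL)" using finite_eigenvalues finite_subset by blast
  hence "\<not> inj_on ev ?LL" using inf finite_imageD by blast
  then obtain L1 L2 where LL: "L1 \<in> ?LL" "L2 \<in> ?LL" "ev L1 = ev L2" "L1 \<noteq> L2" unfolding inj_on_def by blast
  obtain q1 l1 k1 r1 h1 g1 where 1: "q1 \<in> V" "L1 = orbit_in N \<A> X V q1" "orbit_germ \<kappa> q1 l1 k1 r1 h1 g1 L1" "ev L1 = l1 * of_nat k1"
    using ev[OF LL(1)] by (auto simp: P_def)
  obtain q2 l2 k2 r2 h2 g2 where 2: "q2 \<in> V" "L2 = orbit_in N \<A> X V q2" "orbit_germ \<kappa> q2 l2 k2 r2 h2 g2 L2" "ev L2 = l2 * of_nat k2"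
    using ev[OF LL(2)] by (auto simp: P_def)
  have eq: "l1 * of_nat k1 = l2 * of_nat k2" using 1(4) 2(4) LL(3) by simp
  have disj: "x \<notin> L2" if "x \<in> L1" for x
    using orbit_in_member[OF V(1) 1(1), of x] orbit_in_member[OF V(1) 2(1), of x] that LL(4) 1(2) 2(2) by metis
  have e1: "jac (Y \<kappa>) 0 (g1 0) = (l1 * of_nat k1) *s g1 0" by (rule orbit_germ_eigenvector[OF \<kappa> sing 1(3)])
  have e2: "jac (Y \<kappa>) 0 (g2 0) = (l1 * of_nat k1) *s g2 0" unfolding eq by (rule orbit_germ_eigenvector[OF \<kappa> sing 2(3)])
  have G1: "l1 \<noteq> 0" "k1 > 0" "r1 > 0" "h1 0 = 0" "g1 0 \<noteq> 0" "\<And>i. (\<lambda>w. h1 w $ i) holomorphic_on ball 0 r1" "\<And>i. (\<lambda>w. g1 w $ i) holomorphic_on ball 0 r1"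
    "\<And>w. w \<in> ball 0 r1 \<Longrightarrow> h1 w = w ^ k1 *s g1 w" using 1(3) by (auto simp: orbit_germ_def)
  have G2: "l2 \<noteq> 0" "k2 > 0" "r2 > 0" "h2 0 = 0" "g2 0 \<noteq> 0" "\<And>i. (\<lambda>w. h2 w $ i) holomorphic_on ball 0 r2" "\<And>i. (\<lambda>w. g2 w $ i) holomorphic_on ball 0 r2"
    "\<And>w. w \<in> ball 0 r2 \<Longrightarrow> h2 w = w ^ k2 *s g2 w" using 2(3) by (auto simp: orbit_germ_def)
  show thesis
  proof (cases "\<exists>s. g1 0 = s *s g2 0")
    \<comment> \<open>Non-parallel leading vectors with the same eigenvalue: the linear part is a
      multiple of the identity and \<nu> is 1.\<close>
    case False
    have "x = 0 \<and> y = 0" if xy: "x *s g1 0 + y *s g2 0 = 0" for x y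
    proof (cases "x = 0")
      case True
      thus ?thesis using xy G2(5) by (auto simp: vec_eq_iff)
    next
      case x: False
      have "g1 0 = (- y / x) *s g2 0"
        using xy x by (simp add: vec_eq_iff field_simps add_eq_0_iff)
      thus ?thesis using False by blast
    qed
    thus thesis using e2 1(3) by (intro that[of q1 l1 k1 r1 h1 g1 L1 "g2 0" 1 1 1]) simp_all
  next
    case True
    then obtain s where s: "g1 0 = s *s g2 0" by blast
    have s0: "s \<noteq> 0" using s G1(5) by auto
    \<comment> \<open>Substituting \<open>w ^ k2\<close> and \<open>(c * w) ^ k1\<close> gives both
      discs the leading order \<open>K\<close> and the same rate \<open>l\<close>; the choice
      \<open>c ^ K = s\<close> makes their leading coefficients equal.\<close>
    define K where "K = k1 * k2"
    have K: "K > 0" using G1(2) G2(2) by (simp add: K_def)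
    define c where "c = exp (ln s / of_nat K)"
    have cK: "c ^ K = s" using K s0 by (simp add: c_def exp_of_nat_mult[symmetric])
    have c0: "c \<noteq> 0" by (simp add: c_def)
    define H1 where "H1 w = h1 (w ^ k2)" for w
    define H2 where "H2 w = h2 ((c * w) ^ k1)" for w
    define l where "l = l1 / of_nat k2"
    have l: "l * of_nat k2 = l1" "l * of_nat k1 = l2" "l * of_nat K = l1 * of_nat k1"
      using eq G1(2) G2(2) by (simp_all add: l_def K_def field_simps)
    have "((\<lambda>w. w ^ k2) \<longlongrightarrow> 0 ^ k2) (at (0::complex))" "((\<lambda>w. (c * w) ^ k1) \<longlongrightarrow> (c * 0) ^ k1) (at 0)"
      by (intro tendsto_intros)+
    hence "\<forall>\<^sub>F w in at 0. norm (w ^ k2) < r1 \<and> norm ((c * w) ^ k1) < r2"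
      using G1(2,3) G2(2,3) by (intro eventually_conj order_tendstoD(2)[OF tendsto_norm_zero]) (simp_all add: power_0_left)
    then obtain d where d: "d > 0" "\<And>w. norm w < d \<Longrightarrow> w \<noteq> 0 \<Longrightarrow> norm (w ^ k2) < r1 \<and> norm ((c * w) ^ k1) < r2"
      unfolding eventually_at by (auto simp: dist_norm)
    have in1: "w ^ k2 \<in> ball 0 r1" and in2: "(c * w) ^ k1 \<in> ball 0 r2" if "w \<in> ball 0 d" for w
      using d(2)[of w] that G1(2,3) G2(2,3) by (cases "w = 0"; simp add: power_0_left)+
    have sub1: "(\<lambda>w. w ^ k2) ` ball (0::complex) d \<subseteq> ball 0 r1" by (rule image_subsetI) (rule in1)
    have sub2: "(\<lambda>w. (c * w) ^ k1) ` ball 0 d \<subseteq> ball 0 r2" by (rule image_subsetI) (rule in2)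
    have H1h: "(\<lambda>w. H1 w $ i) holomorphic_on ball 0 d" for i
      unfolding H1_def by (rule holomorphic_on_compose_gen[OF _ G1(6) sub1, unfolded comp_def]) (intro holomorphic_intros)
    have H2h: "(\<lambda>w. H2 w $ i) holomorphic_on ball 0 d" for i
      unfolding H2_def by (rule holomorphic_on_compose_gen[OF _ G2(6) sub2, unfolded comp_def]) (intro holomorphic_intros)
    have H0: "H1 0 = 0" "H2 0 = 0" using G1(2,4) G2(2,4) by (simp_all add: H1_def H2_def power_0_left)
    have dpow: "x * (of_nat n * x ^ (n - 1)) = of_nat n * x ^ n" if "n > 0" for x :: complex and n
      using that by (cases n) simp_all
    have ode1: "l * w * deriv (\<lambda>w. H1 w $ i) w = Y \<kappa> (H1 w) $ i" if w: "w \<in> ball 0 d" "w \<noteq> 0" for w i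
    proof -
      have "((\<lambda>w. w ^ k2) has_field_derivative of_nat k2 * w ^ (k2 - 1)) (at w)" by (auto intro!: derivative_eq_intros)
      from DERIV_chain2[OF holomorphic_derivI[OF G1(6) open_ball in1[OF w(1)]] this]
      have "deriv (\<lambda>w. H1 w $ i) w = deriv (\<lambda>w. h1 w $ i) (w ^ k2) * (of_nat k2 * w ^ (k2 - 1))" unfolding H1_def by (rule DERIV_imp_deriv)
      hence "l * w * deriv (\<lambda>w. H1 w $ i) w = l * (w * (of_nat k2 * w ^ (k2 - 1))) * deriv (\<lambda>w. h1 w $ i) (w ^ k2)" by simp
      also have "\<dots> = (l * of_nat k2) * w ^ k2 * deriv (\<lambda>w. h1 w $ i) (w ^ k2)" unfolding dpow[OF G2(2)] by simp
      also have "\<dots> = Y \<kappa> (H1 w) $ i" unfolding l H1_def by (rule orbit_germ_ode[OF \<kappa>(1) 1(3) in1[OF w(1)]]) (use w in simp)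
      finally show ?thesis .
    qed
    have ode2: "l * w * deriv (\<lambda>w. H2 w $ i) w = Y \<kappa> (H2 w) $ i" if w: "w \<in> ball 0 d" "w \<noteq> 0" for w i
    proof -
      have "((\<lambda>w. (c * w) ^ k1) has_field_derivative of_nat k1 * (c * w) ^ (k1 - 1) * c) (at w)" by (auto intro!: derivative_eq_intros)
      from DERIV_chain2[OF holomorphic_derivI[OF G2(6) open_ball in2[OF w(1)]] this]
      have "deriv (\<lambda>w. H2 w $ i) w = deriv (\<lambda>w. h2 w $ i) ((c * w) ^ k1) * (of_nat k1 * (c * w) ^ (k1 - 1) * c)" unfolding H2_def by (rule DERIV_imp_deriv)
      hence "l * w * deriv (\<lambda>w. H2 w $ i) w = l * ((c * w) * (of_nat k1 * (c * w) ^ (k1 - 1))) * deriv (\<lambda>w. h2 w $ i) ((c * w) ^ k1)" by simp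
      also have "\<dots> = (l * of_nat k1) * (c * w) ^ k1 * deriv (\<lambda>w. h2 w $ i) ((c * w) ^ k1)" unfolding dpow[OF G1(2)] by simp
      also have "\<dots> = Y \<kappa> (H2 w) $ i" unfolding l H2_def by (rule orbit_germ_ode[OF \<kappa>(1) 2(3) in2[OF w(1)]]) (use w c0 in simp)
      finally show ?thesis .
    qed
    define w0 where "w0 = complex_of_real (d / 2)"
    have w0: "w0 \<in> ball 0 d" "w0 \<noteq> 0" using d(1) by (simp_all add: w0_def)
    \<comment> \<open>Distinct leaves are disjoint, so the two discs cannot have the same value at
      \<open>w0\<close>.\<close>
    have ne: "H1 w0 - H2 w0 \<noteq> 0"
    proof
      assume eq0: "H1 w0 - H2 w0 = 0"
      define t1 where "t1 = ln (w0 ^ k2) / l1"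
      define t2 where "t2 = ln ((c * w0) ^ k1) / l2"
      have t: "exp (l1 * t1) = w0 ^ k2" "exp (l2 * t2) = (c * w0) ^ k1" using w0(2) c0 G1(1) G2(1) by (simp_all add: t1_def t2_def)
      have n: "norm (exp (l1 * t1)) < r1" "norm (exp (l2 * t2)) < r2" unfolding t using in1[OF w0(1)] in2[OF w0(1)] by simp_all
      have p1: "flow t1 q1 \<in> fst \<kappa>" "flow t1 q1 \<in> L1" "snd \<kappa> (flow t1 q1) = H1 w0" 
        using orbit_germ_flow[OF 1(3) n(1)] unfolding H1_def t by simp_all
      have p2: "flow t2 q2 \<in> fst \<kappa>" "flow t2 q2 \<in> L2" "snd \<kappa> (flow t2 q2) = H2 w0" 
        using orbit_germ_flow[OF 2(3) n(2)] unfolding H2_def t by simp_all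
      have "flow t1 q1 = flow t2 q2" using inj_onD[OF chart_inj[OF \<kappa>(1)] _ p1(1) p2(1)] p1(3) p2(3) eq0 by simp
      thus False using disj[OF p1(2)] p2(2) by simp
    qed
    have dh: "(\<lambda>w. (H1 w - H2 w) $ i) holomorphic_on ball 0 d" for i using H1h H2h by (auto intro!: holomorphic_intros)
    have "H1 0 - H2 0 = 0" by (simp add: H0)
    from vector_order[of "\<lambda>w. H1 w - H2 w", OF dh d(1) this w0(1) ne]
    obtain m r g where g': "m > 0 \<and> 0 < r \<and> r \<le> d \<and> (\<forall>i. (\<lambda>w. g w $ i) holomorphic_on ball 0 r) \<and> g 0 \<noteq> 0 \<and>
        (\<forall>w\<in>ball 0 r. H1 w - H2 w = w ^ m *s g w)" by (elim exE)
    hence g: "m > 0" "0 < r" "r \<le> d" "\<And>i. (\<lambda>w. g w $ i) holomorphic_on ball 0 r" "g 0 \<noteq> 0" "\<And>w. w \<in> ball 0 r \<Longrightarrow> H1 w - H2 w = w ^ m *s g w"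
      by simp_all
    have rd: "w \<in> ball 0 d" if "w \<in> ball 0 r" for w using that g(3) by simp
    have Hr: "(\<lambda>w. H1 w $ i) holomorphic_on ball 0 r" "(\<lambda>w. H2 w $ i) holomorphic_on ball 0 r" for i
      by (intro holomorphic_on_subset[OF H1h] holomorphic_on_subset[OF H2h] subsetI rd, assumption)+
    have i0: "0 \<in> img \<kappa>" using chart_in[OF \<kappa>(2)] \<kappa>(3) by simp
    have "pd 1 (\<lambda>z. Y \<kappa> z $ i) 0 * g 0 $ 1 + pd 2 (\<lambda>z. Y \<kappa> z $ i) 0 * g 0 $ 2 = l * of_nat m * g 0 $ i" for i
      by (rule leading_eigenvector[where ?h1.0=H1 and ?h2.0=H2 and \<rho>=r, OF Y_hol[OF \<kappa>(1)] i0 Hr(1) H0(1) Hr(2) H0(2) g(2) ode1 ode2 g(4,6,1)])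
         (use g(3) in auto)
    hence eg: "jac (Y \<kappa>) 0 (g 0) = (l * of_nat m) *s g 0" by (simp add: vec_eq_iff jac_def)
    \<comment> \<open>The terms of order \<open>K\<close> cancel by the choice of \<open>c\<close>;
      if \<open>m\<close> were at most \<open>K\<close>, the leading coefficient \<open>g 0\<close>
      of the difference would be the limit 0.\<close>
    have mK: "m > K"
    proof (rule ccontr)
      assume "\<not> m > K"
      hence mK: "m \<le> K" by simp
      define \<psi> where "\<psi> w = w ^ (K - m) *s (g1 (w ^ k2) - c ^ K *s g2 ((c * w) ^ k1))" for w
      have g\<psi>: "g w = \<psi> w" if w: "w \<in> ball 0 r" "w \<noteq> 0" for w
      proof -
        have alg: "A *s u - (A * C) *s v = x *s (B *s (u - C *s v))" if "A = x * B" for A B C x and u v :: "complex^2"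
          using that by (simp add: vec_eq_iff algebra_simps)
        have pw: "(w ^ k2) ^ k1 = w ^ K" "((c * w) ^ k1) ^ k2 = w ^ K * c ^ K"
          by (simp_all add: K_def power_mult[symmetric] power_mult_distrib mult.commute)
        have "w ^ m *s g w = (w ^ k2) ^ k1 *s g1 (w ^ k2) - ((c * w) ^ k1) ^ k2 *s g2 ((c * w) ^ k1)"
          using g(6)[OF w(1)] G1(8)[OF in1[OF rd[OF w(1)]]] G2(8)[OF in2[OF rd[OF w(1)]]] by (simp add: H1_def H2_def)
        also have "\<dots> = w ^ m *s \<psi> w"
          unfolding pw \<psi>_def by (rule alg) (use mK in \<open>simp add: power_add[symmetric]\<close>)
        finally show ?thesis using w(2) by (simp add: vec_eq_iff)
      qed
      have cont0: "(f \<longlongrightarrow> f 0) (at 0)" if "\<And>i. (\<lambda>w. f w $ i) holomorphic_on ball 0 \<rho>" "\<rho> > 0" for f :: "complex \<Rightarrow> complex^2" and \<rho>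
      proof (rule vec_tendstoI)
        fix i have "isCont (\<lambda>w. f w $ i) 0" using holomorphic_on_imp_continuous_on[OF that(1)] that(2) by (simp add: continuous_on_eq_continuous_at)
        thus "((\<lambda>w. f w $ i) \<longlongrightarrow> f 0 $ i) (at 0)" by (simp add: isCont_def)
      qed
      have lg: "(g \<longlongrightarrow> g 0) (at 0)" by (rule cont0[OF g(4,2)])
      have fl1: "filterlim (\<lambda>w. w ^ k2) (at 0) (at (0::complex))" 
        unfolding filterlim_at using G2(2) by (auto intro!: tendsto_eq_intros simp: eventually_at_filter power_0_left)
      have fl2: "filterlim (\<lambda>w. (c * w) ^ k1) (at 0) (at (0::complex))" 
        unfolding filterlim_at using G1(2) c0 by (auto intro!: tendsto_eq_intros simp: eventually_at_filter power_0_left)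
      have "(\<psi> \<longlongrightarrow> 0 ^ (K - m) *s (g1 0 - c ^ K *s g2 0)) (at 0)"
        unfolding \<psi>_def
        by (intro tendsto_intros filterlim_compose[OF cont0[OF G1(7,3)] fl1] filterlim_compose[OF cont0[OF G2(7,3)] fl2])
      hence "(\<psi> \<longlongrightarrow> 0) (at 0)" by (simp add: cK s)
      moreover have "\<forall>\<^sub>F w in at 0. \<psi> w = g w"
        unfolding eventually_at using g(2) g\<psi> by (intro exI[of _ r]) (auto simp: dist_norm)
      ultimately have "(g \<longlongrightarrow> 0) (at 0)" using tendsto_cong by blast
      with lg have "g 0 = 0" using tendsto_unique by (metis at_neq_bot)
      thus False using g(5) by simp
    qed
    \<comment> \<open>The difference has eigenvalue \<open>l * m\<close>, the common eigenvalue of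
      the leaves is \<open>l * K\<close>; the ratio is rational and exceeds 1, and distinct
      eigenvalues make the eigenvectors independent.\<close>
    define \<nu> where "\<nu> = real m / real K"
    have \<nu>: "\<nu> > 1" using mK K by (simp add: \<nu>_def)
    have lm: "l * of_nat m = l1 * of_nat k1 * of_real \<nu>" using K by (simp add: \<nu>_def l(3)[symmetric])
    have "x = 0 \<and> y = 0" if xy: "x *s g1 0 + y *s g 0 = 0" for x y
    proof -
      have "jac (Y \<kappa>) 0 (x *s g1 0 + y *s g 0) = (l1 * of_nat k1) *s (x *s g1 0 + of_real \<nu> *s (y *s g 0))"
        unfolding jac_add jac_scale e1 eg lm by (simp add: vec_eq_iff algebra_simps)
      moreover have "jac (Y \<kappa>) 0 0 = 0" by (simp add: jac_def vec_eq_iff)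
      ultimately have c: "(l1 * of_nat k1) *s (x *s g1 0 + of_real \<nu> *s (y *s g 0)) = 0" unfolding xy by simp
      have "(of_real \<nu> - 1) * (y * g 0 $ i) = 0" for i
      proof -
        have "(l1 * of_nat k1) * (x * g1 0 $ i + of_real \<nu> * (y * g 0 $ i)) = 0"
          using arg_cong[OF c, of "\<lambda>v. v $ i"] by (simp only: vector_smult_component vector_add_component zero_index)
        hence 1: "x * g1 0 $ i + of_real \<nu> * (y * g 0 $ i) = 0" using G1(1,2) by simp
        have 2: "x * g1 0 $ i + y * g 0 $ i = 0" using arg_cong[OF xy, of "\<lambda>v. v $ i"] by simp
        have "(of_real \<nu> - 1) * (y * g 0 $ i) = (x * g1 0 $ i + of_real \<nu> * (y * g 0 $ i)) - (x * g1 0 $ i + y * g 0 $ i)"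
          by (simp add: algebra_simps)
        thus ?thesis unfolding 1 2 by simp
      qed
      moreover have "complex_of_real \<nu> - 1 \<noteq> 0" using \<nu> by (metis eq_iff_diff_eq_0 less_irrefl of_real_eq_1_iff)
      ultimately have "y *s g 0 = 0" by (simp add: vec_eq_iff)
      hence "y = 0" using g(5) by (auto simp: vec_eq_iff)
      thus ?thesis using xy G1(5) by (auto simp: vec_eq_iff)
    qed
    thus thesis using eg lm 1(3) \<nu> K by (intro that[of q1 l1 k1 r1 h1 g1 L1 "g 0" \<nu> m K]) (simp_all add: \<nu>_def)
  qed
qed

text \<open>The orbit disc supplies the curve of fixed points for the resonant case: it is tangent
  to the eigenvector \<open>g 0\<close>, and the time in question is \<open>b\<close> times the
  period of its orbit.\<close>

lemma dicritical_imp_linearizable: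
  assumes stein: "stein_surface N \<A>" and conn: "connected_space N" and sing: "p \<in> singularities N \<A> X"
    and dic: "dicritical_at N \<A> X p"
  shows "(\<exists>F. biholomorphism_C2 N \<A> F) \<and> globally_linearizable N \<A> X"
proof -
  have pN: "p \<in> topspace N" using sing by (simp add: singularities_def)
  obtain \<kappa> where \<kappa>': "\<kappa> \<in> \<A>" "p \<in> fst \<kappa>" "snd \<kappa> p = 0" "\<forall>i. (\<lambda>q. snd \<kappa> q $ i) \<in> holomorphic_functions \<A>"
    by (rule stein_chart[OF stein pN])
  note \<kappa> = \<kappa>'(1-3) \<kappa>'(4)[rule_format]
  obtain q l k r h g L v2 \<nu> a b where og: "orbit_germ \<kappa> q l k r h g L"
    and v2: "jac (Y \<kappa>) 0 v2 = (l * of_nat k * of_real \<nu>) *s v2" and \<nu>: "\<nu> = real a / real b" "b > 0" "\<nu> \<ge> 1"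
    and ind: "\<forall>x y. x *s g 0 + y *s v2 = 0 \<longrightarrow> x = 0 \<and> y = 0"
    by (rule dicritical_imp_eigenvectors[OF stein \<kappa>(1-3) sing dic])
  have v1: "jac (Y \<kappa>) 0 (g 0) = (l * of_nat k) *s g 0" by (rule orbit_germ_eigenvector[OF \<kappa>(1-3) sing og])
  have o: "q \<in> topspace N" "l \<noteq> 0" "k > 0" "r > 0" "\<And>i. (\<lambda>w. g w $ i) holomorphic_on ball 0 r" "\<And>w. w \<in> ball 0 r \<Longrightarrow> h w = w ^ k *s g w"
    "flow (2 * pi * \<i> / l) q = q"
    "\<And>t. norm (exp (l * t)) < r \<Longrightarrow> flow t q \<in> fst \<kappa>" "\<And>t. norm (exp (l * t)) < r \<Longrightarrow> snd \<kappa> (flow t q) = h (exp (l * t))"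
    using og by (auto simp: orbit_germ_def)
  have l0: "l * of_nat k \<noteq> 0" using o by simp
  define \<omega> where "\<omega> = 2 * pi * \<i> / l"
  have T: "2 * pi * \<i> * of_nat (b * k) / (l * of_nat k) = of_nat b * \<omega>" using o(2,3) by (simp add: \<omega>_def field_simps)
  have per: "flow (t + \<omega>) q = flow t q" for t using flow_add[OF o(1), of t \<omega>] o(7) by (simp add: \<omega>_def)
  have perb: "flow (of_nat b * \<omega>) (flow t q) = flow t q" for t
    using periodic_int_shift[where g="\<lambda>t. flow t q" and T=\<omega> and n="int b", OF per, of t] by (simp add: flow_add[OF o(1)] add.commute)
  have ev0: "\<forall>\<^sub>F w in at (0::complex). w \<in> ball 0 r \<and> w \<noteq> 0"
    unfolding eventually_at using o(4) by (intro exI[of _ r]) auto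
  hence ev: "\<forall>\<^sub>F w in at 0. h w \<in> img \<kappa> \<and> flow (2 * pi * \<i> * of_nat (b * k) / (l * of_nat k)) (param \<kappa> (h w)) = param \<kappa> (h w)"
    unfolding T
  proof eventually_elim
    case (elim w)
    define t where "t = ln w / l"
    have t: "exp (l * t) = w" using elim o(2) by (simp add: t_def)
    have n: "norm (exp (l * t)) < r" using elim by (simp add: t)
    have hw: "h w = snd \<kappa> (flow t q)" using o(9)[OF n] by (simp add: t)
    show ?case unfolding hw using chart_in[OF o(8)[OF n]] perb by (simp add: param_chart[OF \<kappa>(1) o(8)[OF n]])
  qed
  have lim: "((\<lambda>w. h w $ i / w ^ k) \<longlongrightarrow> g 0 $ i) (at 0)" for i
  proof -
    have "isCont (\<lambda>w. g w $ i) 0" using holomorphic_on_imp_continuous_on[OF o(5)] o(4) by (simp add: continuous_on_eq_continuous_at)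
    hence "((\<lambda>w. g w $ i) \<longlongrightarrow> g 0 $ i) (at 0)" by (simp add: isCont_def)
    moreover have "\<forall>\<^sub>F w in at 0. g w $ i = h w $ i / w ^ k" using ev0 by eventually_elim (simp add: o(6))
    ultimately show ?thesis by (rule Lim_transform_eventually)
  qed
  have "\<exists>F. biholomorphism_C2 N \<A> F \<and> globally_linearizable N \<A> X \<and> F p = 0 \<and>
    (\<forall>i. (\<lambda>q. F q $ i) \<in> holomorphic_functions \<A>) \<and>
    (\<forall>q\<in>topspace N. \<forall>t. F (flow t q) = vec2 (exp (l * of_nat k * t) * F q $ 1) (exp (l * of_nat k * of_real \<nu> * t) * F q $ 2))"
    by (rule linearization_from_eigenvectors[OF stein conn sing \<kappa> v1 v2 ind[rule_format] l0 \<nu> o(3)]) (use ev lim in auto)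
  thus ?thesis by (elim exE conjE) (intro conjI exI)
qed

end

text \<open>Since \<open>b > 0\<close>, the first coordinate bounds \<open>u\<close>, so the
  parameters of a convergent sequence on the curve have a convergent subsequence.\<close>

lemma closed_monomial_curve:
  fixes s :: complex
  assumes "b > 0"
  shows "closed (range (\<lambda>u. vec2 (u ^ b) (s * u ^ a)))"
  unfolding closed_sequential_limits
proof (intro allI impI, elim conjE)
  let ?f = "\<lambda>u. vec2 (u ^ b) (s * u ^ a)"
  fix y l assume y: "\<forall>n. y n \<in> range ?f" "y \<longlonglongrightarrow> l"
  obtain u where u: "\<And>n. y n = ?f (u n)" using y(1) by (auto simp: image_iff) metis
  have "Bseq y" using y(2) by (intro convergent_imp_Bseq convergentI)
  then obtain B where B: "B > 0" "\<And>n. norm (y n) \<le> B" by (auto elim: BseqE)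
  have "norm (u n) \<le> max 1 B" for n
  proof (cases "norm (u n) \<le> 1")
    case False
    have "norm (u n) ^ 1 \<le> norm (u n) ^ b" using False assms by (intro power_increasing) auto
    also have "\<dots> = norm (y n $ 1)" by (simp add: u norm_power)
    also have "\<dots> \<le> norm (y n)" by (rule Finite_Cartesian_Product.norm_nth_le)
    finally show ?thesis using B(2)[of n] by simp
  qed simp
  hence "bounded (range u)" unfolding bounded_iff by auto
  then obtain u0 \<sigma> where \<sigma>: "strict_mono \<sigma>" "(u \<circ> \<sigma>) \<longlonglongrightarrow> u0"
    using bounded_imp_convergent_subsequence by blast
  have "isCont ?f u0" using continuous_on_vec2[of UNIV "\<lambda>u. u ^ b" "\<lambda>u. s * u ^ a"]
    by (auto simp: continuous_on_eq_continuous_at intro!: continuous_intros)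
  from isCont_tendsto_compose[OF this \<sigma>(2)] have "(y \<circ> \<sigma>) \<longlonglongrightarrow> ?f u0" by (simp add: u comp_def)
  moreover have "(y \<circ> \<sigma>) \<longlonglongrightarrow> l" by (rule LIMSEQ_subseq_LIMSEQ[OF y(2) \<sigma>(1)])
  ultimately have "l = ?f u0" using LIMSEQ_unique by blast
  thus "l \<in> range ?f" by blast
qed

section \<open>Orbits of the linear model and the first-jet case\<close>

context complete_field
begin

text \<open>In the linear model with \<open>\<nu> = a / b\<close> the orbits are \<open>{(u\<^sup>b, s u\<^sup>a) | u \<noteq> 0}\<close>.\<close>

lemma linear_imp_dicritical:
  fixes m :: complex and \<nu> :: real and a b :: nat
  assumes sing: "p \<in> singularities N \<A> X" and bih: "biholomorphism_C2 N \<A> F" and Fp: "F p = 0"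
    and Fh: "\<And>i. (\<lambda>q. F q $ i) \<in> holomorphic_functions \<A>"
    and eqv: "\<And>q t. q \<in> topspace N \<Longrightarrow> F (flow t q) = vec2 (exp (m * t) * F q $ 1) (exp (m * of_real \<nu> * t) * F q $ 2)"
    and m: "m \<noteq> 0" and \<nu>: "\<nu> = real a / real b" "a > 0" "b > 0"
  shows "dicritical_at N \<A> X p"
proof -
  have pN: "p \<in> topspace N" using sing by (simp add: singularities_def)
  have bij: "bij_betw F (topspace N) UNIV" using bih by (simp add: biholomorphism_C2_def)
  have inj: "x = y" if "x \<in> topspace N" "y \<in> topspace N" "F x = F y" for x y
    using bij that unfolding bij_betw_def by (metis inj_onD)
  define G where "G = inv_into (topspace N) F"
  have G: "G z \<in> topspace N" "F (G z) = z" for z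
    using bij unfolding G_def bij_betw_def by (metis UNIV_I inv_into_into, metis UNIV_I f_inv_into_f)
  define f where "f s u = vec2 (u ^ b) (s * u ^ a)" for s u
  \<comment> \<open>Base points on the line \<open>x = 1\<close>. The neighbourhood in the
    definition of a dicritical singularity is taken to be all of \<open>N\<close>, so that leaves
    are full orbits.\<close>
  define Q where "Q s = G (vec2 1 s)" for s
  define Or where "Or s = orbit_in N \<A> X (topspace N) (Q s)" for s
  have Q: "Q s \<in> topspace N" "F (Q s) = vec2 1 s" for s by (simp_all add: Q_def G)
  have lt: "leaf_times (topspace N) (Q s) = UNIV" for s
    using flow_topspace[OF Q(1)] by (simp add: leaf_times_def connected_UNIV connected_component_eq_UNIV)
  have Oeq: "Or s = {q \<in> topspace N. \<exists>u. u \<noteq> 0 \<and> F q = f s u}" for s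
    unfolding Or_def orbit_in_eq[OF openin_topspace Q(1)] lt
  proof (intro equalityI subsetI)
    fix q assume "q \<in> range (\<lambda>t. flow t (Q s))"
    then obtain t where t: "q = flow t (Q s)" by blast
    \<comment> \<open>Dividing the exponent by \<open>b\<close> parametrizes the orbit with integer
      powers in both coordinates.\<close>
    define u where "u = exp (m * t / of_nat b)"
    have "u ^ b = exp (m * t)" using \<nu>(3) by (simp add: u_def exp_of_nat_mult[symmetric])
    moreover have "u ^ a = exp (m * of_real \<nu> * t)" by (simp add: u_def \<nu>(1) exp_of_nat_mult[symmetric] mult_ac)
    ultimately have "F q = f s u" unfolding t eqv[OF Q(1)] Q(2) f_def by (simp add: mult.commute)
    moreover have "u \<noteq> 0" by (simp add: u_def)
    ultimately show "q \<in> {q \<in> topspace N. \<exists>u. u \<noteq> 0 \<and> F q = f s u}" using flow_topspace[OF Q(1)] t by blast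
  next
    fix q assume "q \<in> {q \<in> topspace N. \<exists>u. u \<noteq> 0 \<and> F q = f s u}"
    then obtain u where u: "q \<in> topspace N" "u \<noteq> 0" "F q = f s u" by blast
    define t where "t = of_nat b * ln u / m"
    have "m * t = of_nat b * ln u" "m * of_real \<nu> * t = of_nat a * ln u" using m \<nu>(3) by (simp_all add: t_def \<nu>(1))
    moreover have "exp (of_nat n * ln u) = u ^ n" for n using u(2) by (simp add: exp_of_nat_mult)
    ultimately have "exp (m * t) = u ^ b" "exp (m * of_real \<nu> * t) = u ^ a" by (simp_all only:)
    hence "F (flow t (Q s)) = F q" unfolding eqv[OF Q(1)] Q(2) u(3) f_def by (simp add: mult.commute)
    hence "flow t (Q s) = q" by (rule inj[OF flow_topspace[OF Q(1)] u(1)])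
    thus "q \<in> range (\<lambda>t. flow t (Q s))" by blast
  qed
  have Fc: "continuous_map N euclidean F"
  proof -
    have "continuous_map N (prod_topology euclidean euclidean) (\<lambda>q. (F q $ 1, F q $ 2))"
      using holomorphic_continuous_map[OF Fh[of 1]] holomorphic_continuous_map[OF Fh[of 2]] unfolding continuous_map_pairwise comp_def by simp
    hence "continuous_map N euclidean (\<lambda>q. (F q $ 1, F q $ 2))" by (simp only: prod_topology_euclidean)
    moreover have "continuous_map euclidean euclidean (\<lambda>x. vec2 (fst x) (snd x))"
      by (simp add: continuous_intros)
    ultimately have "continuous_map N euclidean ((\<lambda>x. vec2 (fst x) (snd x)) \<circ> (\<lambda>q. (F q $ 1, F q $ 2)))" by (rule continuous_map_compose)
    thus ?thesis by (simp add: comp_def)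
  qed
  have pO: "p \<notin> Or s" for s
  proof
    assume "p \<in> Or s"
    then obtain u where "u \<noteq> 0" "F p = f s u" by (auto simp: Oeq)
    thus False using Fp by (simp add: f_def vec2_eq_iff)
  qed
  have f0: "f s 0 = 0" for s using \<nu> by (simp add: f_def vec2_eq_iff power_0_left)
  have "closedin N {q \<in> topspace N. F q \<in> range (f s)}" for s
    by (rule closedin_continuous_map_preimage[OF Fc]) (use closed_monomial_curve[OF \<nu>(3), of s a] in \<open>simp add: f_def\<close>)
  moreover have "Or s \<subseteq> {q \<in> topspace N. F q \<in> range (f s)}" for s by (auto simp: Oeq)
  ultimately have "N closure_of Or s \<subseteq> {q \<in> topspace N. F q \<in> range (f s)}" for s using closure_of_minimal by metis
  moreover have "{q \<in> topspace N. F q \<in> range (f s)} \<subseteq> insert p (Or s)" for s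
  proof
    fix q assume "q \<in> {q \<in> topspace N. F q \<in> range (f s)}"
    then obtain u where u: "q \<in> topspace N" "F q = f s u" by blast
    show "q \<in> insert p (Or s)"
    proof (cases "u = 0")
      case True thus ?thesis using inj[OF u(1) pN] u(2) by (simp add: f0 Fp)
    next
      case False thus ?thesis using u by (auto simp: Oeq)
    qed
  qed
  ultimately have sub: "N closure_of Or s \<subseteq> insert p (Or s)" for s by blast
  \<comment> \<open>The curve tends to 0 as \<open>u\<close> tends to 0. Since \<open>F\<close> maps
    a chart domain around \<open>p\<close> onto an open set with continuous inverse, the orbit
    enters every neighbourhood of \<open>p\<close>.\<close>
  have pcl: "p \<in> N closure_of Or s" for s
    unfolding in_closure_of
  proof (intro conjI allI impI pN, elim conjE)
    fix W assume W: "p \<in> W" "openin N W"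
    obtain \<kappa> where \<kappa>: "\<kappa> \<in> \<A>" "p \<in> fst \<kappa>" using chart_at[OF pN] by blast
    have hol: "holomorphic_fun2 (F ` fst \<kappa>) (\<lambda>z. snd \<kappa> (G z) $ i)" for i
      using bih \<kappa>(1) by (simp add: biholomorphism_C2_def holomorphic_map2_def comp_def G_def)
    have op: "open (F ` fst \<kappa>)" using hol by (simp add: holomorphic_fun2_def)
    have in0: "0 \<in> F ` fst \<kappa>" using \<kappa>(2) Fp by (metis image_eqI)
    have GF: "G (F q) = q" if "q \<in> fst \<kappa>" for q
      using inj[OF G(1), of q "F q"] G(2) that chart_sub[OF \<kappa>(1)] by blast
    have G0: "G 0 = p" using GF[OF \<kappa>(2)] Fp by simp
    have "isCont (\<lambda>z. snd \<kappa> (G z) $ i) 0" for i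
      using hol[of i] in0 unfolding holomorphic_fun2_iff by (intro cdiff_isCont) blast
    hence "((\<lambda>z. snd \<kappa> (G z) $ i) \<longlongrightarrow> snd \<kappa> (G 0) $ i) (nhds 0)" for i
      unfolding isCont_def tendsto_at_iff_tendsto_nhds[where g="\<lambda>z. snd \<kappa> (G z) $ i" and l=0, symmetric] .
    from vec_tendstoI[OF this] have lim: "((\<lambda>z. snd \<kappa> (G z)) \<longlongrightarrow> snd \<kappa> p) (nhds 0)" unfolding G0 .
    have lf: "(f s \<longlongrightarrow> 0) (at 0)"
    proof -
      have "((\<lambda>u. f s u) \<longlongrightarrow> f s 0) (at 0)" unfolding f_def vec2_def
        by (intro tendsto_vec_lambda) (auto intro!: tendsto_eq_intros)
      thus ?thesis by (simp add: f0)
    qed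
    have "\<forall>\<^sub>F u in at 0. f s u \<in> F ` fst \<kappa>" by (rule topological_tendstoD[OF lf op in0])
    moreover have "\<forall>\<^sub>F u in at 0. snd \<kappa> (G (f s u)) \<in> {z \<in> img \<kappa>. param \<kappa> z \<in> W}"
      by (rule topological_tendstoD[OF filterlim_compose[OF lim lf] param_preimage_open[OF \<kappa>(1) W(2)]])
         (simp add: chart_in \<kappa>(2) param_chart[OF \<kappa>] W(1))
    ultimately have "\<forall>\<^sub>F u in at (0::complex). f s u \<in> F ` fst \<kappa> \<and> snd \<kappa> (G (f s u)) \<in> {z \<in> img \<kappa>. param \<kappa> z \<in> W} \<and> u \<noteq> 0"
      by (auto simp: eventually_conj_iff eventually_at_filter)
    then obtain u where u: "f s u \<in> F ` fst \<kappa>" "param \<kappa> (snd \<kappa> (G (f s u))) \<in> W" "u \<noteq> 0"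
      using eventually_happens'[OF at_neq_bot] by fastforce
    obtain q where q: "q \<in> fst \<kappa>" "F q = f s u" using u(1) by (metis imageE)
    have "G (f s u) = q" using GF[OF q(1)] q(2) by simp
    hence "q \<in> W" using u(2) param_chart[OF \<kappa>(1) q(1)] by simp
    moreover have "q \<in> Or s" using q u(3) chart_sub[OF \<kappa>(1)] by (auto simp: Oeq)
    ultimately show "\<exists>y. y \<in> Or s \<and> y \<in> W" by blast
  qed
  have clos: "(N closure_of Or s) \<inter> topspace N - Or s = {p}" for s
    using sub[of s] pcl[of s] pO[of s] pN by blast
  \<comment> \<open>If \<open>(1, s)\<close> and \<open>(1, s')\<close> lie on one orbit, then
    \<open>s = s' u ^ a\<close> with \<open>u ^ b = 1\<close>, so the modulus of \<open>s\<close> is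
    determined by the orbit; positive integers give infinitely many moduli.\<close>
  have "inj (\<lambda>n. Or (of_nat (Suc n)))"
  proof (rule injI)
    fix n n' assume eq: "Or (of_nat (Suc n)) = Or (of_nat (Suc n'))"
    have "Q (of_nat (Suc n)) \<in> Or (of_nat (Suc n))"
      unfolding Oeq using Q by (auto simp: f_def intro!: exI[of _ 1])
    hence "Q (of_nat (Suc n)) \<in> Or (of_nat (Suc n'))" by (simp only: eq)
    then obtain u where "F (Q (of_nat (Suc n))) = f (of_nat (Suc n')) u" unfolding Oeq by blast
    hence "vec2 1 (of_nat (Suc n)) = f (of_nat (Suc n')) u" by (simp only: Q(2))
    hence u: "u ^ b = 1" "of_nat (Suc n) = of_nat (Suc n') * u ^ a" by (simp_all only: f_def vec2_eq_iff vec2_nth)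
    have "norm u ^ b = 1 ^ b" using u(1) by (metis norm_one norm_power power_one)
    hence "norm u = 1" by (rule power_eq_imp_eq_base) (use \<nu>(3) in auto)
    moreover have "norm (of_nat (Suc n) :: complex) = norm (of_nat (Suc n') :: complex) * norm u ^ a"
      unfolding u(2) norm_mult norm_power ..
    ultimately have "real (Suc n) = real (Suc n')" by (simp only: norm_of_nat power_one mult_1_right)
    thus "n = n'" by simp
  qed
  hence "infinite (range (\<lambda>n. Or (of_nat (Suc n))))" by (rule range_inj_infinite)
  moreover have "range (\<lambda>n. Or (of_nat (Suc n))) \<subseteq> {L \<in> orbit_in N \<A> X (topspace N) ` topspace N. (N closure_of L) \<inter> topspace N - L = {p}}"
    using clos Q(1) by (auto simp: Or_def)
  ultimately have "infinite {L \<in> orbit_in N \<A> X (topspace N) ` topspace N. (N closure_of L) \<inter> topspace N - L = {p}}"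
    using infinite_super by blast
  thus ?thesis unfolding dicritical_at_def using pN by blast
qed

text \<open>A vector fixed by the linear part is fixed by all its powers, and the Jacobian of the
  transition carries it to a nonzero fixed vector in any other chart.\<close>

lemma first_jet_imp_non_nilpotent:
  assumes sing: "p \<in> singularities N \<A> X" and \<kappa>: "\<kappa> \<in> \<A>" "p \<in> fst \<kappa>" and e: "jac (Y \<kappa>) (snd \<kappa> p) e = e" "e \<noteq> 0"
  shows "non_nilpotent_at \<A> X p"
  unfolding non_nilpotent_at_def
proof (intro ballI impI notI, elim exE)
  fix \<kappa>' k assume \<kappa>': "\<kappa>' \<in> \<A>" "p \<in> fst \<kappa>'" and nil: "linear_part X \<kappa>' p ^^ k = (\<lambda>v. 0)"
  define u where "u = jac (transition \<kappa> \<kappa>') (snd \<kappa> p) e"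
  have fix1: "linear_part X \<kappa>' p u = u"
    unfolding linear_part_jac[OF \<kappa>'] u_def linear_part_conjugate[OF sing \<kappa> \<kappa>'] e(1) ..
  have "(linear_part X \<kappa>' p ^^ k) u = u" by (induction k) (simp_all add: fix1)
  hence "u = 0" unfolding nil by simp
  hence "e = jac (transition \<kappa>' \<kappa>) (snd \<kappa>' p) 0" using transition_inverse[OF \<kappa> \<kappa>', of e] unfolding u_def[symmetric] by simp
  also have "\<dots> = 0" by (simp add: jac_def vec_eq_iff)
  finally have "e = 0" .
  thus False using e(2) by simp
qed

text \<open>Linearization asks for an eigenvalue ratio of at least 1. For \<rho> below 1 the
  eigenvalues 1 and \<rho> exchange their roles, with base eigenvalue \<rho> and ratio
  \<open>1 / \<rho>\<close>. The excluded values \<open>n\<close> and \<open>1 / n\<close> with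
  \<open>n \<ge> 2\<close> are precisely the resonant ones in the two cases.\<close>

lemma first_jet_imp_dicritical:
  fixes \<rho> :: rat
  assumes stein: "stein_surface N \<A>" and conn: "connected_space N" and sing: "p \<in> singularities N \<A> X"
    and \<rho>: "\<rho> > 0" "\<And>n::nat. n \<ge> 2 \<Longrightarrow> \<rho> \<noteq> of_nat n \<and> \<rho> \<noteq> 1 / of_nat n"
    and fj: "first_jet_X_lambda_at \<A> X (of_rat \<rho>) p"
  shows "non_nilpotent_at \<A> X p \<and> dicritical_at N \<A> X p"
proof -
  have pN: "p \<in> topspace N" using sing by (simp add: singularities_def)
  obtain \<kappa>0 where \<kappa>0: "\<kappa>0 \<in> \<A>" "p \<in> fst \<kappa>0" and lp: "linear_part X \<kappa>0 p = (\<lambda>v. vector [v $ 1, of_rat \<rho> * v $ 2])"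
    using fj by (auto simp: first_jet_X_lambda_at_def)
  obtain i j where ij: "\<rho> = of_int i / of_int j" "j > 0" using quotient_of_div[of \<rho>] quotient_of_denom_pos[of \<rho>] by (metis prod.exhaust)
  have i: "i > 0" using \<rho>(1) ij by (simp add: zero_less_divide_iff)
  define a where "a = nat i"
  define b where "b = nat j"
  have ab: "a > 0" "b > 0" using i ij(2) by (simp_all add: a_def b_def)
  have \<rho>ab: "\<rho> = of_nat a / of_nat b" using i ij by (simp add: a_def b_def)
  define R where "R = real a / real b"
  have R0: "R > 0" using ab by (simp add: R_def)
  have Rc: "of_rat \<rho> = complex_of_real R" by (simp add: \<rho>ab R_def of_rat_divide)
  have lin: "jac (Y \<kappa>0) (snd \<kappa>0 p) v = vec2 (v $ 1) (of_real R * v $ 2)" for v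
    using lp unfolding linear_part_jac[OF \<kappa>0] Rc by (simp add: vec2_eq_iff vector_2)
  obtain \<kappa> where \<kappa>': "\<kappa> \<in> \<A>" "p \<in> fst \<kappa>" "snd \<kappa> p = 0" "\<forall>i. (\<lambda>q. snd \<kappa> q $ i) \<in> holomorphic_functions \<A>"
    by (rule stein_chart[OF stein pN])
  note \<kappa> = \<kappa>'(1-3) \<kappa>'(4)[rule_format]
  \<comment> \<open>The chart of the jet need not have globally holomorphic coordinates; the
    eigenvectors are carried by the Jacobian of the transition to a chart that has them.\<close>
  let ?\<tau> = "jac (transition \<kappa>0 \<kappa>) (snd \<kappa>0 p)"
  define w1 where "w1 = ?\<tau> (axis 1 1)"
  define w2 where "w2 = ?\<tau> (axis 2 1)"
  have conj: "jac (Y \<kappa>) 0 (?\<tau> u) = ?\<tau> (jac (Y \<kappa>0) (snd \<kappa>0 p) u)" for u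
    using linear_part_conjugate[OF sing \<kappa>0 \<kappa>(1,2), of u] by (simp add: \<kappa>(3))
  have l1: "jac (Y \<kappa>0) (snd \<kappa>0 p) (axis 1 1) = axis 1 1" and l2: "jac (Y \<kappa>0) (snd \<kappa>0 p) (axis 2 1) = of_real R *s axis 2 1"
    by (simp_all add: lin vec2_eq_iff)
  have e: "jac (Y \<kappa>) 0 w1 = w1" "jac (Y \<kappa>) 0 w2 = of_real R *s w2"
    unfolding w1_def w2_def conj l1 l2 jac_scale by simp_all
  have ind: "x = 0 \<and> y = 0" if xy: "x *s w1 + y *s w2 = 0" for x y
  proof -
    have "?\<tau> (x *s axis 1 1 + y *s axis 2 1) = 0" using xy by (simp add: jac_add jac_scale w1_def w2_def)
    hence "x *s axis 1 1 + y *s axis 2 1 = jac (transition \<kappa> \<kappa>0) (snd \<kappa> p) 0" using transition_inverse[OF \<kappa>0 \<kappa>(1,2)] by metis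
    also have "\<dots> = 0" by (simp add: jac_def vec_eq_iff)
    finally show ?thesis by (simp add: vec2_eq_iff)
  qed
  have nn: "non_nilpotent_at \<A> X p"
    by (rule first_jet_imp_non_nilpotent[OF sing \<kappa>0 l1]) (simp add: vec2_eq_iff)
  have "dicritical_at N \<A> X p"
  proof (cases "R \<ge> 1")
    case True
    have nres: "\<forall>n::nat. n \<ge> 2 \<longrightarrow> R \<noteq> real n"
    proof (intro allI impI notI)
      fix n :: nat assume n: "n \<ge> 2" "R = real n"
      hence "real a = real (n * b)" using ab by (simp add: R_def field_simps)
      hence "a = n * b" by (simp only: of_nat_eq_iff)
      hence "\<rho> = of_nat n" using ab by (simp add: \<rho>ab)
      thus False using \<rho>(2)[of n] n by simp
    qed
    have "\<exists>F. biholomorphism_C2 N \<A> F \<and> globally_linearizable N \<A> X \<and> F p = 0 \<and>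
      (\<forall>i. (\<lambda>q. F q $ i) \<in> holomorphic_functions \<A>) \<and>
      (\<forall>q\<in>topspace N. \<forall>t. F (flow t q) = vec2 (exp (1 * t) * F q $ 1) (exp (1 * of_real R * t) * F q $ 2))"
      by (rule linearization_from_eigenvectors[OF stein conn sing \<kappa> _ _ ind _ R_def ab(2) True, where k=1])
         (use e nres in auto)
    then obtain F where "biholomorphism_C2 N \<A> F \<and> globally_linearizable N \<A> X \<and> F p = 0 \<and>
      (\<forall>i. (\<lambda>q. F q $ i) \<in> holomorphic_functions \<A>) \<and>
      (\<forall>q\<in>topspace N. \<forall>t. F (flow t q) = vec2 (exp (1 * t) * F q $ 1) (exp (1 * of_real R * t) * F q $ 2))" by (elim exE)
    thus ?thesis by (intro linear_imp_dicritical[OF sing, where F=F and m=1 and \<nu>=R, OF _ _ _ _ _ R_def ab]) simp_all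
  next
    case False
    define S where "S = real b / real a"
    have S: "S \<ge> 1" using False ab by (simp add: S_def R_def)
    have RS: "complex_of_real R * of_real S = 1" using ab by (simp add: R_def S_def)
    have nres: "\<forall>n::nat. n \<ge> 2 \<longrightarrow> S \<noteq> real n"
    proof (intro allI impI notI)
      fix n :: nat assume n: "n \<ge> 2" "S = real n"
      hence "real b = real (n * a)" using ab by (simp add: S_def field_simps)
      hence "b = n * a" by (simp only: of_nat_eq_iff)
      hence "\<rho> = 1 / of_nat n" using ab by (simp add: \<rho>ab)
      thus False using \<rho>(2)[of n] n by simp
    qed
    have ind': "x = 0 \<and> y = 0" if "x *s w2 + y *s w1 = 0" for x y using ind[of y x] that by (simp add: add.commute)
    have e': "jac (Y \<kappa>) 0 w1 = (of_real R * of_real S) *s w1" unfolding RS using e(1) by simp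
    have R0': "complex_of_real R \<noteq> 0" using R0 by simp
    have "\<exists>F. biholomorphism_C2 N \<A> F \<and> globally_linearizable N \<A> X \<and> F p = 0 \<and>
      (\<forall>i. (\<lambda>q. F q $ i) \<in> holomorphic_functions \<A>) \<and>
      (\<forall>q\<in>topspace N. \<forall>t. F (flow t q) = vec2 (exp (of_real R * t) * F q $ 1) (exp (of_real R * of_real S * t) * F q $ 2))"
      by (rule linearization_from_eigenvectors[OF stein conn sing \<kappa> e(2) e' ind' R0' S_def ab(1) S, where k=1])
         (use nres in auto)
    then obtain F where "biholomorphism_C2 N \<A> F \<and> globally_linearizable N \<A> X \<and> F p = 0 \<and>
      (\<forall>i. (\<lambda>q. F q $ i) \<in> holomorphic_functions \<A>) \<and>
      (\<forall>q\<in>topspace N. \<forall>t. F (flow t q) = vec2 (exp (of_real R * t) * F q $ 1) (exp (of_real R * of_real S * t) * F q $ 2))" by (elim exE)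
    thus ?thesis by (intro linear_imp_dicritical[OF sing, where F=F and m="of_real R" and \<nu>=S, OF _ _ _ _ R0' S_def ab(2,1)]) simp_all
  qed
  thus ?thesis using nn by blast
qed

end

theorem corollary1:
  fixes N :: "'a topology" and \<A> :: "'a chart set" and X :: "'a vfield"
  assumes "stein_surface N \<A>"
    and "connected_space N"
    and "trivial_group (cohomology_group 2 N)"
    and "holomorphic_vector_field \<A> X"
    and "complete_vector_field N \<A> X"
    and "finite (singularities N \<A> X)"
  shows "((\<exists>p \<in> singularities N \<A> X. non_nilpotent_at \<A> X p \<and> dicritical_at N \<A> X p) \<longrightarrow>
            (\<exists>F. biholomorphism_C2 N \<A> F) \<and> globally_linearizable N \<A> X) \<and>
         (\<forall>p \<in> singularities N \<A> X. \<forall>\<rho>::rat.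
            \<rho> > 0 \<and> (\<forall>n::nat. n \<ge> 2 \<longrightarrow> \<rho> \<noteq> of_nat n \<and> \<rho> \<noteq> 1 / of_nat n) \<and>
            first_jet_X_lambda_at \<A> X (of_rat \<rho>) p \<longrightarrow>
            non_nilpotent_at \<A> X p \<and> dicritical_at N \<A> X p)"
proof -
  interpret complete_field N \<A> X
    by unfold_locales (use assms(1,4,5) in \<open>simp_all add: stein_surface_def\<close>)
  show ?thesis
  proof (intro conjI impI ballI allI)
    assume "\<exists>p \<in> singularities N \<A> X. non_nilpotent_at \<A> X p \<and> dicritical_at N \<A> X p"
    then obtain p where "p \<in> singularities N \<A> X" "dicritical_at N \<A> X p" by blast
    from dicritical_imp_linearizable[OF assms(1,2) this]
    show "\<exists>F. biholomorphism_C2 N \<A> F" "globally_linearizable N \<A> X" by simp_all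
  next
    fix p and \<rho> :: rat
    assume p: "p \<in> singularities N \<A> X" and \<rho>: "\<rho> > 0 \<and> (\<forall>n::nat. n \<ge> 2 \<longrightarrow> \<rho> \<noteq> of_nat n \<and> \<rho> \<noteq> 1 / of_nat n) \<and>
            first_jet_X_lambda_at \<A> X (of_rat \<rho>) p"
    have "non_nilpotent_at \<A> X p \<and> dicritical_at N \<A> X p"
      by (rule first_jet_imp_dicritical[OF assms(1,2) p]) (use \<rho> in auto)
    thus "non_nilpotent_at \<A> X p" "dicritical_at N \<A> X p" by simp_all
  qed
qed

end
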